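(* Let $N$ be a positive integer, $k\ge0$ an integer, and let $\Gamma$ be a congruence subgroup of $\mathrm{SL}_2(\mathbb{Z})$ with $\Gamma_1(N)\subset\Gamma\subset\Gamma_0(N)$. Then the quotient $$H_1(\overline{\Gamma},\mathcal{V}_{2k})\big/\mathfrak{Z}_{\Gamma,2k}$$ is a Hecke module over $\mathbb{Z}$ (that is, $\mathfrak Z_{\Gamma,2k}$ is stable under all double coset operators $[\Gamma\alpha\Gamma]$, $\alpha\in M_2^+(\mathbb{Z})$, so that these act on the quotient), it is of finite order, and it is non-ordinary at every prime number $p$.
   Context: For a subset $A\subset \mathrm{SL}_2(\mathbb{Z})$, $\overline{A}$ is its image in $\mathrm{PSL}_2(\mathbb{Z})=\mathrm{SL}_2(\mathbb{Z})/\{\pm1\}$. Coefficients: $M_2^+(\mathbb{Z})$ is the monoid of integral $2\times2$ matrices of positive determinant. $\mathcal{V}_k=\mathrm{Sym}^k(\mathrm{Hom}(\mathbb{Z}^2,\mathbb{Z}))$ is the group of homogeneous polynomials of degree $k$ in $\mathbb{Z}[X_1,X_2]$, with left $M_2^+(\mathbb{Z})$-action $\left(\begin{smallmatrix}a&b\\c&d\end{smallmatrix}\right)\cdot P(X_1,X_2)=P(dX_1-bX_2,\,-cX_1+aX_2)$. For even $k$ the matrix $-1$ acts trivially. Homology: $H_1(\overline\Gamma,\mathcal V)$ is group homology, identified with the set of $\sum_\gamma(\gamma-1)\otimes v_\gamma\in I_{\overline\Gamma}\otimes_{\mathbb{Z}[\overline\Gamma]}\mathcal V$ with $\sum_\gamma(\gamma-1)v_\gamma=0$,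 where $I_{\overline\Gamma}$ is the augmentation ideal of $\mathbb{Z}[\overline\Gamma]$. Hyperbolic cycles: $\gamma=\left(\begin{smallmatrix}a&b\\c&d\end{smallmatrix}\right)\in\mathrm{PSL}_2(\mathbb{Z})$ is hyperbolic if $|\mathrm{trace}(\gamma)|>2$; $\overline\Gamma^{\mathrm{hyp}}$ is the set of hyperbolic elements of $\overline\Gamma$. For hyperbolic $\gamma$ put $Q_\gamma(X_1,X_2)=-\frac{\mathrm{sgn}(a+d)}{\gcd(c,a-d,b)}\left(cX_1^2-(a-d)X_1X_2-bX_2^2\right)\in\mathcal V_2$, which satisfies $\gamma\cdot Q_\gamma=Q_\gamma$. For $\gamma\in\overline\Gamma^{\mathrm{hyp}}$ put $\mathfrak z_{\Gamma,2k}(\gamma)=(\gamma-1)\otimes Q_\gamma^k\in H_1(\overline\Gamma,\mathcal V_{2k})$, and let $\mathfrak Z_{\Gamma,2k}\subset H_1(\overline\Gamma,\mathcal V_{2k})$ be the subgroup generated by all $\mathfrak z_{\Gamma,2k}(\gamma)$, $\gamma\in\overline\Gamma^{\mathrm{hyp}}$. Double coset operators: for congruence subgroups $\Gamma,\Gamma'$, $\alpha\in M_2^+(\mathbb{Z})$ and a left $M_2^+(\mathbb{Z})/\{\pm1\}$-module $\mathcal V$, let $\beta_1,\dots,\beta_r$ represent $\overline{\Gamma'}\backslash\overline{\Gamma'}\alpha\overline{\Gamma}$. The operator $[\Gamma'\alpha\Gamma]:H_i(\overline\Gamma,\mathcal V)\to H_i(\overline{\Gamma'},\mathcal V)$ is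 the $\delta$-functorial extension of $m\mapsto\sum_i\beta_im$ on $H_0$. On $H_1$ it is induced by $(\gamma-1)\otimes v\mapsto\sum_{i=1}^r(\gamma_i'-1)\otimes\beta_{\sigma(i)}v$, where $\beta_i\gamma=\gamma'_i\beta_{\sigma(i)}$ with $\gamma_i'\in\overline{\Gamma'}$. It is independent of choices. Non-ordinary: for a prime $p$, a finite abelian group $M$ with an action of $t_p=[\Gamma\left(\begin{smallmatrix}1&0\\0&p\end{smallmatrix}\right)\Gamma]$ is non-ordinary at $p$ if its $p$-ordinary part vanishes, i.e. $e_p(M\otimes\mathbb{Z}_p)=0$ where $e_p=\lim_{m\to\infty}t_p^{m!}$; equivalently $t_p$ acts nilpotently on $M\otimes\mathbb{Z}_p$. *)

theory Defs
  imports
    "HOL-Analysis.Determinants"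
    "HOL-Algebra.Ring"
    "HOL-Algebra.Free_Abelian_Groups"
    "HOL-Computational_Algebra.Polynomial"
    "HOL-Number_Theory.Cong"
begin

section \<open>Matrices and congruence subgroups\<close>

type_synonym mat2 = "int ^ 2 ^ 2"

definition M2plus :: "mat2 monoid" where
  "M2plus = \<lparr>carrier = {A. det A > 0}, monoid.mult = (**), one = mat 1\<rparr>"

definition SL2Z :: "mat2 monoid" where
  "SL2Z = M2plus\<lparr>carrier := {A. det A = 1}\<rparr>"

definition Gamma0 :: "nat \<Rightarrow> mat2 set" where
  "Gamma0 N = {A \<in> carrier SL2Z. [A $ 2 $ 1 = 0] (mod int N)}"

definition Gamma1 :: "nat \<Rightarrow> mat2 set" where
  "Gamma1 N = {A \<in> carrier SL2Z.
     [A $ 1 $ 1 = 1] (mod int N) \<and> [A $ 2 $ 1 = 0] (mod int N) \<and> [A $ 2 $ 2 = 1] (mod int N)}"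

definition principal_congruence_subgroup :: "nat \<Rightarrow> mat2 set" where
  "principal_congruence_subgroup N =
     {A \<in> carrier SL2Z. \<forall>i j. [A $ i $ j = (mat 1 :: mat2) $ i $ j] (mod int N)}"

definition congruence_subgroup :: "mat2 set \<Rightarrow> bool" where
  "congruence_subgroup \<Gamma> \<longleftrightarrow>
     subgroup \<Gamma> SL2Z \<and> (\<exists>N>0. principal_congruence_subgroup N \<subseteq> \<Gamma>)"

definition pm1 :: "mat2 set" where
  "pm1 = {mat 1, - mat 1}"

text \<open>Elements of the quotients by \<open>\<plusminus>1\<close> are the two-element sets \<open>{A, -A}\<close>. The operations of
  \<open>SL2Z Mod pm1\<close> and \<open>M2plus Mod pm1\<close> are the same function, so the former is a
  submonoid of the latter.\<close>

definition cls :: "mat2 \<Rightarrow> mat2 set" where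
  "cls A = pm1 #>\<^bsub>M2plus\<^esub> A"

definition PM2plus :: "mat2 set monoid" where
  "PM2plus = M2plus Mod pm1"

definition PSL2Z :: "mat2 set monoid" where
  "PSL2Z = SL2Z Mod pm1"

text \<open>The image of \<open>\<Gamma>\<close> in \<open>PSL2Z\<close>, as a group.\<close>

definition bar :: "mat2 set \<Rightarrow> mat2 set monoid" where
  "bar \<Gamma> = PSL2Z\<lparr>carrier := cls ` \<Gamma>\<rparr>"


section \<open>The coefficient modules\<close>

text \<open>The ring of integral polynomials in \<open>X1\<close>, \<open>X2\<close> is \<^typ>\<open>int poly poly\<close>:
  \<open>X1\<close> is the inner and \<open>X2\<close> the outer variable.\<close>

type_synonym poly2 = "int poly poly"

definition X1 :: poly2 where "X1 = [:[:0, 1:]:]"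

definition X2 :: poly2 where "X2 = [:0, 1:]"

definition V :: "nat \<Rightarrow> poly2 set" where
  "V n = {P. \<forall>i j. coeff (coeff P j) i \<noteq> 0 \<longrightarrow> i + j = n}"

text \<open>\<open>subst2 P L1 L2\<close> is \<open>P(L1, L2)\<close>.\<close>

definition subst2 :: "poly2 \<Rightarrow> poly2 \<Rightarrow> poly2 \<Rightarrow> poly2" where
  "subst2 P L1 L2 = poly (map_poly (\<lambda>q. poly (map_poly of_int q) L1) P) L2"

definition act :: "mat2 \<Rightarrow> poly2 \<Rightarrow> poly2" where
  "act A P = subst2 P
     (of_int (A $ 2 $ 2) * X1 - of_int (A $ 1 $ 2) * X2)
     (- of_int (A $ 2 $ 1) * X1 + of_int (A $ 1 $ 1) * X2)"

text \<open>The induced action of a class \<open>{A, -A}\<close>; meaningful on \<open>V n\<close> for even \<open>n\<close>, where the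
  image below is a singleton.\<close>

definition act_cls :: "mat2 set \<Rightarrow> poly2 \<Rightarrow> poly2" where
  "act_cls g P = the_elem ((\<lambda>A. act A P) ` g)"


section \<open>Group rings and tensor products\<close>

definition group_ring :: "('g, 'm) monoid_scheme \<Rightarrow> ('g \<Rightarrow>\<^sub>0 int) ring" where
  "group_ring G =
     \<lparr>carrier = {r. Poly_Mapping.keys r \<subseteq> carrier G},
      monoid.mult = (\<lambda>r s. frag_extend (\<lambda>g. frag_extend (\<lambda>h. frag_of (g \<otimes>\<^bsub>G\<^esub> h)) s) r),
      one = frag_of \<one>\<^bsub>G\<^esub>,
      ring.zero = 0,
      ring.add = (+)\<rparr>"

definition augmentation :: "('g \<Rightarrow>\<^sub>0 int) \<Rightarrow> int" where
  "augmentation r = (\<Sum>g\<in>Poly_Mapping.keys r. Poly_Mapping.lookup r g)"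

definition augmentation_ideal :: "('g, 'm) monoid_scheme \<Rightarrow> ('g \<Rightarrow>\<^sub>0 int) set" where
  "augmentation_ideal G = {r \<in> carrier (group_ring G). augmentation r = 0}"

text \<open>Abelian groups are written multiplicatively as in \<^theory>\<open>HOL-Algebra.Group\<close>; this turns
  an additively closed subset of a type into such a group.\<close>

definition additive_group :: "'a::{plus,zero} set \<Rightarrow> 'a monoid" where
  "additive_group S = \<lparr>carrier = S, monoid.mult = (+), one = 0\<rparr>"

text \<open>The tensor product over a ring with underlying set \<open>R\<close>, acting on the abelian group \<open>M\<close> from
  the right by \<open>ra\<close> and on the abelian group \<open>N\<close> from the left by \<open>la\<close>.\<close>

definition tensor_relations ::
  "('a, 'm) monoid_scheme \<Rightarrow> ('b, 'n) monoid_scheme \<Rightarrow> 'r set \<Rightarrow> ('a \<Rightarrow> 'r \<Rightarrow> 'a) \<Rightarrow> ('r \<Rightarrow> 'b \<Rightarrow> 'b)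
     \<Rightarrow> ('a \<times> 'b \<Rightarrow>\<^sub>0 int) set" where
  "tensor_relations M N R ra la = generate (free_Abelian_group (carrier M \<times> carrier N))
     ({frag_of (x \<otimes>\<^bsub>M\<^esub> y, v) - frag_of (x, v) - frag_of (y, v) | x y v.
         x \<in> carrier M \<and> y \<in> carrier M \<and> v \<in> carrier N} \<union>
      {frag_of (x, v \<otimes>\<^bsub>N\<^esub> w) - frag_of (x, v) - frag_of (x, w) | x v w.
         x \<in> carrier M \<and> v \<in> carrier N \<and> w \<in> carrier N} \<union>
      {frag_of (ra x r, v) - frag_of (x, la r v) | x r v.
         x \<in> carrier M \<and> r \<in> R \<and> v \<in> carrier N})"

definition tensor_product ::
  "('a, 'm) monoid_scheme \<Rightarrow> ('b, 'n) monoid_scheme \<Rightarrow> 'r set \<Rightarrow> ('a \<Rightarrow> 'r \<Rightarrow> 'a) \<Rightarrow> ('r \<Rightarrow> 'b \<Rightarrow> 'b)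
     \<Rightarrow> ('a \<times> 'b \<Rightarrow>\<^sub>0 int) set monoid" where
  "tensor_product M N R ra la =
     free_Abelian_group (carrier M \<times> carrier N) Mod tensor_relations M N R ra la"

text \<open>\<open>induced K f\<close> is the map induced on cosets by a map \<open>f\<close> that is compatible with passing to
  the quotient \<open>H Mod K\<close> on the target side.\<close>

definition induced :: "('b, 'n) monoid_scheme \<Rightarrow> 'b set \<Rightarrow> ('a \<Rightarrow> 'b) \<Rightarrow> 'a set \<Rightarrow> 'b set" where
  "induced H K f X = the_elem ((\<lambda>c. K #>\<^bsub>H\<^esub> f c) ` X)"


section \<open>First homology\<close>

text \<open>The left action of the group ring on polynomials.\<close>

definition ring_act :: "(mat2 set \<Rightarrow>\<^sub>0 int) \<Rightarrow> poly2 \<Rightarrow> poly2" where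
  "ring_act r v =
     (\<Sum>g\<in>Poly_Mapping.keys r. of_int (Poly_Mapping.lookup r g) * act_cls g v)"

abbreviation aug_group :: "mat2 set \<Rightarrow> (mat2 set \<Rightarrow>\<^sub>0 int) monoid" where
  "aug_group \<Gamma> \<equiv> additive_group (augmentation_ideal (bar \<Gamma>))"

definition I_free :: "mat2 set \<Rightarrow> nat \<Rightarrow> ((mat2 set \<Rightarrow>\<^sub>0 int) \<times> poly2 \<Rightarrow>\<^sub>0 int) monoid" where
  "I_free \<Gamma> n = free_Abelian_group (augmentation_ideal (bar \<Gamma>) \<times> V n)"

definition I_relations :: "mat2 set \<Rightarrow> nat \<Rightarrow> ((mat2 set \<Rightarrow>\<^sub>0 int) \<times> poly2 \<Rightarrow>\<^sub>0 int) set" where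
  "I_relations \<Gamma> n = tensor_relations (aug_group \<Gamma>) (additive_group (V n))
     (carrier (group_ring (bar \<Gamma>))) (\<lambda>x r. x \<otimes>\<^bsub>group_ring (bar \<Gamma>)\<^esub> r) ring_act"

definition I_tensor :: "mat2 set \<Rightarrow> nat \<Rightarrow> ((mat2 set \<Rightarrow>\<^sub>0 int) \<times> poly2 \<Rightarrow>\<^sub>0 int) set monoid" where
  "I_tensor \<Gamma> n = tensor_product (aug_group \<Gamma>) (additive_group (V n))
     (carrier (group_ring (bar \<Gamma>))) (\<lambda>x r. x \<otimes>\<^bsub>group_ring (bar \<Gamma>)\<^esub> r) ring_act"

text \<open>The pure tensor \<open>x \<otimes> v\<close>.\<close>

definition pure_tensor ::
  "mat2 set \<Rightarrow> nat \<Rightarrow> (mat2 set \<Rightarrow>\<^sub>0 int) \<Rightarrow> poly2 \<Rightarrow> ((mat2 set \<Rightarrow>\<^sub>0 int) \<times> poly2 \<Rightarrow>\<^sub>0 int) set" where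
  "pure_tensor \<Gamma> n x v = I_relations \<Gamma> n #>\<^bsub>I_free \<Gamma> n\<^esub> frag_of (x, v)"

text \<open>The map \<open>x \<otimes> v \<mapsto> x v\<close>.\<close>

definition boundary :: "((mat2 set \<Rightarrow>\<^sub>0 int) \<times> poly2 \<Rightarrow>\<^sub>0 int) set \<Rightarrow> poly2" where
  "boundary X = the_elem
     ((\<lambda>c. \<Sum>xv\<in>Poly_Mapping.keys c.
             of_int (Poly_Mapping.lookup c xv) * ring_act (fst xv) (snd xv)) ` X)"

definition H1 :: "mat2 set \<Rightarrow> nat \<Rightarrow> ((mat2 set \<Rightarrow>\<^sub>0 int) \<times> poly2 \<Rightarrow>\<^sub>0 int) set monoid" where
  "H1 \<Gamma> n = (I_tensor \<Gamma> n)
     \<lparr>carrier := kernel (I_tensor \<Gamma> n) (additive_group (V n)) boundary\<rparr>"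


section \<open>Hyperbolic cycles\<close>

definition hyperbolic :: "mat2 set \<Rightarrow> bool" where
  "hyperbolic g \<longleftrightarrow> (\<exists>A\<in>g. \<bar>trace A\<bar> > 2)"

definition Q_mat :: "mat2 \<Rightarrow> poly2" where
  "Q_mat A =
     (let a = A $ 1 $ 1; b = A $ 1 $ 2; c = A $ 2 $ 1; d = A $ 2 $ 2;
          e = gcd c (gcd (a - d) b)
      in - of_int (sgn (a + d)) *
           (of_int (c div e) * X1\<^sup>2 - of_int ((a - d) div e) * X1 * X2 - of_int (b div e) * X2\<^sup>2))"

definition Q :: "mat2 set \<Rightarrow> poly2" where
  "Q g = the_elem (Q_mat ` g)"

definition hyperbolic_cycle ::
  "mat2 set \<Rightarrow> nat \<Rightarrow> mat2 set \<Rightarrow> ((mat2 set \<Rightarrow>\<^sub>0 int) \<times> poly2 \<Rightarrow>\<^sub>0 int) set" where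
  "hyperbolic_cycle \<Gamma> k g =
     pure_tensor \<Gamma> (2 * k) (frag_of g - frag_of \<one>\<^bsub>bar \<Gamma>\<^esub>) (Q g ^ k)"

definition hyperbolic_cycles ::
  "mat2 set \<Rightarrow> nat \<Rightarrow> ((mat2 set \<Rightarrow>\<^sub>0 int) \<times> poly2 \<Rightarrow>\<^sub>0 int) set set" where
  "hyperbolic_cycles \<Gamma> k =
     generate (H1 \<Gamma> (2 * k)) (hyperbolic_cycle \<Gamma> k ` {g \<in> carrier (bar \<Gamma>). hyperbolic g})"


section \<open>Double coset operators\<close>

definition double_coset :: "mat2 set \<Rightarrow> mat2 \<Rightarrow> mat2 set \<Rightarrow> mat2 set set" where
  "double_coset \<Gamma>' \<alpha> \<Gamma> =
     carrier (bar \<Gamma>') <#>\<^bsub>PM2plus\<^esub> (cls \<alpha> <#\<^bsub>PM2plus\<^esub> carrier (bar \<Gamma>))"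

text \<open>\<open>B\<close> is a system of representatives of \<open>bar \<Gamma>' \ bar \<Gamma>' \<alpha> bar \<Gamma>\<close>.\<close>

definition coset_reps :: "mat2 set \<Rightarrow> mat2 \<Rightarrow> mat2 set \<Rightarrow> mat2 set set \<Rightarrow> bool" where
  "coset_reps \<Gamma>' \<alpha> \<Gamma> B \<longleftrightarrow> B \<subseteq> double_coset \<Gamma>' \<alpha> \<Gamma> \<and>
     (\<forall>\<delta>\<in>double_coset \<Gamma>' \<alpha> \<Gamma>. \<exists>!\<beta>. \<beta> \<in> B \<and> \<delta> \<in> carrier (bar \<Gamma>') #>\<^bsub>PM2plus\<^esub> \<beta>)"

text \<open>The factorisation \<open>\<beta> \<gamma> = \<gamma>' \<beta>'\<close> with \<open>\<beta>' \<in> B\<close> and \<open>\<gamma>' \<in> bar \<Gamma>'\<close>: \<open>rep_perm\<close> is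
  \<open>\<beta>'\<close>, \<open>rep_factor\<close> is \<open>\<gamma>'\<close>.\<close>

definition rep_perm :: "mat2 set \<Rightarrow> mat2 set set \<Rightarrow> mat2 set \<Rightarrow> mat2 set \<Rightarrow> mat2 set" where
  "rep_perm \<Gamma>' B \<beta> \<gamma> =
     (THE \<beta>'. \<beta>' \<in> B \<and> \<beta> \<otimes>\<^bsub>PM2plus\<^esub> \<gamma> \<in> carrier (bar \<Gamma>') #>\<^bsub>PM2plus\<^esub> \<beta>')"

definition rep_factor :: "mat2 set \<Rightarrow> mat2 set set \<Rightarrow> mat2 set \<Rightarrow> mat2 set \<Rightarrow> mat2 set" where
  "rep_factor \<Gamma>' B \<beta> \<gamma> =
     (THE \<gamma>'. \<gamma>' \<in> carrier (bar \<Gamma>') \<and>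
        \<beta> \<otimes>\<^bsub>PM2plus\<^esub> \<gamma> = \<gamma>' \<otimes>\<^bsub>PM2plus\<^esub> rep_perm \<Gamma>' B \<beta> \<gamma>)"

text \<open>An element \<open>x = \<Sum> n\<^sub>\<gamma> \<gamma>\<close> of the augmentation ideal equals \<open>\<Sum> n\<^sub>\<gamma> (\<gamma> - 1)\<close>, so the
  prescription on the tensors \<open>(\<gamma> - 1) \<otimes> v\<close> extends to \<open>x \<otimes> v\<close> by summing over the support
  of \<open>x\<close>. For fixed \<open>B\<close> this respects the relations of the tensor product; the induced map on
  homology does not depend on \<open>B\<close>.\<close>

definition hecke_chain ::
  "mat2 set \<Rightarrow> mat2 set set \<Rightarrow> ((mat2 set \<Rightarrow>\<^sub>0 int) \<times> poly2 \<Rightarrow>\<^sub>0 int)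
     \<Rightarrow> ((mat2 set \<Rightarrow>\<^sub>0 int) \<times> poly2 \<Rightarrow>\<^sub>0 int)" where
  "hecke_chain \<Gamma>' B =
     frag_extend (\<lambda>(x, v). frag_extend (\<lambda>\<gamma>. \<Sum>\<beta>\<in>B.
       frag_of (frag_of (rep_factor \<Gamma>' B \<beta> \<gamma>) - frag_of \<one>\<^bsub>bar \<Gamma>'\<^esub>,
                act_cls (rep_perm \<Gamma>' B \<beta> \<gamma>) v)) x)"

text \<open>The operator \<open>[\<Gamma>' \<alpha> \<Gamma>]\<close> from \<open>H1 \<Gamma> n\<close> to \<open>H1 \<Gamma>' n\<close>, for even \<open>n\<close>.\<close>

definition hecke ::
  "mat2 set \<Rightarrow> mat2 \<Rightarrow> mat2 set \<Rightarrow> nat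
     \<Rightarrow> ((mat2 set \<Rightarrow>\<^sub>0 int) \<times> poly2 \<Rightarrow>\<^sub>0 int) set \<Rightarrow> ((mat2 set \<Rightarrow>\<^sub>0 int) \<times> poly2 \<Rightarrow>\<^sub>0 int) set" where
  "hecke \<Gamma>' \<alpha> \<Gamma> n =
     induced (I_free \<Gamma>' n) (I_relations \<Gamma>' n) (hecke_chain \<Gamma>' (SOME B. coset_reps \<Gamma>' \<alpha> \<Gamma> B))"

definition cycle_quotient ::
  "mat2 set \<Rightarrow> nat \<Rightarrow> ((mat2 set \<Rightarrow>\<^sub>0 int) \<times> poly2 \<Rightarrow>\<^sub>0 int) set set monoid" where
  "cycle_quotient \<Gamma> k = H1 \<Gamma> (2 * k) Mod hyperbolic_cycles \<Gamma> k"

definition hecke_quotient ::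
  "mat2 set \<Rightarrow> mat2 \<Rightarrow> nat
     \<Rightarrow> ((mat2 set \<Rightarrow>\<^sub>0 int) \<times> poly2 \<Rightarrow>\<^sub>0 int) set set \<Rightarrow> ((mat2 set \<Rightarrow>\<^sub>0 int) \<times> poly2 \<Rightarrow>\<^sub>0 int) set set" where
  "hecke_quotient \<Gamma> \<alpha> k =
     induced (H1 \<Gamma> (2 * k)) (hyperbolic_cycles \<Gamma> k) (hecke \<Gamma> \<alpha> \<Gamma> (2 * k))"

definition diag2 :: "int \<Rightarrow> int \<Rightarrow> mat2" where
  "diag2 a d = vector [vector [a, 0], vector [0, d]]"


section \<open>Ordinary parts\<close>

text \<open>The additive group of \<open>p\<close>-adic integers, as the inverse limit of the groups
  of integers modulo \<open>p ^ n\<close>.\<close>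

definition padic_integers :: "nat \<Rightarrow> (nat \<Rightarrow> int) monoid" where
  "padic_integers p =
     (let G = product_group UNIV (\<lambda>n. integer_mod_group (p ^ n))
      in G\<lparr>carrier := {f \<in> carrier G. \<forall>n. f (Suc n) mod int (p ^ n) = f n}\<rparr>)"

definition Z_tensor ::
  "('a, 'm) monoid_scheme \<Rightarrow> ('b, 'n) monoid_scheme \<Rightarrow> ('a \<times> 'b \<Rightarrow>\<^sub>0 int) set monoid" where
  "Z_tensor M N = tensor_product M N (UNIV :: int set) (\<lambda>x n. x [^]\<^bsub>M\<^esub> n) (\<lambda>n y. y [^]\<^bsub>N\<^esub> n)"

text \<open>The endomorphism \<open>t \<otimes> 1\<close> of \<open>M \<otimes> N\<close>; the neutral element of \<open>Z_tensor M N\<close> is the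
  subgroup of relations.\<close>

definition tensor_endo ::
  "('a, 'm) monoid_scheme \<Rightarrow> ('b, 'n) monoid_scheme \<Rightarrow> ('a \<Rightarrow> 'a)
     \<Rightarrow> ('a \<times> 'b \<Rightarrow>\<^sub>0 int) set \<Rightarrow> ('a \<times> 'b \<Rightarrow>\<^sub>0 int) set" where
  "tensor_endo M N t =
     induced (free_Abelian_group (carrier M \<times> carrier N)) \<one>\<^bsub>Z_tensor M N\<^esub>
       (frag_extend (\<lambda>(x, y). frag_of (t x, y)))"

text \<open>The projector \<open>e\<^sub>p\<close>, the limit of \<open>(t \<otimes> 1) ^^ (m!)\<close> on the tensor product of \<open>M\<close> with the
  \<open>p\<close>-adic integers. For finite \<open>M\<close> that tensor product is a finite, hence discrete, module,
  so the limit is the eventual value.\<close>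

definition ordinary_projector ::
  "nat \<Rightarrow> ('a, 'm) monoid_scheme \<Rightarrow> ('a \<Rightarrow> 'a)
     \<Rightarrow> ('a \<times> (nat \<Rightarrow> int) \<Rightarrow>\<^sub>0 int) set \<Rightarrow> ('a \<times> (nat \<Rightarrow> int) \<Rightarrow>\<^sub>0 int) set" where
  "ordinary_projector p M t x =
     (THE y. \<forall>\<^sub>F m in sequentially. (tensor_endo M (padic_integers p) t ^^ fact m) x = y)"

definition non_ordinary :: "nat \<Rightarrow> ('a, 'm) monoid_scheme \<Rightarrow> ('a \<Rightarrow> 'a) \<Rightarrow> bool" where
  "non_ordinary p M t \<longleftrightarrow>
     ordinary_projector p M t ` carrier (Z_tensor M (padic_integers p))
       = {\<one>\<^bsub>Z_tensor M (padic_integers p)\<^esub>}"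

end

theory Submission
  imports Defs "HOL-Library.Function_Algebras"
begin

text \<open>
  For hyperbolic \<open>\<gamma>\<close> the Hecke operator groups the representatives \<open>\<beta>\<close> into orbits under right
  multiplication by \<open>\<gamma>\<close>. An orbit of length \<open>l\<close> contributes \<open>(\<gamma>' - 1) \<otimes> \<beta> Q\<^sub>\<gamma>\<^sup>k\<close> with
  \<open>\<gamma>' = \<beta> \<gamma>\<^sup>l \<beta>\<^sup>-\<^sup>1\<close>, and \<open>\<beta> Q\<^sub>\<gamma>\<close> is an integral multiple of the primitive form \<open>Q\<^sub>\<gamma>\<^sub>'\<close>; so the
  hyperbolic cycles are stable.

  The homology is finitely generated, so finiteness amounts to the quotient being torsion. By duality
  this says that a rational cocycle which vanishes on \<open>Q\<^sub>\<gamma>\<^sup>k\<close> for all hyperbolic \<open>\<gamma>\<close> is a coboundary.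
  Along the progressions \<open>T\<^sup>m \<gamma>\<close>, with \<open>T\<close> a parabolic element of the group, the vanishing is a
  polynomial identity in \<open>m\<close>, and its coefficients determine the cocycle.

  The operator \<open>T\<^sub>p\<close> has representatives whose second row vanishes modulo \<open>p\<close>, and these send every form
  to a multiple of \<open>X\<^sub>2\<^sup>2\<^sup>k\<close> modulo \<open>p\<close>. The elements congruent to \<open>(1, b; 0, 1)\<close> modulo \<open>p\<close> are
  products of hyperbolic ones, for which \<open>Q\<^sub>\<gamma>\<close> is a unit multiple of \<open>X\<^sub>2\<^sup>2\<close> modulo \<open>p\<close>. Hence
  \<open>T\<^sub>p\<close> maps every cycle into the hyperbolic cycles plus \<open>p\<close> times the cycles, and it is nilpotent on the
  \<open>p\<close>-part of the finite quotient.
\<close>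

section \<open>Two by two matrices\<close>

text \<open>Homology classes are handled as chains in a free abelian group, and every identity is a
  congruence modulo a subgroup: the tensor relations \<open>R\<close>, then \<open>KH\<close>, then
  \<open>Kp\<close>. The obstacle at \<open>p\<close> is that a given representative of the double
  coset need not have second row divisible by \<open>p\<close>. Left multiplication by a group
  element makes it so, for \<open>p\<close> dividing \<open>N\<close> or not, and changes the image
  of a chain only by a term that depends on its boundary. The terms of the resulting sum are not
  cycles one by one, and an element with lower left entry divisible by \<open>p\<close> and upper
  left entry \<open>a\<close> acts on \<open>X2 ^ n\<close>, \<open>n = 2 * k\<close>, through the
  character \<open>a ^ n\<close> modulo \<open>p\<close>. If this character is trivial, Fermat's
  theorem leads back to the unipotent elements; if not, the vanishing of the boundary of the whole
  sum decides. In the rational part the cocycle is first changed by a coboundary so that it vanishes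
  on the translation. After that its values along a progression are values of one single element on
  varying forms, which is why they are polynomial.\<close>

definition mk :: "int \<Rightarrow> int \<Rightarrow> int \<Rightarrow> int \<Rightarrow> mat2" where
  "mk a b c d = vector [vector [a, b], vector [c, d]]"

text \<open>For determinant 1 this is the inverse; in general \<open>A ** adj A\<close> is the
  scalar \<open>det A\<close>, so that conjugation formulas with it stay integral.\<close>

definition adj :: "mat2 \<Rightarrow> mat2" where
  "adj A = mk (A$2$2) (- A$1$2) (- A$2$1) (A$1$1)"

lemma mk_nth [simp]:
  "mk a b c d $ 1 $ 1 = a" "mk a b c d $ 1 $ 2 = b" "mk a b c d $ 2 $ 1 = c" "mk a b c d $ 2 $ 2 = d"
  by (simp_all add: mk_def)

lemma mat2_eq_iff:
  fixes A B :: mat2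
  shows "A = B \<longleftrightarrow> A$1$1 = B$1$1 \<and> A$1$2 = B$1$2 \<and> A$2$1 = B$2$1 \<and> A$2$2 = B$2$2"
  by (auto simp: vec_eq_iff forall_2)

lemma mult_nth:
  fixes A B :: mat2
  shows "(A ** B) $ i $ j = A $ i $ 1 * B $ 1 $ j + A $ i $ 2 * B $ 2 $ j"
  by (simp add: matrix_matrix_mult_def sum_2)

lemma mat_1_nth [simp]:
  "(mat 1 :: mat2) $ 1 $ 1 = 1" "(mat 1 :: mat2) $ 1 $ 2 = 0"
  "(mat 1 :: mat2) $ 2 $ 1 = 0" "(mat 1 :: mat2) $ 2 $ 2 = 1"
  by (simp_all add: mat_def)

lemma mk_mult: "mk a b c d ** mk a' b' c' d' = mk (a * a' + b * c') (a * b' + b * d') (c * a' + d * c') (c * b' + d * d')"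
  by (simp add: mat2_eq_iff mult_nth)

lemma adj_nth [simp]:
  "adj A $ 1 $ 1 = A$2$2" "adj A $ 1 $ 2 = - A$1$2" "adj A $ 2 $ 1 = - A$2$1" "adj A $ 2 $ 2 = A$1$1"
  by (simp_all add: adj_def)

lemma det_mat2: "det (A :: mat2) = A$1$1 * A$2$2 - A$1$2 * A$2$1"
  by (simp add: det_2)

lemma det_mk [simp]: "det (mk a b c d) = a * d - b * c"
  by (simp add: det_mat2)

lemma trace_mat2: "trace (A :: mat2) = A$1$1 + A$2$2"
  by (simp add: trace_def sum_2)

lemma adj_adj [simp]: "adj (adj A) = A"
  by (simp add: mat2_eq_iff)

lemma adj_mult: "adj (A ** B) = adj B ** adj A"
  by (simp add: mat2_eq_iff mult_nth)

lemma det_adj [simp]: "det (adj A) = det A"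
  by (simp add: det_mat2)

lemma adj_inverse:
  assumes "det A = 1"
  shows "A ** adj A = mat 1" "adj A ** A = mat 1"
  using assms by (simp_all add: mat2_eq_iff mult_nth det_mat2 algebra_simps)

lemma mult_adj_cancel:
  assumes "det A = 1"
  shows "A ** (adj A ** B) = B" "adj A ** (A ** B) = B"
    "(B ** A) ** adj A = B" "(B ** adj A) ** A = B"
  using adj_inverse[OF assms] by (metis matrix_mul_assoc matrix_mul_lid matrix_mul_rid)+

lemma neg_mult [simp]:
  fixes A B :: mat2
  shows "(- A) ** B = - (A ** B)" "A ** (- B) = - (A ** B)"
  by (simp_all add: mat2_eq_iff mult_nth)

lemma det_neg [simp]: "det (- A :: mat2) = det A"
  by (simp add: det_mat2)

text \<open>Multiplying by the adjugate turns \<open>C\<close> into the scalar \<open>det C\<close>,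
  which cancels entrywise.\<close>

lemma mult_right_cancel_det:
  fixes A B C :: mat2
  assumes "det C \<noteq> 0" "A ** C = B ** C"
  shows "A = B"
proof -
  have *: "X ** C ** adj C = (\<chi> i j. det C * X $ i $ j)" for X :: mat2
    by (simp add: mat2_eq_iff mult_nth det_mat2 algebra_simps)
  have "(\<chi> i j. det C * A $ i $ j) = (\<chi> i j. det C * B $ i $ j)"
    using assms(2) by (simp flip: *)
  then show ?thesis
    using assms(1) by (auto simp: vec_eq_iff)
qed

section \<open>The action on polynomials\<close>

text \<open>Substitution for the inner variable alone, so that \<open>subst2\<close> can be treated
  by induction on both layers of coefficients.\<close>

definition ev :: "poly2 \<Rightarrow> int poly \<Rightarrow> poly2" where
  "ev L q = poly (map_poly of_int q) L"

lemma ev_0 [simp]: "ev L 0 = 0"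
  by (simp add: ev_def)

lemma ev_pCons [simp]: "ev L (pCons a q) = of_int a + L * ev L q"
  by (simp add: ev_def map_poly_pCons)

lemma ev_1 [simp]: "ev L 1 = 1"
  by (simp add: one_pCons)

lemma ev_add: "ev L (p + q) = ev L p + ev L q"
  by (induction p q rule: poly_induct2) (simp_all add: algebra_simps)

lemma ev_smult: "ev L (smult a p) = of_int a * ev L p"
  by (induction p) (simp_all add: algebra_simps)

lemma ev_mult: "ev L (p * q) = ev L p * ev L q"
  by (induction p) (simp_all add: algebra_simps ev_add ev_smult)

lemma subst2_0 [simp]: "subst2 0 L M = 0"
  by (simp add: subst2_def)

lemma subst2_pCons [simp]: "subst2 (pCons a q) L M = ev L a + M * subst2 q L M"
  by (simp add: subst2_def map_poly_pCons flip: ev_def)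

lemma subst2_add: "subst2 (p + q) L M = subst2 p L M + subst2 q L M"
  by (induction p q rule: poly_induct2) (simp_all add: algebra_simps ev_add)

lemma subst2_smult: "subst2 (smult a p) L M = ev L a * subst2 p L M"
  by (induction p) (simp_all add: algebra_simps ev_mult)

lemma subst2_mult: "subst2 (p * q) L M = subst2 p L M * subst2 q L M"
  by (induction p) (simp_all add: algebra_simps subst2_add subst2_smult)

lemma act_0 [simp]: "act A 0 = 0"
  by (simp add: act_def)

lemma act_add: "act A (p + q) = act A p + act A q"
  by (simp add: act_def subst2_add)

lemma act_mult: "act A (p * q) = act A p * act A q"
  by (simp add: act_def subst2_mult)

lemma act_1 [simp]: "act A 1 = 1"
  by (simp add: act_def one_pCons)

lemma act_power: "act A (p ^ m) = act A p ^ m"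
  by (induction m) (simp_all add: act_mult)

lemma act_minus: "act A (- p) = - act A p"
  using act_add[of A p "- p"] by (simp add: eq_neg_iff_add_eq_0 add.commute)

lemma act_diff: "act A (p - q) = act A p - act A q"
  using act_add[of A p "- q"] by (simp add: act_minus)

lemma act_of_nat [simp]: "act A (of_nat m) = of_nat m"
  by (induction m) (simp_all add: act_add)

lemma act_of_int [simp]: "act A (of_int m) = of_int m"
  by (cases m) (simp_all add: act_minus act_add act_diff)

lemma act_sum: "act A (sum f S) = (\<Sum>x\<in>S. act A (f x))"
  by (induction S rule: infinite_finite_induct) (simp_all add: act_add)

lemma act_X1 [simp]: "act A X1 = of_int (A $ 2 $ 2) * X1 - of_int (A $ 1 $ 2) * X2"
  by (simp add: act_def X1_def)

lemma act_X2 [simp]: "act A X2 = - of_int (A $ 2 $ 1) * X1 + of_int (A $ 1 $ 1) * X2"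
  by (simp add: act_def X2_def)

lemma monom_X1_X2: "of_int a * X1 ^ i * X2 ^ j = monom (monom a i) j"
proof -
  have 1: "[:[:0, 1:]:] ^ i = [:monom 1 i:]" for i :: nat
    by (induction i) (simp_all add: one_pCons monom_0 monom_Suc)
  have 2: "[:0, 1:] ^ j = (monom 1 j :: poly2)" for j :: nat
    by (induction j) (simp_all add: monom_0 monom_Suc)
  have "(of_int a :: poly2) = [:[:a:]:]"
    by (simp add: of_int_poly)
  then show ?thesis
    by (simp add: X1_def X2_def 1 2 smult_monom)
qed

lemma coeff_coeff_monom: "coeff (coeff (monom (monom a i') j') j) i = (if j' = j \<and> i' = i then a else 0)"
  by simp

text \<open>The working form of membership in \<open>V n\<close>: it reduces statements about forms
  to finitely many monomials.\<close>

lemma V_iff_sum: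
  "P \<in> V n \<longleftrightarrow> (\<exists>a :: nat \<Rightarrow> int. P = (\<Sum>j\<le>n. of_int (a j) * X1 ^ (n - j) * X2 ^ j))"
proof -
  have *: "coeff (coeff (\<Sum>l\<le>n. monom (monom (a l) (n - l)) l) j) i = (if i + j = n then a j else 0)"
    for a :: "nat \<Rightarrow> int" and i j
  proof -
    have "coeff (coeff (\<Sum>l\<le>n. monom (monom (a l) (n - l)) l) j) i
      = (\<Sum>l\<le>n. if j = l then (if n - j = i then a j else 0) else 0)"
      unfolding coeff_sum coeff_coeff_monom by (rule sum.cong) (simp_all split: if_splits)
    also have "\<dots> = (if j \<le> n then (if n - j = i then a j else 0) else 0)"
      by (subst sum.delta') simp_all
    also have "\<dots> = (if i + j = n then a j else 0)"
      by (simp split: if_split) linarith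
    finally show ?thesis .
  qed
  show ?thesis
    unfolding monom_X1_X2
  proof
    assume P: "P \<in> V n"
    have 1: "coeff (coeff P j) i = (if i + j = n then coeff (coeff P j) (n - j) else 0)" for i j
      using P unfolding V_def by (cases "i + j = n") auto
    have "P = (\<Sum>j\<le>n. monom (monom (coeff (coeff P j) (n - j)) (n - j)) j)"
      by (intro poly_eqI) (subst *, rule 1)
    then show "\<exists>a. P = (\<Sum>j\<le>n. monom (monom (a j) (n - j)) j)"
      by (rule exI[of _ "\<lambda>j. coeff (coeff P j) (n - j)"])
  next
    assume "\<exists>a. P = (\<Sum>j\<le>n. monom (monom (a j) (n - j)) j)"
    then obtain a :: "nat \<Rightarrow> int" where P: "P = (\<Sum>j\<le>n. monom (monom (a j) (n - j)) j)" ..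
    show "P \<in> V n"
      unfolding V_def P mem_Collect_eq * by simp
  qed
qed

lemma V_0 [simp]: "0 \<in> V n"
  by (simp add: V_def)

lemma V_add: "P \<in> V n \<Longrightarrow> P' \<in> V n \<Longrightarrow> P + P' \<in> V n"
  by (auto simp: V_def) (metis add.right_neutral)

lemma V_minus: "P \<in> V n \<Longrightarrow> - P \<in> V n"
  by (auto simp: V_def)

lemma V_diff: "P \<in> V n \<Longrightarrow> P' \<in> V n \<Longrightarrow> P - P' \<in> V n"
  using V_add[of P n "- P'"] V_minus by simp

lemma V_sum: "(\<And>x. x \<in> S \<Longrightarrow> f x \<in> V n) \<Longrightarrow> sum f S \<in> V n"
  by (induction S rule: infinite_finite_induct) (auto intro: V_add)

lemma V_mult:
  assumes "P \<in> V m" "P' \<in> V n"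
  shows "P * P' \<in> V (m + n)"
  unfolding V_def
proof safe
  fix i j
  assume "coeff (coeff (P * P') j) i \<noteq> 0"
  then have "(\<Sum>x\<le>j. \<Sum>y\<le>i. coeff (coeff P x) y * coeff (coeff P' (j - x)) (i - y)) \<noteq> 0"
    by (simp add: coeff_mult coeff_sum)
  then obtain x where x: "x \<le> j" "(\<Sum>y\<le>i. coeff (coeff P x) y * coeff (coeff P' (j - x)) (i - y)) \<noteq> 0"
    by (meson atMost_iff sum.not_neutral_contains_not_neutral)
  then obtain y where y: "y \<le> i" "coeff (coeff P x) y * coeff (coeff P' (j - x)) (i - y) \<noteq> 0"
    by (meson atMost_iff sum.not_neutral_contains_not_neutral)
  then have "y + x = m" "(i - y) + (j - x) = n"
    using assms by (auto simp: V_def)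
  then show "i + j = m + n"
    using x y by linarith
qed

lemma V_1: "1 \<in> V 0"
  unfolding V_iff_sum by (rule exI[of _ "\<lambda>_. 1"]) simp

lemma V_of_int: "of_int a \<in> V 0"
  unfolding V_iff_sum by (rule exI[of _ "\<lambda>_. a"]) simp

lemma V_of_int_mult: "P \<in> V n \<Longrightarrow> of_int a * P \<in> V n"
  using V_mult[OF V_of_int] by force

lemma V_power: "P \<in> V m \<Longrightarrow> P ^ i \<in> V (m * i)"
  by (induction i) (auto simp: V_1 intro: V_mult)

lemma V_X1 [simp]: "X1 \<in> V (Suc 0)" and V_X2 [simp]: "X2 \<in> V (Suc 0)"
  by (auto simp: V_def X1_def X2_def one_pCons coeff_pCons split: nat.splits)

lemma V_monomial: "i + j = n \<Longrightarrow> X1 ^ i * X2 ^ j \<in> V n"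
  using V_mult[OF V_power[OF V_X1, of i] V_power[OF V_X2, of j]] by simp

lemma V_linear: "of_int a * X1 + of_int b * X2 \<in> V (Suc 0)"
  by (intro V_add V_of_int_mult) simp_all

lemma V_act:
  assumes "P \<in> V n"
  shows "act A P \<in> V n"
proof -
  obtain a where a: "P = (\<Sum>j\<le>n. of_int (a j) * X1 ^ (n - j) * X2 ^ j)"
    using assms V_iff_sum by blast
  have "act A X1 \<in> V (Suc 0)" "act A X2 \<in> V (Suc 0)"
    using V_linear[of "A$2$2" "- A$1$2"] V_linear[of "- A$2$1" "A$1$1"] by simp_all
  then have "act A X1 ^ (n - j) * act A X2 ^ j \<in> V n" if "j \<le> n" for j
    using V_mult[OF V_power V_power, of _ "Suc 0" _ "Suc 0" "n - j" j] that by simp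
  then show ?thesis
    unfolding a by (auto simp: act_sum act_mult act_power mult.assoc
      simp del: act_X1 act_X2 intro!: V_sum V_of_int_mult)
qed

lemma act_subst2: "act A (subst2 P L M) = subst2 P (act A L) (act A M)"
proof -
  have "act A (ev L q) = ev (act A L) q" for q
    by (induction q) (simp_all add: act_add act_mult)
  then show ?thesis
    by (induction P) (simp_all add: act_add act_mult)
qed

lemma act_eq_subst2: "act A P = subst2 P (act A X1) (act A X2)"
  unfolding act_X1 act_X2 by (simp add: act_def)

text \<open>Both sides are substitutions, so it suffices to compare them on \<open>X1\<close> and
  \<open>X2\<close>.\<close>

lemma act_act: "act A (act B P) = act (A ** B) P"
proof -
  have 1: "act A (act B X1) = act (A ** B) X1" "act A (act B X2) = act (A ** B) X2"
    by (simp_all add: act_add act_diff act_mult act_minus mult_nth algebra_simps)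
  show ?thesis
    unfolding act_eq_subst2[of B P] act_subst2 1 act_eq_subst2[of "A ** B" P] ..
qed

lemma act_mat_1: "act (mat 1) P = P"
proof -
  have *: "ev X1 q = [:q:]" for q
    by (induction q) (auto simp: X1_def of_int_poly)
  have "subst2 P X1 X2 = P"
    by (induction P) (simp_all add: X2_def * )
  then show ?thesis
    by (simp add: act_def)
qed

text \<open>A form of even degree is unchanged when both variables change sign; hence classes modulo
  sign act.\<close>

lemma act_neg:
  assumes "P \<in> V (2 * k)"
  shows "act (- A) P = act A P"
proof -
  obtain a where a: "P = (\<Sum>j\<le>2*k. of_int (a j) * X1 ^ (2*k - j) * X2 ^ j)"
    using assms V_iff_sum by blast
  have 1: "act (- A) X1 = - act A X1" "act (- A) X2 = - act A X2"
    by (simp_all add: algebra_simps)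
  have "(- x) ^ (2*k - j) * (- y) ^ j = x ^ (2*k - j) * y ^ j" if "j \<le> 2*k" for x y :: poly2 and j
    using that by (cases "even j") auto
  then show ?thesis
    unfolding a by (auto simp: act_sum act_mult act_power 1 mult.assoc simp del: act_X1 act_X2 intro!: sum.cong)
qed

section \<open>The invariant quadratic form of a matrix\<close>

text \<open>The invariant form before division by the content and the sign. Unlike
  \<open>Q_mat\<close> it is polynomial in the entries of \<open>A\<close>, as the arguments along
  progressions require.\<close>

definition qf :: "mat2 \<Rightarrow> poly2" where
  "qf A = of_int (A$2$1) * X1\<^sup>2 - of_int (A$1$1 - A$2$2) * X1 * X2 - of_int (A$1$2) * X2\<^sup>2"

text \<open>\<open>qf A\<close> is the determinant of the columns \<open>(x, A x)\<close>, whence its equivariance.\<close>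

lemma act_qf: "act B (qf A) = qf (B ** A ** adj B)"
  by (simp add: qf_def act_add act_diff act_mult act_power act_minus mult_nth power2_eq_square algebra_simps)

lemma qf_V: "qf A \<in> V 2"
proof -
  have "of_int a * (X1 * X1) + (of_int b * (X1 * X2) + of_int c * (X2 * X2)) \<in> V (Suc 0 + Suc 0)" for a b c
    by (intro V_add V_of_int_mult V_mult) simp_all
  from this[of "A$2$1" "- (A$1$1 - A$2$2)" "- A$1$2"] show ?thesis
    by (simp add: qf_def power2_eq_square numeral_2_eq_2 algebra_simps)
qed

definition mat_content :: "mat2 \<Rightarrow> int" where
  "mat_content A = gcd (A$2$1) (gcd (A$1$1 - A$2$2) (A$1$2))"

text \<open>The integer divisions inside \<open>Q_mat\<close> are exact, so identities for
  \<open>Q_mat\<close> follow from those for \<open>qf\<close> by cancelling a nonzero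
  integer.\<close>

lemma Q_mat_qf: "of_int (mat_content A) * Q_mat A = - of_int (sgn (trace A)) * qf A"
proof -
  define e where "e = mat_content A"
  have d: "e dvd A$2$1" "e dvd A$1$1 - A$2$2" "e dvd A$1$2"
    unfolding e_def mat_content_def by (auto intro: dvd_trans)
  have "of_int e * (of_int (A$2$1 div e) * X1\<^sup>2 - of_int ((A$1$1 - A$2$2) div e) * X1 * X2
      - of_int (A$1$2 div e) * X2\<^sup>2) =
      of_int (e * (A$2$1 div e)) * X1\<^sup>2 - of_int (e * ((A$1$1 - A$2$2) div e)) * X1 * X2
      - of_int (e * (A$1$2 div e)) * X2\<^sup>2"
    unfolding of_int_mult by (simp add: algebra_simps)
  also have "\<dots> = qf A"
    unfolding dvd_mult_div_cancel[OF d(1)] dvd_mult_div_cancel[OF d(2)] dvd_mult_div_cancel[OF d(3)] qf_def ..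
  finally show ?thesis
    unfolding Q_mat_def Let_def mat_content_def[symmetric] e_def[symmetric] trace_mat2
    by (simp add: mult.left_commute[of "of_int e"] del: of_int_diff of_int_mult)
qed

lemma Q_mat_V: "Q_mat A \<in> V 2"
proof -
  have *: "of_int a * X1\<^sup>2 - of_int b * X1 * X2 - of_int c * X2\<^sup>2 \<in> V 2" for a b c
    using qf_V[of "mk b c a 0"] by (simp add: qf_def)
  show ?thesis
    unfolding Q_mat_def Let_def
    using V_of_int_mult[OF *, of "- s" for s] by simp
qed

text \<open>Negating \<open>A\<close> changes both the form and the sign of the trace; therefore
  \<open>Q\<close> is well defined on classes modulo sign.\<close>

lemma Q_mat_neg: "Q_mat (- A) = Q_mat A"
proof -
  have 1: "- A$1$1 + A$2$2 = - (A$1$1 - A$2$2)"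
    by simp
  have d: "mat_content A dvd A$2$1" "mat_content A dvd A$1$1 - A$2$2" "mat_content A dvd A$1$2"
    unfolding mat_content_def by (auto intro: dvd_trans)
  have 2: "gcd (- A$2$1) (gcd (- (A$1$1 - A$2$2)) (- A$1$2)) = mat_content A"
    unfolding mat_content_def by (simp only: gcd_neg1_int gcd_neg2_int)
  have 3: "- x div mat_content A = - (x div mat_content A)" if "mat_content A dvd x" for x
    using that by (rule dvd_neg_div)
  have 4: "sgn (- A$1$1 - A$2$2) = - sgn (A$1$1 + A$2$2)"
    by (simp add: sgn_if)
  show ?thesis
    unfolding Q_mat_def Let_def vector_uminus_component diff_minus_eq_add 1 2
      3[OF d(1)] 3[OF d(2)] 3[OF d(3)] mat_content_def[symmetric]
    by (simp add: algebra_simps 4)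
qed

section \<open>Cocycles vanishing on hyperbolic elements\<close>

definition additive_on :: "poly2 set \<Rightarrow> (poly2 \<Rightarrow> rat) \<Rightarrow> bool" where
  "additive_on W f \<longleftrightarrow> (\<forall>v\<in>W. \<forall>w\<in>W. f (v + w) = f v + f w)"

lemma additive_onD: "additive_on W f \<Longrightarrow> v \<in> W \<Longrightarrow> w \<in> W \<Longrightarrow> f (v + w) = f v + f w"
  by (simp add: additive_on_def)

lemma additive_on_0:
  assumes "additive_on (V n) f"
  shows "f 0 = 0"
  using additive_onD[OF assms V_0 V_0] by simp

lemma additive_on_minus:
  assumes "additive_on (V n) f" "v \<in> V n"
  shows "f (- v) = - f v"
  using additive_onD[OF assms(1) assms(2) V_minus[OF assms(2)]] additive_on_0[OF assms(1)] by simp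

lemma additive_on_diff:
  assumes "additive_on (V n) f" "v \<in> V n" "w \<in> V n"
  shows "f (v - w) = f v - f w"
  using additive_onD[OF assms(1,2) V_minus[OF assms(3)]] additive_on_minus[OF assms(1,3)] by simp

lemma additive_on_of_nat:
  assumes "additive_on (V n) f" "v \<in> V n"
  shows "f (of_nat m * v) = of_nat m * f v"
proof (induction m)
  case (Suc m)
  have "of_nat m * v \<in> V n"
    using V_of_int_mult[OF assms(2), of "int m"] by simp
  then have "f (v + of_nat m * v) = f v + of_nat m * f v"
    using additive_onD[OF assms] Suc by simp
  then show ?case
    by (simp add: distrib_right)
qed (simp add: additive_on_0[OF assms(1)])

lemma additive_on_of_int:
  assumes "additive_on (V n) f" "v \<in> V n"
  shows "f (of_int m * v) = of_int m * f v"
proof (cases m rule: int_cases2)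
  case (nonneg l)
  then show ?thesis using additive_on_of_nat[OF assms] by simp
next
  case (nonpos l)
  have "of_nat l * v \<in> V n"
    using V_of_int_mult[OF assms(2), of "int l"] by simp
  then show ?thesis
    using nonpos additive_on_of_nat[OF assms] additive_on_minus[OF assms(1)] by simp
qed

lemma additive_on_sum:
  assumes "additive_on (V n) f" "\<And>x. x \<in> S \<Longrightarrow> g x \<in> V n"
  shows "f (sum g S) = (\<Sum>x\<in>S. f (g x))"
  using assms(2)
  by (induction S rule: infinite_finite_induct)
    (auto simp: additive_on_0[OF assms(1)] V_sum additive_onD[OF assms(1)])

lemma additive_on_linear_combination:
  assumes "additive_on (V n) f" "\<And>x. x \<in> S \<Longrightarrow> g x \<in> V n"
  shows "f (\<Sum>x\<in>S. of_int (a x) * g x) = (\<Sum>x\<in>S. of_int (a x) * f (g x))"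
proof -
  have "f (\<Sum>x\<in>S. of_int (a x) * g x) = (\<Sum>x\<in>S. f (of_int (a x) * g x))"
    using assms by (intro additive_on_sum[OF assms(1)] V_of_int_mult)
  also have "\<dots> = (\<Sum>x\<in>S. of_int (a x) * f (g x))"
    using assms by (intro sum.cong additive_on_of_int[OF assms(1)]) auto
  finally show ?thesis .
qed

lemma additive_on_eqI:
  assumes "additive_on (V n) f" "additive_on (V n) g" "v \<in> V n"
    and "\<And>j. j \<le> n \<Longrightarrow> f (X1 ^ (n - j) * X2 ^ j) = g (X1 ^ (n - j) * X2 ^ j)"
  shows "f v = g v"
proof -
  obtain a where a: "v = (\<Sum>j\<le>n. of_int (a j) * X1 ^ (n - j) * X2 ^ j)"
    using assms(3) V_iff_sum by blast
  have m: "X1 ^ (n - j) * X2 ^ j \<in> V n" if "j \<le> n" for j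
    using that by (intro V_monomial) simp
  have *: "h v = (\<Sum>j\<le>n. of_int (a j) * h (X1 ^ (n - j) * X2 ^ j))" if "additive_on (V n) h" for h
    unfolding a mult.assoc by (rule additive_on_linear_combination[OF that]) (simp add: m)
  show ?thesis
    unfolding *[OF assms(1)] *[OF assms(2)] using assms(4) by simp
qed

text \<open>The source of the polynomial identities below: on a power of a form that is affine in an
  integer \<open>s\<close>, the value of \<open>f\<close> is a polynomial in \<open>s\<close> whose
  coefficients are again values of \<open>f\<close>, up to binomials.\<close>

lemma additive_on_binomial:
  assumes "additive_on (V n) f" "P \<in> V d" "R \<in> V d" "M \<in> V l" "d * m + l = n"
  shows "f ((of_int s * R + P) ^ m * M)
    = (\<Sum>e\<le>m. of_nat (m choose e) * f (R ^ e * P ^ (m - e) * M) * of_int s ^ e)"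
proof -
  have *: "R ^ e * P ^ (m - e) * M \<in> V n" if "e \<le> m" for e
  proof -
    have "d * e + d * (m - e) + l = n"
      using that assms(5) by (metis add_mult_distrib2 le_add_diff_inverse)
    then show ?thesis
      using V_mult[OF V_mult[OF V_power[OF assms(3), of e] V_power[OF assms(2), of "m - e"]] assms(4)] by simp
  qed
  have "f ((of_int s * R + P) ^ m * M)
    = f (\<Sum>e\<le>m. of_int (int (m choose e) * s ^ e) * (R ^ e * P ^ (m - e) * M))"
    unfolding binomial_ring sum_distrib_right
    by (rule arg_cong[of _ _ f], rule sum.cong) (simp_all add: power_mult_distrib mult_ac)
  also have "\<dots> = (\<Sum>e\<le>m. of_int (int (m choose e) * s ^ e) * f (R ^ e * P ^ (m - e) * M))"
    using * by (intro additive_on_linear_combination[OF assms(1)]) simp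
  also have "\<dots> = (\<Sum>e\<le>m. of_nat (m choose e) * f (R ^ e * P ^ (m - e) * M) * of_int s ^ e)"
    by (rule sum.cong) simp_all
  finally show ?thesis .
qed

section \<open>Vanishing polynomials, triangular systems, evaluations\<close>

lemma poly_identity:
  fixes a :: "nat \<Rightarrow> rat"
  assumes "infinite S" "\<And>s. s \<in> S \<Longrightarrow> (\<Sum>e\<le>n. a e * of_int s ^ e) = 0" "e \<le> n"
  shows "a e = 0"
proof -
  define p where "p = (\<Sum>e\<le>n. monom (a e) e)"
  have "of_int ` S \<subseteq> {z. poly p z = 0}"
    using assms(2) by (auto simp: p_def poly_sum poly_monom)
  moreover have "infinite (of_int ` S :: rat set)"
    using assms(1) finite_imageD[of "of_int :: int \<Rightarrow> rat" S] by (auto simp: inj_on_def)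
  ultimately have "p = 0"
    using poly_roots_finite[of p] finite_subset by blast
  moreover have "coeff p e = a e"
    using assms(3) by (simp add: p_def coeff_sum)
  ultimately show ?thesis
    by simp
qed

text \<open>Forward substitution. It supplies the functional whose coboundary normalises a cocycle
  at the translation.\<close>

lemma triangular_system:
  fixes c :: "nat \<Rightarrow> nat \<Rightarrow> rat"
  assumes "\<And>e. c e e \<noteq> 0"
  shows "\<exists>L. \<forall>e<n. (\<Sum>i\<le>e. c e i * L i) = \<mu> e"
proof (induction n)
  case (Suc n)
  then obtain L where L: "\<And>e. e < n \<Longrightarrow> (\<Sum>i\<le>e. c e i * L i) = \<mu> e"
    by blast
  define L' where "L' = L(n := (\<mu> n - (\<Sum>i<n. c n i * L i)) / c n n)"
  have "(\<Sum>i\<le>e. c e i * L' i) = \<mu> e" if "e < Suc n" for e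
  proof (cases "e = n")
    case True
    have "(\<Sum>i\<le>n. c n i * L' i) = (\<Sum>i<n. c n i * L i) + c n n * L' n"
      by (simp add: lessThan_Suc_atMost[symmetric] L'_def)
    then show ?thesis
      using assms[of n] True by (simp add: L'_def)
  next
    case False
    then have "(\<Sum>i\<le>e. c e i * L' i) = (\<Sum>i\<le>e. c e i * L i)"
      using that by (intro sum.cong) (auto simp: L'_def)
    then show ?thesis
      using L False that by simp
  qed
  then show ?case by blast
qed simp

text \<open>The value at \<open>(0, 1)\<close>, on \<open>V n\<close> the coefficient of
  \<open>X2 ^ n\<close>. The translation \<open>mk 1 1 0 1\<close> fixes \<open>X2 ^ n\<close>, so
  no coboundary alters the value of a cocycle there; this is the part that the normalisation leaves
  over.\<close>

definition eval01 :: "poly2 \<Rightarrow> int" where "eval01 v = poly (poly v 1) 0"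

lemma eval01 [simp]:
  "eval01 X1 = 0" "eval01 X2 = 1" "eval01 (p + q) = eval01 p + eval01 q"
  "eval01 (p - q) = eval01 p - eval01 q" "eval01 (- p) = - eval01 p"
  "eval01 (p * q) = eval01 p * eval01 q" "eval01 (p ^ m) = eval01 p ^ m" "eval01 (of_int z) = z"
  "eval01 (of_nat m) = int m"
  by (simp_all add: eval01_def X1_def X2_def of_int_poly of_nat_poly)

text \<open>The value at \<open>(1, 0)\<close>, a functional fixed by all translations. Its
  multiples are the functionals on \<open>V n\<close> whose coboundary vanishes on
  \<open>mk 1 1 0 1\<close>.\<close>

definition eval10 :: "poly2 \<Rightarrow> int" where "eval10 v = poly (poly v 0) 1"

lemma eval10 [simp]:
  "eval10 X1 = 1" "eval10 X2 = 0" "eval10 (p + q) = eval10 p + eval10 q"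
  "eval10 (p - q) = eval10 p - eval10 q" "eval10 (- p) = - eval10 p"
  "eval10 (p * q) = eval10 p * eval10 q" "eval10 (p ^ m) = eval10 p ^ m" "eval10 (of_int z) = z"
  by (simp_all add: eval10_def X1_def X2_def of_int_poly)

text \<open>For determinant 1 this is the linear form that \<open>A\<close> sends to
  \<open>X2\<close>. Forms are expanded in powers of \<open>X2\<close> and
  \<open>lf A\<close>.\<close>

definition lf :: "mat2 \<Rightarrow> poly2" where
  "lf A = of_int (A$2$1) * X1 + of_int (A$2$2) * X2"

lemma lf_V: "lf A \<in> V (Suc 0)"
  unfolding lf_def by (rule V_linear)

section \<open>Rational cocycles and their normalisation at the translation\<close>

locale rational_cocycle =
  fixes \<Gamma> :: "mat2 set" and N k :: nat and \<phi> :: "mat2 \<Rightarrow> poly2 \<Rightarrow> rat"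
  assumes N_pos: "N > 0"
    and det_1: "A \<in> \<Gamma> \<Longrightarrow> det A = 1"
    and mult_closed: "A \<in> \<Gamma> \<Longrightarrow> B \<in> \<Gamma> \<Longrightarrow> A ** B \<in> \<Gamma>"
    and T_in: "mk 1 1 0 1 \<in> \<Gamma>"
    and U_in: "mk 1 0 (int N) 1 \<in> \<Gamma>"
    and additive: "A \<in> \<Gamma> \<Longrightarrow> additive_on (V (2 * k)) (\<phi> A)"
    and cocycle: "A \<in> \<Gamma> \<Longrightarrow> B \<in> \<Gamma> \<Longrightarrow> v \<in> V (2 * k) \<Longrightarrow> \<phi> (A ** B) v = \<phi> A (act B v) + \<phi> B v"
    and phi_neg: "A \<in> \<Gamma> \<Longrightarrow> v \<in> V (2 * k) \<Longrightarrow> \<phi> (- A) v = \<phi> A v"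
    and phi_hyp: "A \<in> \<Gamma> \<Longrightarrow> \<bar>trace A\<bar> > 2 \<Longrightarrow> \<phi> A (qf A ^ k) = 0"
begin

abbreviation n where "n \<equiv> 2 * k"

lemma qf_power_V: "qf A ^ k \<in> V n"
  by (rule V_power[OF qf_V])

lemma T_power_in: "m > 0 \<Longrightarrow> mk 1 (int m) 0 1 \<in> \<Gamma>"
proof (induction m)
  case (Suc m)
  then show ?case
    using T_in mult_closed[OF T_in, of "mk 1 (int m) 0 1"] by (cases "m = 0") (simp_all add: mk_mult add.commute)
qed simp

lemma U_power_in: "m > 0 \<Longrightarrow> mk 1 0 (int (m * N)) 1 \<in> \<Gamma>"
proof (induction m)
  case (Suc m)
  then show ?case
    using U_in mult_closed[OF U_in, of "mk 1 0 (int (m * N)) 1"] by (cases "m = 0") (simp_all add: mk_mult add.commute)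
qed simp

text \<open>Subtracting a coboundary keeps the vanishing on hyperbolic elements, because
  \<open>A\<close> fixes \<open>qf A\<close>.\<close>

lemma shift:
  assumes "additive_on (V n) L"
  shows "rational_cocycle \<Gamma> N k (\<lambda>A v. \<phi> A v - (L (act A v) - L v))"
proof
  fix A B v assume A: "A \<in> \<Gamma>"
  show "additive_on (V n) (\<lambda>v. \<phi> A v - (L (act A v) - L v))"
    using additive[OF A] assms by (auto simp: additive_on_def act_add V_act)
  { assume "B \<in> \<Gamma>" "v \<in> V n"
    then show "\<phi> (A ** B) v - (L (act (A ** B) v) - L v)
      = \<phi> A (act B v) - (L (act A (act B v)) - L (act B v)) + (\<phi> B v - (L (act B v) - L v))"
      using A by (simp add: cocycle act_act) }
  { assume "v \<in> V n"
    then show "\<phi> (- A) v - (L (act (- A) v) - L v) = \<phi> A v - (L (act A v) - L v)"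
      using A by (simp add: phi_neg act_neg) }
  { assume "2 < \<bar>trace A\<bar>"
    then show "\<phi> A (qf A ^ k) - (L (act A (qf A ^ k)) - L (qf A ^ k)) = 0"
      using A phi_hyp by (simp add: act_power act_qf mult_adj_cancel(3) det_1) }
qed (auto simp: N_pos det_1 mult_closed T_in U_in[simplified])

text \<open>On the monomials with a positive power of \<open>X1\<close> the map
  \<open>v \<mapsto> act T v - v\<close>, \<open>T = mk 1 1 0 1\<close>, is triangular with nonzero
  diagonal. A functional can therefore be prescribed that absorbs the values of the cocycle there,
  and only the value on the fixed form \<open>X2 ^ n\<close> remains.\<close>

lemma exists_normalisation:
  "\<exists>L t. additive_on (V n) L \<and>
    (\<forall>v\<in>V n. \<phi> (mk 1 1 0 1) v - (L (act (mk 1 1 0 1) v) - L v) = t * of_int (eval01 v))"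
proof -
  let ?T = "mk 1 1 0 1"
  \<comment> \<open>These are the coefficients of \<open>(X1 - X2) ^ Suc e\<close> at
    \<open>X1 ^ i\<close>; those with \<open>i \<le> e\<close> are the coefficients of its
    difference from \<open>X1 ^ Suc e\<close>.\<close>
  define c :: "nat \<Rightarrow> nat \<Rightarrow> rat" where "c e i = of_nat (Suc e choose i) * (-1) ^ (Suc e - i)" for e i
  have "c e e \<noteq> 0" for e
    by (simp add: c_def)
  from triangular_system[of c, OF this, where n = n and \<mu> = "\<lambda>e. \<phi> ?T (X1 ^ Suc e * X2 ^ (n - Suc e))"]
  obtain L where L: "\<And>e. e < n \<Longrightarrow> (\<Sum>i\<le>e. c e i * L i) = \<phi> ?T (X1 ^ Suc e * X2 ^ (n - Suc e))"
    by blast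
  define M :: "poly2 \<Rightarrow> rat" where "M v = (\<Sum>i\<le>n. of_int (coeff (coeff v (n - i)) i) * L i)" for v
  have M: "additive_on (V n) M"
    by (simp add: additive_on_def M_def algebra_simps sum.distrib)
  have M_mono: "M (X1 ^ i * X2 ^ (n - i)) = L i" if "i \<le> n" for i
  proof -
    have "M (X1 ^ i * X2 ^ (n - i)) = (\<Sum>l\<le>n. if l = i then L i else 0)"
      unfolding M_def using monom_X1_X2[of 1 i "n - i"] that
      by (intro sum.cong) (auto simp: coeff_coeff_monom)
    then show ?thesis using that by simp
  qed
  define t where "t = \<phi> ?T (X2 ^ n)"
  have M_T: "M (act ?T (X1 ^ Suc e * X2 ^ (n - Suc e))) - M (X1 ^ Suc e * X2 ^ (n - Suc e))
      = \<phi> ?T (X1 ^ Suc e * X2 ^ (n - Suc e))" if "e < n" for e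
  proof -
    have "act ?T (X1 ^ Suc e * X2 ^ (n - Suc e)) = (of_int 1 * X1 + of_int (-1) * X2) ^ Suc e * X2 ^ (n - Suc e)"
      by (simp add: act_mult act_power)
    then have "M (act ?T (X1 ^ Suc e * X2 ^ (n - Suc e)))
      = (\<Sum>i\<le>Suc e. of_nat (Suc e choose i) * M (X1 ^ i * (of_int (-1) * X2) ^ (Suc e - i) * X2 ^ (n - Suc e)) * of_int 1 ^ i)"
      using additive_on_binomial[OF M, of "of_int (-1) * X2" "Suc 0" X1 "X2 ^ (n - Suc e)" "n - Suc e" "Suc e" 1]
        that V_linear[of 0 "-1"] V_power[OF V_X2, of "n - Suc e"] by simp
    also have "\<dots> = (\<Sum>i\<le>Suc e. c e i * L i)"
    proof (rule sum.cong)
      fix i assume "i \<in> {..Suc e}"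
      then have "Suc e - i + (n - Suc e) = n - i" "i \<le> n"
        using that by auto
      then have eq: "X1 ^ i * (of_int (-1) * X2) ^ (Suc e - i) * X2 ^ (n - Suc e)
        = of_int ((-1) ^ (Suc e - i)) * (X1 ^ i * X2 ^ (n - i))"
        unfolding power_mult_distrib by (simp add: mult_ac flip: power_add)
      then show "of_nat (Suc e choose i) * M (X1 ^ i * (of_int (-1) * X2) ^ (Suc e - i) * X2 ^ (n - Suc e)) * of_int 1 ^ i = c e i * L i"
        unfolding eq using \<open>i \<le> n\<close> additive_on_of_int[OF M V_monomial, of i "n - i" "(-1) ^ (Suc e - i)"]
        by (simp add: c_def M_mono)
    qed simp
    also have "\<dots> = \<phi> ?T (X1 ^ Suc e * X2 ^ (n - Suc e)) + L (Suc e)"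
      using L[OF that] by (simp add: c_def)
    finally show ?thesis
      using M_mono[of "Suc e"] that by simp
  qed
  have "\<phi> ?T v - (M (act ?T v) - M v) = t * of_int (eval01 v)" if v: "v \<in> V n" for v
  proof (rule additive_on_eqI[OF _ _ v])
    show "additive_on (V n) (\<lambda>v. \<phi> ?T v - (M (act ?T v) - M v))"
      using additive[OF T_in] M by (auto simp: additive_on_def act_add V_act)
    show "additive_on (V n) (\<lambda>v. t * of_int (eval01 v))"
      by (simp add: additive_on_def algebra_simps)
    fix j assume j: "j \<le> n"
    show "\<phi> ?T (X1 ^ (n - j) * X2 ^ j) - (M (act ?T (X1 ^ (n - j) * X2 ^ j)) - M (X1 ^ (n - j) * X2 ^ j))
      = t * of_int (eval01 (X1 ^ (n - j) * X2 ^ j))"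
    proof (cases "n - j")
      case 0
      then show ?thesis
        using j by (simp add: t_def act_power)
    next
      case (Suc e)
      then have "j = n - Suc e" "e < n"
        using j by auto
      then show ?thesis
        using M_T[of e] Suc by simp
    qed
  qed
  then show ?thesis
    using M by blast
qed

end

section \<open>Normalised cocycles are coboundaries\<close>

locale normalised_cocycle = rational_cocycle +
  fixes t :: rat
  assumes phi_T: "v \<in> V (2 * k) \<Longrightarrow> \<phi> (mk 1 1 0 1) v = t * of_int (eval01 v)"
begin

lemma phi_T_power:
  assumes "v \<in> V n" "m > 0"
  shows "\<phi> (mk 1 (int m) 0 1) v = t * of_int (\<Sum>i<m. eval01 (act (mk 1 (int i) 0 1) v))"
  using \<open>m > 0\<close>
proof (induction m)
  case (Suc m)
  show ?case
  proof (cases "m = 0")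
    case True
    have "mk 1 0 0 1 = mat 1"
      by (simp add: mat2_eq_iff)
    then show ?thesis
      using True assms(1) by (simp add: phi_T act_mat_1)
  next
    case False
    have "mk 1 (int (Suc m)) 0 1 = mk 1 1 0 1 ** mk 1 (int m) 0 1"
      by (simp add: mk_mult add.commute)
    then have "\<phi> (mk 1 (int (Suc m)) 0 1) v
      = \<phi> (mk 1 1 0 1) (act (mk 1 (int m) 0 1) v) + \<phi> (mk 1 (int m) 0 1) v"
      using cocycle[OF T_in T_power_in assms(1)] False by simp
    then show ?thesis
      using Suc.IH False assms(1) by (simp add: phi_T V_act algebra_simps)
  qed
qed simp

text \<open>A growth argument on the hyperbolic elements \<open>T^m U\<close>, with
  \<open>T = mk 1 1 0 1\<close>. The vanishing equates, up to sign, \<open>t\<close> times a sum of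
  \<open>m\<close> terms that are each at least \<open>m ^ k\<close> with a polynomial in
  \<open>m\<close> of degree at most \<open>k\<close>. So \<open>\<bar>t\<bar> * m\<close> is
  bounded.\<close>

lemma t_eq_0: "t = 0"
proof -
  let ?U = "mk 1 0 (int N) 1"
  define R where "R = - (of_int (int N) * (X1 * X2) + X2\<^sup>2)"
  define P where "P = of_int (int N) * X1\<^sup>2"
  have V2: "R \<in> V 2" "P \<in> V 2"
    using qf_V[of "mk (int N) 1 0 0"] qf_V[of "mk 0 0 (int N) 0"]
    by (simp_all add: R_def P_def qf_def mult.assoc)
  \<comment> \<open>As \<open>m \<ge> 1\<close>, the polynomial is at most \<open>m ^ k\<close>
    times the sum of the absolute values of its coefficients.\<close>
  define C where "C = (\<Sum>e\<le>k. of_nat (k choose e) * \<bar>\<phi> ?U (R ^ e * P ^ (k - e))\<bar>)"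
  have bound: "\<bar>t\<bar> * of_nat m \<le> C" if m: "m > 0" for m :: nat
  proof -
    let ?A = "mk 1 (int m) 0 1 ** ?U"
    have A: "?A \<in> \<Gamma>"
      by (intro mult_closed T_power_in U_in m)
    have "trace ?A > 2"
      using m N_pos by (simp add: mk_mult trace_mat2)
    then have "0 = \<phi> ?A (qf ?A ^ k)"
      using phi_hyp[OF A] by simp
    also have "\<dots> = \<phi> (mk 1 (int m) 0 1) (act ?U (qf ?A ^ k)) + \<phi> ?U (qf ?A ^ k)"
      by (rule cocycle[OF T_power_in[OF m] U_in qf_power_V])
    also have "act ?U (qf ?A ^ k) = qf (?U ** mk 1 (int m) 0 1) ^ k"
      by (simp add: act_power act_qf mult_adj_cancel matrix_mul_assoc)
    \<comment> \<open>The \<open>i\<close>-th translate of the quadratic form has the value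
      \<open>- (m + i N (m - i))\<close> at \<open>(0, 1)\<close>, negative for every
      \<open>i < m\<close>; so no cancellation can occur in the sum of the \<open>k\<close>-th
      powers.\<close>
    also have "\<phi> (mk 1 (int m) 0 1) \<dots>
      = t * of_int (\<Sum>i<m. (- 1) ^ k * (int m + int (i * N) * (int m - int i)) ^ k)"
    proof -
      have "eval01 (act (mk 1 (int i) 0 1) (qf (?U ** mk 1 (int m) 0 1) ^ k))
        = (- 1) ^ k * (int m + int (i * N) * (int m - int i)) ^ k" for i
        unfolding power_mult_distrib[symmetric]
        by (simp add: act_power act_qf) (simp add: qf_def mk_mult adj_def algebra_simps)
      then show ?thesis
        by (simp add: phi_T_power[OF qf_power_V m])
    qed
    also have "qf ?A = of_int (int m) * R + P"
      by (simp add: qf_def mk_mult R_def P_def algebra_simps)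
    finally have eq: "\<bar>\<phi> ?U ((of_int (int m) * R + P) ^ k)\<bar>
      = \<bar>t\<bar> * of_int (\<Sum>i<m. (int m + int (i * N) * (int m - int i)) ^ k)"
      (is "?l = \<bar>t\<bar> * of_int ?s")
    proof -
      assume "0 = t * of_int (\<Sum>i<m. (- 1) ^ k * (int m + int (i * N) * (int m - int i)) ^ k)
        + \<phi> ?U ((of_int (int m) * R + P) ^ k)"
      then have "\<phi> ?U ((of_int (int m) * R + P) ^ k) = - (t * (- 1) ^ k * of_int ?s)"
        by (simp add: sum_distrib_left[symmetric])
      moreover have "?s \<ge> 0"
        by (intro sum_nonneg zero_le_power) auto
      then have "\<bar>of_int ?s :: rat\<bar> = of_int ?s"
        by (simp only: abs_of_nonneg of_int_0_le_iff)
      ultimately show ?thesis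
        by (simp only: abs_minus_cancel abs_mult power_abs[symmetric]) simp
    qed
    have "(\<Sum>i<m. int m ^ k) \<le> ?s"
      by (intro sum_mono power_mono) auto
    then have "int m * int m ^ k \<le> ?s"
      by simp
    then have "of_int (int m * int m ^ k) \<le> (of_int ?s :: rat)"
      by (rule of_int_le_iff[THEN iffD2])
    then have "\<bar>t\<bar> * (of_nat m * of_nat m ^ k) \<le> ?l"
      unfolding eq by (intro mult_left_mono) simp_all
    also have "?l \<le> C * of_nat m ^ k"
    proof -
      have "\<phi> ?U ((of_int (int m) * R + P) ^ k * 1)
        = (\<Sum>e\<le>k. of_nat (k choose e) * \<phi> ?U (R ^ e * P ^ (k - e) * 1) * of_int (int m) ^ e)"
        by (rule additive_on_binomial[OF additive[OF U_in] V2(2,1) V_1]) simp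
      then have "?l \<le> (\<Sum>e\<le>k. \<bar>of_nat (k choose e) * \<phi> ?U (R ^ e * P ^ (k - e)) * of_nat m ^ e\<bar>)"
        by (simp add: sum_abs)
      also have "\<dots> \<le> (\<Sum>e\<le>k. of_nat (k choose e) * \<bar>\<phi> ?U (R ^ e * P ^ (k - e))\<bar> * of_nat m ^ k)"
        using m by (intro sum_mono) (auto simp: abs_mult intro!: mult_left_mono power_increasing)
      finally show ?thesis
        by (simp add: C_def sum_distrib_right)
    qed
    finally have "(\<bar>t\<bar> * of_nat m) * of_nat m ^ k \<le> C * of_nat m ^ k"
      by (simp add: mult_ac)
    then show ?thesis
      using m by simp
  qed
  show ?thesis
  proof (rule ccontr)
    assume "t \<noteq> 0"
    then obtain m :: nat where "C < of_nat m * \<bar>t\<bar>"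
      using ex_less_of_nat_mult[of "\<bar>t\<bar>" C] by auto
    moreover have "of_nat m * \<bar>t\<bar> \<le> of_nat (Suc m) * \<bar>t\<bar>"
      by (intro mult_right_mono) auto
    ultimately show False
      using bound[of "Suc m"] by (simp add: mult.commute)
  qed
qed

lemma phi_T_mult:
  assumes "A \<in> \<Gamma>" "v \<in> V n" "m > 0"
  shows "\<phi> (mk 1 (int m) 0 1 ** A) v = \<phi> A v"
  using assms cocycle[OF T_power_in[OF assms(3)] assms(1,2)]
  by (simp add: phi_T_power V_act t_eq_0)

text \<open>On \<open>T^m A\<close> the cocycle has the same values as on \<open>A\<close>, while
  \<open>c\<close> times the invariant form is \<open>s * (X2 * w) + (w ^ 2 + X2 ^ 2)\<close> with
  \<open>w = lf A\<close>, \<open>c\<close> the lower left entry and \<open>s\<close> minus the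
  trace. The trace runs through an arithmetic progression, so each coefficient in \<open>s\<close>
  vanishes.\<close>

lemma phi_quadratic:
  assumes A: "A \<in> \<Gamma>" and c: "A$2$1 \<noteq> 0" and j: "j \<le> k"
  shows "\<phi> A ((X2 * lf A) ^ j * ((lf A)\<^sup>2 + X2\<^sup>2) ^ (k - j)) = 0"
proof -
  define c a where "c = A$2$1" and "a = trace A"
  have det: "A$1$1 * A$2$2 - A$1$2 * A$2$1 = 1"
    using det_1[OF A] by (simp add: det_mat2)
  have V2: "X2 * lf A \<in> V 2" "(lf A)\<^sup>2 + X2\<^sup>2 \<in> V 2"
    using V_mult[OF V_X2 lf_V[of A]] V_power[OF lf_V[of A], of 2] V_power[OF V_X2, of 2]
    by (simp_all add: numeral_2_eq_2 V_add)
  \<comment> \<open>From \<open>m = \<bar>a\<bar> + 3\<close> on, the trace \<open>a + m c\<close>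
    exceeds 2 in absolute value, as \<open>c\<close> is nonzero.\<close>
  define S where "S = (\<lambda>m. - (a + int m * c)) ` {nat (\<bar>a\<bar> + 3)..}"
  have "inj (\<lambda>m. - (a + int m * c))"
    using c by (auto simp: inj_def c_def)
  then have inf: "infinite S"
    unfolding S_def using infinite_Ici by (metis finite_imageD inj_on_subset subset_UNIV)
  have *: "(\<Sum>e\<le>k. (of_nat (k choose e) * \<phi> A ((X2 * lf A) ^ e * ((lf A)\<^sup>2 + X2\<^sup>2) ^ (k - e))) * of_int s ^ e) = 0"
    if s: "s \<in> S" for s
  proof -
    obtain m where "s = - (a + int m * c)" "nat (\<bar>a\<bar> + 3) \<le> m"
      using s unfolding S_def by blast
    then have m: "s = - (a + int m * c)" "int m \<ge> \<bar>a\<bar> + 3"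
      by linarith+
    let ?B = "mk 1 (int m) 0 1 ** A"
    have m0: "m > 0"
      using m(2) by linarith
    have B: "?B \<in> \<Gamma>"
      by (intro mult_closed T_power_in A m0)
    have tr: "trace ?B = a + int m * c"
      by (simp add: trace_mat2 mult_nth a_def c_def)
    have "int m * 1 \<le> int m * \<bar>c\<bar>"
      using c by (intro mult_left_mono) (simp_all add: c_def)
    then have "\<bar>int m * c\<bar> \<ge> int m"
      by (simp add: abs_mult)
    then have "\<bar>trace ?B\<bar> > 2"
      using m(2) unfolding tr by linarith
    then have "\<phi> A (qf ?B ^ k) = 0"
      using phi_hyp[OF B] phi_T_mult[OF A qf_power_V m0] by simp
    moreover have "of_int c * qf ?B = of_int s * (X2 * lf A) + ((lf A)\<^sup>2 + X2\<^sup>2)"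
    proof -
      have "(of_int (A$1$1) * of_int (A$2$2) - of_int (A$1$2) * of_int (A$2$1) :: poly2) = 1"
        using arg_cong[OF det, of "of_int :: int \<Rightarrow> poly2"] by simp
      moreover have "of_int c * qf ?B = of_int s * (X2 * lf A) + ((lf A)\<^sup>2 + X2\<^sup>2)
        - (1 - (of_int (A$1$1) * of_int (A$2$2) - of_int (A$1$2) * of_int (A$2$1))) * X2\<^sup>2"
        unfolding m(1) a_def c_def trace_mat2
        by (simp add: qf_def lf_def mult_nth algebra_simps power2_eq_square)
      ultimately show ?thesis
        by simp
    qed
    then have "\<phi> A ((of_int s * (X2 * lf A) + ((lf A)\<^sup>2 + X2\<^sup>2)) ^ k * 1)
      = \<phi> A (of_int (c ^ k) * qf ?B ^ k)"
      by (metis mult.right_neutral of_int_power power_mult_distrib)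
    ultimately have "\<phi> A ((of_int s * (X2 * lf A) + ((lf A)\<^sup>2 + X2\<^sup>2)) ^ k * 1) = 0"
      by (simp only: additive_on_of_int[OF additive[OF A] qf_power_V] mult_zero_right)
    then show ?thesis
      using additive_on_binomial[OF additive[OF A] V2(2,1) V_1, of k s] by simp
  qed
  have "of_nat (k choose j) * \<phi> A ((X2 * lf A) ^ j * ((lf A)\<^sup>2 + X2\<^sup>2) ^ (k - j)) = 0"
    using poly_identity[OF inf * j] .
  then show ?thesis
    using j by simp
qed

text \<open>The products in \<open>phi_quadratic\<close> span the forms of degree \<open>n\<close>
  that are symmetric in \<open>u = X2\<close> and \<open>w = lf A\<close>. The power sums are
  reached by the recursion \<open>w^(2a) + u^(2a) = (w^2 + u^2) (w^(2a-2) + u^(2a-2)) - (u w)^2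
  (w^(2a-4) + u^(2a-4))\<close>.\<close>

lemma phi_power_sum:
  assumes A: "A \<in> \<Gamma>" and c: "A$2$1 \<noteq> 0" and "x + y + a = k"
  shows "\<phi> A (((lf A)\<^sup>2 + X2\<^sup>2) ^ x * (X2 * lf A) ^ y * (lf A ^ (2 * a) + X2 ^ (2 * a))) = 0"
  using assms(3)
proof (induction a arbitrary: x y rule: less_induct)
  case (less a)
  let ?w = "lf A" and ?u = "X2"
  let ?p = "?w\<^sup>2 + ?u\<^sup>2"
  have V: "?p ^ x * (?u * ?w) ^ y * (?w ^ (2 * a) + ?u ^ (2 * a)) \<in> V n" if "x + y + a = k" for x y a
  proof -
    have "?p \<in> V (2 * 1)" "?u * ?w \<in> V (2 * 1)"
      using V_mult[OF V_X2 lf_V[of A]] V_power[OF lf_V[of A], of 2] V_power[OF V_X2, of 2]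
      by (simp_all add: numeral_2_eq_2 V_add)
    moreover have "?w ^ (2 * a) + ?u ^ (2 * a) \<in> V (2 * a)"
      using V_add[OF V_power[OF lf_V[of A], of "2 * a"] V_power[OF V_X2, of "2 * a"]] by simp
    ultimately have "?p ^ x * (?u * ?w) ^ y * (?w ^ (2 * a) + ?u ^ (2 * a)) \<in> V (2 * 1 * x + 2 * 1 * y + 2 * a)"
      by (rule V_mult[OF V_mult[OF V_power V_power]])
    then show ?thesis
      by (simp flip: that add: algebra_simps)
  qed
  consider "a = 0" | "a = 1" | b where "a = Suc (Suc b)"
    by (metis One_nat_def not0_implies_Suc)
  then show ?case
  proof cases
    case 1
    then have eq: "?p ^ x * (?u * ?w) ^ y * (?w ^ (2 * a) + ?u ^ (2 * a))
      = of_int 2 * ((?u * ?w) ^ y * ?p ^ (k - y))"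
      using less.prems by (simp add: mult_ac flip: less.prems)
    moreover have "(?u * ?w) ^ y * ?p ^ (k - y) \<in> V n"
      using V_power[OF _, of "(?u * ?w)" 2 y] V[of "k - y" y 0] less.prems 1
        V_mult[OF V_power[of "?u * ?w" 2 y] V_power[of ?p 2 "k - y"]]
        V_mult[OF V_X2 lf_V[of A]] V_power[OF lf_V[of A], of 2] V_power[OF V_X2, of 2]
      by (simp add: numeral_2_eq_2 V_add algebra_simps)
    ultimately show ?thesis
      unfolding eq using additive_on_of_int[OF additive[OF A], of "(?u * ?w) ^ y * ?p ^ (k - y)" 2]
        phi_quadratic[OF A c, of y] less.prems by simp
  next
    case 2
    then have eq: "?p ^ x * (?u * ?w) ^ y * (?w ^ (2 * a) + ?u ^ (2 * a)) = (?u * ?w) ^ y * ?p ^ (k - y)"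
      using less.prems by (simp add: mult_ac flip: less.prems)
    show ?thesis
      unfolding eq using phi_quadratic[OF A c, of y] less.prems by simp
  next
    case 3
    have "?p ^ x * (?u * ?w) ^ y * (?w ^ (2 * a) + ?u ^ (2 * a))
      = ?p ^ Suc x * (?u * ?w) ^ y * (?w ^ (2 * Suc b) + ?u ^ (2 * Suc b))
      - ?p ^ x * (?u * ?w) ^ (y + 2) * (?w ^ (2 * b) + ?u ^ (2 * b))"
      unfolding 3 by (simp add: algebra_simps power2_eq_square)
    also have "\<phi> A \<dots> = 0"
      using less.prems 3 less.IH[of "Suc b" "Suc x" y] less.IH[of b x "y + 2"]
      by (subst additive_on_diff[OF additive[OF A] V V]) simp_all
    finally show ?thesis .
  qed
qed

text \<open>A functional that kills the symmetric forms changes sign when \<open>X2\<close> and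
  \<open>lf A\<close> are exchanged. The remaining information comes from comparing two elements of
  the group.\<close>

lemma phi_antisym:
  assumes A: "A \<in> \<Gamma>" and c: "A$2$1 \<noteq> 0" and "e \<le> n"
  shows "\<phi> A (X2 ^ e * lf A ^ (n - e)) = - \<phi> A (X2 ^ (n - e) * lf A ^ e)"
proof -
  have V: "X2 ^ e * lf A ^ (n - e) \<in> V n" if "e \<le> n" for e
    using V_mult[OF V_power[OF V_X2, of e] V_power[OF lf_V[of A], of "n - e"]] that by simp
  have *: "\<phi> A (X2 ^ e * lf A ^ (n - e)) + \<phi> A (X2 ^ (n - e) * lf A ^ e) = 0" if "e \<le> k" for e
  proof -
    have "\<phi> A (X2 ^ e * lf A ^ (n - e)) + \<phi> A (X2 ^ (n - e) * lf A ^ e)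
      = \<phi> A (X2 ^ e * lf A ^ (n - e) + X2 ^ (n - e) * lf A ^ e)"
      using V[of e] V[of "n - e"] that by (simp add: additive_onD[OF additive[OF A]])
    also have "X2 ^ e * lf A ^ (n - e) + X2 ^ (n - e) * lf A ^ e
      = ((lf A)\<^sup>2 + X2\<^sup>2) ^ 0 * (X2 * lf A) ^ e * (lf A ^ (2 * (k - e)) + X2 ^ (2 * (k - e)))"
    proof -
      have eq: "n - e = e + 2 * (k - e)"
        using that by simp
      show ?thesis
        unfolding eq power_add power_mult_distrib power_0 mult_1_left distrib_left by (simp only: mult_ac)
    qed
    also have "\<phi> A \<dots> = 0"
      using that by (intro phi_power_sum[OF A c]) simp
    finally show ?thesis .
  qed
  show ?thesis
  proof (cases "e \<le> k")
    case True
    then show ?thesis using *[of e] by simp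
  next
    case False
    then have "n - e \<le> k" by simp
    then show ?thesis using *[of "n - e"] assms(3) by (simp add: eq_neg_iff_add_eq_0 add.commute)
  qed
qed

text \<open>The symmetric form \<open>h(x, y) = x^i y^j + x^j y^i\<close> is evaluated for the element
  \<open>B T^l A\<close>, whose lower left entry \<open>S\<close> runs through an arithmetic progression; the identity is a
  polynomial one in \<open>S\<close>.\<close>

lemma phi_relation:
  assumes A: "A \<in> \<Gamma>" and B: "B \<in> \<Gamma>" and c: "A$2$1 \<noteq> 0" "B$2$1 \<noteq> 0"
    and ij: "i + j = n" and e: "e \<le> n"
  defines "c \<equiv> of_int (A$2$1) :: rat" and "c' \<equiv> of_int (B$2$1) :: rat"
  shows "c' ^ n * (of_nat (j choose e) * (- c') ^ (j - e) * c ^ i + of_nat (i choose e) * (- c') ^ (i - e) * c ^ j)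
      * \<phi> A (X2 ^ (n - e) * lf A ^ e)
    = c ^ n * (of_nat (i choose e) * (- c) ^ (i - e) * c' ^ j + of_nat (j choose e) * (- c) ^ (j - e) * c' ^ i)
      * \<phi> B (X2 ^ (n - e) * lf B ^ e)"
proof -
  define a b where "a = A$2$1" and "b = B$2$1"
  let ?T = "\<lambda>l. mk 1 (int l) 0 1"
  define s where "s l = int l * a * b + (b * A$1$1 + B$2$2 * a)" for l
  \<comment> \<open>Left out are \<open>l = 0\<close>, since the translation rule is stated for
    positive exponents, and \<open>s l = 0\<close>, since antisymmetry is available only for a
    nonzero lower left entry.\<close>
  define S where "S = (\<lambda>l. s l) ` {l. l > 0 \<and> s l \<noteq> 0}"
  have inj: "inj s"
    using c by (auto simp: inj_def s_def a_def b_def)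
  have "finite {l. s l = 0}"
    using finite_vimageI[OF finite.insertI[OF finite.emptyI] inj, of 0] by (simp add: vimage_def)
  then have "finite ({0} \<union> {l. s l = 0})"
    by simp
  then have "infinite (- ({0} \<union> {l. s l = 0}))"
    by (metis finite_compl infinite_UNIV_nat)
  moreover have "- ({0} \<union> {l. s l = 0}) = {l. l > 0 \<and> s l \<noteq> 0}"
    by auto
  ultimately have inf: "infinite S"
    unfolding S_def using inj by (metis finite_imageD inj_on_subset subset_UNIV)
  have VX: "X2 ^ p * lf C ^ q \<in> V n" if "p + q = n" for p q C
    using V_mult[OF V_power[OF V_X2, of p] V_power[OF lf_V[of C], of q]] that by simp
  \<comment> \<open>The linear forms belonging to \<open>C = B T^l A\<close> are affine in its lower
    left entry \<open>x\<close> up to a denominator: \<open>a * lf C = x * lf A - b * X2\<close>,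
    and \<open>b\<close> times the image of \<open>X2\<close> under \<open>T^l A\<close> is
    \<open>x * X2 - a * lf B\<close>. The factors \<open>a ^ n\<close> and \<open>b ^ n\<close>
    clear these denominators.\<close>
  have key: "of_int (b ^ n) * \<phi> A ((of_int a * X2) ^ i * (of_int x * lf A + of_int (- b) * X2) ^ j
        + (of_int a * X2) ^ j * (of_int x * lf A + of_int (- b) * X2) ^ i)
      + of_int (a ^ n) * \<phi> B ((of_int x * X2 + of_int (- a) * lf B) ^ i * (of_int b * lf B) ^ j
        + (of_int x * X2 + of_int (- a) * lf B) ^ j * (of_int b * lf B) ^ i) = 0"
    if x: "x \<in> S" for x
  proof -
    obtain l where l: "x = s l" "l > 0" "x \<noteq> 0"
      using x unfolding S_def by blast
    define C where "C = B ** (?T l ** A)"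
    have TA: "?T l ** A \<in> \<Gamma>"
      using T_power_in[OF l(2)] A mult_closed by blast
    have C: "C \<in> \<Gamma>"
      unfolding C_def using B TA mult_closed by blast
    have C21: "C$2$1 = x"
      by (simp add: C_def mult_nth l s_def a_def b_def algebra_simps)
    define h where "h = X2 ^ i * lf C ^ j + X2 ^ j * lf C ^ i"
    have hV: "h \<in> V n"
      unfolding h_def using ij by (intro V_add VX) auto
    have "\<phi> C h = \<phi> C (X2 ^ i * lf C ^ j) + \<phi> C (X2 ^ j * lf C ^ i)"
      unfolding h_def using ij by (intro additive_onD[OF additive[OF C]] VX) auto
    also have "\<dots> = 0"
      using phi_antisym[OF C, of i] C21 l(3) ij by (simp add: add.commute) (metis add_diff_cancel_left' add_diff_cancel_right' add.right_inverse add.left_inverse)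
    finally have 0: "\<phi> B (act (?T l ** A) h) + \<phi> A h = 0"
      unfolding C_def using cocycle[OF B TA hV] phi_T_mult[OF A hV l(2)] by simp
    have "of_int (b ^ n) * \<phi> A (of_int (a ^ n) * h) + of_int (a ^ n) * \<phi> B (of_int (b ^ n) * act (?T l ** A) h)
      = of_int (a ^ n) * of_int (b ^ n) * (\<phi> B (act (?T l ** A) h) + \<phi> A h)"
      unfolding additive_on_of_int[OF additive[OF A] hV] additive_on_of_int[OF additive[OF B] V_act[OF hV]]
      by (simp only: distrib_left mult_ac add_ac)
    then have "of_int (b ^ n) * \<phi> A (of_int (a ^ n) * h) + of_int (a ^ n) * \<phi> B (of_int (b ^ n) * act (?T l ** A) h) = 0"
      unfolding 0 by (simp only: mult_zero_right)
    moreover have "of_int (a ^ n) * h = (of_int a * X2) ^ i * (of_int x * lf A + of_int (- b) * X2) ^ j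
        + (of_int a * X2) ^ j * (of_int x * lf A + of_int (- b) * X2) ^ i"
    proof -
      have d: "(of_int (A$1$1) * of_int (A$2$2) - of_int (A$1$2) * of_int (A$2$1) :: poly2) = 1"
        using arg_cong[OF det_1[OF A], of "of_int :: int \<Rightarrow> poly2"] by (simp add: det_mat2)
      have "of_int a * lf C = of_int x * lf A + (of_int (A$1$1) * of_int (A$2$2) - of_int (A$1$2) * of_int (A$2$1)) * of_int (- b) * X2"
        unfolding lf_def C21 by (simp add: C_def l(1) s_def a_def b_def mult_nth algebra_simps)
      then have w: "of_int a * lf C = of_int x * lf A + of_int (- b) * X2"
        unfolding d by simp
      have "of_int (a ^ n) = (of_int a ^ i * of_int a ^ j :: poly2)"
        by (simp flip: ij add: power_add)
      then show ?thesis
        unfolding h_def w[symmetric] power_mult_distrib by (simp add: algebra_simps)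
    qed
    moreover have "of_int (b ^ n) * act (?T l ** A) h
      = (of_int x * X2 + of_int (- a) * lf B) ^ i * (of_int b * lf B) ^ j
        + (of_int x * X2 + of_int (- a) * lf B) ^ j * (of_int b * lf B) ^ i"
    proof -
      have d: "(of_int (A$1$1) * of_int (A$2$2) - of_int (A$1$2) * of_int (A$2$1) :: poly2) = 1"
        using arg_cong[OF det_1[OF A], of "of_int :: int \<Rightarrow> poly2"] by (simp add: det_mat2)
      have u: "of_int b * act (?T l ** A) X2 = of_int x * X2 + of_int (- a) * lf B"
        unfolding lf_def by (simp add: l(1) s_def a_def b_def mult_nth algebra_simps)
      have "act (?T l ** A) (lf C) = (of_int (A$1$1) * of_int (A$2$2) - of_int (A$1$2) * of_int (A$2$1)) * lf B"
        unfolding lf_def C_def by (simp add: act_add act_mult mult_nth algebra_simps)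
      then have w: "act (?T l ** A) (lf C) = lf B"
        unfolding d by simp
      have "of_int (b ^ n) = (of_int b ^ i * of_int b ^ j :: poly2)"
        by (simp flip: ij add: power_add)
      then show ?thesis
        unfolding h_def act_add act_mult act_power w u[symmetric] power_mult_distrib
        by (simp add: algebra_simps)
    qed
    ultimately show ?thesis by simp
  qed
  have expA: "\<phi> A ((of_int a * X2) ^ p * (of_int x * lf A + of_int (- b) * X2) ^ q)
      = (\<Sum>e\<le>n. of_nat (q choose e) * (- c') ^ (q - e) * c ^ p * \<phi> A (X2 ^ (n - e) * lf A ^ e) * of_int x ^ e)"
    if pq: "p + q = n" for p q x
  proof -
    have "\<phi> A ((of_int x * lf A + of_int (- b) * X2) ^ q * (of_int a * X2) ^ p)
      = (\<Sum>e\<le>q. of_nat (q choose e) * \<phi> A (lf A ^ e * (of_int (- b) * X2) ^ (q - e) * (of_int a * X2) ^ p) * of_int x ^ e)"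
    proof (rule additive_on_binomial[OF additive[OF A] V_of_int_mult[OF V_X2] lf_V])
      show "(of_int a * X2) ^ p \<in> V p"
        using V_power[OF V_of_int_mult[OF V_X2], of a p] by simp
      show "Suc 0 * q + p = n"
        using pq by linarith
    qed
    also have "\<dots> = (\<Sum>e\<le>q. of_nat (q choose e) * (- c') ^ (q - e) * c ^ p * \<phi> A (X2 ^ (n - e) * lf A ^ e) * of_int x ^ e)"
    proof (rule sum.cong)
      fix e assume "e \<in> {..q}"
      then have e: "e \<le> q" "n - e = (q - e) + p" "e \<le> n"
        using pq by auto
      have v: "X2 ^ (n - e) * lf A ^ e \<in> V n"
        using e(3) by (intro VX) simp
      have eq: "lf A ^ e * (of_int (- b) * X2) ^ (q - e) * (of_int a * X2) ^ p
        = of_int ((- b) ^ (q - e) * a ^ p) * (X2 ^ (n - e) * lf A ^ e)"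
        unfolding power_mult_distrib e(2) power_add by (simp add: mult_ac)
      show "of_nat (q choose e) * \<phi> A (lf A ^ e * (of_int (- b) * X2) ^ (q - e) * (of_int a * X2) ^ p) * of_int x ^ e
        = of_nat (q choose e) * (- c') ^ (q - e) * c ^ p * \<phi> A (X2 ^ (n - e) * lf A ^ e) * of_int x ^ e"
        unfolding eq additive_on_of_int[OF additive[OF A] v] by (simp add: c_def c'_def a_def b_def)
    qed simp
    also have "\<dots> = (\<Sum>e\<le>n. of_nat (q choose e) * (- c') ^ (q - e) * c ^ p * \<phi> A (X2 ^ (n - e) * lf A ^ e) * of_int x ^ e)"
      using pq by (intro sum.mono_neutral_left) auto
    finally show ?thesis
      by (simp add: mult.commute)
  qed
  \<comment> \<open>Here \<open>X2\<close> and \<open>lf B\<close> come out with exchanged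
    exponents; antisymmetry turns them round and produces the minus sign.\<close>
  have expB: "\<phi> B ((of_int x * X2 + of_int (- a) * lf B) ^ p * (of_int b * lf B) ^ q)
      = (\<Sum>e\<le>n. - (of_nat (p choose e) * (- c) ^ (p - e) * c' ^ q * \<phi> B (X2 ^ (n - e) * lf B ^ e) * of_int x ^ e))"
    if pq: "p + q = n" for p q x
  proof -
    have "\<phi> B ((of_int x * X2 + of_int (- a) * lf B) ^ p * (of_int b * lf B) ^ q)
      = (\<Sum>e\<le>p. of_nat (p choose e) * \<phi> B (X2 ^ e * (of_int (- a) * lf B) ^ (p - e) * (of_int b * lf B) ^ q) * of_int x ^ e)"
    proof (rule additive_on_binomial[OF additive[OF B] V_of_int_mult[OF lf_V] V_X2])
      show "(of_int b * lf B) ^ q \<in> V q"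
        using V_power[OF V_of_int_mult[OF lf_V], of b B q] by simp
      show "Suc 0 * p + q = n"
        using pq by linarith
    qed
    also have "\<dots> = (\<Sum>e\<le>p. - (of_nat (p choose e) * (- c) ^ (p - e) * c' ^ q * \<phi> B (X2 ^ (n - e) * lf B ^ e) * of_int x ^ e))"
    proof (rule sum.cong)
      fix e assume "e \<in> {..p}"
      then have e: "e \<le> p" "n - e = (p - e) + q" "e \<le> n"
        using pq by auto
      have v: "X2 ^ e * lf B ^ (n - e) \<in> V n"
        using e(3) by (intro VX) simp
      have eq: "X2 ^ e * (of_int (- a) * lf B) ^ (p - e) * (of_int b * lf B) ^ q
        = of_int ((- a) ^ (p - e) * b ^ q) * (X2 ^ e * lf B ^ (n - e))"
        unfolding power_mult_distrib e(2) power_add by (simp add: mult_ac)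
      show "of_nat (p choose e) * \<phi> B (X2 ^ e * (of_int (- a) * lf B) ^ (p - e) * (of_int b * lf B) ^ q) * of_int x ^ e
        = - (of_nat (p choose e) * (- c) ^ (p - e) * c' ^ q * \<phi> B (X2 ^ (n - e) * lf B ^ e) * of_int x ^ e)"
        unfolding eq additive_on_of_int[OF additive[OF B] v] phi_antisym[OF B c(2) e(3)]
        by (simp add: c_def c'_def a_def b_def)
    qed simp
    also have "\<dots> = (\<Sum>e\<le>n. - (of_nat (p choose e) * (- c) ^ (p - e) * c' ^ q * \<phi> B (X2 ^ (n - e) * lf B ^ e) * of_int x ^ e))"
      using pq by (intro sum.mono_neutral_left) auto
    finally show ?thesis .
  qed
  have Vs: "(of_int y * X2) ^ p * (of_int x * lf A + of_int z * X2) ^ q \<in> V n"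
    "(of_int x * X2 + of_int y * lf B) ^ p * (of_int z * lf B) ^ q \<in> V n" if "p + q = n" for p q x y z
    using V_mult[OF V_power[OF V_of_int_mult[OF V_X2], of y p]
        V_power[OF V_add[OF V_of_int_mult[OF lf_V[of A]] V_of_int_mult[OF V_X2]], of x z q]]
      V_mult[OF V_power[OF V_add[OF V_of_int_mult[OF V_X2] V_of_int_mult[OF lf_V[of B]]], of x y p]
        V_power[OF V_of_int_mult[OF lf_V[of B]], of z q]] that by simp_all
  have aux: "(z * (p + q) * f - y * (r + s) * g) * x = z * (p * f * x + q * f * x) + y * (- (r * g * x) + - (s * g * x))"
    for z p q f y r s g x :: rat
    by (simp add: algebra_simps)
  have ji: "j + i = n"
    using ij by simp
  have "(\<Sum>e\<le>n. (c' ^ n * (of_nat (j choose e) * (- c') ^ (j - e) * c ^ i + of_nat (i choose e) * (- c') ^ (i - e) * c ^ j)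
      * \<phi> A (X2 ^ (n - e) * lf A ^ e)
    - c ^ n * (of_nat (i choose e) * (- c) ^ (i - e) * c' ^ j + of_nat (j choose e) * (- c) ^ (j - e) * c' ^ i)
      * \<phi> B (X2 ^ (n - e) * lf B ^ e)) * of_int x ^ e) = 0" (is "?L = 0") if "x \<in> S" for x
  proof -
    have "?L = c' ^ n * ((\<Sum>e\<le>n. of_nat (j choose e) * (- c') ^ (j - e) * c ^ i * \<phi> A (X2 ^ (n - e) * lf A ^ e) * of_int x ^ e)
        + (\<Sum>e\<le>n. of_nat (i choose e) * (- c') ^ (i - e) * c ^ j * \<phi> A (X2 ^ (n - e) * lf A ^ e) * of_int x ^ e))
      + c ^ n * ((\<Sum>e\<le>n. - (of_nat (i choose e) * (- c) ^ (i - e) * c' ^ j * \<phi> B (X2 ^ (n - e) * lf B ^ e) * of_int x ^ e))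
        + (\<Sum>e\<le>n. - (of_nat (j choose e) * (- c) ^ (j - e) * c' ^ i * \<phi> B (X2 ^ (n - e) * lf B ^ e) * of_int x ^ e)))"
      unfolding sum.distrib[symmetric] sum_distrib_left
      by (rule sum.cong[OF refl], rule aux)
    also have "\<dots> = 0"
      unfolding expA[OF ij, symmetric] expA[OF ji, symmetric] expB[OF ij, symmetric] expB[OF ji, symmetric]
      using key[OF that] ij ji
      by (simp only: additive_onD[OF additive[OF A] Vs(1)[OF ij] Vs(1)[OF ji]]
        additive_onD[OF additive[OF B] Vs(2)[OF ij] Vs(2)[OF ji]] c_def c'_def a_def b_def of_int_power)
    finally show ?thesis .
  qed
  from poly_identity[OF inf this e] show ?thesis
    by simp
qed

text \<open>Two instances of the relation. With \<open>i = j = k\<close> the values scale like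
  powers of the lower left entry. With \<open>i = k - 1\<close> and \<open>j = k + 1\<close> a
  second relation arises; it is independent of the first when the two entries differ in absolute
  value, because \<open>Suc k choose e\<close> and \<open>k - 1 choose e\<close> differ for
  \<open>e \<ge> 1\<close>.\<close>

lemma phi_coeffs:
  assumes A: "A \<in> \<Gamma>" and B: "B \<in> \<Gamma>" and c: "A$2$1 \<noteq> 0" "B$2$1 \<noteq> 0"
    and e: "e \<le> k"
  shows "of_int (B$2$1) ^ (n - e) * \<phi> A (X2 ^ (n - e) * lf A ^ e)
    = of_int (A$2$1) ^ (n - e) * \<phi> B (X2 ^ (n - e) * lf B ^ e)" (is ?eq)
    and "1 \<le> e \<Longrightarrow> \<bar>A$2$1\<bar> \<noteq> \<bar>B$2$1\<bar> \<Longrightarrow> \<phi> A (X2 ^ (n - e) * lf A ^ e) = 0"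
proof -
  define c c' f f' where "c = (of_int (A$2$1) :: rat)" and "c' = (of_int (B$2$1) :: rat)"
    and "f = \<phi> A (X2 ^ (n - e) * lf A ^ e)" and "f' = \<phi> B (X2 ^ (n - e) * lf B ^ e)"
  have nz: "c \<noteq> 0" "c' \<noteq> 0"
    using c by (simp_all add: c_def c'_def)
  obtain m where m: "k = e + m"
    using e le_Suc_ex by blast
  have n_eq: "n = e + m + (e + m)" "n - e = e + m + m"
    using m by simp_all
  have rel: "c' ^ n * (of_nat (j choose e) * (- c') ^ (j - e) * c ^ i + of_nat (i choose e) * (- c') ^ (i - e) * c ^ j) * f
    = c ^ n * (of_nat (i choose e) * (- c) ^ (i - e) * c' ^ j + of_nat (j choose e) * (- c) ^ (j - e) * c' ^ i) * f'"
    if "i + j = n" for i j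
    using phi_relation[OF A B c that, of e] e by (simp add: c_def c'_def f_def f'_def)
  have 1: "c' ^ (n - e) * f = c ^ (n - e) * f'"
  proof -
    let ?b = "2 * of_nat (k choose e) * (- 1) ^ m :: rat"
    have "?b * (c ^ k * c' ^ k) * (c' ^ (n - e) * f) = ?b * (c ^ k * c' ^ k) * (c ^ (n - e) * f')"
      using rel[of k k] unfolding n_eq power_minus[of c] power_minus[of c'] by (simp add: m power_add mult_ac)
    moreover have "?b \<noteq> 0"
      using e by simp
    ultimately show ?thesis
      using nz by simp
  qed
  then show ?eq
    by (simp add: c_def c'_def f_def f'_def)
  assume e1: "1 \<le> e" and ne: "\<bar>A$2$1\<bar> \<noteq> \<bar>B$2$1\<bar>"
  have "(A$2$1)\<^sup>2 \<noteq> (B$2$1)\<^sup>2"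
    using ne by (simp add: power2_eq_iff abs_eq_iff)
  then have sq: "c\<^sup>2 \<noteq> c'\<^sup>2"
    unfolding c_def c'_def by (metis of_int_eq_iff of_int_power)
  define p q :: rat where "p = of_nat (Suc k choose e)" and "q = of_nat (k - 1 choose e)"
  have "(k - 1) choose e < Suc k choose e"
  proof -
    obtain e' k' where "e = Suc e'" "k = Suc k'"
      using e1 e by (metis Suc_le_D One_nat_def le_trans)
    moreover have "0 < k choose e'"
      using e calculation by simp
    ultimately show ?thesis
      by simp
  qed
  then have pq: "p \<noteq> q"
    by (simp add: p_def q_def)
  have "c' ^ (n - e) * f * (p * c'\<^sup>2 + q * c\<^sup>2) = c ^ (n - e) * f' * (q * c'\<^sup>2 + p * c\<^sup>2)"
  proof (cases m)
    \<comment> \<open>Here \<open>e = k\<close>, so \<open>k - 1 choose e\<close> is 0 and the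
      exponent \<open>k - 1 - e\<close> is truncated; the general computation starts at
      \<open>e < k\<close>.\<close>
    case 0
    obtain k' where k': "e = Suc k'" "k = Suc k'"
      using e1 m 0 by (cases e) auto
    have "q = 0"
      using k' by (simp add: q_def)
    have "(c ^ k' * c' ^ k' * c * c') * (c' ^ (n - e) * f * (p * c'\<^sup>2)) = (c ^ k' * c' ^ k' * c * c') * (c ^ (n - e) * f' * (p * c\<^sup>2))"
    proof -
      have "c' ^ n * (p * (- c') * c ^ k') * f = c ^ n * (p * (- c) * c' ^ k') * f'"
        using rel[of k' "Suc k"] unfolding p_def k' by (simp only: binomial_eq_0) simp
      then show ?thesis
        unfolding n_eq 0 by (simp add: k' power_add power2_eq_square mult_ac)
    qed
    then show ?thesis
      using nz by (simp add: \<open>q = 0\<close>)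
  next
    case (Suc m')
    have k1: "k - 1 = e + m'" "Suc k = e + m' + 2" "k - 1 + Suc k = n"
      using m Suc by simp_all
    have "(- 1) ^ m' * (c ^ (e + m') * c' ^ (e + m')) * (c' ^ (n - e) * f * (p * c'\<^sup>2 + q * c\<^sup>2))
      = (- 1) ^ m' * (c ^ (e + m') * c' ^ (e + m')) * (c ^ (n - e) * f' * (q * c'\<^sup>2 + p * c\<^sup>2))"
      using rel[OF k1(3)] unfolding p_def[symmetric] q_def[symmetric] unfolding n_eq k1(1,2)
        power_minus[of c] power_minus[of c']
      by (simp add: Suc power_add power2_eq_square algebra_simps)
    then show ?thesis
      using nz by simp
  qed
  then have "c ^ (n - e) * f' * ((p - q) * (c'\<^sup>2 - c\<^sup>2)) = 0"
    unfolding 1 by (simp add: algebra_simps)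
  then have "f' = 0"
    using nz pq sq by simp
  then have "f = 0"
    using 1 nz by simp
  then show "\<phi> A (X2 ^ (n - e) * lf A ^ e) = 0"
    by (simp add: f_def)
qed

text \<open>As the lower left entry is nonzero, \<open>X2\<close> and \<open>lf A\<close> span the
  linear forms rationally; a power of that entry clears the denominator of each monomial.\<close>

lemma phi_ext:
  assumes A: "A$2$1 \<noteq> 0" and f: "additive_on (V n) f" and v: "v \<in> V n"
    and 0: "\<And>e. e \<le> n \<Longrightarrow> f (X2 ^ (n - e) * lf A ^ e) = 0"
  shows "f v = 0"
proof (rule additive_on_eqI[OF f _ v, of "\<lambda>_. 0"])
  show "additive_on (V n) (\<lambda>_. 0)"
    by (simp add: additive_on_def)
  fix j assume j: "j \<le> n"
  let ?c = "A$2$1" and ?d = "A$2$2"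
  have 1: "of_int (?c ^ (n - j)) * (X1 ^ (n - j) * X2 ^ j) = (of_int (- ?d) * X2 + lf A) ^ (n - j) * X2 ^ j"
  proof -
    have "of_int (- ?d) * X2 + lf A = of_int ?c * X1"
      by (simp add: lf_def)
    then show ?thesis
      by (simp add: power_mult_distrib mult_ac)
  qed
  have "f ((of_int (- ?d) * X2 + lf A) ^ (n - j) * X2 ^ j)
    = (\<Sum>e\<le>n - j. of_nat ((n - j) choose e) * f (X2 ^ e * lf A ^ (n - j - e) * X2 ^ j) * of_int (- ?d) ^ e)"
  proof (rule additive_on_binomial[OF f lf_V V_X2])
    show "X2 ^ j \<in> V j"
      using V_power[OF V_X2, of j] by simp
    show "Suc 0 * (n - j) + j = n"
      using j by simp
  qed
  also have "\<dots> = 0"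
  proof (rule sum.neutral, safe)
    fix e assume "e \<le> n - j"
    then have i: "n - j - e \<le> n" "e + j = n - (n - j - e)"
      using j by auto
    have "X2 ^ e * lf A ^ (n - j - e) * X2 ^ j = X2 ^ (e + j) * lf A ^ (n - j - e)"
      by (simp only: power_add mult_ac)
    then have "f (X2 ^ e * lf A ^ (n - j - e) * X2 ^ j) = 0"
      using 0[OF i(1)] unfolding i(2) by (simp only:)
    then show "of_nat ((n - j) choose e) * f (X2 ^ e * lf A ^ (n - j - e) * X2 ^ j) * of_int (- ?d) ^ e = 0"
      by (simp only: mult_zero_right mult_zero_left)
  qed
  finally have "f (of_int (?c ^ (n - j)) * (X1 ^ (n - j) * X2 ^ j)) = 0"
    unfolding 1 .
  moreover have "X1 ^ (n - j) * X2 ^ j \<in> V n"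
    using j by (intro V_monomial) simp
  ultimately have "of_int (?c ^ (n - j)) * f (X1 ^ (n - j) * X2 ^ j) = 0"
    using additive_on_of_int[OF f] by (simp only:)
  then show "f (X1 ^ (n - j) * X2 ^ j) = 0"
    using A by simp
qed

text \<open>For a nonzero lower left entry \<open>c\<close> the only surviving values are those on
  \<open>X2 ^ n\<close> and \<open>lf A ^ n\<close>, namely \<open>\<kappa> * c ^ n\<close> with one
  constant \<open>\<kappa>\<close> for the whole group, and its negative. These are the values of
  the coboundary of \<open>\<kappa> * eval10\<close>.\<close>

lemma phi_coboundary:
  "\<exists>L. additive_on (V n) L \<and> (\<forall>A\<in>\<Gamma>. \<forall>v\<in>V n. \<phi> A v = L (act A v) - L v)"
proof -
  let ?U = "mk 1 0 (int N) 1"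
  define \<kappa> where "\<kappa> = \<phi> ?U (X2 ^ n) / of_int (int N) ^ n"
  define L where "L v = \<kappa> * of_int (eval10 v)" for v
  have L: "additive_on (V n) L"
    by (simp add: additive_on_def L_def algebra_simps)
  have nonzero: "\<phi> A v = L (act A v) - L v" if A: "A \<in> \<Gamma>" and c: "A$2$1 \<noteq> 0" and v: "v \<in> V n" for A v
  proof -
    let ?f = "\<lambda>v. \<phi> A v - (L (act A v) - L v)"
    have f: "additive_on (V n) ?f"
      using additive[OF A] L by (auto simp: additive_on_def act_add V_act)
    have 0: "\<phi> A (X2 ^ n) = \<kappa> * of_int (A$2$1) ^ n"
      using phi_coeffs(1)[OF A U_in c, of 0] N_pos by (simp add: \<kappa>_def field_simps)
    have 1: "\<phi> A (X2 ^ (n - e) * lf A ^ e) = 0" if "1 \<le> e" "e \<le> k" for e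
    proof -
      \<comment> \<open>Any power of \<open>mk 1 0 (int N) 1\<close> serves for the comparison if
        its lower left entry exceeds that of \<open>A\<close> in absolute value.\<close>
      define m where "m = Suc (nat \<bar>A$2$1\<bar>)"
      let ?B = "mk 1 0 (int (m * N)) 1"
      have "1 * int m \<le> int N * int m"
        using N_pos by (intro mult_right_mono) simp_all
      moreover have "int (m * N) = int N * int m"
        by simp
      moreover have "int m = \<bar>A$2$1\<bar> + 1"
        by (simp add: m_def)
      ultimately have "\<bar>A$2$1\<bar> < int (m * N)"
        by linarith
      then show ?thesis
        using that c by (intro phi_coeffs(2)[OF A U_power_in[of m] c]) (simp_all add: m_def)
    qed
    have Aw: "act A (lf A) = X2"
    proof -
      have d: "(of_int (A$1$1) * of_int (A$2$2) - of_int (A$1$2) * of_int (A$2$1) :: poly2) = 1"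
        using arg_cong[OF det_1[OF A], of "of_int :: int \<Rightarrow> poly2"] by (simp add: det_mat2)
      have "act A (lf A) = (of_int (A$1$1) * of_int (A$2$2) - of_int (A$1$2) * of_int (A$2$1)) * X2"
        by (simp add: lf_def act_add act_mult algebra_simps)
      then show ?thesis
        unfolding d by simp
    qed
    have "?f (X2 ^ (n - e) * lf A ^ e) = 0" if en: "e \<le> n" for e
    proof -
      have Le: "L (act A (X2 ^ (n - e) * lf A ^ e)) - L (X2 ^ (n - e) * lf A ^ e)
        = \<kappa> * ((- of_int (A$2$1)) ^ (n - e) * 0 ^ e - 0 ^ (n - e) * of_int (A$2$1) ^ e)"
        unfolding L_def act_mult act_power Aw by (simp add: lf_def right_diff_distrib)
      consider "n = 0" | "e = 0" "n > 0" | "1 \<le> e" "e \<le> k" | "k < e" "e < n" | "e = n" "n > 0"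
        using en by linarith
      then show ?thesis
      proof cases
        case 1
        then show ?thesis
          using en Le phi_antisym[OF A c, of 0] by simp
      next
        case 2
        then show ?thesis
          using Le 0 by simp
      next
        case 3
        then have z: "0 ^ e = (0::rat)" "0 ^ (n - e) = (0::rat)"
          by auto
        show ?thesis
          unfolding Le z using 1[OF 3] by simp
      next
        case 4
        then have z: "0 ^ e = (0::rat)" "0 ^ (n - e) = (0::rat)"
          by auto
        have "\<phi> A (X2 ^ (n - e) * lf A ^ e) = 0"
          using 1[of "n - e"] phi_antisym[OF A c, of "n - e"] 4 by simp
        then show ?thesis
          unfolding Le z by simp
      next
        case 5
        then show ?thesis
          unfolding Le using 0 phi_antisym[OF A c, of 0] by (simp add: zero_power)
      qed
    qed
    then have "?f v = 0"
      by (rule phi_ext[OF c f v])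
    then show ?thesis
      by simp
  qed
  \<comment> \<open>The translation rules cover positive exponents only; multiplying by
    \<open>T^m\<close> with \<open>m > \<bar>b\<bar>\<close> reaches that range.\<close>
  have T: "\<phi> A v = 0" if A: "A \<in> \<Gamma>" "A = mk 1 b 0 1 \<or> A = - mk 1 b 0 1" and v: "v \<in> V n" for A b v
  proof -
    define m where "m = Suc (nat \<bar>b\<bar>)"
    let ?C = "mk 1 (int (nat (int m + b))) 0 1"
    have C: "?C \<in> \<Gamma>"
      by (rule T_power_in) (simp add: m_def)
    have "\<phi> A v = \<phi> (mk 1 (int m) 0 1 ** A) v"
      using phi_T_mult[OF A(1) v, of m] by (simp add: m_def)
    also have "int (nat (int m + b)) = int m + b"
      by (simp add: m_def)
    then have "mk 1 (int m) 0 1 ** mk 1 b 0 1 = ?C"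
      by (simp only: mk_mult) (simp add: add.commute)
    then have "\<phi> (mk 1 (int m) 0 1 ** A) v = \<phi> ?C v"
      using A(2) phi_neg[OF C v] by auto
    also have "\<dots> = 0"
      by (subst phi_T_power[OF v]) (simp_all add: m_def t_eq_0)
    finally show ?thesis .
  qed
  have "\<phi> A v = L (act A v) - L v" if A: "A \<in> \<Gamma>" and v: "v \<in> V n" for A v
  proof (cases "A$2$1 = 0")
    case True
    then have "A$1$1 * A$2$2 = 1"
      using det_1[OF A] by (simp add: det_mat2)
    then obtain s where s: "A$1$1 = s" "A$2$2 = s" "s = 1 \<or> s = - 1"
      using zmult_eq_1_iff by auto
    then have "A = mk 1 (s * A$1$2) 0 1 \<or> A = - mk 1 (s * A$1$2) 0 1"
      using True by (auto simp: mat2_eq_iff)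
    then have "\<phi> A v = 0"
      using T[OF A _ v] by blast
    moreover have "L (act A v) = L v"
    proof (rule additive_on_eqI[OF _ L v])
      show "additive_on (V n) (\<lambda>v. L (act A v))"
        using L by (auto simp: additive_on_def act_add V_act)
      fix j assume "j \<le> n"
      have "of_int s ^ (n - j) * 0 ^ j = (0 ^ j :: rat)"
        using s(3) by (cases j) auto
      then show "L (act A (X1 ^ (n - j) * X2 ^ j)) = L (X1 ^ (n - j) * X2 ^ j)"
        using True s(1,2) by (simp add: L_def act_mult act_power)
    qed
    ultimately show ?thesis
      by simp
  next
    case False
    then show ?thesis
      using nonzero A v by blast
  qed
  then show ?thesis
    using L by blast
qed

end

lemma (in rational_cocycle) coboundary:
  "\<exists>L. additive_on (V n) L \<and> (\<forall>A\<in>\<Gamma>. \<forall>v\<in>V n. \<phi> A v = L (act A v) - L v)"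
proof -
  obtain L t where L: "additive_on (V n) L"
    and t: "\<And>v. v \<in> V n \<Longrightarrow> \<phi> (mk 1 1 0 1) v - (L (act (mk 1 1 0 1) v) - L v) = t * of_int (eval01 v)"
    using exists_normalisation by blast
  interpret s: rational_cocycle \<Gamma> N k "\<lambda>A v. \<phi> A v - (L (act A v) - L v)"
    by (rule shift[OF L])
  interpret s: normalised_cocycle \<Gamma> N k "\<lambda>A v. \<phi> A v - (L (act A v) - L v)" t
    by unfold_locales (simp add: t)
  obtain M where M: "additive_on (V n) M"
    and *: "\<forall>A\<in>\<Gamma>. \<forall>v\<in>V n. \<phi> A v - (L (act A v) - L v) = M (act A v) - M v"
    using s.phi_coboundary by blast
  have "additive_on (V n) (\<lambda>v. L v + M v)"
    using L M by (auto simp: additive_on_def)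
  moreover have "\<phi> A v = (L (act A v) + M (act A v)) - (L v + M v)" if "A \<in> \<Gamma>" "v \<in> V n" for A v
    using * that by (force simp: algebra_simps)
  ultimately show ?thesis
    by blast
qed

section \<open>Additive subgroups and congruences\<close>

definition add_subgroup :: "'a::ab_group_add set \<Rightarrow> bool" where
  "add_subgroup K \<longleftrightarrow> 0 \<in> K \<and> (\<forall>a\<in>K. \<forall>b\<in>K. a - b \<in> K)"

lemma add_subgroupD:
  assumes "add_subgroup K"
  shows "0 \<in> K" "a \<in> K \<Longrightarrow> b \<in> K \<Longrightarrow> a - b \<in> K" "a \<in> K \<Longrightarrow> - a \<in> K"
    "a \<in> K \<Longrightarrow> b \<in> K \<Longrightarrow> a + b \<in> K" "(\<And>x. x \<in> S \<Longrightarrow> f x \<in> K) \<Longrightarrow> sum f S \<in> K"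
proof -
  show 0: "0 \<in> K" and d: "a \<in> K \<Longrightarrow> b \<in> K \<Longrightarrow> a - b \<in> K" for a b
    using assms by (simp_all add: add_subgroup_def)
  show m: "a \<in> K \<Longrightarrow> - a \<in> K" for a
    using d[OF 0] by simp
  show p: "a \<in> K \<Longrightarrow> b \<in> K \<Longrightarrow> a + b \<in> K" for a b
    using d[OF _ m] by simp
  show "(\<And>x. x \<in> S \<Longrightarrow> f x \<in> K) \<Longrightarrow> sum f S \<in> K"
    by (induction S rule: infinite_finite_induct) (auto intro: 0 p)
qed

lemma add_subgroup_frag_cmul:
  assumes "add_subgroup K" "c \<in> K"
  shows "frag_cmul m c \<in> K"
proof -
  have *: "frag_cmul (int l) c \<in> K" for l
  proof (induction l)
    case (Suc l)
    then show ?case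
      using add_subgroupD(4)[OF assms(1) assms(2)] by (simp add: frag_cmul_distrib)
  qed (simp add: add_subgroupD(1)[OF assms(1)])
  show ?thesis
  proof (cases m rule: int_cases2)
    case (nonpos l)
    then show ?thesis
      using add_subgroupD(3)[OF assms(1) *[of l]] by simp
  qed (use * in simp)
qed

text \<open>Congruence modulo an additive subgroup. It keeps computations with homology classes on
  the level of chains.\<close>

definition cg :: "'a::ab_group_add set \<Rightarrow> 'a \<Rightarrow> 'a \<Rightarrow> bool" where
  "cg K a b \<longleftrightarrow> a - b \<in> K"

lemma cg_0_iff: "cg K a 0 \<longleftrightarrow> a \<in> K"
  by (simp add: cg_def)

context
  fixes K :: "'a::ab_group_add set"
  assumes K: "add_subgroup K"
begin

lemma cg_refl: "cg K a a"
  using add_subgroupD(1)[OF K] by (simp add: cg_def)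

lemma cg_sym: "cg K a b \<Longrightarrow> cg K b a"
  using add_subgroupD(3)[OF K, of "a - b"] by (simp add: cg_def)

lemma cg_trans: "cg K a b \<Longrightarrow> cg K b c \<Longrightarrow> cg K a c"
  using add_subgroupD(4)[OF K, of "a - b" "b - c"] by (simp add: cg_def)

lemma cg_add: "cg K a b \<Longrightarrow> cg K c d \<Longrightarrow> cg K (a + c) (b + d)"
  using add_subgroupD(4)[OF K, of "a - b" "c - d"] by (simp add: cg_def algebra_simps)

lemma cg_diff: "cg K a b \<Longrightarrow> cg K c d \<Longrightarrow> cg K (a - c) (b - d)"
  using add_subgroupD(2)[OF K, of "a - b" "c - d"] by (simp add: cg_def algebra_simps)

lemma cg_minus: "cg K a b \<Longrightarrow> cg K (- a) (- b)"
  using cg_diff[OF cg_refl[of 0]] by simp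

lemma cg_sum: "(\<And>x. x \<in> S \<Longrightarrow> cg K (f x) (g x)) \<Longrightarrow> cg K (sum f S) (sum g S)"
  using add_subgroupD(5)[OF K, of S "\<lambda>x. f x - g x"] by (simp add: cg_def sum_subtractf)

lemma cg_mem: "cg K a b \<Longrightarrow> b \<in> K \<Longrightarrow> a \<in> K"
  using add_subgroupD(4)[OF K, of "a - b" b] by (simp add: cg_def)

end

lemma frag_cmul_diff: "frag_cmul m (a - b) = frag_cmul m a - frag_cmul m b"
  by (rule poly_mapping_eqI) (simp add: lookup_minus right_diff_distrib)

lemma cg_cmul: "add_subgroup K \<Longrightarrow> cg K a b \<Longrightarrow> cg K (frag_cmul m a) (frag_cmul m b)"
  using add_subgroup_frag_cmul[of K "a - b" m] by (simp add: cg_def frag_cmul_diff)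

lemma cg_mono: "K \<subseteq> K' \<Longrightarrow> cg K a b \<Longrightarrow> cg K' a b"
  by (auto simp: cg_def)

text \<open>The generated subgroup as a set in the additive type itself, with an induction that has
  a single closure step.\<close>

inductive_set zspan :: "'a::ab_group_add set \<Rightarrow> 'a set" for S where
  zspan_zero: "0 \<in> zspan S"
| zspan_base: "x \<in> S \<Longrightarrow> x \<in> zspan S"
| zspan_diff: "x \<in> zspan S \<Longrightarrow> y \<in> zspan S \<Longrightarrow> x - y \<in> zspan S"

lemma add_subgroup_zspan [simp]: "add_subgroup (zspan S)"
  by (simp add: add_subgroup_def zspan_zero zspan_diff)

lemma zspan_least:
  assumes "S \<subseteq> K" "add_subgroup K"
  shows "zspan S \<subseteq> K"
proof
  fix x assume "x \<in> zspan S"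
  then show "x \<in> K"
    by induction (use assms add_subgroupD[OF assms(2)] in auto)
qed

lemma zspan_mono: "S \<subseteq> T \<Longrightarrow> zspan S \<subseteq> zspan T"
  by (intro zspan_least) (auto intro: zspan_base)

lemma add_subgroup_frag_carrier: "add_subgroup {c. Poly_Mapping.keys c \<subseteq> X}"
  using keys_diff by (fastforce simp: add_subgroup_def)

lemma generate_free_Abelian_group:
  assumes "S \<subseteq> carrier (free_Abelian_group X)"
  shows "generate (free_Abelian_group X) S = zspan S"
proof
  have sub: "generate (free_Abelian_group X) S \<subseteq> carrier (free_Abelian_group X)"
    using group.generate_incl[OF group_free_Abelian_group assms] .
  show "generate (free_Abelian_group X) S \<subseteq> zspan S"
  proof
    fix x assume "x \<in> generate (free_Abelian_group X) S"
    then show "x \<in> zspan S"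
    proof induction
      case (inv h)
      then show ?case
        using add_subgroupD(3)[OF add_subgroup_zspan zspan_base[OF inv]] subsetD[OF assms inv]
        by (subst inv_free_Abelian_group) simp_all
    next
      case (eng h1 h2)
      then show ?case
        using add_subgroupD(4)[OF add_subgroup_zspan] by simp
    qed (auto intro: zspan.intros)
  qed
  show "zspan S \<subseteq> generate (free_Abelian_group X) S"
  proof (rule zspan_least)
    show "add_subgroup (generate (free_Abelian_group X) S)"
      unfolding add_subgroup_def
    proof (intro conjI ballI)
      show "0 \<in> generate (free_Abelian_group X) S"
        using generate.one[of "free_Abelian_group X"] by simp
      fix a b assume ab: "a \<in> generate (free_Abelian_group X) S" "b \<in> generate (free_Abelian_group X) S"
      have "inv\<^bsub>free_Abelian_group X\<^esub> b \<in> generate (free_Abelian_group X) S"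
        by (rule group.generate_m_inv_closed[OF group_free_Abelian_group assms ab(2)])
      moreover have "inv\<^bsub>free_Abelian_group X\<^esub> b = - b"
        using subsetD[OF sub ab(2)] by (simp add: inv_free_Abelian_group)
      ultimately show "a - b \<in> generate (free_Abelian_group X) S"
        using generate.eng[OF ab(1)] by force
    qed
  qed (auto intro: generate.incl)
qed

text \<open>The counterpart of \<open>frag_extend\<close> with values in a commutative ring. The
  augmentation, the action of the group ring and the boundary are of this kind.\<close>

definition lext :: "('x \<Rightarrow> 'r::comm_ring_1) \<Rightarrow> ('x \<Rightarrow>\<^sub>0 int) \<Rightarrow> 'r" where
  "lext f c = (\<Sum>x\<in>Poly_Mapping.keys c. of_int (Poly_Mapping.lookup c x) * f x)"

lemma lext_superset:
  assumes "finite S" "Poly_Mapping.keys c \<subseteq> S"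
  shows "lext f c = (\<Sum>x\<in>S. of_int (Poly_Mapping.lookup c x) * f x)"
  unfolding lext_def using assms by (intro sum.mono_neutral_left) (auto simp: in_keys_iff)

lemma lext_diff: "lext f (a - b) = lext f a - lext f b"
proof -
  let ?S = "Poly_Mapping.keys a \<union> Poly_Mapping.keys b"
  have "Poly_Mapping.keys (a - b) \<subseteq> ?S"
    by (rule keys_diff)
  then show ?thesis
    by (simp add: lext_superset[of ?S] lookup_minus left_diff_distrib sum_subtractf)
qed

lemma lext_0 [simp]: "lext f 0 = 0"
  by (simp add: lext_def)

lemma lext_minus: "lext f (- a) = - lext f a"
  using lext_diff[of f 0 a] by simp

lemma lext_add: "lext f (a + b) = lext f a + lext f b"
  using lext_diff[of f a "- b"] by (simp add: lext_minus)

lemma lext_frag_of [simp]: "lext f (frag_of x) = f x"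
  by (simp add: lext_def)

lemma lext_frag_cmul: "lext f (frag_cmul m c) = of_int m * lext f c"
  by (subst lext_superset[of "Poly_Mapping.keys c"]) (auto simp: keys_cmul lext_def sum_distrib_left mult.assoc)

lemma frag_extend_fun_diff: "frag_extend (\<lambda>x. f x - g x) c = frag_extend f c - frag_extend g c"
  by (simp add: frag_extend_def frag_cmul_diff sum_subtractf)

section \<open>Classes of matrices modulo sign\<close>

lemma cls_eq: "cls A = {A, - A}"
  by (auto simp: cls_def pm1_def r_coset_def M2plus_def)

lemma cls_eq_iff: "cls A = cls B \<longleftrightarrow> A = B \<or> A = - B"
  by (auto simp: cls_eq doubleton_eq_iff)

lemma cls_neg: "cls (- A) = cls A"
  by (auto simp: cls_eq)

lemma pm1_eq_cls: "pm1 = cls (mat 1)"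
  by (simp add: pm1_def cls_eq)

abbreviation cls_mult (infixl "\<cdot>" 70) where "g \<cdot> h \<equiv> g \<otimes>\<^bsub>PM2plus\<^esub> h"

lemma cls_mult: "cls A \<cdot> cls B = cls (A ** B)"
  by (auto simp: PM2plus_def FactGroup_def set_mult_def M2plus_def cls_eq)

lemma bar_simps [simp]:
  "carrier (bar \<Gamma>) = cls ` \<Gamma>" "\<one>\<^bsub>bar \<Gamma>\<^esub> = cls (mat 1)" "g \<otimes>\<^bsub>bar \<Gamma>\<^esub> h = g \<cdot> h"
  by (simp_all add: bar_def PSL2Z_def PM2plus_def FactGroup_def pm1_eq_cls SL2Z_def set_mult_def M2plus_def)

lemma act_cls_cls: "v \<in> V (2 * k) \<Longrightarrow> act_cls (cls A) v = act A v"
  by (simp add: act_cls_def cls_eq act_neg)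

lemma hyperbolic_cls: "hyperbolic (cls A) \<longleftrightarrow> \<bar>trace A\<bar> > 2"
  by (auto simp: hyperbolic_def cls_eq trace_mat2)

lemma Q_cls: "Q (cls A) = Q_mat A"
  by (simp add: Q_def cls_eq Q_mat_neg)

lemma Q_power_V: "Q (cls A) ^ k \<in> V (2 * k)"
  unfolding Q_cls by (rule V_power[OF Q_mat_V])

section \<open>Chains\<close>

text \<open>The subgroup axioms in terms of matrices, with the adjugate as inverse; the classes
  modulo sign inherit them.\<close>

locale level =
  fixes \<Gamma> :: "mat2 set" and N k :: nat
  assumes N_pos: "N > 0"
    and one_in: "mat 1 \<in> \<Gamma>"
    and mult_in: "A \<in> \<Gamma> \<Longrightarrow> B \<in> \<Gamma> \<Longrightarrow> A ** B \<in> \<Gamma>"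
    and adj_in: "A \<in> \<Gamma> \<Longrightarrow> adj A \<in> \<Gamma>"
    and det_1: "A \<in> \<Gamma> \<Longrightarrow> det A = 1"
    and Gamma1_sub: "Gamma1 N \<subseteq> \<Gamma>"
begin

abbreviation n where "n \<equiv> 2 * k"
abbreviation G where "G \<equiv> cls ` \<Gamma>"
abbreviation e where "e \<equiv> cls (mat 1)"
abbreviation I where "I \<equiv> augmentation_ideal (bar \<Gamma>)"
abbreviation R where "R \<equiv> I_relations \<Gamma> n"

definition chains :: "((mat2 set \<Rightarrow>\<^sub>0 int) \<times> poly2 \<Rightarrow>\<^sub>0 int) set" where "chains = {c. Poly_Mapping.keys c \<subseteq> I \<times> V n}"

text \<open>The chain \<open>(g - 1) \<otimes> v\<close>. Modulo relations these generate all chains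
  and satisfy the cocycle rule \<open>ch_mult\<close>.\<close>

definition ch :: "mat2 set \<Rightarrow> poly2 \<Rightarrow> ((mat2 set \<Rightarrow>\<^sub>0 int) \<times> poly2 \<Rightarrow>\<^sub>0 int)" where
  "ch g v = frag_of (frag_of g - frag_of e, v)"

abbreviation gmul :: "(mat2 set \<Rightarrow>\<^sub>0 int) \<Rightarrow> (mat2 set \<Rightarrow>\<^sub>0 int) \<Rightarrow> (mat2 set \<Rightarrow>\<^sub>0 int)" where
  "gmul x r \<equiv> frag_extend (\<lambda>g. frag_extend (\<lambda>h. frag_of (g \<cdot> h)) r) x"

lemma G_mult: "g \<in> G \<Longrightarrow> h \<in> G \<Longrightarrow> g \<cdot> h \<in> G"
  using mult_in by (auto simp: cls_mult)

lemma G_one: "e \<in> G"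
  using one_in by blast

lemma G_inverse:
  assumes "g \<in> G"
  obtains g' where "g' \<in> G" "g \<cdot> g' = e" "g' \<cdot> g = e"
proof -
  from assms obtain A where A: "A \<in> \<Gamma>" "g = cls A"
    by blast
  show thesis
    using A adj_in det_1 by (intro that[of "cls (adj A)"]) (auto simp: cls_mult adj_inverse)
qed

lemma cls_mult_1 [simp]: "e \<cdot> cls A = cls A" "cls A \<cdot> e = cls A"
  by (simp_all add: cls_mult)

lemma cls_mult_assoc: "cls A \<cdot> cls B \<cdot> cls C = cls A \<cdot> (cls B \<cdot> cls C)"
  by (simp add: cls_mult matrix_mul_assoc)

lemmas act_cls_n = act_cls_cls[where k = k]

lemma act_G_V: "g \<in> G \<Longrightarrow> v \<in> V n \<Longrightarrow> act_cls g v \<in> V n"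
  by (auto simp: act_cls_n V_act)

lemma act_cls_mult: "v \<in> V n \<Longrightarrow> act_cls (cls A \<cdot> cls B) v = act_cls (cls A) (act_cls (cls B) v)"
  by (simp add: cls_mult act_cls_n V_act act_act)

lemma act_cls_e: "v \<in> V n \<Longrightarrow> act_cls e v = v"
  by (simp add: act_cls_n act_mat_1)

lemma act_cls_diff: "v \<in> V n \<Longrightarrow> w \<in> V n \<Longrightarrow> act_cls (cls A) (v - w) = act_cls (cls A) v - act_cls (cls A) w"
  by (simp add: act_cls_n V_diff act_diff)

lemma gmul_diff_right: "gmul x (r - s) = gmul x r - gmul x s"
  by (simp add: frag_extend_diff frag_extend_fun_diff)

lemma ring_act_lext: "ring_act r v = lext (\<lambda>g. act_cls g v) r"
  by (simp add: ring_act_def lext_def)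

lemma augmentation_lext: "augmentation r = lext (\<lambda>_. 1) r"
  by (simp add: augmentation_def lext_def)

lemma ring_act_V:
  assumes "Poly_Mapping.keys r \<subseteq> G" "v \<in> V n"
  shows "ring_act r v \<in> V n"
  unfolding ring_act_def using assms by (intro V_sum V_of_int_mult act_G_V) auto

lemma add_subgroup_I: "add_subgroup I"
  unfolding add_subgroup_def augmentation_ideal_def group_ring_def augmentation_lext
  by (auto simp: lext_diff dest: subsetD[OF keys_diff])

text \<open>An element of augmentation 0 does not change when the identity is subtracted from each
  group element of its expansion.\<close>

lemma I_eq: "I = zspan ((\<lambda>g. frag_of g - frag_of e) ` G)"
proof
  show "zspan ((\<lambda>g. frag_of g - frag_of e) ` G) \<subseteq> I"
    using G_one by (intro zspan_least add_subgroup_I)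
      (auto simp: augmentation_ideal_def group_ring_def augmentation_lext lext_diff keys_frag_of
        dest!: subsetD[OF keys_diff])
  show "I \<subseteq> zspan ((\<lambda>g. frag_of g - frag_of e) ` G)"
  proof
    fix x assume x: "x \<in> I"
    then have keys: "Poly_Mapping.keys x \<subseteq> G" and 0: "augmentation x = 0"
      by (auto simp: augmentation_ideal_def group_ring_def)
    have "frag_extend (\<lambda>g. frag_of e) x = frag_cmul (augmentation x) (frag_of e)"
      unfolding frag_extend_def augmentation_def by (induction "Poly_Mapping.keys x" rule: infinite_finite_induct)
        (simp_all add: poly_mapping_eqI lookup_sum sum_distrib_right)
    then have "frag_extend (\<lambda>g. frag_of e) x = 0"
      by (simp add: 0)
    then have "x = frag_extend (\<lambda>g. frag_of g - frag_of e) x"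
      using frag_expansion[of x] by (simp add: frag_extend_fun_diff)
    also have "\<dots> \<in> zspan ((\<lambda>g. frag_of g - frag_of e) ` G)"
      unfolding frag_extend_def using keys
      by (intro add_subgroupD(5)[OF add_subgroup_zspan]
        add_subgroup_frag_cmul[OF add_subgroup_zspan] zspan_base) auto
    finally show "x \<in> zspan ((\<lambda>g. frag_of g - frag_of e) ` G)" .
  qed
qed

lemma I_induct [consumes 1, case_names zero base diff]:
  assumes "x \<in> I" "P 0" "\<And>g. g \<in> G \<Longrightarrow> P (frag_of g - frag_of e)"
    "\<And>x y. x \<in> I \<Longrightarrow> y \<in> I \<Longrightarrow> P x \<Longrightarrow> P y \<Longrightarrow> P (x - y)"
  shows "P x"
  using assms(1) unfolding I_eq
  by (induction rule: zspan.induct) (use assms(2-) in \<open>auto simp: I_eq\<close>)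

lemma I_base: "g \<in> G \<Longrightarrow> frag_of g - frag_of e \<in> I"
  unfolding I_eq by (auto intro: zspan_base)

lemma gmul_I:
  assumes "x \<in> I" "Poly_Mapping.keys r \<subseteq> G"
  shows "gmul x r \<in> I"
  using assms(2,1)
proof (induction r rule: frag_induction)
  case zero
  then show ?case
    using add_subgroupD(1)[OF add_subgroup_I] by (simp add: frag_extend_eq_0)
next
  case (one h)
  then have h: "h \<in> G" by simp
  show ?case
    using one.prems
  proof (induction rule: I_induct)
    case (base g)
    have "gmul (frag_of g - frag_of e) (frag_of h) = (frag_of (g \<cdot> h) - frag_of e) - (frag_of h - frag_of e)"
      using h by (auto simp: frag_extend_diff)
    then show ?case
      using add_subgroupD(2)[OF add_subgroup_I I_base I_base] h G_mult base by simp
  next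
    case (diff x y)
    then show ?case
      using add_subgroupD(2)[OF add_subgroup_I] by (simp add: frag_extend_diff)
  qed (simp add: add_subgroupD(1)[OF add_subgroup_I])
next
  case (diff a b)
  then show ?case
    using add_subgroupD(2)[OF add_subgroup_I] by (simp only: gmul_diff_right)
qed

section \<open>Relations of the tensor product and the cocycle rule\<close>

definition relators where
  "relators = {frag_of (x + y, v) - frag_of (x, v) - frag_of (y, v) | x y v. x \<in> I \<and> y \<in> I \<and> v \<in> V n} \<union>
      {frag_of (x, v + w) - frag_of (x, v) - frag_of (x, w) | x v w. x \<in> I \<and> v \<in> V n \<and> w \<in> V n} \<union>
      {frag_of (gmul x r, v) - frag_of (x, ring_act r v) | x r v. x \<in> I \<and> Poly_Mapping.keys r \<subseteq> G \<and> v \<in> V n}"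

lemma I_free_eq: "I_free \<Gamma> n = free_Abelian_group (I \<times> V n)"
  by (simp add: I_free_def)

lemma relators_chains: "relators \<subseteq> chains"
proof -
  have sub: "add_subgroup chains"
    unfolding chains_def by (rule add_subgroup_frag_carrier)
  have f: "x \<in> I \<Longrightarrow> v \<in> V n \<Longrightarrow> frag_of (x, v) \<in> chains" for x v
    by (simp add: chains_def keys_frag_of)
  show ?thesis
    unfolding relators_def
    by (auto intro!: add_subgroupD(2)[OF sub] f gmul_I ring_act_V V_add
      add_subgroupD(4)[OF add_subgroup_I])
qed

lemma R_eq: "R = zspan relators"
proof -
  have "R = generate (free_Abelian_group (I \<times> V n)) relators"
    unfolding I_relations_def tensor_relations_def relators_def additive_group_def
    by (simp add: group_ring_def)
  then show ?thesis
    using generate_free_Abelian_group[of relators "I \<times> V n"] relators_chains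
    by (simp add: chains_def free_Abelian_group_def)
qed

lemma add_subgroup_R [simp]: "add_subgroup R"
  by (simp add: R_eq)

lemma add_subgroup_chains: "add_subgroup chains"
  unfolding chains_def by (rule add_subgroup_frag_carrier)

lemma R_chains: "R \<subseteq> chains"
  unfolding R_eq by (rule zspan_least[OF relators_chains add_subgroup_chains])

lemma ch_chains: "g \<in> G \<Longrightarrow> v \<in> V n \<Longrightarrow> ch g v \<in> chains"
  by (simp add: ch_def chains_def keys_frag_of I_base)

lemma gmul_R:
  assumes "x \<in> I" "Poly_Mapping.keys r \<subseteq> G" "v \<in> V n"
  shows "cg R (frag_of (gmul x r, v)) (frag_of (x, ring_act r v))"
  unfolding cg_def R_eq relators_def using assms by (intro zspan_base) blast

lemma frag_diff_R:
  assumes "x \<in> I" "y \<in> I" "v \<in> V n"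
  shows "cg R (frag_of (x - y, v)) (frag_of (x, v) - frag_of (y, v))"
proof -
  have "frag_of ((x - y) + y, v) - frag_of (x - y, v) - frag_of (y, v) \<in> R"
    unfolding R_eq using assms add_subgroupD(2)[OF add_subgroup_I]
    by (intro zspan_base) (unfold relators_def, blast)
  then have *: "frag_of (x, v) - frag_of (x - y, v) - frag_of (y, v) \<in> R"
    by simp
  show ?thesis
    using add_subgroupD(3)[OF add_subgroup_R *] by (simp add: cg_def algebra_simps)
qed

lemma ch_add:
  assumes "g \<in> G" "v \<in> V n" "w \<in> V n"
  shows "cg R (ch g (v + w)) (ch g v + ch g w)"
  unfolding cg_def R_eq ch_def diff_diff_eq[symmetric]
  using assms I_base by (intro zspan_base) (unfold relators_def, blast)

text \<open>From \<open>(g h - 1) - (h - 1) = (g - 1) h\<close> and the balancing relation of the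
  tensor product. All later computations with chains rest on this cocycle rule.\<close>

lemma ch_mult:
  assumes "g \<in> G" "h \<in> G" "v \<in> V n"
  shows "cg R (ch (g \<cdot> h) v) (ch g (act_cls h v) + ch h v)"
proof -
  let ?x = "frag_of g - frag_of e"
  have eq: "gmul ?x (frag_of h) = (frag_of (g \<cdot> h) - frag_of e) - (frag_of h - frag_of e)"
    using assms(2) by (auto simp: frag_extend_diff)
  have "cg R (frag_of (gmul ?x (frag_of h), v)) (frag_of (?x, ring_act (frag_of h) v))"
    using assms by (intro gmul_R I_base) (simp_all add: keys_frag_of)
  then have "cg R (frag_of ((frag_of (g \<cdot> h) - frag_of e) - (frag_of h - frag_of e), v)) (ch g (act_cls h v))"
    by (simp only: eq ch_def ring_act_lext lext_frag_of)
  moreover have "cg R (frag_of ((frag_of (g \<cdot> h) - frag_of e) - (frag_of h - frag_of e), v)) (ch (g \<cdot> h) v - ch h v)"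
    unfolding ch_def using assms by (intro frag_diff_R I_base G_mult)
  ultimately have "cg R (ch (g \<cdot> h) v - ch h v) (ch g (act_cls h v))"
    by (meson add_subgroup_R cg_sym cg_trans)
  then show ?thesis
    by (simp add: cg_def algebra_simps)
qed

lemma ch_zero: "g \<in> G \<Longrightarrow> cg R (ch g 0) 0"
  using cg_minus[OF add_subgroup_R ch_add[of g 0 0]] by (simp add: cg_def)

lemma ch_diff:
  assumes "g \<in> G" "v \<in> V n" "w \<in> V n"
  shows "cg R (ch g (v - w)) (ch g v - ch g w)"
proof -
  have "cg R (ch g ((v - w) + w)) (ch g (v - w) + ch g w)"
    using assms by (intro ch_add V_diff)
  then have "cg R (ch g (v - w) + ch g w) (ch g v)"
    by (simp add: cg_sym)
  then show ?thesis
    by (simp add: cg_def algebra_simps)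
qed

lemma ch_of_int:
  assumes "g \<in> G" "v \<in> V n"
  shows "cg R (ch g (of_int m * v)) (frag_cmul m (ch g v))"
proof -
  have *: "cg R (ch g (of_int (int l) * v)) (frag_cmul (int l) (ch g v))" for l
  proof (induction l)
    case (Suc l)
    have "cg R (ch g (v + of_int (int l) * v)) (ch g v + ch g (of_int (int l) * v))"
      using assms by (intro ch_add V_of_int_mult)
    moreover have "cg R (ch g v + ch g (of_int (int l) * v)) (ch g v + frag_cmul (int l) (ch g v))"
      by (intro cg_add cg_refl Suc) simp_all
    ultimately have "cg R (ch g (v + of_int (int l) * v)) (ch g v + frag_cmul (int l) (ch g v))"
      by (rule cg_trans[OF add_subgroup_R])
    then show ?case
      by (simp add: distrib_right frag_cmul_distrib)
  qed (use ch_zero assms in simp)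
  show ?thesis
  proof (cases m rule: int_cases2)
    case (nonpos l)
    have "cg R (ch g (0 - of_int (int l) * v)) (ch g 0 - ch g (of_int (int l) * v))"
      using assms by (intro ch_diff V_of_int_mult) simp_all
    moreover have "cg R (ch g 0 - ch g (of_int (int l) * v)) (0 - frag_cmul (int l) (ch g v))"
      by (intro cg_diff ch_zero * assms) simp
    ultimately have "cg R (ch g (0 - of_int (int l) * v)) (0 - frag_cmul (int l) (ch g v))"
      by (rule cg_trans[OF add_subgroup_R])
    then show ?thesis
      by (simp add: nonpos)
  qed (use * in simp)
qed

lemma ch_sum:
  assumes "g \<in> G" "\<And>x. x \<in> S \<Longrightarrow> f x \<in> V n"
  shows "cg R (ch g (sum f S)) (\<Sum>x\<in>S. ch g (f x))"
  using assms(2)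
proof (induction S rule: infinite_finite_induct)
  case (insert x S)
  then have "cg R (ch g (f x + sum f S)) (ch g (f x) + ch g (sum f S))"
    using assms(1) by (intro ch_add V_sum) auto
  moreover have "cg R (ch g (f x) + ch g (sum f S)) (ch g (f x) + (\<Sum>x\<in>S. ch g (f x)))"
    using insert by (intro cg_add cg_refl) auto
  ultimately have "cg R (ch g (f x + sum f S)) (ch g (f x) + (\<Sum>x\<in>S. ch g (f x)))"
    by (rule cg_trans[OF add_subgroup_R])
  then show ?case
    using insert.hyps by simp
qed (use ch_zero assms(1) in simp_all)

lemma ch_e: "v \<in> V n \<Longrightarrow> cg R (ch e v) 0"
proof -
  assume v: "v \<in> V n"
  have "cg R (ch (e \<cdot> e) v) (ch e (act_cls e v) + ch e v)"
    by (intro ch_mult G_one v)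
  then have "- ch e v \<in> R"
    using v by (simp add: cg_def act_cls_e)
  from add_subgroupD(3)[OF add_subgroup_R this] show ?thesis
    by (simp add: cg_def)
qed

lemma ch_inverse:
  assumes "g \<in> G" "g' \<in> G" "g' \<cdot> g = e" "v \<in> V n"
  shows "cg R (ch g' (act_cls g v)) (- ch g v)"
proof -
  have "cg R (ch g' (act_cls g v) + ch g v) (ch (g' \<cdot> g) v)"
    by (rule cg_sym[OF add_subgroup_R ch_mult]) (use assms in simp_all)
  moreover have "cg R (ch (g' \<cdot> g) v) 0"
    unfolding assms(3) by (rule ch_e[OF assms(4)])
  ultimately have "cg R (ch g' (act_cls g v) + ch g v) 0"
    by (rule cg_trans[OF add_subgroup_R])
  then show ?thesis
    by (simp add: cg_def)
qed

text \<open>Source of the induction rule by which statements about arbitrary chains are reduced to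
  the chains \<open>ch g v\<close>.\<close>

lemma chains_eq: "chains = zspan (R \<union> {ch g v | g v. g \<in> G \<and> v \<in> V n})" (is "_ = ?Z")
proof
  show "?Z \<subseteq> chains"
    using R_chains ch_chains by (intro zspan_least add_subgroup_chains) auto
  have sub: "add_subgroup ?Z"
    by simp
  have RZ: "R \<subseteq> ?Z"
    by (auto intro: zspan_base)
  have f: "frag_of (x, v) \<in> ?Z" if "x \<in> I" and v: "v \<in> V n" for x v
    using that(1)
  proof (induction rule: I_induct)
    case zero
    have "cg R (frag_of (0 - 0, v)) (frag_of (0, v) - frag_of (0, v))"
      using add_subgroupD(1)[OF add_subgroup_I] v by (intro frag_diff_R) auto
    then show ?case
      using RZ by (auto simp: cg_def)
  next
    case (base g)
    then show ?case
      using v by (intro zspan_base) (auto simp: ch_def)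
  next
    case (diff x y)
    then show ?case
      using cg_mem[OF sub cg_mono[OF RZ frag_diff_R[OF diff(1,2) v]]] zspan_diff by blast
  qed
  show "chains \<subseteq> ?Z"
  proof
    fix c assume "c \<in> chains"
    then have "Poly_Mapping.keys c \<subseteq> I \<times> V n"
      by (simp add: chains_def)
    then show "c \<in> ?Z"
      by (induction c rule: frag_induction) (auto intro: zspan_zero zspan_diff f)
  qed
qed

lemma chains_induct [consumes 1, case_names zero rel ch diff]:
  assumes "c \<in> chains" "P 0" "\<And>c. c \<in> R \<Longrightarrow> P c" "\<And>g v. g \<in> G \<Longrightarrow> v \<in> V n \<Longrightarrow> P (ch g v)"
    "\<And>a b. a \<in> chains \<Longrightarrow> b \<in> chains \<Longrightarrow> P a \<Longrightarrow> P b \<Longrightarrow> P (a - b)"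
  shows "P c"
  using assms(1) unfolding chains_eq
  by (induction rule: zspan.induct) (use assms(2-) in \<open>auto simp: chains_eq\<close>)

text \<open>The universal property of the tensor product: a map given on generators of the form
  \<open>g \<otimes> v\<close> kills the relations as soon as it is a cocycle.\<close>

lemma relations_into:
  fixes \<Psi> :: "((mat2 set \<Rightarrow>\<^sub>0 int) \<times> poly2 \<Rightarrow>\<^sub>0 int) \<Rightarrow> 'b::ab_group_add"
  assumes K: "add_subgroup K"
    and diff: "\<And>a b. \<Psi> (a - b) = \<Psi> a - \<Psi> b"
    and left: "\<And>x y v. \<Psi> (frag_of (x - y, v)) = \<Psi> (frag_of (x, v)) - \<Psi> (frag_of (y, v))"
    and right: "\<And>g v w. g \<in> G \<Longrightarrow> v \<in> V n \<Longrightarrow> w \<in> V n \<Longrightarrow>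
      cg K (\<Psi> (ch g (v + w))) (\<Psi> (ch g v) + \<Psi> (ch g w))"
    and mult: "\<And>g h v. g \<in> G \<Longrightarrow> h \<in> G \<Longrightarrow> v \<in> V n \<Longrightarrow>
      cg K (\<Psi> (ch (g \<cdot> h) v)) (\<Psi> (ch g (act_cls h v)) + \<Psi> (ch h v))"
    and r: "r \<in> R"
  shows "\<Psi> r \<in> K"
proof -
  define E where "E x v = \<Psi> (frag_of (x, v))" for x v
  have left': "E (x - y) v = E x v - E y v" for x y v
    by (simp add: E_def left)
  have left_0: "E 0 v = 0" for v
    using left'[of 0 0 v] by simp
  have left_add: "E (x + y) v = E x v + E y v" for x y v
    using left'[of "x + y" y v] by simp
  have right': "cg K (E x (v + w)) (E x v + E x w)" if "x \<in> I" "v \<in> V n" "w \<in> V n" for x v w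
    using that(1)
  proof (induction rule: I_induct)
    case (base g)
    then show ?case
      using right that unfolding E_def ch_def by blast
  next
    case (diff x y)
    then have "cg K (E x (v + w) - E y (v + w)) ((E x v + E x w) - (E y v + E y w))"
      by (intro cg_diff[OF K])
    then show ?case
      by (simp add: left' algebra_simps)
  qed (simp add: left_0 cg_refl[OF K])
  have right_0: "cg K (E x 0) 0" if "x \<in> I" for x
    using cg_minus[OF K right'[OF that V_0 V_0]] by (simp add: cg_def)
  have right_diff: "cg K (E x (v - w)) (E x v - E x w)" if "x \<in> I" "v \<in> V n" "w \<in> V n" for x v w
  proof -
    have "cg K (E x ((v - w) + w)) (E x (v - w) + E x w)"
      using that by (intro right' V_diff)
    then have "cg K (E x (v - w) + E x w) (E x v)"
      by (simp add: cg_sym[OF K])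
    then show ?thesis
      by (simp add: cg_def algebra_simps)
  qed
  \<comment> \<open>Membership in \<open>V n\<close> is part of the induction, because the
    difference step knows nothing about the supports of its two arguments and yet uses additivity in
    the second factor.\<close>
  have bal: "ring_act r v \<in> V n \<and> cg K (E (gmul x r) v) (E x (ring_act r v))" if "Poly_Mapping.keys r \<subseteq> G" "x \<in> I" "v \<in> V n" for x r v
    using that(1)
  proof (induction r rule: frag_induction)
    case zero
    then show ?case
      using cg_sym[OF K right_0[OF that(2)]] by (simp add: frag_extend_eq_0 left_0 ring_act_lext)
  next
    case (one h)
    have "cg K (E (gmul x (frag_of h)) v) (E x (act_cls h v))"
      using that(2)
    proof (induction rule: I_induct)
      case (base g)
      have "gmul (frag_of g - frag_of e) (frag_of h) = (frag_of (g \<cdot> h) - frag_of e) - (frag_of h - frag_of e)"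
        using one by (auto simp: frag_extend_diff)
      then have "E (gmul (frag_of g - frag_of e) (frag_of h)) v = \<Psi> (ch (g \<cdot> h) v) - \<Psi> (ch h v)"
        by (simp only: left' ch_def flip: E_def)
      moreover have "cg K (\<Psi> (ch (g \<cdot> h) v) - \<Psi> (ch h v)) (\<Psi> (ch g (act_cls h v)) + \<Psi> (ch h v) - \<Psi> (ch h v))"
        using base one that by (intro cg_diff[OF K] cg_refl[OF K] mult) auto
      ultimately show ?case
        by (simp add: E_def ch_def)
    next
      case (diff x y)
      then show ?case
        using cg_diff[OF K diff(3,4)] by (simp add: frag_extend_diff left')
    qed (simp add: left_0 cg_refl[OF K])
    then show ?case
      using one that(3) by (auto simp: ring_act_lext intro: act_G_V)
  next
    case (diff a b)
    then have "cg K (E (gmul x a) v - E (gmul x b) v) (E x (ring_act a v) - E x (ring_act b v))"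
      by (intro cg_diff[OF K]) auto
    moreover have "cg K (E x (ring_act a v - ring_act b v)) (E x (ring_act a v) - E x (ring_act b v))"
      using diff that by (intro right_diff) auto
    ultimately have "cg K (E (gmul x a) v - E (gmul x b) v) (E x (ring_act a v - ring_act b v))"
      by (rule cg_trans[OF K _ cg_sym[OF K]])
    then show ?case
      using diff unfolding gmul_diff_right left' ring_act_lext lext_diff by (simp add: V_diff)
  qed
  have "\<Psi> 0 = 0"
    using diff[of 0 0] by simp
  have "relators \<subseteq> {c. \<Psi> c \<in> K}"
    unfolding relators_def
  proof (intro Un_least subsetI; elim CollectE exE conjE)
    fix c :: "(mat2 set \<Rightarrow>\<^sub>0 int) \<times> poly2 \<Rightarrow>\<^sub>0 int" and x y v assume c: "c = frag_of (x + y, v) - frag_of (x, v) - frag_of (y, v)"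
    have "\<Psi> c = 0"
      by (simp add: c diff left_add flip: E_def)
    then show "c \<in> {c. \<Psi> c \<in> K}"
      using add_subgroupD(1)[OF K] by simp
  next
    fix c :: "(mat2 set \<Rightarrow>\<^sub>0 int) \<times> poly2 \<Rightarrow>\<^sub>0 int" and x v w assume c: "c = frag_of (x, v + w) - frag_of (x, v) - frag_of (x, w)"
      and x: "x \<in> I" "v \<in> V n" "w \<in> V n"
    show "c \<in> {c. \<Psi> c \<in> K}"
      using right'[OF x] unfolding c diff cg_def mem_Collect_eq E_def[symmetric] by (simp only: diff_diff_eq)
  next
    fix c :: "(mat2 set \<Rightarrow>\<^sub>0 int) \<times> poly2 \<Rightarrow>\<^sub>0 int" and x r v assume c: "c = frag_of (gmul x r, v) - frag_of (x, ring_act r v)"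
      and x: "x \<in> I" "Poly_Mapping.keys r \<subseteq> G" "v \<in> V n"
    show "c \<in> {c. \<Psi> c \<in> K}"
      using conjunct2[OF bal[OF x(2,1,3)]] by (simp add: c diff cg_def flip: E_def)
  qed
  moreover have "add_subgroup {c. \<Psi> c \<in> K}"
    using add_subgroupD[OF K] \<open>\<Psi> 0 = 0\<close> by (auto simp: add_subgroup_def diff)
  ultimately have "R \<subseteq> {c. \<Psi> c \<in> K}"
    unfolding R_eq by (rule zspan_least)
  then show ?thesis
    using r by blast
qed

section \<open>The boundary of a chain\<close>

definition bd :: "((mat2 set \<Rightarrow>\<^sub>0 int) \<times> poly2 \<Rightarrow>\<^sub>0 int) \<Rightarrow> poly2" where
  "bd = lext (\<lambda>xv. ring_act (fst xv) (snd xv))"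

lemma bd_diff: "bd (a - b) = bd a - bd b"
  by (simp add: bd_def lext_diff)

lemma bd_0 [simp]: "bd 0 = 0"
  by (simp add: bd_def)

lemma bd_add: "bd (a + b) = bd a + bd b"
  by (simp add: bd_def lext_add)

lemma bd_ch: "v \<in> V n \<Longrightarrow> bd (ch g v) = act_cls g v - v"
  by (simp add: bd_def ch_def ring_act_lext lext_diff act_cls_e)

lemma bd_R: "r \<in> R \<Longrightarrow> bd r = 0"
proof -
  have "bd r \<in> {0}" if "r \<in> R"
  proof (rule relations_into[OF _ _ _ _ _ that])
    show "add_subgroup {0 :: poly2}"
      by (simp add: add_subgroup_def)
  qed (auto simp: bd_ch bd_diff V_add V_act act_G_V act_cls_n cls_mult act_add act_act cg_def,
      auto simp: bd_def ring_act_lext lext_diff)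
  then show "r \<in> R \<Longrightarrow> bd r = 0" by simp
qed

end

section \<open>Hyperbolic matrices\<close>

lemma coeff_of_int_mult: "coeff (coeff (of_int x * P :: poly2) j) i = x * coeff (coeff P j) i"
  by (simp add: of_int_poly)

lemma of_int_cancel_poly2: "x \<noteq> 0 \<Longrightarrow> of_int x * P = of_int x * (P' :: poly2) \<Longrightarrow> P = P'"
  by simp

lemma mat_content_nonzero:
  assumes "det A = 1" "\<bar>trace A\<bar> > 2"
  shows "mat_content A \<noteq> 0"
proof
  assume "mat_content A = 0"
  then have "A$2$1 = 0" "A$1$1 = A$2$2" "A$1$2 = 0"
    by (simp_all add: mat_content_def)
  then have "A$1$1 * A$1$1 = 1" "trace A = 2 * A$1$1"
    using assms(1) by (simp_all add: det_mat2 trace_mat2)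
  then show False
    using assms(2) zmult_eq_1_iff[of "A$1$1" "A$1$1"] by auto
qed

lemma gcd3_mult: "gcd (x * a) (gcd (x * b) (x * c)) = \<bar>x\<bar> * gcd a (gcd b (c :: int))"
proof -
  have "gcd (x * b) (x * c) = \<bar>x * gcd b c\<bar>"
    by (simp add: gcd_mult_distrib_int[symmetric] abs_mult)
  then have "gcd (x * a) (gcd (x * b) (x * c)) = gcd (x * a) (x * gcd b c)"
    by simp
  then show ?thesis
    by (simp only: gcd_mult_distrib_int)
qed

text \<open>The coefficients of \<open>Q_mat A\<close> are coprime, so \<open>x\<close> must divide
  \<open>y\<close>. This is why the images of hyperbolic cycles are integral, and not only rational,
  combinations of such cycles.\<close>

lemma Q_mat_primitive:
  assumes x: "x \<noteq> 0" and A: "\<bar>trace A\<bar> > 2" "mat_content A \<noteq> 0" and eq: "of_int x * P = of_int y * Q_mat A"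
  shows "\<exists>m. P = of_int m * Q_mat A"
proof -
  let ?c = "mat_content A"
  define a1 a2 a3 where "a1 = A$2$1 div ?c" and "a2 = (A$1$1 - A$2$2) div ?c" and "a3 = A$1$2 div ?c"
  have dvd: "?c dvd A$2$1" "?c dvd A$1$1 - A$2$2" "?c dvd A$1$2"
    unfolding mat_content_def by (auto intro: dvd_trans)
  have "?c = gcd (?c * a1) (gcd (?c * a2) (?c * a3))"
    unfolding a1_def a2_def a3_def dvd_mult_div_cancel[OF dvd(1)] dvd_mult_div_cancel[OF dvd(2)]
      dvd_mult_div_cancel[OF dvd(3)] by (simp add: mat_content_def)
  also have "\<dots> = \<bar>?c\<bar> * gcd a1 (gcd a2 a3)"
    by (rule gcd3_mult)
  finally have "?c = \<bar>?c\<bar> * gcd a1 (gcd a2 a3)" .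
  moreover have "?c \<ge> 0"
    by (simp add: mat_content_def)
  ultimately have coprime: "gcd a1 (gcd a2 a3) = 1"
    using A(2) by simp
  define s where "s = sgn (trace A)"
  have s: "s * s = 1"
    using A(1) by (auto simp: s_def sgn_if)
  have "Q_mat A = of_int (- s * a1) * X1 ^ 2 * X2 ^ 0 + of_int (s * a2) * X1 ^ 1 * X2 ^ 1 + of_int (s * a3) * X1 ^ 0 * X2 ^ 2"
    by (simp add: Q_mat_def Let_def a1_def a2_def a3_def s_def trace_mat2 algebra_simps flip: mat_content_def)
  then have Q: "Q_mat A = monom (monom (- s * a1) 2) 0 + monom (monom (s * a2) 1) 1 + monom (monom (s * a3) 0) 2"
    unfolding monom_X1_X2 .
  have "coeff (coeff (of_int x * P) j) i = coeff (coeff (of_int y * Q_mat A) j) i" for i j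
    using eq by simp
  then have *: "x * coeff (coeff P j) i = y * coeff (coeff (Q_mat A) j) i" for i j
    unfolding coeff_of_int_mult .
  have "x dvd y * (- s * a1)" "x dvd y * (s * a2)" "x dvd y * (s * a3)"
    using *[of 0 2] *[of 1 1] *[of 2 0] unfolding Q
    by (simp_all del: minus_mult_left mult_minus_left) (metis dvd_triv_left)+
  then have "x dvd y * (- s * a1) * (- s)" "x dvd y * (s * a2) * s" "x dvd y * (s * a3) * s"
    by (metis dvd_mult2)+
  moreover have "y * (- s * a1) * (- s) = y * a1 * (s * s)" "y * (s * a2) * s = y * a2 * (s * s)"
    "y * (s * a3) * s = y * a3 * (s * s)"
    by (simp_all only: mult_minus_left mult_minus_right minus_minus mult_ac)
  ultimately have "x dvd y * a1" "x dvd y * a2" "x dvd y * a3"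
    unfolding s by (simp_all only: mult_1_right)
  then have "x dvd gcd (y * a1) (gcd (y * a2) (y * a3))"
    by simp
  also have "\<dots> = \<bar>y\<bar> * gcd a1 (gcd a2 a3)"
    by (rule gcd3_mult)
  finally have "x dvd y"
    using coprime by simp
  then obtain m where "y = x * m" ..
  then have "of_int x * P = of_int x * (of_int m * Q_mat A)"
    using eq by (simp add: mult.assoc)
  then have "P = of_int m * Q_mat A"
    by (rule of_int_cancel_poly2[OF x])
  then show ?thesis ..
qed

lemma act_Q_mat:
  assumes "det A = 1" "\<bar>trace A\<bar> > 2"
  shows "act A (Q_mat A) = Q_mat A"
proof (rule of_int_cancel_poly2[OF mat_content_nonzero[OF assms]])
  have "of_int (mat_content A) * act A (Q_mat A) = act A (of_int (mat_content A) * Q_mat A)"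
    by (simp add: act_mult)
  also have "\<dots> = of_int (mat_content A) * Q_mat A"
    unfolding Q_mat_qf by (simp add: act_mult act_minus act_qf mult_adj_cancel(3)[OF assms(1)])
  finally show "of_int (mat_content A) * act A (Q_mat A) = of_int (mat_content A) * Q_mat A" .
qed

primrec mpow :: "mat2 \<Rightarrow> nat \<Rightarrow> mat2" where
  "mpow A 0 = mat 1"
| "mpow A (Suc m) = mpow A m ** A"

lemma det_mpow: "det A = 1 \<Longrightarrow> det (mpow A m) = 1"
  by (induction m) (simp_all add: det_mul)

text \<open>By Cayley-Hamilton \<open>tr(A^(m+2)) = tr(A) tr(A^(m+1)) - tr(A^m)\<close>; since
  \<open>\<bar>tr A\<bar> \<ge> 3\<close>, the absolute values increase strictly, starting from
  2.\<close>

lemma trace_mpow: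
  assumes "det A = 1" "\<bar>trace A\<bar> > 2" "m > 0"
  shows "\<bar>trace (mpow A m)\<bar> > 2"
proof -
  have rec: "trace (mpow A (Suc (Suc m))) = trace A * trace (mpow A (Suc m)) - trace (mpow A m)" for m
  proof -
    have "trace (P ** A ** A) = trace A * trace (P ** A) - det A * trace P" for P :: mat2
      by (simp add: trace_mat2 det_mat2 mult_nth algebra_simps)
    then show ?thesis
      by (simp add: assms(1))
  qed
  have "\<bar>trace (mpow A m)\<bar> < \<bar>trace (mpow A (Suc m))\<bar> \<and> \<bar>trace (mpow A m)\<bar> \<ge> 2" for m
  proof (induction m)
    case 0
    then show ?case
      using assms(2) by (simp add: trace_mat2 mult_nth)
  next
    case (Suc m)
    let ?x = "trace (mpow A (Suc m))" and ?y = "trace (mpow A m)"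
    have "3 * \<bar>?x\<bar> \<le> \<bar>trace A\<bar> * \<bar>?x\<bar>"
      using assms(2) by (intro mult_right_mono) auto
    also have "\<dots> \<le> \<bar>trace (mpow A (Suc (Suc m)))\<bar> + \<bar>?y\<bar>"
      unfolding rec abs_mult[symmetric] by linarith
    finally show ?case
      using Suc by linarith
  qed
  from this[of "m - 1"] show ?thesis
    using assms(3) by auto
qed

text \<open>By Cayley-Hamilton the powers stay in the span of \<open>A\<close> and the identity, so
  \<open>A\<close> and its powers have proportional invariant forms.\<close>

lemma mpow_linear:
  assumes "det A = 1"
  shows "\<exists>y z. mpow A m = mk (y * A$1$1 + z) (y * A$1$2) (y * A$2$1) (y * A$2$2 + z)"
proof (induction m)
  case 0
  show ?case
    by (rule exI[of _ 0], rule exI[of _ 1]) (simp add: mat2_eq_iff)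
next
  case (Suc m)
  then obtain y z where *: "mpow A m = mk (y * A$1$1 + z) (y * A$1$2) (y * A$2$1) (y * A$2$2 + z)"
    by blast
  have "A$1$2 * A$2$1 = A$1$1 * A$2$2 - 1"
    using assms by (simp add: det_mat2)
  then have d: "y + y * (A$1$2 * A$2$1) = y * (A$1$1 * A$2$2)"
    by (simp add: right_diff_distrib)
  have "mpow A (Suc m) = mk ((y * trace A + z) * A$1$1 + - y) ((y * trace A + z) * A$1$2)
      ((y * trace A + z) * A$2$1) ((y * trace A + z) * A$2$2 + - y)"
    unfolding mpow.simps * mat2_eq_iff mult_nth trace_mat2 using d
    by (simp add: algebra_simps)
  then show ?case
    by blast
qed

text \<open>\<open>M\<close> carries the form of \<open>A^m\<close> to the form of
  \<open>M A^m adj M = C M adj M\<close>, which is \<open>det M\<close> times that of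
  \<open>C\<close>. So the image of \<open>Q_mat A\<close> is rationally proportional to
  \<open>Q_mat C\<close>, and primitivity makes the factor an integer.\<close>

lemma act_Q_mat_conjugate:
  assumes A: "det A = 1" "\<bar>trace A\<bar> > 2" and C: "det C = 1" and M: "det M \<noteq> 0"
    and m: "m > 0" and eq: "M ** mpow A m = C ** M"
  shows "\<bar>trace C\<bar> > 2" "\<exists>l. act M (Q_mat A) = of_int l * Q_mat C"
proof -
  let ?P = "mpow A m"
  have "trace (M ** ?P ** adj M) = det M * trace ?P" "trace (C ** M ** adj M) = det M * trace C"
    by (simp_all add: mult_nth trace_mat2 det_mat2 algebra_simps)
  then have "trace C = trace ?P"
    using M eq by simp
  then show tC: "\<bar>trace C\<bar> > 2"
    using trace_mpow[OF A m] by simp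
  obtain y z where yz: "?P = mk (y * A$1$1 + z) (y * A$1$2) (y * A$2$1) (y * A$2$2 + z)"
    using mpow_linear[OF A(1)] by blast
  \<comment> \<open>Otherwise the power would be scalar of determinant 1, with trace 2 in absolute
    value.\<close>
  have "y \<noteq> 0"
  proof
    assume "y = 0"
    then have "z * z = 1" "trace ?P = 2 * z"
      using det_mpow[OF A(1), of m] unfolding yz by (simp_all add: trace_mat2)
    then show False
      using trace_mpow[OF A m] zmult_eq_1_iff[of z z] by auto
  qed
  have qP: "qf ?P = of_int y * qf A"
    unfolding yz by (simp add: qf_def algebra_simps)
  have "act M (qf ?P) = qf (C ** M ** adj M)"
    by (simp add: act_qf eq)
  also have "\<dots> = of_int (det M) * qf C"
    by (simp add: qf_def mult_nth det_mat2 algebra_simps)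
  finally have 1: "of_int y * act M (qf A) = of_int (det M) * qf C"
    unfolding qP by (simp add: act_mult)
  have s: "sgn (trace C) * sgn (trace C) = 1"
    using tC by (auto simp: sgn_if)
  have "of_int (- sgn (trace C)) * (of_int (mat_content C) * Q_mat C) = of_int (sgn (trace C) * sgn (trace C)) * qf C"
    unfolding Q_mat_qf by (simp only: of_int_mult of_int_minus minus_mult_minus mult.assoc)
  then have qC: "qf C = of_int (- sgn (trace C) * mat_content C) * Q_mat C"
    unfolding s by (simp add: mult.assoc)
  have "of_int (mat_content A) * act M (Q_mat A) = act M (of_int (mat_content A) * Q_mat A)"
    by (simp add: act_mult)
  also have "\<dots> = of_int (- sgn (trace A)) * act M (qf A)"
    unfolding Q_mat_qf by (simp add: act_mult act_minus)
  finally have "of_int y * (of_int (mat_content A) * act M (Q_mat A)) = of_int (- sgn (trace A)) * (of_int y * act M (qf A))"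
    by (simp add: mult.left_commute)
  then have "of_int (y * mat_content A) * act M (Q_mat A)
    = of_int (- sgn (trace A) * det M * (- sgn (trace C) * mat_content C)) * Q_mat C"
    unfolding 1 qC by (simp add: mult_ac)
  moreover have "y * mat_content A \<noteq> 0"
    using \<open>y \<noteq> 0\<close> mat_content_nonzero[OF A] by simp
  ultimately show "\<exists>l. act M (Q_mat A) = of_int l * Q_mat C"
    using Q_mat_primitive[OF _ tC mat_content_nonzero[OF C tC]] by blast
qed

section \<open>Sums over orbits of a permutation\<close>

lemma funpow_closed: "s ` B = B \<Longrightarrow> \<beta> \<in> B \<Longrightarrow> (s ^^ m) \<beta> \<in> B"
  by (induction m) auto

text \<open>One cycle of the permutation is removed at a time. The hypothesis speaks of every period
  \<open>m\<close>; it is applied to the least one, for which the points of the orbit are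
  distinct.\<close>

lemma sum_orbits:
  fixes f :: "'b \<Rightarrow> 'a::ab_group_add"
  assumes K: "add_subgroup K"
    and orbit: "\<And>\<beta> m. \<beta> \<in> B \<Longrightarrow> m > 0 \<Longrightarrow> (s ^^ m) \<beta> = \<beta> \<Longrightarrow> (\<Sum>i<m. f ((s ^^ i) \<beta>)) \<in> K"
    and "finite B" "s ` B = B" "inj_on s B"
  shows "sum f B \<in> K"
proof -
  have "sum f C \<in> K" if "C \<subseteq> B" "s ` C = C" for C
    using finite_subset[OF \<open>C \<subseteq> B\<close> \<open>finite B\<close>] that
  proof (induction C rule: finite_psubset_induct)
    case (psubset C)
    show ?case
    proof (cases "C = {}")
      case True
      then show ?thesis
        using add_subgroupD(1)[OF K] by simp
    next
      case False
      then obtain \<beta> where \<beta>: "\<beta> \<in> C"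
        by blast
      have inj_C: "inj_on s C"
        using \<open>inj_on s B\<close> psubset.prems(1) by (rule inj_on_subset)
      have in_C: "(s ^^ i) \<beta> \<in> C" for i
        by (rule funpow_closed[OF psubset.prems(2) \<beta>])
      have inj: "(s ^^ i) x = (s ^^ i) y \<Longrightarrow> x \<in> C \<Longrightarrow> y \<in> C \<Longrightarrow> x = y" for i x y
        by (induction i) (use inj_C funpow_closed[OF psubset.prems(2)] in \<open>auto dest: inj_onD\<close>)
      have cancel: "(s ^^ (j - i)) \<beta> = \<beta>" if "(s ^^ i) \<beta> = (s ^^ j) \<beta>" "i < j" for i j
      proof -
        have "(s ^^ j) \<beta> = (s ^^ i) ((s ^^ (j - i)) \<beta>)"
          using that(2) by (simp flip: funpow_add comp_apply[of "s ^^ i" "s ^^ (j - i)" \<beta>])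
        then show ?thesis
          using inj[of i "(s ^^ (j - i)) \<beta>" \<beta>] in_C[of "j - i"] \<beta> that(1) by simp
      qed
      have "\<not> inj_on (\<lambda>i. (s ^^ i) \<beta>) UNIV"
      proof
        assume "inj_on (\<lambda>i. (s ^^ i) \<beta>) UNIV"
        moreover have "range (\<lambda>i. (s ^^ i) \<beta>) \<subseteq> C"
          using in_C by blast
        ultimately show False
          using psubset.hyps finite_subset finite_imageD infinite_UNIV_nat by blast
      qed
      then obtain i j where "(s ^^ i) \<beta> = (s ^^ j) \<beta>" "i < j"
        unfolding inj_on_def by (metis linorder_neqE_nat)
      then have ex: "\<exists>m. m > 0 \<and> (s ^^ m) \<beta> = \<beta>"
        using cancel[of i j] by (intro exI[of _ "j - i"]) simp
      define m where "m = (LEAST m. m > 0 \<and> (s ^^ m) \<beta> = \<beta>)"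
      have m: "m > 0" "(s ^^ m) \<beta> = \<beta>"
        using LeastI_ex[OF ex] by (simp_all add: m_def)
      have minimal: "(s ^^ i) \<beta> \<noteq> \<beta>" if "0 < i" "i < m" for i
        using not_less_Least[of i "\<lambda>m. m > 0 \<and> (s ^^ m) \<beta> = \<beta>"] that by (simp add: m_def)
      define D where "D = (\<lambda>i. (s ^^ i) \<beta>) ` {..<m}"
      have inj_D: "inj_on (\<lambda>i. (s ^^ i) \<beta>) {..<m}"
      proof (rule linorder_inj_onI)
        fix i j assume "i < j" "i \<in> {..<m}" "j \<in> {..<m}"
        then show "(s ^^ i) \<beta> \<noteq> (s ^^ j) \<beta>"
          using cancel[of i j] minimal[of "j - i"] by auto
      qed auto
      have D_C: "D \<subseteq> C"
        using in_C by (auto simp: D_def)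
      have "s ` D = D"
      proof
        show "s ` D \<subseteq> D"
        proof
          fix x assume "x \<in> s ` D"
          then obtain i where i: "i < m" "x = (s ^^ Suc i) \<beta>"
            by (auto simp: D_def)
          show "x \<in> D"
          proof (cases "Suc i = m")
            case True
            then have "x = (s ^^ 0) \<beta>"
              using i m(2) by simp
            then show ?thesis
              unfolding D_def using m(1) by blast
          next
            case False
            then have "Suc i \<in> {..<m}"
              using i(1) by simp
            then show ?thesis
              unfolding D_def i(2) by (rule imageI)
          qed
        qed
        then show "D \<subseteq> s ` D"
          using endo_inj_surj[of D s] inj_on_subset[OF inj_C D_C] by (simp add: D_def)
      qed
      then have "s ` (C - D) = C - D"
        using inj_on_image_set_diff[OF inj_C, of C D] D_C psubset.prems(2) by auto
      moreover have "\<beta> \<in> D"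
        unfolding D_def using m(1) by (intro image_eqI[of _ _ 0]) auto
      then have "C - D \<subset> C"
        using \<beta> by blast
      ultimately have "sum f (C - D) \<in> K"
        using psubset.prems(1) by (intro psubset.IH) auto
      moreover have "sum f D \<in> K"
        using orbit[of \<beta> m] \<beta> psubset.prems(1) m unfolding D_def
        by (simp add: sum.reindex[OF inj_D] subset_eq)
      moreover have "sum f C = sum f (C - D) + sum f D"
        by (rule sum.subset_diff[OF D_C psubset.hyps(1)])
      ultimately show ?thesis
        using add_subgroupD(4)[OF K] by simp
    qed
  qed
  then show ?thesis
    using assms(4) by blast
qed

section \<open>Hecke operators on chains\<close>

context level
begin

definition is_reps :: "mat2 set set \<Rightarrow> bool" where
  "is_reps B \<longleftrightarrow> finite B \<and> (\<forall>\<beta>\<in>B. \<exists>A. det A \<noteq> 0 \<and> \<beta> = cls A) \<and>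
    (\<forall>\<beta>\<in>B. \<forall>g\<in>G. \<exists>!\<beta>'. \<beta>' \<in> B \<and> (\<exists>\<gamma>\<in>G. \<beta> \<cdot> g = \<gamma> \<cdot> \<beta>'))"

lemma r_coset_iff: "\<delta> \<in> carrier (bar \<Gamma>) #>\<^bsub>PM2plus\<^esub> \<beta> \<longleftrightarrow> (\<exists>\<gamma>\<in>G. \<delta> = \<gamma> \<cdot> \<beta>)"
  by (auto simp: r_coset_def)

lemma cls_right_cancel:
  assumes "det C \<noteq> 0" "cls A \<cdot> cls C = cls B \<cdot> cls C"
  shows "cls A = cls B"
proof -
  consider "A ** C = B ** C" | "A ** C = (- B) ** C"
    using assms(2) by (auto simp: cls_mult cls_eq_iff)
  then show ?thesis
  proof cases
    case 1
    then show ?thesis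
      by (simp add: mult_right_cancel_det[OF assms(1) 1])
  next
    case 2
    show ?thesis
      unfolding mult_right_cancel_det[OF assms(1) 2] by (rule cls_neg)
  qed
qed

definition hyp where "hyp = {ch g (Q g ^ k) | g. g \<in> G \<and> hyperbolic g}"

text \<open>The chains that become zero in the quotient by the hyperbolic cycles.\<close>

abbreviation KH where "KH \<equiv> zspan (R \<union> hyp)"

lemma bd_V: "c \<in> chains \<Longrightarrow> bd c \<in> V n"
  by (induction rule: chains_induct) (auto simp: bd_R bd_ch bd_diff intro!: V_diff act_G_V)

lemma R_KH: "R \<subseteq> KH"
  by (auto intro: zspan_base)

lemma act_cls_Q: "g \<in> G \<Longrightarrow> hyperbolic g \<Longrightarrow> act_cls g (Q g ^ k) = Q g ^ k"
  by (auto simp: hyperbolic_cls act_cls_n Q_power_V) (simp add: Q_cls act_power act_Q_mat det_1)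

lemma bd_KH: "c \<in> KH \<Longrightarrow> bd c = 0"
proof (induction rule: zspan.induct)
  case (zspan_base x)
  then show ?case
    by (auto simp: bd_R hyp_def bd_ch Q_power_V act_cls_Q)
qed (simp_all add: bd_diff)

lemma KH_chains: "KH \<subseteq> chains"
  using R_chains by (intro zspan_least add_subgroup_chains) (auto simp: hyp_def intro!: ch_chains Q_power_V)

section \<open>The Hecke operator of a system of representatives\<close>

context
  fixes B :: "mat2 set set"
  assumes B: "is_reps B"
begin

abbreviation perm where "perm \<equiv> rep_perm \<Gamma> B"
abbreviation factor where "factor \<equiv> rep_factor \<Gamma> B"
abbreviation hc where "hc \<equiv> hecke_chain \<Gamma> B"

lemma finite_B: "finite B"
  using B by (simp add: is_reps_def)

lemma B_cls: "\<beta> \<in> B \<Longrightarrow> \<exists>A. det A \<noteq> 0 \<and> \<beta> = cls A"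
  using B by (simp add: is_reps_def)

lemma G_right_cancel:
  assumes "\<gamma> \<in> G" "\<gamma>' \<in> G" "\<beta> \<in> B" "\<gamma> \<cdot> \<beta> = \<gamma>' \<cdot> \<beta>"
  shows "\<gamma> = \<gamma>'"
proof -
  obtain C A A' where *: "det C \<noteq> 0" "\<beta> = cls C" "\<gamma> = cls A" "\<gamma>' = cls A'"
    using B_cls[OF assms(3)] assms(1,2) by blast
  show ?thesis
    using assms(4) unfolding *(2-4) by (rule cls_right_cancel[OF *(1)])
qed

lemma B_ex1:
  assumes "\<beta> \<in> B" "g \<in> G"
  shows "\<exists>!\<beta>'. \<beta>' \<in> B \<and> (\<exists>\<gamma>\<in>G. \<beta> \<cdot> g = \<gamma> \<cdot> \<beta>')"
proof -
  have "\<forall>\<beta>\<in>B. \<forall>g\<in>G. \<exists>!\<beta>'. \<beta>' \<in> B \<and> (\<exists>\<gamma>\<in>G. \<beta> \<cdot> g = \<gamma> \<cdot> \<beta>')"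
    using B unfolding is_reps_def by (elim conjE)
  from this[THEN bspec, OF assms(1), THEN bspec, OF assms(2)] show ?thesis .
qed

lemma perm_factor:
  assumes "\<beta> \<in> B" "g \<in> G"
  shows "perm \<beta> g \<in> B" "factor \<beta> g \<in> G" "\<beta> \<cdot> g = factor \<beta> g \<cdot> perm \<beta> g"
proof -
  note ex1 = B_ex1[OF assms(1,2)]
  have p: "perm \<beta> g \<in> B \<and> (\<exists>\<gamma>\<in>G. \<beta> \<cdot> g = \<gamma> \<cdot> perm \<beta> g)"
    unfolding rep_perm_def r_coset_iff by (rule theI'[OF ex1])
  then obtain \<gamma> where \<gamma>: "\<gamma> \<in> G" "\<beta> \<cdot> g = \<gamma> \<cdot> perm \<beta> g"
    by blast
  have "factor \<beta> g = \<gamma>"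
    unfolding rep_factor_def
  proof (rule the_equality)
    fix \<gamma>' assume "\<gamma>' \<in> carrier (bar \<Gamma>) \<and> \<beta> \<cdot> g = \<gamma>' \<cdot> perm \<beta> g"
    then have "\<gamma>' \<in> G" "\<gamma>' \<cdot> perm \<beta> g = \<gamma> \<cdot> perm \<beta> g"
      using \<gamma>(2) by simp_all
    then show "\<gamma>' = \<gamma>"
      using G_right_cancel[of \<gamma>' \<gamma> "perm \<beta> g"] \<gamma>(1) p by blast
  qed (use \<gamma> in simp)
  then show "perm \<beta> g \<in> B" "factor \<beta> g \<in> G" "\<beta> \<cdot> g = factor \<beta> g \<cdot> perm \<beta> g"
    using p \<gamma> by simp_all
qed

lemma perm_factor_unique:
  assumes "\<beta> \<in> B" "g \<in> G" "\<beta>' \<in> B" "\<gamma> \<in> G" "\<beta> \<cdot> g = \<gamma> \<cdot> \<beta>'"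
  shows "perm \<beta> g = \<beta>'" "factor \<beta> g = \<gamma>"
proof -
  note ex1 = B_ex1[OF assms(1,2)]
  have "\<exists>\<gamma>\<in>G. \<beta> \<cdot> g = \<gamma> \<cdot> perm \<beta> g" "\<exists>\<gamma>\<in>G. \<beta> \<cdot> g = \<gamma> \<cdot> \<beta>'"
    using perm_factor[OF assms(1,2)] assms(4,5) by (blast, blast)
  then show p: "perm \<beta> g = \<beta>'"
    using ex1 perm_factor(1)[OF assms(1,2)] assms(3) by (elim ex1E) (metis (no_types, lifting))
  have "factor \<beta> g \<cdot> \<beta>' = \<gamma> \<cdot> \<beta>'"
    using perm_factor(3)[OF assms(1,2)] unfolding assms(5) p by simp
  then show "factor \<beta> g = \<gamma>"
    by (rule G_right_cancel[OF perm_factor(2)[OF assms(1,2)] assms(4,3)])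
qed

lemma perm_factor_e: "\<beta> \<in> B \<Longrightarrow> perm \<beta> e = \<beta>" "\<beta> \<in> B \<Longrightarrow> factor \<beta> e = e"
proof -
  assume b: "\<beta> \<in> B"
  then obtain C where "\<beta> = cls C"
    using B_cls by blast
  then have "\<beta> \<cdot> e = e \<cdot> \<beta>"
    by simp
  then show "perm \<beta> e = \<beta>" "factor \<beta> e = e"
    using perm_factor_unique[OF b G_one b G_one] by simp_all
qed

text \<open>By uniqueness of the factorisation, \<open>perm\<close> is a right action of the group
  on the representatives and \<open>factor\<close> is a cocycle over it.\<close>

lemma perm_factor_mult:
  assumes "\<beta> \<in> B" "g \<in> G" "h \<in> G"
  shows "perm \<beta> (g \<cdot> h) = perm (perm \<beta> g) h"
    "factor \<beta> (g \<cdot> h) = factor \<beta> g \<cdot> factor (perm \<beta> g) h"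
proof -
  note 1 = perm_factor[OF assms(1,2)]
  note 2 = perm_factor[OF 1(1) assms(3)]
  obtain A1 A2 A3 A4 A5 A6 A7 where *: "\<beta> = cls A1" "g = cls A2" "h = cls A3" "factor \<beta> g = cls A4" "perm \<beta> g = cls A5"
    "factor (perm \<beta> g) h = cls A6" "perm (perm \<beta> g) h = cls A7"
    using B_cls[OF assms(1)] assms(2,3) 1(1,2) B_cls[OF 1(1)] 2(1,2) B_cls[OF 2(1)] by blast
  have "\<beta> \<cdot> (g \<cdot> h) = \<beta> \<cdot> g \<cdot> h"
    by (simp add: * cls_mult_assoc)
  also have "\<dots> = factor \<beta> g \<cdot> (perm \<beta> g \<cdot> h)"
    unfolding 1(3) by (simp only: *(3,4,5) cls_mult_assoc)
  also have "\<dots> = factor \<beta> g \<cdot> factor (perm \<beta> g) h \<cdot> perm (perm \<beta> g) h"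
    unfolding 2(3) by (simp only: *(4,6,7) cls_mult_assoc)
  finally show "perm \<beta> (g \<cdot> h) = perm (perm \<beta> g) h" "factor \<beta> (g \<cdot> h) = factor \<beta> g \<cdot> factor (perm \<beta> g) h"
    using perm_factor_unique[OF assms(1) G_mult[OF assms(2,3)] 2(1) G_mult[OF 1(2) 2(2)]] by simp_all
qed

lemma perm_image_inj:
  assumes "g \<in> G"
  shows "(\<lambda>\<beta>. perm \<beta> g) ` B = B" "inj_on (\<lambda>\<beta>. perm \<beta> g) B"
proof -
  obtain g' where g': "g' \<in> G" "g \<cdot> g' = e" "g' \<cdot> g = e"
    using G_inverse[OF assms] by blast
  have "perm (perm \<beta> g) g' = \<beta>" if "\<beta> \<in> B" for \<beta>
    using perm_factor_mult(1)[OF that assms g'(1)] perm_factor_e(1)[OF that] g'(2) by simp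
  then show inj: "inj_on (\<lambda>\<beta>. perm \<beta> g) B"
    by (rule inj_on_inverseI)
  show "(\<lambda>\<beta>. perm \<beta> g) ` B = B"
    using perm_factor(1)[OF _ assms] by (intro endo_inj_surj[OF finite_B _ inj]) auto
qed

lemma sum_perm: "g \<in> G \<Longrightarrow> (\<Sum>\<beta>\<in>B. f (perm \<beta> g)) = sum f B"
  using sum.reindex[OF perm_image_inj(2), of g f] perm_image_inj(1)[of g] by simp

lemma act_B_V: "\<beta> \<in> B \<Longrightarrow> v \<in> V n \<Longrightarrow> act_cls \<beta> v \<in> V n"
  using B_cls by (fastforce simp: act_cls_n V_act)

lemma act_B_diff: "\<beta> \<in> B \<Longrightarrow> v \<in> V n \<Longrightarrow> w \<in> V n \<Longrightarrow> act_cls \<beta> (v - w) = act_cls \<beta> v - act_cls \<beta> w"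
  using B_cls act_cls_diff by blast

lemma act_B_add: "\<beta> \<in> B \<Longrightarrow> v \<in> V n \<Longrightarrow> w \<in> V n \<Longrightarrow> act_cls \<beta> (v + w) = act_cls \<beta> v + act_cls \<beta> w"
  using B_cls by (fastforce simp: act_cls_n V_add act_add)

lemma act_perm_factor:
  assumes "\<beta> \<in> B" "g \<in> G" "v \<in> V n"
  shows "act_cls (factor \<beta> g) (act_cls (perm \<beta> g) v) = act_cls \<beta> (act_cls g v)"
proof -
  note 1 = perm_factor[OF assms(1,2)]
  obtain A1 A2 A4 A5 where *: "\<beta> = cls A1" "g = cls A2" "factor \<beta> g = cls A4" "perm \<beta> g = cls A5"
    using B_cls[OF assms(1)] assms(2) 1(1,2) B_cls[OF 1(1)] by blast
  have "act_cls (factor \<beta> g) (act_cls (perm \<beta> g) v) = act_cls (factor \<beta> g \<cdot> perm \<beta> g) v"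
    unfolding *(3,4) by (rule act_cls_mult[OF assms(3), symmetric])
  also have "\<dots> = act_cls (\<beta> \<cdot> g) v"
    by (simp only: 1(3))
  also have "\<dots> = act_cls \<beta> (act_cls g v)"
    unfolding *(1,2) by (rule act_cls_mult[OF assms(3)])
  finally show ?thesis .
qed

definition hsum where "hsum g v = (\<Sum>\<beta>\<in>B. ch (factor \<beta> g) (act_cls (perm \<beta> g) v))"

lemma hc_diff: "hc (a - b) = hc a - hc b"
  by (simp add: hecke_chain_def frag_extend_diff)

text \<open>The identity in \<open>g - 1\<close> contributes to the image as well. It fixes every
  representative with factor \<open>e\<close>, so its share consists of chains
  \<open>ch e w\<close>, which are relations.\<close>

lemma hc_ch:
  assumes "g \<in> G" "v \<in> V n"
  shows "cg R (hc (ch g v)) (hsum g v)"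
proof -
  have "hc (ch g v) = hsum g v - hsum e v"
    by (simp add: hecke_chain_def ch_def hsum_def frag_extend_diff)
  moreover have "cg R (hsum e v) (\<Sum>\<beta>\<in>B. 0)"
    unfolding hsum_def
  proof (rule cg_sum[OF add_subgroup_R])
    fix \<beta> assume "\<beta> \<in> B"
    then show "cg R (ch (factor \<beta> e) (act_cls (perm \<beta> e) v)) 0"
      using assms ch_e[of "act_cls \<beta> v"] by (simp add: perm_factor_e act_B_V)
  qed
  then have "cg R (hsum g v - hsum e v) (hsum g v - 0)"
    by (intro cg_diff cg_refl) simp_all
  ultimately show ?thesis
    by simp
qed

lemma hsum_add:
  assumes "g \<in> G" "v \<in> V n" "w \<in> V n"
  shows "cg R (hsum g (v + w)) (hsum g v + hsum g w)"
  unfolding hsum_def sum.distrib[symmetric]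
proof (rule cg_sum[OF add_subgroup_R])
  fix \<beta> assume b: "\<beta> \<in> B"
  note 1 = perm_factor[OF b assms(1)]
  show "cg R (ch (factor \<beta> g) (act_cls (perm \<beta> g) (v + w)))
    (ch (factor \<beta> g) (act_cls (perm \<beta> g) v) + ch (factor \<beta> g) (act_cls (perm \<beta> g) w))"
    unfolding act_B_add[OF 1(1) assms(2,3)] using assms by (intro ch_add 1 act_B_V)
qed

text \<open>Each summand splits by \<open>ch_mult\<close>; the second halves, reindexed along the
  permutation induced by \<open>g\<close>, add up to \<open>hsum h v\<close>.\<close>

lemma hsum_mult:
  assumes "g \<in> G" "h \<in> G" "v \<in> V n"
  shows "cg R (hsum (g \<cdot> h) v) (hsum g (act_cls h v) + hsum h v)"
proof -
  have "cg R (hsum (g \<cdot> h) v) (\<Sum>\<beta>\<in>B. ch (factor \<beta> g) (act_cls (perm \<beta> g) (act_cls h v))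
      + ch (factor (perm \<beta> g) h) (act_cls (perm (perm \<beta> g) h) v))"
    unfolding hsum_def
  proof (rule cg_sum[OF add_subgroup_R])
    fix \<beta> assume b: "\<beta> \<in> B"
    note 1 = perm_factor[OF b assms(1)]
    note 2 = perm_factor[OF 1(1) assms(2)]
    show "cg R (ch (factor \<beta> (g \<cdot> h)) (act_cls (perm \<beta> (g \<cdot> h)) v))
      (ch (factor \<beta> g) (act_cls (perm \<beta> g) (act_cls h v)) + ch (factor (perm \<beta> g) h) (act_cls (perm (perm \<beta> g) h) v))"
      unfolding perm_factor_mult[OF b assms(1,2)] act_perm_factor[OF 1(1) assms(2,3), symmetric]
      by (intro ch_mult 1 2 act_B_V assms)
  qed
  also have "(\<Sum>\<beta>\<in>B. ch (factor \<beta> g) (act_cls (perm \<beta> g) (act_cls h v))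
      + ch (factor (perm \<beta> g) h) (act_cls (perm (perm \<beta> g) h) v)) = hsum g (act_cls h v) + hsum h v"
    unfolding sum.distrib sum_perm[OF assms(1), of "\<lambda>\<beta>. ch (factor \<beta> h) (act_cls (perm \<beta> h) v)"]
    by (simp add: hsum_def)
  finally show ?thesis .
qed

lemma hc_R: 
  assumes "r \<in> R"
  shows "hc r \<in> R"
proof (rule relations_into[OF add_subgroup_R hc_diff _ _ _ assms])
  fix x y v
  show "hc (frag_of (x - y, v)) = hc (frag_of (x, v)) - hc (frag_of (y, v))"
    by (simp add: hecke_chain_def frag_extend_diff)
next
  fix g v w assume g: "g \<in> G" and v: "v \<in> V n" "w \<in> V n"
  have 1: "cg R (hc (ch g v) + hc (ch g w)) (hsum g v + hsum g w)"
    using g v by (intro cg_add hc_ch) simp_all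
  have 2: "cg R (hc (ch g (v + w))) (hsum g v + hsum g w)"
    by (rule cg_trans[OF add_subgroup_R hc_ch[OF g V_add[OF v]] hsum_add[OF g v]])
  show "cg R (hc (ch g (v + w))) (hc (ch g v) + hc (ch g w))"
    by (rule cg_trans[OF add_subgroup_R 2 cg_sym[OF add_subgroup_R 1]])
next
  fix g h v assume g: "g \<in> G" "h \<in> G" and v: "v \<in> V n"
  have 1: "cg R (hc (ch g (act_cls h v)) + hc (ch h v)) (hsum g (act_cls h v) + hsum h v)"
    using g v by (intro cg_add hc_ch act_G_V) simp_all
  have 2: "cg R (hc (ch (g \<cdot> h) v)) (hsum g (act_cls h v) + hsum h v)"
    by (rule cg_trans[OF add_subgroup_R hc_ch[OF G_mult[OF g] v] hsum_mult[OF g v]])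
  show "cg R (hc (ch (g \<cdot> h) v)) (hc (ch g (act_cls h v)) + hc (ch h v))"
    by (rule cg_trans[OF add_subgroup_R 2 cg_sym[OF add_subgroup_R 1]])
qed

lemma hsum_chains: "g \<in> G \<Longrightarrow> v \<in> V n \<Longrightarrow> hsum g v \<in> chains"
  unfolding hsum_def
  by (intro add_subgroupD(5)[OF add_subgroup_chains] ch_chains perm_factor(2) act_B_V perm_factor(1))

lemma hc_0: "hc 0 = 0"
  by (simp add: hecke_chain_def)

lemma hc_chains: "c \<in> chains \<Longrightarrow> hc c \<in> chains"
proof (induction rule: chains_induct)
  case zero
  then show ?case
    using add_subgroupD(1)[OF add_subgroup_chains] by (simp add: hc_0)
next
  case (rel c)
  then show ?case
    using hc_R R_chains by blast
next
  case (ch g v)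
  show ?case
    using cg_mem[OF add_subgroup_chains cg_mono[OF R_chains hc_ch[OF ch]] hsum_chains[OF ch]] .
next
  case (diff a b)
  then show ?case
    using add_subgroupD(2)[OF add_subgroup_chains] by (simp add: hc_diff)
qed

lemma bd_hsum:
  assumes "g \<in> G" "v \<in> V n"
  shows "bd (hsum g v) = (\<Sum>\<beta>\<in>B. act_cls \<beta> (act_cls g v) - act_cls \<beta> v)"
proof -
  have "bd (sum f S) = (\<Sum>x\<in>S. bd (f x))" for f :: "mat2 set \<Rightarrow> _" and S
    by (induction S rule: infinite_finite_induct) (simp_all add: bd_add)
  then have "bd (hsum g v) = (\<Sum>\<beta>\<in>B. bd (ch (factor \<beta> g) (act_cls (perm \<beta> g) v)))"
    by (simp add: hsum_def)
  also have "\<dots> = (\<Sum>\<beta>\<in>B. act_cls \<beta> (act_cls g v) - act_cls (perm \<beta> g) v)"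
    using assms by (intro sum.cong) (simp_all add: bd_ch act_B_V perm_factor act_perm_factor)
  also have "\<dots> = (\<Sum>\<beta>\<in>B. act_cls \<beta> (act_cls g v)) - (\<Sum>\<beta>\<in>B. act_cls \<beta> v)"
    unfolding sum_subtractf sum_perm[OF assms(1), of "\<lambda>\<beta>. act_cls \<beta> v"] ..
  finally show ?thesis
    by (simp add: sum_subtractf)
qed

lemma bd_cg_R: "cg R a b \<Longrightarrow> bd a = bd b"
  using bd_R[of "a - b"] by (simp add: cg_def bd_diff)

lemma bd_hc: "c \<in> chains \<Longrightarrow> bd (hc c) = (\<Sum>\<beta>\<in>B. act_cls \<beta> (bd c))"
proof -
  have act_0: "act_cls \<beta> 0 = 0" if "\<beta> \<in> B" for \<beta>
    using act_B_diff[OF that V_0 V_0] by simp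
  show "c \<in> chains \<Longrightarrow> bd (hc c) = (\<Sum>\<beta>\<in>B. act_cls \<beta> (bd c))"
  proof (induction rule: chains_induct)
    case (rel c)
    then show ?case
      using hc_R bd_R act_0 by simp
  next
    case (ch g v)
    have "bd (hc (ch g v)) = bd (hsum g v)"
      by (rule bd_cg_R[OF hc_ch[OF ch]])
    also have "\<dots> = (\<Sum>\<beta>\<in>B. act_cls \<beta> (act_cls g v - v))"
      unfolding bd_hsum[OF ch] using ch by (intro sum.cong) (simp_all add: act_B_diff act_G_V)
    finally show ?case
      using ch by (simp add: bd_ch)
  next
    case (diff a b)
    then show ?case
      by (simp add: hc_diff bd_diff act_B_diff bd_V sum_subtractf)
  qed (simp add: hc_0 act_0)
qed

lemma hc_cycle: "c \<in> chains \<Longrightarrow> bd c = 0 \<Longrightarrow> bd (hc c) = 0"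
  using act_B_diff[OF _ V_0 V_0] by (simp add: bd_hc)

text \<open>Since \<open>g\<close> fixes the form, the summands along an orbit telescope: by the
  cocycle rule they add up to one chain, that of the factor of \<open>\<beta>\<close> and
  \<open>g^m\<close> when \<open>m\<close> is a period.\<close>

lemma hsum_hyperbolic:
  assumes A: "A \<in> \<Gamma>" "\<bar>trace A\<bar> > 2"
  shows "hsum (cls A) (Q_mat A ^ k) \<in> KH"
proof -
  define w g where "w = Q_mat A ^ k" and "g = cls A"
  have w: "w \<in> V n"
    unfolding w_def by (rule V_power[OF Q_mat_V])
  have g: "g \<in> G" "act_cls g w = w"
    using A act_cls_Q[of g] by (auto simp: g_def w_def Q_cls hyperbolic_cls)
  let ?s = "\<lambda>\<beta>. perm \<beta> g"
  let ?f = "\<lambda>\<beta>. ch (factor \<beta> g) (act_cls (perm \<beta> g) w)"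
  have sub: "add_subgroup KH"
    by simp
  have "mpow A m \<in> \<Gamma>" for m
    by (induction m) (simp_all add: one_in mult_in A(1))
  then have gp: "cls (mpow A m) \<in> G" for m
    by blast
  have "sum ?f B \<in> KH"
  proof (rule sum_orbits[OF sub _ finite_B perm_image_inj[OF g(1)]])
    fix \<beta> m assume b: "\<beta> \<in> B" and m: "m > 0" "(?s ^^ m) \<beta> = \<beta>"
    have in_B: "(?s ^^ i) \<beta> \<in> B" for i
      by (rule funpow_closed[OF perm_image_inj(1)[OF g(1)] b])
    have pow: "perm \<beta> (cls (mpow A i)) = (?s ^^ i) \<beta> \<and>
      cg R (ch (factor \<beta> (cls (mpow A i))) (act_cls ((?s ^^ i) \<beta>) w)) (\<Sum>j<i. ?f ((?s ^^ j) \<beta>))" for i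
    proof (induction i)
      case 0
      then show ?case
        using b w by (simp add: perm_factor_e ch_e act_B_V)
    next
      case (Suc i)
      let ?\<beta> = "(?s ^^ i) \<beta>"
      have mult: "cls (mpow A (Suc i)) = cls (mpow A i) \<cdot> g"
        by (simp add: cls_mult g_def)
      have p: "perm \<beta> (cls (mpow A (Suc i))) = ?s ?\<beta>" "factor \<beta> (cls (mpow A (Suc i))) = factor \<beta> (cls (mpow A i)) \<cdot> factor ?\<beta> g"
        unfolding mult perm_factor_mult[OF b gp g(1)] using Suc by simp_all
      note 1 = perm_factor[OF in_B[of i] g(1)]
      have "cg R (ch (factor \<beta> (cls (mpow A i)) \<cdot> factor ?\<beta> g) (act_cls (?s ?\<beta>) w))
        (ch (factor \<beta> (cls (mpow A i))) (act_cls (factor ?\<beta> g) (act_cls (?s ?\<beta>) w)) + ?f ?\<beta>)"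
        by (intro ch_mult perm_factor(2)[OF b gp] 1 act_B_V w)
      also have "act_cls (factor ?\<beta> g) (act_cls (?s ?\<beta>) w) = act_cls ?\<beta> w"
        using act_perm_factor[OF in_B g(1) w] g(2) by simp
      finally have 2: "cg R (ch (factor \<beta> (cls (mpow A (Suc i)))) (act_cls (?s ?\<beta>) w))
        (ch (factor \<beta> (cls (mpow A i))) (act_cls ?\<beta> w) + ?f ?\<beta>)"
        unfolding p .
      have 3: "cg R (ch (factor \<beta> (cls (mpow A i))) (act_cls ?\<beta> w) + ?f ?\<beta>) ((\<Sum>j<i. ?f ((?s ^^ j) \<beta>)) + ?f ?\<beta>)"
        using Suc by (intro cg_add cg_refl) simp_all
      show ?case
        using cg_trans[OF add_subgroup_R 2 3] p(1) by simp
    qed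
    let ?P = "cls (mpow A m)"
    note 1 = perm_factor[OF b gp[of m]]
    obtain M where M: "det M \<noteq> 0" "\<beta> = cls M"
      using B_cls[OF b] by blast
    obtain C0 where C0: "C0 \<in> \<Gamma>" "factor \<beta> ?P = cls C0"
      using 1(2) by blast
    have perm_P: "perm \<beta> ?P = \<beta>"
      using pow[of m] m(2) by simp
    have "cls (M ** mpow A m) = cls (C0 ** M)"
      using 1(3) unfolding C0(2) perm_P unfolding M(2) cls_mult .
    then have "M ** mpow A m = C0 ** M \<or> M ** mpow A m = (- C0) ** M"
      by (simp add: cls_eq_iff)
    \<comment> \<open>The classes determine the matrices only up to sign. The sign is moved into
      \<open>C\<close>, which may then lie outside \<open>\<Gamma>\<close>, although its class is
      that of \<open>C0\<close>.\<close>
    then obtain C where C: "det C = 1" "cls C = cls C0" "M ** mpow A m = C ** M"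
      using det_1[OF C0(1)] cls_neg[of C0] det_neg[of C0] by metis
    obtain l where l: "act M (Q_mat A) = of_int l * Q_mat C" and tr: "\<bar>trace C\<bar> > 2"
      using act_Q_mat_conjugate[OF det_1[OF A(1)] A(2) C(1) M(1) m(1) C(3)] by blast
    have "act_cls \<beta> w = of_int (l ^ k) * Q (cls C) ^ k"
      using w by (simp add: M(2) act_cls_n) (simp add: w_def act_power l power_mult_distrib Q_cls)
    then have "cg R (ch (cls C) (act_cls \<beta> w)) (frag_cmul (l ^ k) (ch (cls C) (Q (cls C) ^ k)))"
      using ch_of_int[of "cls C" "Q (cls C) ^ k" "l ^ k"] C0(1) C(2) Q_power_V by auto
    moreover have "ch (cls C) (Q (cls C) ^ k) \<in> KH"
    proof -
      have "cls C \<in> G"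
        using C0(1) C(2) by simp
      moreover have "hyperbolic (cls C)"
        using tr by (simp add: hyperbolic_cls)
      ultimately show ?thesis
        unfolding hyp_def by (intro zspan_base UnI2) blast
    qed
    then have "frag_cmul (l ^ k) (ch (cls C) (Q (cls C) ^ k)) \<in> KH"
      by (rule add_subgroup_frag_cmul[OF sub])
    ultimately have "ch (cls C) (act_cls \<beta> w) \<in> KH"
      using cg_mem[OF sub cg_mono[OF R_KH]] by blast
    then have "ch (factor \<beta> ?P) (act_cls ((?s ^^ m) \<beta>) w) \<in> KH"
      by (simp add: C0(2) C(2) m(2))
    moreover have "cg R (\<Sum>j<m. ?f ((?s ^^ j) \<beta>)) (ch (factor \<beta> ?P) (act_cls ((?s ^^ m) \<beta>) w))"
      using pow[of m] cg_sym[OF add_subgroup_R] by blast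
    ultimately show "(\<Sum>j<m. ?f ((?s ^^ j) \<beta>)) \<in> KH"
      using cg_mem[OF sub cg_mono[OF R_KH]] by blast
  qed
  then show ?thesis
    by (simp add: hsum_def w_def g_def)
qed

lemma hc_KH: "c \<in> KH \<Longrightarrow> hc c \<in> KH"
proof (induction rule: zspan.induct)
  case (zspan_base x)
  then show ?case
  proof
    assume "x \<in> R"
    then show ?thesis
      using hc_R R_KH by blast
  next
    assume "x \<in> hyp"
    then obtain A where A: "A \<in> \<Gamma>" "\<bar>trace A\<bar> > 2" "x = ch (cls A) (Q_mat A ^ k)"
      by (auto simp: hyp_def hyperbolic_cls Q_cls)
    have "Q_mat A ^ k \<in> V n"
      by (rule V_power[OF Q_mat_V])
    then have "cg R (hc x) (hsum (cls A) (Q_mat A ^ k))"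
      unfolding A(3) using A(1) by (intro hc_ch) auto
    then show ?thesis
      using cg_mem[OF add_subgroup_zspan cg_mono[OF R_KH] hsum_hyperbolic[OF A(1,2)]] by blast
  qed
qed (auto simp: hc_0 hc_diff intro: zspan.intros)

end

end

section \<open>Finite generation\<close>

text \<open>Euclid's algorithm on the first column: a translation reduces \<open>A$1$1\<close>
  modulo \<open>A$2$1\<close>, and \<open>mk 0 (-1) 1 0\<close> exchanges the two entries up to
  sign.\<close>

lemma SL2_generated:
  assumes S: "mk 0 (-1) 1 0 \<in> H" and T: "mk 1 1 0 1 \<in> H"
    and mult: "\<And>A B. A \<in> H \<Longrightarrow> B \<in> H \<Longrightarrow> A ** B \<in> H" and adj: "\<And>A. A \<in> H \<Longrightarrow> adj A \<in> H"
    and "det A = 1"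
  shows "A \<in> H"
proof -
  have m1: "mk (-1) 0 0 (-1) \<in> H"
    using mult[OF S S] by (simp add: mk_mult)
  have one: "mk 1 0 0 1 \<in> H"
    using mult[OF m1 m1] by (simp add: mk_mult)
  have nat: "mk 1 (int m) 0 1 \<in> H" for m
  proof (induction m)
    case (Suc m)
    then show ?case
      using mult[OF Suc T] by (simp add: mk_mult)
  qed (use one in simp)
  have Tb: "mk 1 b 0 1 \<in> H" for b
  proof (cases b rule: int_cases2)
    case (nonpos m)
    then show ?thesis
      using adj[OF nat[of m]] by (simp add: adj_def)
  qed (use nat in simp)
  show ?thesis
    using \<open>det A = 1\<close>
  proof (induction "nat \<bar>A$2$1\<bar>" arbitrary: A rule: less_induct)
    case less
    show ?case
    proof (cases "A$2$1 = 0")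
      case True
      then have "A$1$1 * A$2$2 = 1"
        using less.prems by (simp add: det_mat2)
      then consider "A$1$1 = 1" "A$2$2 = 1" | "A$1$1 = -1" "A$2$2 = -1"
        using zmult_eq_1_iff by blast
      then show ?thesis
      proof cases
        case 1
        then have "A = mk 1 (A$1$2) 0 1"
          using True by (simp add: mat2_eq_iff)
        then show ?thesis
          using Tb by metis
      next
        case 2
        then have "A = mk (-1) 0 0 (-1) ** mk 1 (- A$1$2) 0 1"
          using True by (simp add: mat2_eq_iff mk_mult)
        then show ?thesis
          using mult[OF m1 Tb] by metis
      qed
    next
      case False
      define q where "q = A$1$1 div A$2$1"
      define B where "B = mk 0 (-1) 1 0 ** (mk 1 (- q) 0 1 ** A)"
      have "B$2$1 = A$1$1 mod A$2$1"
        by (simp add: B_def mult_nth q_def minus_div_mult_eq_mod[symmetric] algebra_simps)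
      then have "nat \<bar>B$2$1\<bar> < nat \<bar>A$2$1\<bar>"
        using False abs_mod_less[of "A$2$1" "A$1$1"] by simp
      moreover have "det B = 1"
        using less.prems by (simp add: B_def det_mul)
      ultimately have "B \<in> H"
        by (rule less.hyps)
      moreover have "A = mk 1 q 0 1 ** (adj (mk 0 (-1) 1 0) ** B)"
        by (simp add: B_def mat2_eq_iff mult_nth)
      ultimately show ?thesis
        using mult[OF Tb mult[OF adj[OF S]]] by metis
    qed
  qed
qed

text \<open>The matrices that preserve \<open>X\<close> by right multiplication, together with their
  inverses, form a group containing both generators; it is then applied to
  \<open>mat 1\<close>.\<close>

lemma SL2_right_generated:
  assumes "mat 1 \<in> X" and X: "\<And>x. x \<in> X \<Longrightarrow> det x = 1"
    and closed: "\<And>x s. x \<in> X \<Longrightarrow> s \<in> {mk 0 (-1) 1 0, mk 1 1 0 1} \<Longrightarrow> x ** s \<in> X \<and> x ** adj s \<in> X"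
    and "det A = 1"
  shows "A \<in> X"
proof -
  define H where "H = {A. det A = 1 \<and> (\<forall>x\<in>X. x ** A \<in> X \<and> x ** adj A \<in> X)}"
  have "A \<in> H"
  proof (rule SL2_generated[OF _ _ _ _ \<open>det A = 1\<close>])
    show "mk 0 (-1) 1 0 \<in> H" "mk 1 1 0 1 \<in> H"
      using closed by (simp_all add: H_def)
    show "A ** B \<in> H" if "A \<in> H" "B \<in> H" for A B
      using that by (simp add: H_def det_mul adj_mult matrix_mul_assoc)
    show "adj A \<in> H" if "A \<in> H" for A
      using that by (simp add: H_def)
  qed
  then show ?thesis
    using assms(1) by (auto simp: H_def dest: bspec[of X _ "mat 1"])
qed

context level
begin

lemma mult_adj_in_Gamma:
  assumes "det A = 1" "det B = 1"
    and "[A$1$1 = B$1$1] (mod int N)" "[A$1$2 = B$1$2] (mod int N)"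
    and "[A$2$1 = B$2$1] (mod int N)" "[A$2$2 = B$2$2] (mod int N)"
  shows "A ** adj B \<in> \<Gamma>"
proof -
  have d: "B$1$1 * B$2$2 - B$1$2 * B$2$1 = 1" "B$2$2 * B$1$1 - B$2$1 * B$1$2 = 1"
    using assms(2) by (simp_all add: det_mat2 algebra_simps)
  have "[A$1$1 * B$2$2 - A$1$2 * B$2$1 = B$1$1 * B$2$2 - B$1$2 * B$2$1] (mod int N)"
    by (intro cong_diff cong_mult assms cong_refl)
  moreover have "[A$2$1 * B$2$2 - A$2$2 * B$2$1 = B$2$1 * B$2$2 - B$2$2 * B$2$1] (mod int N)"
    by (intro cong_diff cong_mult assms cong_refl)
  moreover have "[A$2$2 * B$1$1 - A$2$1 * B$1$2 = B$2$2 * B$1$1 - B$2$1 * B$1$2] (mod int N)"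
    by (intro cong_diff cong_mult assms cong_refl)
  ultimately have "A ** adj B \<in> Gamma1 N"
    using assms(1,2) unfolding d
    by (simp add: Gamma1_def SL2Z_def M2plus_def mult_nth det_mul mult.commute)
  then show ?thesis
    using Gamma1_sub by blast
qed

text \<open>Schreier's argument. Matrices congruent modulo \<open>N\<close> lie in the same coset
  \<open>\<Gamma> B\<close>, so one representative for each residue modulo \<open>N\<close> meets
  all cosets. Generation is expressed through closed sets \<open>H\<close>, as this is how it is
  applied to chains.\<close>

lemma Gamma_finitely_generated:
  "\<exists>F. finite F \<and> F \<subseteq> \<Gamma> \<and>
    (\<forall>H. F \<subseteq> H \<longrightarrow> (\<forall>A\<in>H. \<forall>B\<in>H. A ** B \<in> H) \<longrightarrow> (\<forall>A\<in>H. adj A \<in> H) \<longrightarrow> \<Gamma> \<subseteq> H)"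
proof -
  define \<rho> where "\<rho> A = (A$1$1 mod int N, A$1$2 mod int N, A$2$1 mod int N, A$2$2 mod int N)" for A :: mat2
  define r where "r x = (SOME B. det B = 1 \<and> \<rho> B = x)" for x
  have r: "det (r (\<rho> A)) = 1 \<and> \<rho> (r (\<rho> A)) = \<rho> A" if "det A = 1" for A
    unfolding r_def by (rule someI[where x = A]) (use that in simp)
  have quot: "A ** adj (r (\<rho> A)) \<in> \<Gamma>" if "det A = 1" for A
    using r[OF that] that by (intro mult_adj_in_Gamma) (auto simp: \<rho>_def cong_def)
  define Rs where "Rs = (\<lambda>A. r (\<rho> A)) ` {A. det A = 1}"
  have "range \<rho> \<subseteq> {0..<int N} \<times> {0..<int N} \<times> {0..<int N} \<times> {0..<int N}"
    using N_pos by (auto simp: \<rho>_def)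
  then have "finite (range \<rho>)"
    by (rule finite_subset) (intro finite_cartesian_product finite_atLeastLessThan_int)
  moreover have "Rs \<subseteq> r ` range \<rho>"
    by (auto simp: Rs_def)
  ultimately have fin: "finite Rs"
    using finite_subset by blast
  have det_Rs: "det B = 1" if "B \<in> Rs" for B
    using that r by (auto simp: Rs_def)
  let ?S = "{mk 0 (-1) 1 0, mk 1 1 0 1, adj (mk 0 (-1) 1 0), adj (mk 1 1 0 1)}"
  \<comment> \<open>The Schreier elements, and also \<open>Rs \<inter> \<Gamma>\<close>: different
    residues may belong to the same coset, and the representative of the trivial coset need not be
    the identity.\<close>
  define F where "F = \<Gamma> \<inter> ((\<lambda>(r, s, r'). r ** s ** adj r') ` (Rs \<times> ?S \<times> Rs) \<union> Rs)"
  have "finite F"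
    unfolding F_def using fin by (intro finite_Int disjI2 finite_UnI finite_imageI finite_cartesian_product) simp_all
  moreover have "F \<subseteq> \<Gamma>"
    by (simp add: F_def)
  moreover have "\<Gamma> \<subseteq> H" if F: "F \<subseteq> H" and mult': "\<forall>A\<in>H. \<forall>B\<in>H. A ** B \<in> H"
    and adj': "\<forall>A\<in>H. adj A \<in> H" for H
  proof
    fix A assume A: "A \<in> \<Gamma>"
    have mult: "\<And>A B. A \<in> H \<Longrightarrow> B \<in> H \<Longrightarrow> A ** B \<in> H" and adj: "\<And>A. A \<in> H \<Longrightarrow> adj A \<in> H"
      using mult' adj' by (simp_all)
    \<comment> \<open>This set is stable under right multiplication by both generators of the
      modular group, so it contains every matrix of determinant 1.\<close>
    define X where "X = {h ** r | h r. h \<in> H \<inter> \<Gamma> \<and> r \<in> Rs}"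
    have XI: "h ** r \<in> X" if "h \<in> H" "h \<in> \<Gamma>" "r \<in> Rs" for h r
      using that by (auto simp: X_def)
    have step: "x ** s \<in> X" if x: "x \<in> X" and s: "s \<in> ?S" for x s
    proof -
      obtain h q where h: "h \<in> H" "h \<in> \<Gamma>" "q \<in> Rs" "x = h ** q"
        using x unfolding X_def by blast
      have ds: "det s = 1"
        using s by auto
      then have dqs: "det (q ** s) = 1"
        using det_Rs[OF h(3)] by (simp add: det_mul)
      let ?q = "r (\<rho> (q ** s))"
      have q': "?q \<in> Rs"
        using dqs by (auto simp: Rs_def)
      have "q ** s ** adj ?q \<in> (\<lambda>(r, s, r'). r ** s ** adj r') ` (Rs \<times> ?S \<times> Rs)"
        by (rule image_eqI[of _ _ "(q, s, ?q)"]) (use h(3) s q' in simp_all)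
      then have "q ** s ** adj ?q \<in> F"
        using quot[OF dqs] unfolding F_def by blast
      then have "h ** (q ** s ** adj ?q) \<in> H" "h ** (q ** s ** adj ?q) \<in> \<Gamma>"
        using F mult h mult_in quot[OF dqs] by blast+
      then have "h ** (q ** s ** adj ?q) ** ?q \<in> X"
        using q' by (rule XI)
      also have "h ** (q ** s ** adj ?q) ** ?q = x ** s"
        using mult_adj_cancel(4)[OF det_Rs[OF q'], of "h ** (q ** s)"] by (simp add: h(4) matrix_mul_assoc)
      finally show ?thesis .
    qed
    have "A \<in> X"
    proof (rule SL2_right_generated[OF _ _ _ det_1[OF A]])
      let ?q = "r (\<rho> (mat 1))"
      have q: "?q \<in> Rs"
        by (auto simp: Rs_def)
      have "adj ?q \<in> \<Gamma>"
        using quot[of "mat 1"] by simp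
      then have "?q \<in> \<Gamma>"
        using adj_in[of "adj ?q"] by simp
      then have "?q \<in> F"
        using q by (simp add: F_def)
      then have "adj ?q ** ?q \<in> X"
        using F adj \<open>adj ?q \<in> \<Gamma>\<close> q by (intro XI) auto
      then show "mat 1 \<in> X"
        by (simp add: adj_inverse det_Rs[OF q])
      show "det x = 1" if "x \<in> X" for x
        using that det_1 det_Rs by (auto simp: X_def det_mul)
      show "x ** s \<in> X \<and> x ** adj s \<in> X" if "x \<in> X" "s \<in> {mk 0 (-1) 1 0, mk 1 1 0 1}" for x s
        using step[OF that(1)] that(2) by blast
    qed
    then obtain h q where h: "h \<in> H" "h \<in> \<Gamma>" "q \<in> Rs" "A = h ** q"
      unfolding X_def by blast
    have "q = adj h ** A"
      using mult_adj_cancel(2)[OF det_1[OF h(2)]] by (simp add: h(4))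
    then have "q \<in> \<Gamma>"
      using mult_in adj_in h(2) A by simp
    then have "q \<in> F"
      using h(3) by (simp add: F_def)
    then show "A \<in> H"
      using F mult h(1,4) by blast
  qed
  ultimately show ?thesis
    by (intro exI[of _ F] conjI allI impI)
qed

text \<open>By the cocycle rule, the \<open>A\<close> for which all \<open>ch (cls A) v\<close> lie
  in a given span containing \<open>R\<close> are closed under products and inverses. So the
  monomials on the generators of the group suffice.\<close>

lemma chains_finitely_generated:
  obtains E where "finite E" "E \<subseteq> chains" "chains = zspan (R \<union> E)"
proof -
  obtain F where F: "finite F" "F \<subseteq> \<Gamma>"
    and gen: "\<forall>H. F \<subseteq> H \<longrightarrow> (\<forall>A\<in>H. \<forall>B\<in>H. A ** B \<in> H) \<longrightarrow> (\<forall>A\<in>H. adj A \<in> H) \<longrightarrow> \<Gamma> \<subseteq> H"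
    using Gamma_finitely_generated by (elim exE conjE) (rule that)
  define E where "E = (\<lambda>(A, j). ch (cls A) (X1 ^ (n - j) * X2 ^ j)) ` (F \<times> {..n})"
  have mono: "X1 ^ (n - j) * X2 ^ j \<in> V n" if "j \<le> n" for j
    using that by (intro V_monomial) simp
  let ?K = "zspan (R \<union> E)"
  have sub: "add_subgroup ?K" and RK: "R \<subseteq> ?K"
    by (auto intro: zspan_base)
  have E: "finite E" "E \<subseteq> chains"
    using F mono by (auto simp: E_def intro!: ch_chains)
  define H where "H = {A \<in> \<Gamma>. \<forall>v\<in>V n. ch (cls A) v \<in> ?K}"
  have "F \<subseteq> H"
  proof
    fix A assume A: "A \<in> F"
    have "ch (cls A) v \<in> ?K" if v: "v \<in> V n" for v
    proof -
      obtain a where a: "v = (\<Sum>j\<le>n. of_int (a j) * X1 ^ (n - j) * X2 ^ j)"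
        using v V_iff_sum by blast
      have g: "cls A \<in> G"
        using A F(2) by blast
      have 1: "cg R (ch (cls A) v) (\<Sum>j\<le>n. ch (cls A) (of_int (a j) * (X1 ^ (n - j) * X2 ^ j)))"
        unfolding a mult.assoc using mono by (intro ch_sum[OF g] V_of_int_mult) simp
      have 2: "cg R (\<Sum>j\<le>n. ch (cls A) (of_int (a j) * (X1 ^ (n - j) * X2 ^ j)))
        (\<Sum>j\<le>n. frag_cmul (a j) (ch (cls A) (X1 ^ (n - j) * X2 ^ j)))"
        using mono by (intro cg_sum ch_of_int g) simp_all
      have "(\<Sum>j\<le>n. frag_cmul (a j) (ch (cls A) (X1 ^ (n - j) * X2 ^ j))) \<in> ?K"
        using A by (intro add_subgroupD(5)[OF sub] add_subgroup_frag_cmul[OF sub] zspan_base UnI2)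
          (force simp: E_def)
      then show ?thesis
        using cg_mem[OF sub cg_mono[OF RK cg_trans[OF add_subgroup_R 1 2]]] by blast
    qed
    then show "A \<in> H"
      using A F(2) by (auto simp: H_def)
  qed
  moreover have "A ** B \<in> H" if "A \<in> H" "B \<in> H" for A B
  proof -
    have "ch (cls (A ** B)) v \<in> ?K" if v: "v \<in> V n" for v
    proof -
      have "cg R (ch (cls A \<cdot> cls B) v) (ch (cls A) (act_cls (cls B) v) + ch (cls B) v)"
        using \<open>A \<in> H\<close> \<open>B \<in> H\<close> v by (intro ch_mult) (auto simp: H_def)
      moreover have "ch (cls A) (act_cls (cls B) v) + ch (cls B) v \<in> ?K"
        using \<open>A \<in> H\<close> \<open>B \<in> H\<close> v act_G_V[of "cls B" v]
        by (intro add_subgroupD(4)[OF sub]) (auto simp: H_def)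
      ultimately show ?thesis
        using cg_mem[OF sub cg_mono[OF RK]] by (simp only: cls_mult)
    qed
    then show ?thesis
      using that mult_in by (simp add: H_def)
  qed
  moreover have "adj A \<in> H" if A: "A \<in> H" for A
  proof -
    have d: "det A = 1"
      using A det_1 by (simp add: H_def)
    have "ch (cls (adj A)) v \<in> ?K" if v: "v \<in> V n" for v
    proof -
      let ?v = "act_cls (cls (adj A)) v"
      have g: "cls A \<in> G" "cls (adj A) \<in> G"
        using A adj_in by (auto simp: H_def)
      have e: "cls (adj A) \<cdot> cls A = e" "cls A \<cdot> cls (adj A) = e"
        by (simp_all add: cls_mult adj_inverse[OF d])
      have v': "?v \<in> V n"
        using act_G_V[OF g(2) v] .
      have "act_cls (cls A) ?v = v"
        using act_cls_mult[OF v, of A "adj A"] v unfolding e by (simp add: act_cls_e)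
      then have "cg R (ch (cls (adj A)) v) (- ch (cls A) ?v)"
        using ch_inverse[OF g e(1) v'] by simp
      moreover have "- ch (cls A) ?v \<in> ?K"
        using A v' by (intro add_subgroupD(3)[OF sub]) (auto simp: H_def)
      ultimately show ?thesis
        using cg_mem[OF sub cg_mono[OF RK]] by blast
    qed
    then show ?thesis
      using A adj_in by (simp add: H_def)
  qed
  ultimately have "\<Gamma> \<subseteq> H"
    by (intro gen[rule_format]) simp_all
  then have "R \<union> {ch g v |g v. g \<in> G \<and> v \<in> V n} \<subseteq> ?K"
    using RK by (auto simp: H_def)
  then have "chains \<subseteq> ?K"
    unfolding chains_eq by (rule zspan_least) simp
  moreover have "?K \<subseteq> chains"
    using R_chains E(2) by (intro zspan_least add_subgroup_chains) simp
  ultimately show thesis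
    using that[OF E] by blast
qed

end

section \<open>Subgroups and torsion quotients of finitely generated groups\<close>

lemma zspan_insert:
  fixes S :: "('a \<Rightarrow>\<^sub>0 int) set"
  assumes "x \<in> zspan (insert a S)"
  shows "\<exists>y\<in>zspan S. \<exists>m. x = y + frag_cmul m a"
  using assms
proof (induction rule: zspan.induct)
  case zspan_zero
  show ?case
    by (rule bexI[of _ 0], rule exI[of _ 0]) (simp_all add: zspan.zspan_zero)
next
  case (zspan_base x)
  then consider "x = a" | "x \<in> S"
    by blast
  then show ?case
  proof cases
    case 1
    then show ?thesis
      by (intro bexI[of _ 0] exI[of _ 1]) (simp_all add: zspan.zspan_zero)
  next
    case 2
    then show ?thesis
      by (intro bexI[of _ x] exI[of _ 0]) (simp_all add: zspan.zspan_base)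
  qed
next
  case (zspan_diff x x')
  then obtain y m y' m' where "y \<in> zspan S" "x = y + frag_cmul m a" "y' \<in> zspan S" "x' = y' + frag_cmul m' a"
    by blast
  then show ?case
    by (intro bexI[of _ "y - y'"] exI[of _ "m - m'"]) (simp_all add: frag_cmul_diff_distrib zspan.zspan_diff)
qed

text \<open>The Noetherian property, relative to \<open>R\<close>. Among the elements of
  \<open>C\<close> with positive coefficient at the new generator \<open>a\<close>, one with the
  least coefficient \<open>d\<close> reduces all others, by division with remainder, to the span of
  the earlier generators.\<close>

lemma finitely_generated_subgroup:
  fixes C :: "('a \<Rightarrow>\<^sub>0 int) set"
  assumes "finite E" "add_subgroup C" "R \<subseteq> C" "C \<subseteq> zspan (R \<union> E)"
  shows "\<exists>E'. finite E' \<and> E' \<subseteq> C \<and> C \<subseteq> zspan (R \<union> E')"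
  using assms
proof (induction E arbitrary: C rule: finite_induct)
  case empty
  then show ?case
    by (intro exI[of _ "{}"]) simp
next
  case (insert a E)
  let ?Z = "zspan (R \<union> E)"
  define C' where "C' = C \<inter> ?Z"
  have sub_C': "add_subgroup C'"
    using insert.prems(1) add_subgroup_zspan[of "R \<union> E"]
    by (simp add: C'_def add_subgroup_def)
  have R_C': "R \<subseteq> C'" and C'_Z: "C' \<subseteq> ?Z"
    using insert.prems(2) by (auto simp: C'_def intro: zspan_base)
  obtain E' where E': "finite E'" "E' \<subseteq> C'" "C' \<subseteq> zspan (R \<union> E')"
    using insert.IH[OF sub_C' R_C' C'_Z] by (elim exE conjE) (rule that)
  have split: "\<exists>y\<in>?Z. \<exists>m. c = y + frag_cmul m a" if "c \<in> C" for c
    using zspan_insert[of c a "R \<union> E"] insert.prems(3) that by auto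
  define P where "P m \<longleftrightarrow> m > 0 \<and> (\<exists>y\<in>?Z. y + frag_cmul (int m) a \<in> C)" for m
  show ?case
  proof (cases "\<exists>m. P m")
    case True
    define d where "d = (LEAST m. P m)"
    have "P d"
      unfolding d_def using True by (rule LeastI_ex)
    then obtain y where y: "y \<in> ?Z" "y + frag_cmul (int d) a \<in> C" and d: "d > 0"
      by (auto simp: P_def)
    let ?h = "y + frag_cmul (int d) a"
    have "c \<in> zspan (R \<union> insert ?h E')" if c: "c \<in> C" for c
    proof -
      obtain z m where z: "z \<in> ?Z" "c = z + frag_cmul m a"
        using split[OF c] by blast
      let ?q = "m div int d"
      have eq: "c - frag_cmul ?q ?h = (z - frag_cmul ?q y) + frag_cmul (m mod int d) a"
        unfolding z(2) by (rule poly_mapping_eqI)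
          (simp add: lookup_add lookup_minus algebra_simps minus_div_mult_eq_mod[symmetric])
      have mem: "z - frag_cmul ?q y \<in> ?Z"
        by (intro zspan_diff z(1) add_subgroup_frag_cmul y(1)) simp
      have inC: "c - frag_cmul ?q ?h \<in> C"
        by (intro add_subgroupD(2)[OF insert.prems(1)] c add_subgroup_frag_cmul[OF insert.prems(1)] y(2))
      have "m mod int d = 0"
      proof (rule ccontr)
        assume "m mod int d \<noteq> 0"
        moreover have "0 \<le> m mod int d" "m mod int d < int d"
          using d by simp_all
        ultimately have "nat (m mod int d) > 0" "nat (m mod int d) < d" "int (nat (m mod int d)) = m mod int d"
          by linarith+
        moreover have "P (nat (m mod int d))"
          unfolding P_def using calculation inC mem eq by auto
        ultimately show False
          using not_less_Least[of "nat (m mod int d)" P] by (simp add: d_def)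
      qed
      then have "c - frag_cmul ?q ?h \<in> C'"
        using inC mem unfolding eq by (simp add: C'_def)
      then have "c - frag_cmul ?q ?h \<in> zspan (R \<union> insert ?h E')"
        using E'(3) zspan_mono[of "R \<union> E'" "R \<union> insert ?h E'"] by blast
      moreover have "frag_cmul ?q ?h \<in> zspan (R \<union> insert ?h E')"
        by (intro add_subgroup_frag_cmul zspan_base) simp_all
      ultimately have "(c - frag_cmul ?q ?h) + frag_cmul ?q ?h \<in> zspan (R \<union> insert ?h E')"
        by (rule add_subgroupD(4)[OF add_subgroup_zspan])
      then show ?thesis
        by simp
    qed
    then show ?thesis
      using E' y(2) by (intro exI[of _ "insert ?h E'"]) (auto simp: C'_def)
  next
    case False
    have "c \<in> ?Z" if c: "c \<in> C" for c
    proof -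
      obtain z m where z: "z \<in> ?Z" "c = z + frag_cmul m a"
        using split[OF c] by blast
      have "m = 0"
      proof (rule ccontr)
        assume "m \<noteq> 0"
        then consider "m > 0" | "m < 0"
          by linarith
        then show False
        proof cases
          case 1
          then have "P (nat m)"
            using z c by (auto simp: P_def)
          then show False
            using False by blast
        next
          case 2
          have "- c \<in> C" "- z \<in> ?Z"
            using add_subgroupD(3)[OF insert.prems(1) c] add_subgroupD(3)[OF add_subgroup_zspan z(1)] .
          moreover have "- c = - z + frag_cmul (int (nat (- m))) a"
            using 2 by (simp add: z(2) minus_frag_cmul)
          ultimately have "\<exists>y\<in>?Z. y + frag_cmul (int (nat (- m))) a \<in> C"
            by (intro bexI[of _ "- z"]) (simp_all only:)
          then have "P (nat (- m))"
            using 2 by (simp add: P_def)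
          then show False
            using False by blast
        qed
      qed
      then show ?thesis
        using z by simp
    qed
    then have "C' = C"
      by (auto simp: C'_def)
    then show ?thesis
      using E' by blast
  qed
qed

text \<open>Modulo \<open>K\<close> the coefficient of a generator matters only modulo its torsion
  exponent.\<close>

lemma finite_torsion_quotient:
  fixes K :: "('a \<Rightarrow>\<^sub>0 int) set"
  assumes "finite E" "add_subgroup K" "\<And>e. e \<in> E \<Longrightarrow> \<exists>m>0. frag_cmul m e \<in> K"
  shows "\<exists>T. finite T \<and> (\<forall>c\<in>zspan (K \<union> E). \<exists>t\<in>T. cg K c t)"
  using assms(1,3)
proof (induction E rule: finite_induct)
  case empty
  have "zspan K \<subseteq> K"
    by (rule zspan_least[OF order_refl assms(2)])
  then have "\<forall>c\<in>zspan (K \<union> {}). \<exists>t\<in>{0}. cg K c t"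
    by (auto simp: cg_0_iff)
  then show ?case
    by blast
next
  case (insert a E)
  then obtain T where T: "finite T" "\<And>c. c \<in> zspan (K \<union> E) \<Longrightarrow> \<exists>t\<in>T. cg K c t"
    by auto
  obtain m where m: "m > 0" "frag_cmul m a \<in> K"
    using insert.prems by blast
  define T' where "T' = (\<lambda>(t, i). t + frag_cmul i a) ` (T \<times> {0..<m})"
  have "\<exists>t\<in>T'. cg K c t" if c: "c \<in> zspan (K \<union> insert a E)" for c
  proof -
    obtain y j where y: "y \<in> zspan (K \<union> E)" "c = y + frag_cmul j a"
      using zspan_insert[of c a "K \<union> E"] c by auto
    obtain t where t: "t \<in> T" "cg K y t"
      using T(2)[OF y(1)] by blast
    have "frag_cmul j a - frag_cmul (j mod m) a = frag_cmul (j div m) (frag_cmul m a)"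
      by (simp add: frag_cmul_diff_distrib[symmetric] minus_mod_eq_div_mult)
    then have "cg K (frag_cmul j a) (frag_cmul (j mod m) a)"
      using add_subgroup_frag_cmul[OF assms(2) m(2)] by (simp add: cg_def)
    then have "cg K c (t + frag_cmul (j mod m) a)"
      unfolding y(2) by (rule cg_add[OF assms(2) t(2)])
    moreover have "t + frag_cmul (j mod m) a \<in> T'"
      unfolding T'_def using t(1) m(1) by (intro image_eqI[of _ _ "(t, j mod m)"]) simp_all
    ultimately show ?thesis
      by blast
  qed
  moreover have "finite T'"
    unfolding T'_def using T(1) by simp
  ultimately show ?case
    by blast
qed

section \<open>Rational generation by hyperbolic cycles\<close>

definition fun_scale :: "rat \<Rightarrow> ('x \<Rightarrow> rat) \<Rightarrow> 'x \<Rightarrow> rat" where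
  "fun_scale q f = (\<lambda>x. q * f x)"

lemma vector_space_fun_scale: "vector_space (fun_scale :: rat \<Rightarrow> ('x \<Rightarrow> rat) \<Rightarrow> 'x \<Rightarrow> rat)"
  by unfold_locales (simp_all add: fun_scale_def fun_eq_iff algebra_simps)

lemma vector_space_rat: "vector_space ((*) :: rat \<Rightarrow> rat \<Rightarrow> rat)"
  by unfold_locales (simp_all add: algebra_simps)

text \<open>The duality that turns torsion into a question about cocycles. Clearing denominators
  shows that \<open>c\<close> lies outside the rational span of \<open>S\<close>, in the vector
  space of rational functions on \<open>'x\<close>; there a functional can be prescribed on a
  basis.\<close>

lemma rational_separation:
  fixes S :: "('x \<Rightarrow>\<^sub>0 int) set"
  assumes "\<And>m. m > 0 \<Longrightarrow> frag_cmul m c \<notin> zspan S"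
  shows "\<exists>f :: ('x \<Rightarrow>\<^sub>0 int) \<Rightarrow> rat. (\<forall>a b. f (a - b) = f a - f b) \<and> (\<forall>s\<in>S. f s = 0) \<and> f c = 1"
proof -
  interpret F: vector_space "fun_scale :: rat \<Rightarrow> ('x \<Rightarrow> rat) \<Rightarrow> 'x \<Rightarrow> rat"
    by (rule vector_space_fun_scale)
  interpret FQ: vector_space_pair "fun_scale :: rat \<Rightarrow> ('x \<Rightarrow> rat) \<Rightarrow> 'x \<Rightarrow> rat" "(*) :: rat \<Rightarrow> rat \<Rightarrow> rat"
    by (intro vector_space_pair.intro vector_space_fun_scale vector_space_rat)
  define \<iota> where "\<iota> a = (\<lambda>x. of_int (Poly_Mapping.lookup a x) :: rat)" for a :: "'x \<Rightarrow>\<^sub>0 int"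
  have \<iota>_diff: "\<iota> (a - b) = \<iota> a - \<iota> b" for a b
    by (simp add: \<iota>_def fun_eq_iff lookup_minus)
  have \<iota>_cmul: "\<iota> (frag_cmul m a) = fun_scale (of_int m) (\<iota> a)" for m a
    by (simp add: \<iota>_def fun_scale_def fun_eq_iff)
  have \<iota>_inj: "\<iota> a = \<iota> b \<Longrightarrow> a = b" for a b
    by (rule poly_mapping_eqI) (simp add: \<iota>_def fun_eq_iff)
  have clear: "\<exists>m>0. \<exists>z\<in>zspan S. fun_scale (of_int m) y = \<iota> z" if "y \<in> F.span (\<iota> ` S)" for y
    using that
  proof (induction rule: F.span_induct_alt)
    case base
    show ?case
      by (intro exI[of _ 1] conjI bexI[of _ 0]) (simp_all add: zspan_zero \<iota>_def fun_scale_def fun_eq_iff)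
  next
    case (step q x y)
    obtain m z where m: "m > 0" "z \<in> zspan S" "fun_scale (of_int m) y = \<iota> z"
      using step(2) by blast
    obtain s where s: "s \<in> S" "x = \<iota> s"
      using step(1) by blast
    obtain a b where q: "q = of_int a / of_int b" "b > 0"
      using quotient_of_div[of q "fst (quotient_of q)" "snd (quotient_of q)"] quotient_of_denom_pos'[of q] by auto
    have "of_int m * y t = of_int (Poly_Mapping.lookup z t)" for t
      using fun_cong[OF m(3), of t] by (simp add: fun_scale_def \<iota>_def)
    then have "of_int (b * m) * (q * of_int (Poly_Mapping.lookup s t) + y t)
      = of_int (m * a * Poly_Mapping.lookup s t + b * Poly_Mapping.lookup z t)" for t
      using q by (simp add: field_simps)
    then have "fun_scale (of_int (b * m)) (fun_scale q x + y) = \<iota> (frag_cmul (m * a) s + frag_cmul b z)"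
      by (simp add: fun_scale_def \<iota>_def fun_eq_iff s(2) lookup_add)
    moreover have "frag_cmul (m * a) s + frag_cmul b z \<in> zspan S"
      by (intro add_subgroupD(4)[OF add_subgroup_zspan]
        add_subgroup_frag_cmul[OF add_subgroup_zspan] zspan_base s(1) m(2))
    moreover have "b * m > 0"
      using q(2) m(1) by simp
    ultimately show ?case
      by blast
  qed
  have "\<iota> c \<notin> F.span (\<iota> ` S)"
  proof
    assume "\<iota> c \<in> F.span (\<iota> ` S)"
    then obtain m z where m: "m > 0" "z \<in> zspan S" "fun_scale (of_int m) (\<iota> c) = \<iota> z"
      using clear by blast
    then have "frag_cmul m c = z"
      by (intro \<iota>_inj) (simp add: \<iota>_cmul)
    then show False
      using assms[OF m(1)] m(2) by simp
  qed
  moreover obtain B where B: "B \<subseteq> \<iota> ` S" "F.independent B" "\<iota> ` S \<subseteq> F.span B"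
    using F.maximal_independent_subset by blast
  moreover have "F.span B = F.span (\<iota> ` S)"
    using B F.span_mono F.span_minimal[OF B(3)] by (metis F.subspace_span subset_antisym)
  ultimately have "\<iota> c \<notin> F.span B"
    by simp
  then have ind: "F.independent (insert (\<iota> c) B)"
    by (rule F.independent_insertI[OF _ B(2)])
  obtain g where g: "Vector_Spaces.linear fun_scale (*) g" "\<And>x. x \<in> insert (\<iota> c) B \<Longrightarrow> g x = (if x = \<iota> c then 1 else 0)"
    using FQ.linear_independent_extend[OF ind, of "\<lambda>x. if x = \<iota> c then 1 else 0"] by blast
  interpret g: Vector_Spaces.linear fun_scale "(*)" g
    by (rule g(1))
  have "g x = 0" if "x \<in> F.span B" for x
    using that
  proof (induction rule: F.span_induct_alt)
    case base
    then show ?case by (rule g.zero)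
  next
    case (step q x y)
    moreover have "x \<noteq> \<iota> c"
      using step(1) \<open>\<iota> c \<notin> F.span B\<close> F.span_base by blast
    ultimately show ?case
      unfolding g.add g.scale using g(2)[of x] by simp
  qed
  then have "\<forall>s\<in>S. g (\<iota> s) = 0"
    using B(3) by blast
  moreover have "g (\<iota> c) = 1"
    using g(2)[of "\<iota> c"] by simp
  ultimately show ?thesis
    by (intro exI[of _ "\<lambda>a. g (\<iota> a)"]) (simp add: \<iota>_diff g.diff)
qed

lemma qf_eq_Q_mat:
  assumes "trace A \<noteq> 0"
  shows "qf A = of_int (- sgn (trace A) * mat_content A) * Q_mat A"
proof -
  have s: "sgn (trace A) * sgn (trace A) = 1"
    using assms by (auto simp: sgn_if)
  have "of_int (- sgn (trace A)) * (of_int (mat_content A) * Q_mat A) = of_int (sgn (trace A) * sgn (trace A)) * qf A"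
    unfolding Q_mat_qf by (simp only: of_int_mult of_int_minus minus_mult_minus mult.assoc)
  then show ?thesis
    unfolding s by (simp add: mult.assoc)
qed

context level
begin

lemma Gamma1_mk: "[a = 1] (mod int N) \<Longrightarrow> [c = 0] (mod int N) \<Longrightarrow> [d = 1] (mod int N) \<Longrightarrow> a * d - b * c = 1 \<Longrightarrow> mk a b c d \<in> \<Gamma>"
  using Gamma1_sub by (auto simp: Gamma1_def SL2Z_def M2plus_def)

lemma T_in: "mk 1 1 0 1 \<in> \<Gamma>"
  by (rule Gamma1_mk) simp_all

lemma U_in: "mk 1 0 (int N * m) 1 \<in> \<Gamma>"
  by (rule Gamma1_mk) (simp_all add: cong_0_iff)

text \<open>A cycle without a multiple in \<open>KH\<close> is detected by a functional that kills
  the relations and the hyperbolic chains. Composed with \<open>ch\<close> it is a rational cocycle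
  as treated above, hence the coboundary of some \<open>L\<close>. Then the functional equals
  \<open>L\<close> applied to the boundary and vanishes on cycles.\<close>

lemma cycle_torsion:
  assumes c: "c \<in> chains" "bd c = 0"
  shows "\<exists>m>0. frag_cmul m c \<in> KH"
proof (rule ccontr)
  assume "\<not> ?thesis"
  then have "\<And>m. m > 0 \<Longrightarrow> frag_cmul m c \<notin> KH"
    by blast
  then obtain f :: "_ \<Rightarrow> rat" where diff: "\<And>a b. f (a - b) = f a - f b" and 0: "\<And>s. s \<in> R \<union> hyp \<Longrightarrow> f s = 0" and fc: "f c = 1"
    using rational_separation[of c "R \<union> hyp"] by blast
  have f0: "f 0 = 0"
    using diff[of 0 0] by simp
  have f_minus: "f (- a) = - f a" for a
    using diff[of 0 a] f0 by simp
  have add: "f (a + b) = f a + f b" for a b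
    using diff[of a "- b"] f_minus by simp
  have f_cg: "f a = f b" if "cg R a b" for a b
    using 0[of "a - b"] that diff[of a b] by (simp add: cg_def)
  define \<phi> where "\<phi> A v = f (ch (cls A) v)" for A v
  have ad: "additive_on (V (2 * k)) (\<phi> A)" if "A \<in> \<Gamma>" for A
    unfolding additive_on_def \<phi>_def using that f_cg[OF ch_add] add by auto
  have rc: "rational_cocycle \<Gamma> N k \<phi>"
  proof unfold_locales
    show "mk 1 0 (int N) 1 \<in> \<Gamma>"
      using U_in[of 1] by simp
    show "additive_on (V (2 * k)) (\<phi> A)" if "A \<in> \<Gamma>" for A
      using that by (rule ad)
    show "\<phi> (A ** B) v = \<phi> A (act B v) + \<phi> B v" if "A \<in> \<Gamma>" "B \<in> \<Gamma>" "v \<in> V (2 * k)" for A B v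
      using f_cg[OF ch_mult[of "cls A" "cls B" v]] that by (simp add: \<phi>_def cls_mult add act_cls_n)
    show "\<phi> (- A) v = \<phi> A v" for A v
      by (simp add: \<phi>_def cls_neg)
    show "\<phi> A (qf A ^ k) = 0" if A: "A \<in> \<Gamma>" "2 < \<bar>trace A\<bar>" for A
    proof -
      have "ch (cls A) (Q_mat A ^ k) \<in> hyp"
        unfolding hyp_def using A by (auto simp: hyperbolic_cls Q_cls intro!: exI[of _ "cls A"])
      then have "\<phi> A (Q_mat A ^ k) = 0"
        unfolding \<phi>_def by (intro 0) blast
      moreover define z where "z = - sgn (trace A) * mat_content A"
      have "qf A = of_int z * Q_mat A"
        unfolding z_def using A(2) by (intro qf_eq_Q_mat) auto
      then have "qf A ^ k = of_int (z ^ k) * Q_mat A ^ k"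
        by (simp only: power_mult_distrib of_int_power)
      ultimately show ?thesis
        using additive_on_of_int[OF ad[OF A(1)] V_power[OF Q_mat_V]] by (simp only: mult_zero_right)
    qed
  qed (fact N_pos det_1 mult_in T_in)+
  obtain L where L: "additive_on (V n) L" "\<And>A v. A \<in> \<Gamma> \<Longrightarrow> v \<in> V n \<Longrightarrow> \<phi> A v = L (act A v) - L v"
    using rational_cocycle.coboundary[OF rc] by blast
  have "f c = L (bd c)"
    using c(1)
  proof (induction rule: chains_induct)
    case zero
    show ?case
      using f0 additive_on_0[OF L(1)] by simp
  next
    case (rel c)
    then show ?case
      using 0 bd_R additive_on_0[OF L(1)] by simp
  next
    case (ch g v)
    then obtain A where A: "A \<in> \<Gamma>" "g = cls A"
      by blast
    then show ?case
      using L(2)[OF A(1) ch(2)] additive_on_diff[OF L(1) V_act[OF ch(2)] ch(2)] ch(2)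
      by (simp add: bd_ch \<phi>_def act_cls_n)
  next
    case (diff a b)
    then show ?case
      using additive_on_diff[OF L(1) bd_V bd_V] by (simp add: bd_diff \<open>\<And>a b. f (a - b) = f a - f b\<close>)
  qed
  then show False
    using fc c(2) additive_on_0[OF L(1)] by simp
qed

section \<open>Finiteness modulo the hyperbolic cycles\<close>

definition cycles where "cycles = {c \<in> chains. bd c = 0}"

lemma add_subgroup_cycles: "add_subgroup cycles"
  using add_subgroup_chains by (simp add: cycles_def add_subgroup_def bd_diff)

lemma KH_cycles: "KH \<subseteq> cycles"
  using KH_chains bd_KH by (auto simp: cycles_def)

lemma cycles_finite_quotient: "\<exists>T. finite T \<and> (\<forall>c\<in>cycles. \<exists>t\<in>T. cg KH c t)"
proof -
  obtain E where E: "finite E" "E \<subseteq> chains" "chains = zspan (R \<union> E)"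
    using chains_finitely_generated by blast
  have "R \<subseteq> cycles" "cycles \<subseteq> zspan (R \<union> E)"
    using R_chains bd_R E(3) by (auto simp: cycles_def)
  from finitely_generated_subgroup[OF E(1) add_subgroup_cycles this]
  obtain E' where E': "finite E'" "E' \<subseteq> cycles" "cycles \<subseteq> zspan (R \<union> E')"
    by (elim exE conjE) (rule that)
  have "\<exists>m>0. frag_cmul m e \<in> KH" if "e \<in> E'" for e
    using cycle_torsion[of e] E'(2) that by (auto simp: cycles_def)
  then have "\<exists>T. finite T \<and> (\<forall>c\<in>zspan (KH \<union> E'). \<exists>t\<in>T. cg KH c t)"
    by (intro finite_torsion_quotient[OF E'(1) add_subgroup_zspan])
  then obtain T where T: "finite T" "\<forall>c\<in>zspan (KH \<union> E'). \<exists>t\<in>T. cg KH c t"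
    by (elim exE conjE) (rule that)
  have "zspan (R \<union> E') \<subseteq> zspan (KH \<union> E')"
    using R_KH by (intro zspan_mono) blast
  then have "\<forall>c\<in>cycles. \<exists>t\<in>T. cg KH c t"
    using T(2) E'(3) by (meson subsetD)
  then show ?thesis
    using T(1) by (intro exI[of _ T] conjI)
qed

end

section \<open>Congruences between forms\<close>

text \<open>Multiplication by \<open>a\<close> permutes the nonzero residues, so it preserves their
  product, which is a unit.\<close>

lemma fermat_int:
  fixes a :: int
  assumes p: "prime p" and a: "\<not> int p dvd a"
  shows "int p dvd a ^ (p - 1) - 1"
proof -
  let ?S = "{1..<int p}"
  have cop: "coprime (x::int) (int p)" if "\<not> int p dvd x" for x
    using that prime_imp_coprime[of "int p" x] p by (simp add: coprime_commute)
  have S: "\<not> int p dvd x" if "x \<in> ?S" for x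
    using that zdvd_imp_le[of "int p" x] by auto
  have "inj_on (\<lambda>x. a * x mod int p) ?S"
  proof (rule inj_onI)
    fix x y assume xy: "x \<in> ?S" "y \<in> ?S" "a * x mod int p = a * y mod int p"
    then have "[x = y] (mod int p)"
      using cong_mult_lcancel[OF cop[OF a]] by (simp add: cong_def)
    then show "x = y"
      using xy(1,2) by (simp add: cong_def)
  qed
  moreover have "(\<lambda>x. a * x mod int p) ` ?S \<subseteq> ?S"
  proof safe
    fix x assume x: "x \<in> ?S"
    have "\<not> int p dvd a * x"
      using a S[OF x] p by (simp add: prime_dvd_mult_iff)
    then have "a * x mod int p \<noteq> 0"
      by (simp add: dvd_eq_mod_eq_0)
    moreover have "0 \<le> a * x mod int p" "a * x mod int p < int p"
      using prime_gt_0_nat[OF p] by simp_all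
    ultimately show "a * x mod int p \<in> ?S"
      by simp
  qed
  ultimately have "(\<Prod>x\<in>?S. a * x mod int p) = \<Prod>?S"
    using endo_inj_surj[of ?S] by (intro prod.reindex_bij_betw[where g = "\<lambda>x. x"]) (simp add: bij_betw_def)
  moreover have "[(\<Prod>x\<in>?S. a * x mod int p) = (\<Prod>x\<in>?S. a * x)] (mod int p)"
    by (intro cong_prod) simp
  moreover have *: "nat (int p - 1) = p - Suc 0"
    by linarith
  ultimately have "[1 * \<Prod>?S = a ^ (p - 1) * \<Prod>?S] (mod int p)"
    using * by (simp add: prod.distrib)
  moreover have "coprime (\<Prod>?S) (int p)"
    by (intro prod_coprime_left cop S)
  ultimately have "[1 = a ^ (p - 1)] (mod int p)"
    by (simp only: cong_mult_rcancel)
  then show ?thesis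
    by (simp add: cong_iff_dvd_diff dvd_diff_commute)
qed

text \<open>The quotient form is kept homogeneous of degree \<open>d\<close>, because a chain is
  built from it in \<open>ch_form_cong\<close>.\<close>

definition form_cong :: "int \<Rightarrow> nat \<Rightarrow> poly2 \<Rightarrow> poly2 \<Rightarrow> bool" where
  "form_cong p d P P' \<longleftrightarrow> P' \<in> V d \<and> (\<exists>w\<in>V d. P = P' + of_int p * w)"

lemma form_cong_V: "form_cong p d P P' \<Longrightarrow> P \<in> V d" "form_cong p d P P' \<Longrightarrow> P' \<in> V d"
  by (auto simp: form_cong_def intro: V_add V_of_int_mult)

lemma form_congI: "P' \<in> V d \<Longrightarrow> w \<in> V d \<Longrightarrow> P = P' + of_int p * w \<Longrightarrow> form_cong p d P P'"
  by (auto simp: form_cong_def)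

lemma form_cong_refl: "P \<in> V d \<Longrightarrow> form_cong p d P P"
  by (rule form_congI[of _ _ 0]) simp_all

lemma form_cong_add:
  assumes "form_cong p d P P'" "form_cong p d S S'"
  shows "form_cong p d (P + S) (P' + S')"
proof -
  obtain w w' where w: "w \<in> V d" "P = P' + of_int p * w" "w' \<in> V d" "S = S' + of_int p * w'"
    using assms unfolding form_cong_def by blast
  show ?thesis
    by (rule form_congI[of _ _ "w + w'"]) (use w assms form_cong_V in \<open>auto simp: algebra_simps intro: V_add\<close>)
qed

lemma form_cong_mult:
  assumes "form_cong p d P P'" "form_cong p d' S S'"
  shows "form_cong p (d + d') (P * S) (P' * S')"
proof -
  obtain w w' where w: "w \<in> V d" "P = P' + of_int p * w" "w' \<in> V d'" "S = S' + of_int p * w'"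
    using assms unfolding form_cong_def by blast
  note V = form_cong_V[OF assms(1)] form_cong_V[OF assms(2)]
  show ?thesis
  proof (rule form_congI[of _ _ "P * w' + w * S'"])
    show "P' * S' \<in> V (d + d')" "P * w' + w * S' \<in> V (d + d')"
      by (intro V_add V_mult w V)+
    show "P * S = P' * S' + of_int p * (P * w' + w * S')"
      unfolding w(2,4) by (simp add: algebra_simps)
  qed
qed

lemma form_cong_power: "form_cong p d P P' \<Longrightarrow> form_cong p (d * m) (P ^ m) (P' ^ m)"
proof (induction m)
  case 0
  then show ?case
    by (simp add: form_cong_refl V_1)
next
  case (Suc m)
  then show ?case
    using form_cong_mult[OF Suc.prems Suc.IH] by simp
qed

lemma form_cong_of_int_mult: "form_cong p d P P' \<Longrightarrow> form_cong p d (of_int a * P) (of_int a * P')"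
  using form_cong_mult[OF form_cong_refl[OF V_of_int]] by fastforce

lemma form_cong_sum: "(\<And>x. x \<in> S \<Longrightarrow> form_cong p d (f x) (g x)) \<Longrightarrow> form_cong p d (sum f S) (sum g S)"
  by (induction S rule: infinite_finite_induct) (auto intro: form_cong_add form_cong_refl)

lemma form_cong_linear:
  assumes "p dvd a"
  shows "form_cong p (Suc 0) (of_int a * X1 + of_int b * X2) (of_int b * X2)"
proof -
  obtain a' where "a = p * a'"
    using assms by blast
  then show ?thesis
    using V_of_int_mult[OF V_X1, of a'] V_of_int_mult[OF V_X2, of b]
    by (intro form_congI[of _ _ "of_int a' * X1"]) (simp_all add: algebra_simps)
qed

text \<open>This is what makes \<open>T\<^sub>p\<close> contract modulo \<open>p\<close>.\<close>

lemma form_cong_act: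
  assumes "p dvd M$2$1" "p dvd M$2$2" "v \<in> V d"
  shows "\<exists>m. form_cong p d (act M v) (of_int m * X2 ^ d)"
proof -
  obtain a where a: "v = (\<Sum>j\<le>d. of_int (a j) * X1 ^ (d - j) * X2 ^ j)"
    using assms(3) V_iff_sum by blast
  have 1: "form_cong p (Suc 0) (act M X1) (of_int (- M$1$2) * X2)"
    using form_cong_linear[OF assms(2), of "- M$1$2"] by simp
  have 2: "form_cong p (Suc 0) (act M X2) (of_int (M$1$1) * X2)"
    using form_cong_linear[of p "- M$2$1" "M$1$1"] assms(1) by simp
  have "form_cong p d (of_int (a j) * (act M X1 ^ (d - j) * act M X2 ^ j))
      (of_int (a j * ((- M$1$2) ^ (d - j) * (M$1$1) ^ j)) * X2 ^ d)" if "j \<le> d" for j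
  proof -
    have "form_cong p (Suc 0 * (d - j) + Suc 0 * j) (act M X1 ^ (d - j) * act M X2 ^ j)
      ((of_int (- M$1$2) * X2) ^ (d - j) * (of_int (M$1$1) * X2) ^ j)"
      by (intro form_cong_mult form_cong_power 1 2)
    moreover have "(of_int (- M$1$2) * X2) ^ (d - j) * (of_int (M$1$1) * X2) ^ j
      = of_int ((- M$1$2) ^ (d - j) * (M$1$1) ^ j) * (X2 ^ (d - j) * X2 ^ j)"
      by (simp only: power_mult_distrib of_int_mult of_int_power mult_ac)
    moreover have "X2 ^ (d - j) * X2 ^ j = X2 ^ d"
      using that by (simp flip: power_add)
    ultimately have "form_cong p d (act M X1 ^ (d - j) * act M X2 ^ j) (of_int ((- M$1$2) ^ (d - j) * (M$1$1) ^ j) * X2 ^ d)"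
      using that by simp
    from form_cong_of_int_mult[OF this, of "a j"] show ?thesis
      by (simp only: of_int_mult mult.assoc)
  qed
  then have 3: "form_cong p d (\<Sum>j\<le>d. of_int (a j) * (act M X1 ^ (d - j) * act M X2 ^ j))
      (\<Sum>j\<le>d. of_int (a j * ((- M$1$2) ^ (d - j) * (M$1$1) ^ j)) * X2 ^ d)"
    by (intro form_cong_sum) simp
  have 4: "act M v = (\<Sum>j\<le>d. of_int (a j) * (act M X1 ^ (d - j) * act M X2 ^ j))"
    unfolding a by (simp add: act_sum act_mult act_power mult.assoc del: act_X1 act_X2)
  have 5: "(\<Sum>j\<le>d. of_int (a j * ((- M$1$2) ^ (d - j) * (M$1$1) ^ j)) * X2 ^ d)
      = of_int (\<Sum>j\<le>d. a j * ((- M$1$2) ^ (d - j) * (M$1$1) ^ j)) * X2 ^ d"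
    by (simp add: sum_distrib_right)
  show ?thesis
    using 3 unfolding 4[symmetric] 5 by (rule exI)
qed

lemma form_cong_act_X2:
  assumes "p dvd A$2$1"
  shows "form_cong p d (act A (X2 ^ d)) (of_int (A$1$1 ^ d) * X2 ^ d)"
proof -
  have "form_cong p (Suc 0) (act A X2) (of_int (A$1$1) * X2)"
    using form_cong_linear[of p "- A$2$1" "A$1$1"] assms by simp
  from form_cong_power[OF this, of d] show ?thesis
    by (simp add: act_power power_mult_distrib del: act_X2)
qed

section \<open>The operator \<open>T\<^sub>p\<close> modulo \<open>p\<close>\<close>

context level
begin

context
  fixes p :: nat
  assumes p: "prime p"
begin

text \<open>All chains, not only the cycles, are multiplied by \<open>p\<close>, since the
  congruences below concern single terms that are not cycles. The return to cycles takes place in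
  \<open>hc_divisible\<close>.\<close>

abbreviation Kp where "Kp \<equiv> zspan (KH \<union> (frag_cmul (int p) ` chains))"

lemma Kp_eq: "c \<in> Kp \<Longrightarrow> \<exists>z\<in>KH. \<exists>c'\<in>chains. c = z + frag_cmul (int p) c'"
proof (induction rule: zspan.induct)
  case zspan_zero
  show ?case
    using add_subgroupD(1)[OF add_subgroup_chains]
    by (intro bexI[of _ 0]) (auto intro: zspan.zspan_zero)
next
  case (zspan_base x)
  then show ?case
  proof
    assume "x \<in> KH"
    then show ?thesis
      using add_subgroupD(1)[OF add_subgroup_chains] by (intro bexI[of _ x] bexI[of _ 0]) simp_all
  next
    assume "x \<in> frag_cmul (int p) ` chains"
    then obtain c' where "c' \<in> chains" "x = frag_cmul (int p) c'"
      by blast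
    then show ?thesis
      by (intro bexI[of _ 0] bexI[of _ c']) (simp_all add: zspan.zspan_zero)
  qed
next
  case (zspan_diff x y)
  then obtain z c z' c' where "z \<in> KH" "c \<in> chains" "x = z + frag_cmul (int p) c"
    "z' \<in> KH" "c' \<in> chains" "y = z' + frag_cmul (int p) c'"
    by blast
  then show ?case
    using add_subgroupD(2)[OF add_subgroup_chains]
    by (intro bexI[of _ "z - z'"] bexI[of _ "c - c'"]) (simp_all add: frag_cmul_diff zspan.zspan_diff)
qed

lemma sub_Kp: "add_subgroup Kp"
  by simp

lemma KH_Kp: "KH \<subseteq> Kp"
  by (auto intro: zspan_base)

lemma R_Kp: "R \<subseteq> Kp"
  using R_KH KH_Kp by blast

lemma cg_Kp: "cg R a b \<Longrightarrow> cg Kp a b"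
  by (rule cg_mono[OF R_Kp])

lemma p_Kp: "c \<in> chains \<Longrightarrow> int p dvd m \<Longrightarrow> frag_cmul m c \<in> Kp"
proof -
  assume c: "c \<in> chains" and "int p dvd m"
  then obtain l where "m = int p * l" by blast
  then have eq: "frag_cmul m c = frag_cmul (int p) (frag_cmul l c)"
    by simp
  show ?thesis
    unfolding eq by (intro zspan_base UnI2 imageI add_subgroup_frag_cmul[OF add_subgroup_chains c])
qed

lemma cmul_cong_Kp: "c \<in> chains \<Longrightarrow> int p dvd m - l \<Longrightarrow> cg Kp (frag_cmul m c) (frag_cmul l c)"
  using p_Kp[of c "m - l"] by (simp add: cg_def frag_cmul_diff_distrib)

text \<open>By Bezout, integers prime to \<open>p\<close> act invertibly on the chains modulo
  \<open>p\<close> times the chains.\<close>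

lemma unit_cancel:
  assumes "c \<in> chains" "\<not> int p dvd m" "frag_cmul m c \<in> Kp"
  shows "c \<in> Kp"
proof -
  have "coprime m (int p)"
    using assms(2) p by (meson coprime_commute prime_imp_coprime prime_nat_int_transfer)
  then obtain u v where uv: "u * m + v * int p = 1"
    by (metis bezout_int coprime_iff_gcd_eq_1)
  have "frag_cmul (v * int p) c \<in> Kp"
    by (rule p_Kp[OF assms(1)]) simp
  then have "frag_cmul u (frag_cmul m c) + frag_cmul (v * int p) c \<in> Kp"
    by (rule add_subgroupD(4)[OF sub_Kp add_subgroup_frag_cmul[OF sub_Kp assms(3)]])
  then show ?thesis
    by (simp add: frag_cmul_distrib[symmetric] uv)
qed

lemma ch_form_cong:
  assumes "g \<in> G" "form_cong (int p) n v v'"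
  shows "cg Kp (ch g v) (ch g v')"
proof -
  obtain w where w: "w \<in> V n" "v = v' + of_int (int p) * w" and v': "v' \<in> V n"
    using assms(2) by (auto simp: form_cong_def)
  have 1: "cg R (ch g v) (ch g v' + ch g (of_int (int p) * w))"
    unfolding w(2) using assms(1) v' w(1) by (intro ch_add V_of_int_mult)
  have 2: "cg R (ch g v' + ch g (of_int (int p) * w)) (ch g v' + frag_cmul (int p) (ch g w))"
    using assms(1) w(1) by (intro cg_add cg_refl ch_of_int) simp_all
  have 3: "cg Kp (ch g v' + frag_cmul (int p) (ch g w)) (ch g v' + 0)"
    using p_Kp[OF ch_chains[OF assms(1) w(1)], of "int p"]
    by (intro cg_add[OF sub_Kp] cg_refl[OF sub_Kp]) (simp add: cg_0_iff)
  show ?thesis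
    using cg_trans[OF sub_Kp cg_Kp[OF cg_trans[OF add_subgroup_R 1 2]] 3] by simp
qed

text \<open>The representatives send every form to a multiple of \<open>X2 ^ n\<close> modulo
  \<open>p\<close>, so the question is which of these particular chains lie in
  \<open>Kp\<close>.\<close>

definition \<kappa> where "\<kappa> A = ch (cls A) (X2 ^ n)"

lemma X2_V: "X2 ^ n \<in> V n"
  using V_power[OF V_X2, of n] by simp

lemma \<kappa>_chains: "A \<in> \<Gamma> \<Longrightarrow> \<kappa> A \<in> chains"
  unfolding \<kappa>_def by (intro ch_chains X2_V) simp

lemma ch_multiple:
  assumes "A \<in> \<Gamma>" "form_cong (int p) n v (of_int m * X2 ^ n)"
  shows "cg Kp (ch (cls A) v) (frag_cmul m (\<kappa> A))"
  unfolding \<kappa>_def using assms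
  by (intro cg_trans[OF sub_Kp ch_form_cong[OF _ assms(2)] cg_Kp[OF ch_of_int[OF _ X2_V]]]) simp_all

text \<open>Modulo \<open>p\<close> the form \<open>X2 ^ n\<close> is an eigenvector of
  \<open>B\<close> with eigenvalue \<open>B$1$1 ^ n\<close>, so the cocycle rule stays within the
  chains \<open>\<kappa> A\<close>.\<close>

lemma \<kappa>_mult:
  assumes "A \<in> \<Gamma>" "B \<in> \<Gamma>" "int p dvd B$2$1"
  shows "cg Kp (\<kappa> (A ** B)) (frag_cmul (B$1$1 ^ n) (\<kappa> A) + \<kappa> B)"
proof -
  have "cg R (ch (cls A \<cdot> cls B) (X2 ^ n)) (ch (cls A) (act_cls (cls B) (X2 ^ n)) + ch (cls B) (X2 ^ n))"
    using assms X2_V by (intro ch_mult) simp_all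
  then have 1: "cg Kp (\<kappa> (A ** B)) (ch (cls A) (act B (X2 ^ n)) + \<kappa> B)"
    using cg_Kp X2_V by (simp add: cls_mult \<kappa>_def act_cls_n)
  have 2: "cg Kp (ch (cls A) (act B (X2 ^ n)) + \<kappa> B) (frag_cmul (B$1$1 ^ n) (\<kappa> A) + \<kappa> B)"
    by (intro cg_add[OF sub_Kp] cg_refl[OF sub_Kp] ch_multiple assms form_cong_act_X2)
  show ?thesis
    by (rule cg_trans[OF sub_Kp 1 2])
qed

text \<open>The elements that are upper unipotent modulo \<open>p\<close>. The eigenvalue above is 1
  on them, and \<open>\<kappa>\<close> becomes additive.\<close>

definition G1 where "G1 = {A \<in> \<Gamma>. int p dvd A$2$1 \<and> int p dvd A$1$1 - 1}"

lemma dvd_power_minus_1: "int p dvd a - 1 \<Longrightarrow> int p dvd a ^ m - 1"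
  by (metis cong_iff_dvd_diff cong_pow power_one)

lemma \<kappa>_mult_G1:
  assumes "A \<in> \<Gamma>" "B \<in> G1"
  shows "cg Kp (\<kappa> (A ** B)) (\<kappa> A + \<kappa> B)"
proof -
  have "cg Kp (frag_cmul (B$1$1 ^ n) (\<kappa> A) + \<kappa> B) (frag_cmul 1 (\<kappa> A) + \<kappa> B)"
    using assms by (intro cg_add[OF sub_Kp] cg_refl[OF sub_Kp] cmul_cong_Kp \<kappa>_chains dvd_power_minus_1)
      (simp_all add: G1_def)
  then show ?thesis
    using cg_trans[OF sub_Kp \<kappa>_mult] assms by (simp add: G1_def)
qed

lemma \<kappa>_1: "\<kappa> (mat 1) \<in> Kp"
  using cg_Kp[OF ch_e[OF X2_V]] by (simp add: \<kappa>_def cg_0_iff)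

text \<open>For a hyperbolic \<open>A\<close> congruent to an upper unipotent matrix modulo \<open>p\<close> the invariant form
  is a multiple of \<open>X2\<^sup>2\<close> modulo \<open>p\<close>.\<close>

lemma \<kappa>_hyperbolic:
  assumes A: "A \<in> G1" and b: "\<not> int p dvd A$1$2" and tr: "\<bar>trace A\<bar> > 2"
  shows "\<kappa> A \<in> Kp"
proof -
  have AG: "A \<in> \<Gamma>" and c: "int p dvd A$2$1" and a: "int p dvd A$1$1 - 1"
    using A by (auto simp: G1_def)
  have det: "A$1$1 * A$2$2 - A$1$2 * A$2$1 = 1"
    using det_1[OF AG] by (simp add: det_mat2)
  have eq: "A$1$1 - A$2$2 = (A$1$1 - 1) + (A$1$1 - 1) * A$2$2 - A$1$2 * A$2$1"
    using det by (simp add: algebra_simps)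
  have d: "int p dvd A$1$1 - A$2$2"
    unfolding eq by (intro dvd_add dvd_diff dvd_mult2[OF a] dvd_mult[OF c] a)
  obtain c' d' where cd: "A$2$1 = int p * c'" "A$1$1 - A$2$2 = int p * d'"
    using c d by blast
  have q: "form_cong (int p) 2 (qf A) (of_int (- A$1$2) * X2\<^sup>2)"
  proof (rule form_congI)
    show "of_int (- A$1$2) * X2\<^sup>2 \<in> V 2" "of_int c' * X1\<^sup>2 - of_int d' * X1 * X2 \<in> V 2"
      using qf_V[of "mk 0 (A$1$2) 0 0"] qf_V[of "mk d' 0 c' 0"] by (simp_all add: qf_def)
    show "qf A = of_int (- A$1$2) * X2\<^sup>2 + of_int (int p) * (of_int c' * X1\<^sup>2 - of_int d' * X1 * X2)"
      unfolding qf_def cd by (simp add: algebra_simps)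
  qed
  define z where "z = - sgn (trace A) * mat_content A"
  have qz: "qf A = of_int z * Q_mat A"
    unfolding z_def using tr by (intro qf_eq_Q_mat) auto
  have g: "cls A \<in> G"
    using AG by blast
  have "hyperbolic (cls A)"
    using tr by (simp add: hyperbolic_cls)
  then have "ch (cls A) (Q (cls A) ^ k) \<in> KH"
    using g unfolding hyp_def by (intro zspan_base UnI2) blast
  then have "frag_cmul (z ^ k) (ch (cls A) (Q_mat A ^ k)) \<in> Kp"
    using KH_Kp by (intro add_subgroup_frag_cmul[OF sub_Kp]) (auto simp: Q_cls)
  moreover have "cg R (ch (cls A) (of_int (z ^ k) * Q_mat A ^ k)) (frag_cmul (z ^ k) (ch (cls A) (Q_mat A ^ k)))"
    by (rule ch_of_int[OF g V_power[OF Q_mat_V]])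
  then have "cg Kp (ch (cls A) (qf A ^ k)) (frag_cmul (z ^ k) (ch (cls A) (Q_mat A ^ k)))"
    unfolding qz power_mult_distrib of_int_power[symmetric] by (rule cg_Kp)
  ultimately have 1: "ch (cls A) (qf A ^ k) \<in> Kp"
    using cg_mem[OF sub_Kp] by blast
  have "(of_int (- A$1$2) * X2\<^sup>2) ^ k = of_int ((- A$1$2) ^ k) * X2 ^ n"
    by (simp only: power_mult_distrib power_mult[symmetric] of_int_power)
  then have "form_cong (int p) n (qf A ^ k) (of_int ((- A$1$2) ^ k) * X2 ^ n)"
    using form_cong_power[OF q, of k] by simp
  then have "cg Kp (ch (cls A) (qf A ^ k)) (frag_cmul ((- A$1$2) ^ k) (\<kappa> A))"
    by (rule ch_multiple[OF AG])
  then have "frag_cmul ((- A$1$2) ^ k) (\<kappa> A) \<in> Kp"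
    using 1 cg_mem[OF sub_Kp cg_sym[OF sub_Kp]] by blast
  moreover have "\<not> int p dvd (- A$1$2) ^ k"
    using b p by (metis dvd_minus_iff prime_dvd_power prime_nat_int_transfer)
  ultimately show ?thesis
    using unit_cancel[OF \<kappa>_chains[OF AG]] by blast
qed

lemma T_power_G1: "mk 1 (int m) 0 1 \<in> G1"
proof -
  have "mk 1 (int m) 0 1 \<in> \<Gamma>"
    by (rule Gamma1_mk) simp_all
  then show ?thesis
    by (simp add: G1_def)
qed

text \<open>The translation \<open>T\<close> is parabolic, so it is approached through the
  hyperbolic products \<open>T U_m\<close>, where \<open>U_m\<close> is lower unipotent and trivial
  modulo \<open>p\<close>. The cases \<open>m = 1\<close> and \<open>m = 2\<close>, together with
  \<open>\<kappa> U_2 \<equiv> 2 \<kappa> U_1\<close>, give first \<open>\<kappa> U_1\<close> and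
  then \<open>\<kappa> T\<close>.\<close>

lemma \<kappa>_T: "\<kappa> (mk 1 1 0 1) \<in> Kp"
proof -
  let ?U = "\<lambda>m. mk 1 0 (int N * (int p * m)) 1"
  have U: "?U m \<in> G1" for m
    using U_in[of "int p * m"] by (simp add: G1_def)
  have T: "mk 1 1 0 1 \<in> \<Gamma>"
    by (rule T_in)
  have TU: "mk 1 1 0 1 ** ?U m = mk (1 + int N * (int p * m)) 1 (int N * (int p * m)) 1" for m
    by (simp add: mk_mult)
  have 1: "\<kappa> (mk 1 1 0 1 ** ?U m) \<in> Kp" if "m > 0" for m
  proof (rule \<kappa>_hyperbolic)
    have "mk 1 1 0 1 ** ?U m \<in> \<Gamma>"
      using U T mult_in by (simp add: G1_def)
    then show "mk 1 1 0 1 ** ?U m \<in> G1"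
      unfolding TU by (simp add: G1_def)
    show "\<not> int p dvd (mk 1 1 0 1 ** ?U m)$1$2"
      unfolding TU using p prime_gt_1_nat[of p] by (simp add: zdvd1_eq)
    have "int N * (int p * m) > 0"
      using N_pos p prime_gt_0_nat[of p] that by simp
    then show "\<bar>trace (mk 1 1 0 1 ** ?U m)\<bar> > 2"
      unfolding TU trace_mat2 by simp
  qed
  have 2: "\<kappa> (mk 1 1 0 1) + \<kappa> (?U m) \<in> Kp" if "m > 0" for m
    using cg_mem[OF sub_Kp cg_sym[OF sub_Kp \<kappa>_mult_G1[OF T U]] 1[OF that]] .
  have "?U 1 ** ?U 1 = ?U 2"
    by (simp add: mk_mult algebra_simps)
  then have "cg Kp (\<kappa> (?U 2)) (\<kappa> (?U 1) + \<kappa> (?U 1))"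
    using \<kappa>_mult_G1[of "?U 1" "?U 1"] U[of 1] by (simp add: G1_def)
  moreover have "\<kappa> (?U 2) - \<kappa> (?U 1) \<in> Kp"
    using zspan_diff[OF 2[of 2] 2[of 1]] by simp
  ultimately have "\<kappa> (?U 1) \<in> Kp"
    using add_subgroupD(2)[OF sub_Kp, of "\<kappa> (?U 2) - \<kappa> (?U 1)" "\<kappa> (?U 2) - (\<kappa> (?U 1) + \<kappa> (?U 1))"]
    by (simp add: cg_def)
  then show ?thesis
    using zspan_diff[OF 2[of 1]] by fastforce
qed

lemma \<kappa>_T_power: "\<kappa> (mk 1 (int m) 0 1) \<in> Kp"
proof (induction m)
  case 0
  have "mk 1 0 0 1 = mat 1"
    by (simp add: mat2_eq_iff)
  then show ?case
    using \<kappa>_1 by simp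
next
  case (Suc m)
  have "mk 1 1 0 1 ** mk 1 (int m) 0 1 = mk 1 (int (Suc m)) 0 1"
    by (simp add: mk_mult add.commute)
  then have "cg Kp (\<kappa> (mk 1 (int (Suc m)) 0 1)) (\<kappa> (mk 1 1 0 1) + \<kappa> (mk 1 (int m) 0 1))"
    using \<kappa>_mult_G1[OF T_in T_power_G1[of m]] by simp
  then show ?case
    using cg_mem[OF sub_Kp] add_subgroupD(4)[OF sub_Kp \<kappa>_T Suc] by blast
qed

text \<open>If the lower left entry is nonzero, some \<open>A T^j\<close> is hyperbolic with upper
  right entry prime to \<open>p\<close>; the translation is then split off again by
  additivity.\<close>

lemma \<kappa>_G1:
  assumes A: "A \<in> G1"
  shows "\<kappa> A \<in> Kp"
proof -
  have AG: "A \<in> \<Gamma>" and pc: "int p dvd A$2$1" and pa: "int p dvd A$1$1 - 1"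
    using A by (auto simp: G1_def)
  have det: "A$1$1 * A$2$2 - A$1$2 * A$2$1 = 1"
    using det_1[OF AG] by (simp add: det_mat2)
  have p1: "\<not> int p dvd 1"
    using p prime_gt_1_nat[of p] by (simp add: zdvd1_eq)
  show ?thesis
  proof (cases "A$2$1 = 0")
    \<comment> \<open>No product \<open>A T^j\<close> is hyperbolic here, but \<open>A\<close>
      itself is a translation up to sign.\<close>
    case True
    then have "A$1$1 * A$2$2 = 1"
      using det by simp
    then obtain s where "A$1$1 = s" "A$2$2 = s" "s = 1 \<or> s = - 1"
      using zmult_eq_1_iff by auto
    then have "A = mk 1 (s * A$1$2) 0 1 \<or> A = - mk 1 (s * A$1$2) 0 1"
      using True by (auto simp: mat2_eq_iff)
    then obtain b where "A = mk 1 b 0 1 \<or> A = - mk 1 b 0 1"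
      by blast
    then have eq: "\<kappa> A = \<kappa> (mk 1 b 0 1)"
      by (auto simp: \<kappa>_def cls_neg)
    show ?thesis
    proof (cases b rule: int_cases2)
      case (nonneg m)
      then show ?thesis
        using \<kappa>_T_power eq by simp
    next
      case (nonpos m)
      have b: "mk 1 b 0 1 \<in> \<Gamma>"
        by (rule Gamma1_mk) simp_all
      have "mk 1 b 0 1 ** mk 1 (int m) 0 1 = mat 1"
        by (simp add: mk_mult nonpos mat2_eq_iff)
      then have "cg Kp (\<kappa> (mat 1)) (\<kappa> (mk 1 b 0 1) + \<kappa> (mk 1 (int m) 0 1))"
        using \<kappa>_mult_G1[OF b T_power_G1[of m]] by simp
      then have "\<kappa> (mk 1 b 0 1) + \<kappa> (mk 1 (int m) 0 1) \<in> Kp"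
        using cg_mem[OF sub_Kp cg_sym[OF sub_Kp]] \<kappa>_1 by blast
      from zspan_diff[OF this \<kappa>_T_power[of m]] show ?thesis
        using eq by simp
    qed
  next
    case False
    \<comment> \<open>If \<open>p\<close> divides the upper right entry, adding the upper left entry
      once, which is 1 modulo \<open>p\<close>, makes it prime to \<open>p\<close>. The multiple of
      \<open>p\<close> in \<open>j\<close> then makes the trace large without disturbing
      this.\<close>
    define t :: nat where "t = (if int p dvd A$1$2 then 1 else 0)"
    define j where "j = t + p * nat (\<bar>trace A\<bar> + 3)"
    let ?B = "A ** mk 1 (int j) 0 1"
    have B: "?B$1$1 = A$1$1" "?B$1$2 = int j * A$1$1 + A$1$2" "?B$2$1 = A$2$1" "?B$2$2 = int j * A$2$1 + A$2$2"
      by (simp_all add: mult_nth)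
    have "?B \<in> \<Gamma>"
      using AG T_power_G1[of j] mult_in by (simp add: G1_def)
    then have BG: "?B \<in> G1"
      using pc pa by (simp add: G1_def B)
    have "\<kappa> ?B \<in> Kp"
    proof (rule \<kappa>_hyperbolic[OF BG])
      show "\<not> int p dvd ?B$1$2"
      proof
        assume "int p dvd ?B$1$2"
        moreover have "?B$1$2 = int p * (int (nat (\<bar>trace A\<bar> + 3)) * A$1$1) + (int t * A$1$1 + A$1$2)"
          unfolding B by (simp add: j_def algebra_simps)
        ultimately have *: "int p dvd int t * A$1$1 + A$1$2"
          by (simp add: dvd_add_right_iff)
        show False
        proof (cases "int p dvd A$1$2")
          case True
          then have "int p dvd A$1$1"
            using * by (simp add: t_def dvd_add_left_iff)
          then have "int p dvd A$1$1 - (A$1$1 - 1)"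
            using pa by (rule dvd_diff)
          then show False
            using p1 by simp
        next
          case False
          then show False
            using * by (simp add: t_def)
        qed
      qed
      have "trace ?B = trace A + int j * A$2$1"
        by (simp add: trace_mat2 B)
      moreover have "\<bar>int j * A$2$1\<bar> \<ge> \<bar>trace A\<bar> + 3"
      proof -
        have "1 * (\<bar>trace A\<bar> + 3) \<le> int p * (\<bar>trace A\<bar> + 3)"
          using p prime_gt_0_nat[of p] by (intro mult_right_mono) simp_all
        also have "\<dots> \<le> int j"
          by (simp add: j_def)
        also have "int j * 1 \<le> int j * \<bar>A$2$1\<bar>"
          using False by (intro mult_left_mono) simp_all
        finally show ?thesis
          by (simp add: abs_mult)
      qed
      ultimately show "\<bar>trace ?B\<bar> > 2"
        by linarith
    qed
    then have "\<kappa> A + \<kappa> (mk 1 (int j) 0 1) \<in> Kp"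
      using cg_mem[OF sub_Kp cg_sym[OF sub_Kp \<kappa>_mult_G1[OF AG T_power_G1]]] by blast
    from zspan_diff[OF this \<kappa>_T_power[of j]] show ?thesis
      by simp
  qed
qed

definition G0 where "G0 = {A \<in> \<Gamma>. int p dvd A$2$1}"

text \<open>Matrices that are upper triangular modulo \<open>p\<close> commute up to unipotent ones:
  the commutator lies in \<open>G1\<close>, so \<open>\<kappa>\<close> agrees on
  \<open>A ** D\<close> and \<open>D ** A\<close>. Expanding both by \<open>\<kappa>_mult\<close>
  gives the relation.\<close>

lemma \<kappa>_commute:
  assumes A: "A \<in> G0" and D: "D \<in> G0"
  shows "cg Kp (frag_cmul (D$1$1 ^ n - 1) (\<kappa> A)) (frag_cmul (A$1$1 ^ n - 1) (\<kappa> D))"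
proof -
  have AG: "A \<in> \<Gamma>" "D \<in> \<Gamma>" and c: "int p dvd A$2$1" "int p dvd D$2$1"
    using A D by (auto simp: G0_def)
  let ?C = "A ** D ** adj (D ** A)"
  have CG: "?C \<in> \<Gamma>" "D ** A \<in> \<Gamma>"
    using AG mult_in adj_in by simp_all
  have det: "A$1$1 * A$2$2 - A$1$2 * A$2$1 = 1" "D$1$1 * D$2$2 - D$1$2 * D$2$1 = 1"
    using det_1[OF AG(1)] det_1[OF AG(2)] by (simp_all add: det_mat2)
  have c0: "[A$2$1 = 0] (mod int p)" "[D$2$1 = 0] (mod int p)"
    using c by (simp_all add: cong_0_iff)
  have "[A$1$1 * A$2$2 - A$1$2 * 0 = A$1$1 * A$2$2 - A$1$2 * A$2$1] (mod int p)"
    "[D$1$1 * D$2$2 - D$1$2 * 0 = D$1$1 * D$2$2 - D$1$2 * D$2$1] (mod int p)"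
    by (intro cong_diff cong_mult cong_refl cong_sym[OF c0(1)] cong_sym[OF c0(2)])+
  then have ad: "[A$1$1 * A$2$2 = 1] (mod int p)" "[D$1$1 * D$2$2 = 1] (mod int p)"
    unfolding det by simp_all
  have C21: "?C$2$1 = (A$2$1 * D$1$1 + A$2$2 * D$2$1) * (D$2$1 * A$1$2 + D$2$2 * A$2$2)
      + (A$2$1 * D$1$2 + A$2$2 * D$2$2) * - (D$2$1 * A$1$1 + D$2$2 * A$2$1)"
    by (simp add: mult_nth)
  have "int p dvd ?C$2$1"
    unfolding C21 using c by (intro dvd_add dvd_mult2 dvd_mult) (simp_all add: dvd_add dvd_mult dvd_mult2)
  moreover have C11: "?C$1$1 = (A$1$1 * D$1$1 + A$1$2 * D$2$1) * (D$2$1 * A$1$2 + D$2$2 * A$2$2)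
      + (A$1$1 * D$1$2 + A$1$2 * D$2$2) * - (D$2$1 * A$1$1 + D$2$2 * A$2$1)"
    by (simp add: mult_nth)
  have "[?C$1$1 = (A$1$1 * D$1$1 + A$1$2 * 0) * (0 * A$1$2 + D$2$2 * A$2$2)
      + (A$1$1 * D$1$2 + A$1$2 * D$2$2) * - (0 * A$1$1 + D$2$2 * 0)] (mod int p)"
    unfolding C11 by (intro cong_add cong_mult cong_minus_minus_iff[THEN iffD2] cong_refl c0)
  then have "[?C$1$1 = (A$1$1 * A$2$2) * (D$1$1 * D$2$2)] (mod int p)"
    by (simp add: mult_ac)
  then have "[?C$1$1 = 1 * 1] (mod int p)"
    using cong_mult[OF ad] cong_trans by blast
  then have "int p dvd ?C$1$1 - 1"
    by (simp add: cong_iff_dvd_diff)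
  ultimately have "?C \<in> G1"
    using CG by (simp add: G1_def)
  then have C: "\<kappa> ?C \<in> Kp"
    by (rule \<kappa>_G1)
  have "int p dvd (D ** A)$2$1"
    using c by (simp add: mult_nth)
  from \<kappa>_mult[OF CG this] have "cg Kp (\<kappa> (A ** D)) (frag_cmul ((D ** A)$1$1 ^ n) (\<kappa> ?C) + \<kappa> (D ** A))"
    using mult_adj_cancel(4)[OF det_1[OF CG(2)]] by simp
  moreover have "cg Kp (frag_cmul ((D ** A)$1$1 ^ n) (\<kappa> ?C) + \<kappa> (D ** A)) (0 + \<kappa> (D ** A))"
    using add_subgroup_frag_cmul[OF sub_Kp C] by (intro cg_add[OF sub_Kp] cg_refl[OF sub_Kp]) (simp add: cg_0_iff)
  ultimately have 1: "cg Kp (\<kappa> (A ** D)) (\<kappa> (D ** A))"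
    using cg_trans[OF sub_Kp] by fastforce
  have 2: "cg Kp (\<kappa> (A ** D)) (frag_cmul (D$1$1 ^ n) (\<kappa> A) + \<kappa> D)"
    by (rule \<kappa>_mult[OF AG c(2)])
  have 3: "cg Kp (\<kappa> (D ** A)) (frag_cmul (A$1$1 ^ n) (\<kappa> D) + \<kappa> A)"
    by (rule \<kappa>_mult[OF AG(2,1) c(1)])
  have "cg Kp (frag_cmul (D$1$1 ^ n) (\<kappa> A) + \<kappa> D) (frag_cmul (A$1$1 ^ n) (\<kappa> D) + \<kappa> A)"
    by (rule cg_trans[OF sub_Kp cg_sym[OF sub_Kp 2] cg_trans[OF sub_Kp 1 3]])
  then show ?thesis
    by (simp add: cg_def frag_cmul_diff_distrib algebra_simps)
qed

text \<open>With a trivial character \<open>\<kappa>\<close> is additive on all of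
  \<open>G0\<close>. By Fermat the power \<open>A^(p-1)\<close> lies in \<open>G1\<close>, and
  \<open>p - 1\<close> is a unit modulo \<open>p\<close>.\<close>

lemma \<kappa>_trivial_character:
  assumes triv: "\<And>A. A \<in> G0 \<Longrightarrow> int p dvd A$1$1 ^ n - 1" and A: "A \<in> G0"
  shows "\<kappa> A \<in> Kp"
proof -
  have AG: "A \<in> \<Gamma>" and c: "int p dvd A$2$1"
    using A by (auto simp: G0_def)
  have pow: "mpow A m \<in> G0 \<and> int p dvd (mpow A m)$1$1 - A$1$1 ^ m \<and> cg Kp (\<kappa> (mpow A m)) (frag_cmul (int m) (\<kappa> A))" for m
  proof (induction m)
    case 0
    then show ?case
      using one_in \<kappa>_1 by (simp add: G0_def cg_0_iff)
  next
    case (Suc m)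
    then have m: "mpow A m \<in> \<Gamma>" "int p dvd (mpow A m)$2$1" "int p dvd (mpow A m)$1$1 - A$1$1 ^ m"
      by (auto simp: G0_def)
    have g0: "mpow A (Suc m) \<in> G0"
      using m AG c mult_in by (simp add: G0_def mult_nth)
    have "(mpow A (Suc m))$1$1 - A$1$1 ^ Suc m = ((mpow A m)$1$1 - A$1$1 ^ m) * A$1$1 + (mpow A m)$1$2 * A$2$1"
      by (simp add: mult_nth algebra_simps)
    then have dd: "int p dvd (mpow A (Suc m))$1$1 - A$1$1 ^ Suc m"
      using m(3) c by (simp only: dvd_add dvd_mult dvd_mult2)
    have c1: "cg Kp (\<kappa> (mpow A m ** A)) (frag_cmul (A$1$1 ^ n) (\<kappa> (mpow A m)) + \<kappa> A)"
      by (rule \<kappa>_mult[OF m(1) AG c])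
    have c2: "cg Kp (frag_cmul (A$1$1 ^ n) (\<kappa> (mpow A m)) + \<kappa> A) (frag_cmul 1 (\<kappa> (mpow A m)) + \<kappa> A)"
      by (intro cg_add[OF sub_Kp] cg_refl[OF sub_Kp] cmul_cong_Kp \<kappa>_chains m(1) triv A)
    have c3: "cg Kp (frag_cmul 1 (\<kappa> (mpow A m)) + \<kappa> A) (frag_cmul (int m) (\<kappa> A) + \<kappa> A)"
      using Suc by (intro cg_add[OF sub_Kp] cg_refl[OF sub_Kp]) simp
    have "frag_cmul (int m) (\<kappa> A) + \<kappa> A = frag_cmul (int (Suc m)) (\<kappa> A)"
      by (simp add: frag_cmul_distrib add.commute)
    then have c4: "cg Kp (\<kappa> (mpow A (Suc m))) (frag_cmul (int (Suc m)) (\<kappa> A))"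
      using cg_trans[OF sub_Kp cg_trans[OF sub_Kp c1 c2] c3] by (simp only: mpow.simps)
    show ?case
      using g0 dd c4 by (intro conjI)
  qed
  have det: "A$1$1 * A$2$2 - A$1$2 * A$2$1 = 1"
    using det_1[OF AG] by (simp add: det_mat2)
  have p1: "\<not> int p dvd 1"
    using p prime_gt_1_nat[of p] by (simp add: zdvd1_eq)
  have "\<not> int p dvd A$1$1"
  proof
    assume "int p dvd A$1$1"
    then have "int p dvd A$1$1 * A$2$2 - A$1$2 * A$2$1"
      using c by (intro dvd_diff dvd_mult dvd_mult2)
    then show False
      using p1 det by simp
  qed
  then have "int p dvd A$1$1 ^ (p - 1) - 1"
    by (rule fermat_int[OF p])
  moreover have "int p dvd (mpow A (p - 1))$1$1 - A$1$1 ^ (p - 1)"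
    using pow by blast
  ultimately have "int p dvd ((mpow A (p - 1))$1$1 - A$1$1 ^ (p - 1)) + (A$1$1 ^ (p - 1) - 1)"
    by (intro dvd_add)
  then have "mpow A (p - 1) \<in> G1"
    using pow[of "p - 1"] by (simp add: G1_def G0_def)
  then have "frag_cmul (int (p - 1)) (\<kappa> A) \<in> Kp"
    using \<kappa>_G1 cg_mem[OF sub_Kp cg_sym[OF sub_Kp]] pow[of "p - 1"] by blast
  moreover have "\<not> int p dvd int (p - 1)"
    unfolding int_dvd_int_iff using prime_gt_1_nat[OF p] by (intro nat_dvd_not_less) auto
  ultimately show ?thesis
    using unit_cancel[OF \<kappa>_chains[OF AG]] by blast
qed

text \<open>The chains that the operator at \<open>p\<close> produces, up to relations and a term
  depending on the boundary.\<close>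

definition X0 where "X0 = zspan {ch (cls A) v | A v. A \<in> G0 \<and> (\<exists>m. form_cong (int p) n v (of_int m * X2 ^ n))}"

lemma X0_chains: "X0 \<subseteq> chains"
  unfolding X0_def
  by (intro zspan_least add_subgroup_chains) (auto simp: G0_def intro!: ch_chains form_cong_V(1))

text \<open>Suppose the character is nontrivial at \<open>D\<close>. Then
  \<open>\<kappa>_commute\<close> makes every element of \<open>X0\<close>, after multiplication by
  the unit \<open>D$1$1 ^ n - 1\<close>, a multiple \<open>j\<close> of \<open>\<kappa> D\<close>.
  The integer \<open>j\<close> can be read off from the boundary, whose coefficient at
  \<open>X2 ^ n\<close> is \<open>j\<close> modulo \<open>p\<close>; so for a cycle it is divisible
  by \<open>p\<close>.\<close>

lemma X0_cycle:
  assumes c: "c \<in> X0" "bd c = 0"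
  shows "c \<in> Kp"
proof (cases "\<forall>A\<in>G0. int p dvd A$1$1 ^ n - 1")
  case True
  have "X0 \<subseteq> Kp"
    unfolding X0_def
  proof (intro zspan_least subsetI)
    fix x assume "x \<in> {ch (cls A) v | A v. A \<in> G0 \<and> (\<exists>m. form_cong (int p) n v (of_int m * X2 ^ n))}"
    then obtain A v m where A: "A \<in> G0" "form_cong (int p) n v (of_int m * X2 ^ n)" "x = ch (cls A) v"
      by blast
    have "\<kappa> A \<in> Kp"
      using True by (intro \<kappa>_trivial_character A) simp
    then have "frag_cmul m (\<kappa> A) \<in> Kp"
      by (rule add_subgroup_frag_cmul[OF sub_Kp])
    then show "x \<in> Kp"
      unfolding A(3) using cg_mem[OF sub_Kp ch_multiple[OF _ A(2)]] A(1) by (simp add: G0_def)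
  qed simp
  then show ?thesis
    using c by blast
next
  case False
  then obtain D where D: "D \<in> G0" "\<not> int p dvd D$1$1 ^ n - 1"
    by blast
  have "\<exists>j. cg Kp (frag_cmul (D$1$1 ^ n - 1) c) (frag_cmul j (\<kappa> D)) \<and> int p dvd eval01 (bd c) - j"
    using c(1) unfolding X0_def
  proof (induction rule: zspan.induct)
    case zspan_zero
    show ?case
      by (intro exI[of _ 0]) (simp add: cg_refl[OF sub_Kp] eval01_def)
  next
    case (zspan_base x)
    then obtain A v m where A: "A \<in> G0" "form_cong (int p) n v (of_int m * X2 ^ n)" "x = ch (cls A) v"
      by blast
    have AG: "A \<in> \<Gamma>" "int p dvd A$2$1"
      using A(1) by (auto simp: G0_def)
    let ?d = "D$1$1 ^ n - 1" and ?a = "A$1$1 ^ n - 1"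
    have c1: "cg Kp (frag_cmul ?d x) (frag_cmul ?d (frag_cmul m (\<kappa> A)))"
      unfolding A(3) by (intro cg_cmul[OF sub_Kp] ch_multiple AG A)
    have c2: "frag_cmul ?d (frag_cmul m (\<kappa> A)) = frag_cmul m (frag_cmul ?d (\<kappa> A))"
      by (simp add: mult.commute)
    have c3: "cg Kp (frag_cmul m (frag_cmul ?d (\<kappa> A))) (frag_cmul m (frag_cmul ?a (\<kappa> D)))"
      by (intro cg_cmul[OF sub_Kp] \<kappa>_commute A D)
    have 1: "cg Kp (frag_cmul ?d x) (frag_cmul (m * ?a) (\<kappa> D))"
      using cg_trans[OF sub_Kp c1[unfolded c2] c3] by (simp only: frag_cmul_cmul)
    obtain w where w: "w \<in> V n" "v = of_int m * X2 ^ n + of_int (int p) * w"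
      using A(2) by (auto simp: form_cong_def)
    obtain w' where w': "w' \<in> V n" "act A (X2 ^ n) = of_int (A$1$1 ^ n) * X2 ^ n + of_int (int p) * w'"
      using form_cong_act_X2[OF AG(2), of n] by (auto simp: form_cong_def)
    have v: "v \<in> V n"
      using A(2) by (rule form_cong_V)
    have bd_x: "bd x = act A v - v"
      unfolding A(3) bd_ch[OF v] act_cls_n[OF v] ..
    have "eval01 (bd x) = m * ?a + int p * (m * eval01 w' + eval01 (act A w) - eval01 w)"
      unfolding bd_x unfolding w(2) act_add act_mult act_of_int w'(2) by (simp add: algebra_simps)
    then have "int p dvd eval01 (bd x) - m * ?a"
      by simp
    then show ?case
      using 1 by blast
  next
    case (zspan_diff x y)
    then obtain i j where ij: "cg Kp (frag_cmul (D$1$1 ^ n - 1) x) (frag_cmul i (\<kappa> D))" "int p dvd eval01 (bd x) - i"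
      "cg Kp (frag_cmul (D$1$1 ^ n - 1) y) (frag_cmul j (\<kappa> D))" "int p dvd eval01 (bd y) - j"
      by blast
    have "cg Kp (frag_cmul (D$1$1 ^ n - 1) (x - y)) (frag_cmul (i - j) (\<kappa> D))"
      using cg_diff[OF sub_Kp ij(1) ij(3)]
      by (simp only: frag_cmul_diff[symmetric] frag_cmul_diff_distrib[symmetric])
    moreover have eq: "eval01 (bd (x - y)) - (i - j) = (eval01 (bd x) - i) - (eval01 (bd y) - j)"
      by (simp add: bd_diff)
    have "int p dvd eval01 (bd (x - y)) - (i - j)"
      unfolding eq by (rule dvd_diff[OF ij(2,4)])
    ultimately show ?case
      by blast
  qed
  then obtain j where j: "cg Kp (frag_cmul (D$1$1 ^ n - 1) c) (frag_cmul j (\<kappa> D))" "int p dvd eval01 (bd c) - j"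
    by blast
  then have "int p dvd j"
    using c(2) by (simp add: eval01_def)
  then have "frag_cmul j (\<kappa> D) \<in> Kp"
    using D(1) by (intro p_Kp \<kappa>_chains) (simp_all add: G0_def)
  then have "frag_cmul (D$1$1 ^ n - 1) c \<in> Kp"
    using cg_mem[OF sub_Kp j(1)] by blast
  then show ?thesis
    using unit_cancel[OF _ D(2)] X0_chains c(1) by blast
qed

text \<open>Replacing the representatives \<open>\<beta>\<close> by \<open>\<eta> \<beta>\<close> changes the Hecke chain by a function of the boundary
  only, up to relations.\<close>

lemma hc_decompose:
  assumes B: "is_reps B"
    and good: "\<And>\<beta>. \<beta> \<in> B \<Longrightarrow> \<eta> \<beta> \<in> G \<and> det (M \<beta>) = int p \<and> int p dvd M \<beta>$2$1 \<and> int p dvd M \<beta>$2$2 \<and>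
      \<eta> \<beta> \<cdot> \<beta> = cls (M \<beta>)"
    and c: "c \<in> chains"
  shows "\<exists>x\<in>X0. cg R (hecke_chain \<Gamma> B c) (x - (\<Sum>\<beta>\<in>B. ch (\<eta> \<beta>) (act_cls \<beta> (bd c))))"
proof -
  let ?hc = "hecke_chain \<Gamma> B" and ?\<sigma> = "rep_perm \<Gamma> B" and ?\<tau> = "rep_factor \<Gamma> B"
  define h where "h w = (\<Sum>\<beta>\<in>B. ch (\<eta> \<beta>) (act_cls \<beta> w))" for w
  note subR = add_subgroup_R
  have h_diff: "cg R (h (v - w)) (h v - h w)" if "v \<in> V n" "w \<in> V n" for v w
    unfolding h_def sum_subtractf[symmetric]
  proof (rule cg_sum[OF subR])
    fix \<beta> assume b: "\<beta> \<in> B"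
    show "cg R (ch (\<eta> \<beta>) (act_cls \<beta> (v - w))) (ch (\<eta> \<beta>) (act_cls \<beta> v) - ch (\<eta> \<beta>) (act_cls \<beta> w))"
      unfolding act_B_diff[OF B b that] using good[OF b] that by (intro ch_diff act_B_V[OF B b]) auto
  qed
  have h_0: "cg R (h 0) 0"
    using h_diff[OF V_0 V_0] by simp
  have "\<exists>x\<in>X0. cg R (?hc c) (x - h (bd c))"
    using c
  proof (induction rule: chains_induct)
    case zero
    have "cg R (0 - 0) (0 - h 0)"
      by (rule cg_diff[OF subR cg_refl[OF subR] cg_sym[OF subR h_0]])
    then show ?case
      by (intro bexI[of _ 0]) (simp_all add: hecke_chain_def X0_def zspan_zero)
  next
    case (rel c)
    have "cg R (?hc c - 0) (0 - h 0)"
      using hc_R[OF B rel] by (intro cg_diff[OF subR] cg_sym[OF subR h_0]) (simp add: cg_0_iff)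
    then show ?case
      by (intro bexI[of _ 0]) (simp_all add: bd_R[OF rel] X0_def zspan_zero)
  next
    case (diff a b)
    obtain x where x: "x \<in> X0" "cg R (?hc a) (x - h (bd a))"
      using diff(3) by blast
    obtain y where y: "y \<in> X0" "cg R (?hc b) (y - h (bd b))"
      using diff(4) by blast
    have "cg R (?hc (a - b)) ((x - h (bd a)) - (y - h (bd b)))"
      unfolding hc_diff[OF B] by (intro cg_diff[OF subR] x y)
    moreover have "(x - h (bd a)) - (y - h (bd b)) = (x - y) - (h (bd a) - h (bd b))"
      by simp
    moreover have "cg R ((x - y) - (h (bd a) - h (bd b))) ((x - y) - h (bd (a - b)))"
      unfolding bd_diff
      by (rule cg_diff[OF subR cg_refl[OF subR] cg_sym[OF subR h_diff[OF bd_V bd_V]]]) (rule diff)+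
    ultimately have "cg R (?hc (a - b)) ((x - y) - h (bd (a - b)))"
      using cg_trans[OF subR] by simp
    moreover have "x - y \<in> X0"
      using x(1) y(1) unfolding X0_def by (rule zspan_diff)
    ultimately show ?case
      by blast
  next
    case (ch g v)
    obtain A where A: "A \<in> \<Gamma>" "g = cls A"
      using ch(1) by blast
    have "\<exists>x\<in>X0. cg R (ch (?\<tau> \<beta> g) (act_cls (?\<sigma> \<beta> g) v))
        (x + (ch (\<eta> (?\<sigma> \<beta> g)) (act_cls (?\<sigma> \<beta> g) v) - ch (\<eta> \<beta>) (act_cls \<beta> (act_cls g v))))" if b: "\<beta> \<in> B" for \<beta>
    proof -
      let ?\<beta>' = "?\<sigma> \<beta> g"
      note 1 = perm_factor[OF B b ch(1)]
      obtain C1 where C1: "C1 \<in> \<Gamma>" "\<eta> \<beta> = cls C1"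
        using good[OF b] by blast
      obtain C2 where C2: "C2 \<in> \<Gamma>" "\<eta> ?\<beta>' = cls C2"
        using good[OF 1(1)] by blast
      obtain C3 where C3: "C3 \<in> \<Gamma>" "?\<tau> \<beta> g = cls C3"
        using 1(2) by blast
      obtain D where D: "\<beta> = cls D"
        using B_cls[OF B b] by blast
      obtain D' where D': "?\<beta>' = cls D'"
        using B_cls[OF B 1(1)] by blast
      \<comment> \<open>The factor that belongs to the modified representatives:
        \<open>M \<beta>\<close> times \<open>g\<close> is \<open>C\<close> times the modified
        representative of \<open>?\<beta>'\<close>, as classes.\<close>
      define C where "C = C1 ** (C3 ** adj C2)"
      have CG: "C \<in> \<Gamma>"
        unfolding C_def using C1(1) C2(1) C3(1) mult_in adj_in by simp
      have CC2: "C ** C2 = C1 ** C3"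
        unfolding C_def using mult_adj_cancel(4)[OF det_1[OF C2(1)], of "C1 ** C3"] by (simp add: matrix_mul_assoc)
      have C3_eq: "C3 = adj C1 ** (C ** C2)"
        unfolding CC2 by (rule mult_adj_cancel(2)[OF det_1[OF C1(1)], symmetric])
      have M1: "cls (M \<beta>) = cls C1 \<cdot> \<beta>"
        using good[OF b] C1(2) by simp
      have "cls (M ?\<beta>') = cls C2 \<cdot> ?\<beta>'"
        using good[OF 1(1)] C2(2) by simp
      also have "\<dots> = cls C2 \<cdot> cls D'"
        by (simp only: D')
      finally have M2: "cls C2 \<cdot> cls D' = cls (M ?\<beta>')" ..
      have eqM: "cls (M \<beta>) \<cdot> g = cls C \<cdot> cls (M ?\<beta>')"
      proof -
        have "cls (M \<beta>) \<cdot> g = cls C1 \<cdot> (\<beta> \<cdot> g)"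
          unfolding M1 by (simp only: D A(2) cls_mult_assoc)
        also have "\<dots> = cls C1 \<cdot> (cls C3 \<cdot> cls D')"
          unfolding 1(3) C3(2) D' ..
        also have "\<dots> = cls C \<cdot> (cls C2 \<cdot> cls D')"
          unfolding cls_mult matrix_mul_assoc CC2 ..
        finally show ?thesis
          unfolding M2 .
      qed
      \<comment> \<open>If the lower left entry of \<open>C\<close> were prime to \<open>p\<close>,
        the first row of the modified representative would vanish modulo \<open>p\<close> like the
        second, and \<open>p ^ 2\<close> would divide its determinant \<open>p\<close>.\<close>
      have C0: "C \<in> G0"
      proof -
        have "M \<beta> ** A = C ** M ?\<beta>' \<or> M \<beta> ** A = - (C ** M ?\<beta>')"
          using eqM by (simp add: A(2) cls_mult cls_eq_iff)
        moreover have "int p dvd (M \<beta> ** A)$2$1" "int p dvd (M \<beta> ** A)$2$2"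
          using good[OF b] by (simp_all add: mult_nth)
        ultimately have d: "int p dvd (C ** M ?\<beta>')$2$1" "int p dvd (C ** M ?\<beta>')$2$2"
          by auto
        let ?M = "M ?\<beta>'"
        have M: "int p dvd ?M$2$1" "int p dvd ?M$2$2" "?M$1$1 * ?M$2$2 - ?M$1$2 * ?M$2$1 = int p"
          using good[OF 1(1)] by (simp_all add: det_mat2)
        have dd: "int p dvd C$2$1 * ?M$1$1" "int p dvd C$2$1 * ?M$1$2"
          using d M(1,2) by (simp_all add: mult_nth dvd_add_left_iff)
        have "int p dvd C$2$1"
        proof (rule ccontr)
          assume "\<not> int p dvd C$2$1"
          then have "int p dvd ?M$1$1" "int p dvd ?M$1$2"
            using dd p by (meson prime_dvd_multD prime_nat_int_transfer)+
          then have "int p * int p dvd ?M$1$1 * ?M$2$2 - ?M$1$2 * ?M$2$1"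
            using M(1,2) by (intro dvd_diff mult_dvd_mono)
          then have "int p * int p dvd int p * 1"
            using M(3) by simp
          then have "int p dvd 1"
            using p prime_gt_0_nat[of p] by (simp only: dvd_times_left_cancel_iff) simp
          then show False
            using p prime_gt_1_nat[of p] by (simp add: zdvd1_eq)
        qed
        then show ?thesis
          using CG by (simp add: G0_def)
      qed
      let ?w = "act_cls ?\<beta>' v"
      have wV: "?w \<in> V n"
        by (rule act_B_V[OF B 1(1) ch(2)])
      have "?w = act_cls (cls D') v"
        by (simp only: D')
      then have "act_cls (cls C2) ?w = act_cls (cls C2) (act_cls (cls D') v)"
        by (simp only:)
      also have "\<dots> = act (M ?\<beta>') v"
        using act_cls_mult[OF ch(2), of C2 D'] ch(2) unfolding M2 by (simp add: act_cls_n)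
      finally have M_w: "act_cls (cls C2) ?w = act (M ?\<beta>') v" .
      have "\<exists>m. form_cong (int p) n (act (M ?\<beta>') v) (of_int m * X2 ^ n)"
        using good[OF 1(1)] ch(2) by (intro form_cong_act) auto
      then have x: "ch (cls C) (act_cls (cls C2) ?w) \<in> X0"
        unfolding X0_def M_w using C0 by (intro zspan_base) blast
      \<comment> \<open>The old factor \<open>C3\<close> is \<open>adj C1 ** (C ** C2)\<close>. By
        the cocycle rule its two outer factors yield the terms with \<open>\<eta>\<close>, and the
        middle one yields an element of \<open>X0\<close>.\<close>
      have "cg R (ch (cls (adj C1) \<cdot> cls (C ** C2)) ?w) (ch (cls (adj C1)) (act_cls (cls (C ** C2)) ?w) + ch (cls (C ** C2)) ?w)"
        using C1 C2 CG adj_in mult_in wV by (intro ch_mult) auto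
      then have 2: "cg R (ch (cls C3) ?w) (ch (cls (adj C1)) (act_cls (cls (C ** C2)) ?w) + ch (cls (C ** C2)) ?w)"
        by (simp add: cls_mult C3_eq)
      have "act_cls (cls (C ** C2)) ?w = act_cls (cls C1) (act_cls \<beta> (act_cls g v))"
      proof -
        have "act_cls (cls (C ** C2)) ?w = act_cls (cls C1) (act_cls (cls C3) ?w)"
          using wV by (simp add: CC2 act_cls_n act_act V_act)
        then show ?thesis
          using act_perm_factor[OF B b ch] by (simp add: C3(2))
      qed
      moreover have "cg R (ch (cls (adj C1)) (act_cls (cls C1) (act_cls \<beta> (act_cls g v)))) (- ch (cls C1) (act_cls \<beta> (act_cls g v)))"
        using C1(1) adj_in adj_inverse(2)[OF det_1[OF C1(1)]]
        by (intro ch_inverse act_B_V[OF B b] act_G_V ch) (auto simp: cls_mult)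
      ultimately have 3: "cg R (ch (cls (adj C1)) (act_cls (cls (C ** C2)) ?w)) (- ch (cls C1) (act_cls \<beta> (act_cls g v)))"
        by simp
      have "cg R (ch (cls C \<cdot> cls C2) ?w) (ch (cls C) (act_cls (cls C2) ?w) + ch (cls C2) ?w)"
        using C2 CG wV by (intro ch_mult) auto
      then have 4: "cg R (ch (cls (C ** C2)) ?w) (ch (cls C) (act_cls (cls C2) ?w) + ch (cls C2) ?w)"
        by (simp only: cls_mult)
      have "cg R (ch (cls C3) ?w) (- ch (cls C1) (act_cls \<beta> (act_cls g v)) + (ch (cls C) (act_cls (cls C2) ?w) + ch (cls C2) ?w))"
        by (rule cg_trans[OF subR 2 cg_add[OF subR 3 4]])
      then have "cg R (ch (?\<tau> \<beta> g) ?w) (ch (cls C) (act_cls (cls C2) ?w) + (ch (\<eta> ?\<beta>') ?w - ch (\<eta> \<beta>) (act_cls \<beta> (act_cls g v))))"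
        by (simp add: C1(2) C2(2) C3(2) algebra_simps)
      then show ?thesis
        using x by blast
    qed
    then have "\<forall>\<beta>\<in>B. \<exists>x. x \<in> X0 \<and> cg R (ch (?\<tau> \<beta> g) (act_cls (?\<sigma> \<beta> g) v))
        (x + (ch (\<eta> (?\<sigma> \<beta> g)) (act_cls (?\<sigma> \<beta> g) v) - ch (\<eta> \<beta>) (act_cls \<beta> (act_cls g v))))"
      unfolding Bex_def by (rule ballI)
    from bchoice[OF this] obtain x where "\<forall>\<beta>\<in>B. x \<beta> \<in> X0 \<and> cg R (ch (?\<tau> \<beta> g) (act_cls (?\<sigma> \<beta> g) v))
        (x \<beta> + (ch (\<eta> (?\<sigma> \<beta> g)) (act_cls (?\<sigma> \<beta> g) v) - ch (\<eta> \<beta>) (act_cls \<beta> (act_cls g v))))" ..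
    then have x: "\<And>\<beta>. \<beta> \<in> B \<Longrightarrow> x \<beta> \<in> X0"
      "\<And>\<beta>. \<beta> \<in> B \<Longrightarrow> cg R (ch (?\<tau> \<beta> g) (act_cls (?\<sigma> \<beta> g) v))
        (x \<beta> + (ch (\<eta> (?\<sigma> \<beta> g)) (act_cls (?\<sigma> \<beta> g) v) - ch (\<eta> \<beta>) (act_cls \<beta> (act_cls g v))))"
      by simp_all
    have "cg R (hsum B g v) (\<Sum>\<beta>\<in>B. x \<beta> + (ch (\<eta> (?\<sigma> \<beta> g)) (act_cls (?\<sigma> \<beta> g) v) - ch (\<eta> \<beta>) (act_cls \<beta> (act_cls g v))))"
      unfolding hsum_def[OF B] by (intro cg_sum[OF subR] x)
    also have "(\<Sum>\<beta>\<in>B. x \<beta> + (ch (\<eta> (?\<sigma> \<beta> g)) (act_cls (?\<sigma> \<beta> g) v) - ch (\<eta> \<beta>) (act_cls \<beta> (act_cls g v))))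
      = sum x B - (h (act_cls g v) - h v)"
      unfolding sum.distrib sum_subtractf sum_perm[OF B ch(1), of "\<lambda>\<beta>. ch (\<eta> \<beta>) (act_cls \<beta> v)"] h_def by simp
    finally have 1: "cg R (hsum B g v) (sum x B - (h (act_cls g v) - h v))" .
    have "cg R (sum x B - (h (act_cls g v) - h v)) (sum x B - h (bd (ch g v)))"
      unfolding bd_ch[OF ch(2)]
      by (rule cg_diff[OF subR cg_refl[OF subR] cg_sym[OF subR h_diff]]) (use ch act_G_V in auto)
    then have "cg R (?hc (ch g v)) (sum x B - h (bd (ch g v)))"
      by (rule cg_trans[OF subR cg_trans[OF subR hc_ch[OF B ch] 1]])
    moreover have "sum x B \<in> X0"
      using x(1) unfolding X0_def by (intro add_subgroupD(5)) simp_all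
    ultimately show ?case
      by blast
  qed
  then show ?thesis
    by (simp add: h_def)
qed

text \<open>On a cycle the boundary term of \<open>hc_decompose\<close> disappears, so up to
  relations the image is a cycle in \<open>X0\<close> and lies in \<open>Kp\<close>. Write it as
  \<open>z + p y\<close> with \<open>z\<close> in \<open>KH\<close>: then \<open>p y\<close> has
  boundary 0, and so has \<open>y\<close>, as forms have no torsion.\<close>

lemma hc_divisible:
  assumes B: "is_reps B"
    and good: "\<And>\<beta>. \<beta> \<in> B \<Longrightarrow> \<exists>\<eta>\<in>G. \<exists>M. det M = int p \<and> int p dvd M$2$1 \<and> int p dvd M$2$2 \<and> \<eta> \<cdot> \<beta> = cls M"
    and c: "c \<in> cycles"
  shows "\<exists>c'\<in>cycles. cg KH (hecke_chain \<Gamma> B c) (frag_cmul (int p) c')"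
proof -
  obtain \<eta> M where \<eta>: "\<And>\<beta>. \<beta> \<in> B \<Longrightarrow> \<eta> \<beta> \<in> G \<and> det (M \<beta>) = int p \<and> int p dvd M \<beta>$2$1 \<and> int p dvd M \<beta>$2$2 \<and>
      \<eta> \<beta> \<cdot> \<beta> = cls (M \<beta>)"
    using good by metis
  have c': "c \<in> chains" "bd c = 0"
    using c by (auto simp: cycles_def)
  obtain x where x: "x \<in> X0" "cg R (hecke_chain \<Gamma> B c) (x - (\<Sum>\<beta>\<in>B. ch (\<eta> \<beta>) (act_cls \<beta> (bd c))))"
    using hc_decompose[OF B \<eta> c'(1)] by blast
  have "cg R (\<Sum>\<beta>\<in>B. ch (\<eta> \<beta>) (act_cls \<beta> 0)) (\<Sum>\<beta>\<in>B. 0)"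
  proof (rule cg_sum[OF add_subgroup_R])
    fix \<beta> assume b: "\<beta> \<in> B"
    show "cg R (ch (\<eta> \<beta>) (act_cls \<beta> 0)) 0"
      using act_B_diff[OF B b V_0 V_0] ch_zero \<eta>[OF b] by simp
  qed
  then have "cg R (x - (\<Sum>\<beta>\<in>B. ch (\<eta> \<beta>) (act_cls \<beta> 0))) (x - 0)"
    by (intro cg_diff cg_refl) simp_all
  then have 1: "cg R (hecke_chain \<Gamma> B c) x"
    using cg_trans[OF add_subgroup_R] x(2) c'(2) by simp
  have "bd x = 0"
    using bd_cg_R[OF B 1] hc_cycle[OF B c'] by simp
  then have "x \<in> Kp"
    using X0_cycle[OF x(1)] by blast
  then obtain z y where zy: "z \<in> KH" "y \<in> chains" "x = z + frag_cmul (int p) y"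
    using Kp_eq by blast
  have bd_cmul: "bd (frag_cmul m y) = of_int m * bd y" for m y
    unfolding bd_def by (rule lext_frag_cmul)
  have "bd (frag_cmul (int p) y) = 0"
    using \<open>bd x = 0\<close> bd_KH[OF zy(1)] by (simp add: zy(3) bd_add)
  then have "bd y = 0"
    using p prime_gt_0_nat[of p] unfolding bd_cmul by simp
  then have "y \<in> cycles"
    using zy(2) by (simp add: cycles_def)
  moreover have "cg KH x (frag_cmul (int p) y)"
    using zy(1,3) by (simp add: cg_def)
  then have "cg KH (hecke_chain \<Gamma> B c) (frag_cmul (int p) y)"
    using cg_trans[OF add_subgroup_zspan cg_mono[OF R_KH 1]] by blast
  ultimately show ?thesis
    by blast
qed

end

end

section \<open>Presentations of quotient groups\<close>

text \<open>\<open>M\<close> is the quotient of \<open>C\<close> by \<open>K\<close> with projection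
  \<open>\<pi>\<close>. In this way homology and its quotient by the hyperbolic cycles, cosets of
  cosets, are both described by the same group of chains.\<close>

definition presents :: "('m, 'r) monoid_scheme \<Rightarrow> 'a::ab_group_add set \<Rightarrow> 'a set \<Rightarrow> ('a \<Rightarrow> 'm) \<Rightarrow> bool" where
  "presents M C K \<pi> \<longleftrightarrow> add_subgroup C \<and> add_subgroup K \<and> K \<subseteq> C \<and> carrier M = \<pi> ` C \<and> \<one>\<^bsub>M\<^esub> = \<pi> 0 \<and>
     (\<forall>a\<in>C. \<forall>b\<in>C. \<pi> a \<otimes>\<^bsub>M\<^esub> \<pi> b = \<pi> (a + b)) \<and> (\<forall>a\<in>C. \<forall>b\<in>C. \<pi> a = \<pi> b \<longleftrightarrow> a - b \<in> K)"

context
  fixes M :: "('m, 'r) monoid_scheme" and C K :: "'a::ab_group_add set" and \<pi> :: "'a \<Rightarrow> 'm"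
  assumes M: "presents M C K \<pi>"
begin

lemma presentsD:
  shows "add_subgroup C" "add_subgroup K" "K \<subseteq> C" "carrier M = \<pi> ` C" "\<one>\<^bsub>M\<^esub> = \<pi> 0"
    "a \<in> C \<Longrightarrow> b \<in> C \<Longrightarrow> \<pi> a \<otimes>\<^bsub>M\<^esub> \<pi> b = \<pi> (a + b)"
    "a \<in> C \<Longrightarrow> b \<in> C \<Longrightarrow> \<pi> a = \<pi> b \<longleftrightarrow> a - b \<in> K"
  using M unfolding presents_def by blast+

lemma presents_comm_group: "comm_group M"
proof (rule comm_groupI)
  note C = add_subgroupD[OF presentsD(1)]
  fix x assume "x \<in> carrier M"
  then obtain a where a: "a \<in> C" "x = \<pi> a"
    by (auto simp: presentsD(4))
  show "\<one>\<^bsub>M\<^esub> \<otimes>\<^bsub>M\<^esub> x = x"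
    using presentsD(6)[OF C(1) a(1)] by (simp add: presentsD(5) a(2))
  show "\<exists>y\<in>carrier M. y \<otimes>\<^bsub>M\<^esub> x = \<one>\<^bsub>M\<^esub>"
    using presentsD(6)[OF C(3)[OF a(1)] a(1)] C(3)[OF a(1)]
    by (intro bexI[of _ "\<pi> (- a)"]) (simp_all add: presentsD(4,5) a(2))
  fix y assume "y \<in> carrier M"
  then obtain b where b: "b \<in> C" "y = \<pi> b"
    by (auto simp: presentsD(4))
  show "x \<otimes>\<^bsub>M\<^esub> y \<in> carrier M" "x \<otimes>\<^bsub>M\<^esub> y = y \<otimes>\<^bsub>M\<^esub> x"
    using C(4)[OF a(1) b(1)] by (simp_all add: presentsD(4,6) a b add.commute)
  fix z assume "z \<in> carrier M"
  then obtain c where c: "c \<in> C" "z = \<pi> c"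
    by (auto simp: presentsD(4))
  show "x \<otimes>\<^bsub>M\<^esub> y \<otimes>\<^bsub>M\<^esub> z = x \<otimes>\<^bsub>M\<^esub> (y \<otimes>\<^bsub>M\<^esub> z)"
    using C(4)[OF a(1) b(1)] C(4)[OF b(1) c(1)] by (simp add: presentsD(6) a b c add.assoc)
next
  show "\<one>\<^bsub>M\<^esub> \<in> carrier M"
    using add_subgroupD(1)[OF presentsD(1)] by (simp add: presentsD(4,5))
qed

lemma presents_inv:
  assumes "a \<in> C"
  shows "inv\<^bsub>M\<^esub> (\<pi> a) = \<pi> (- a)"
proof (rule group.inv_equality)
  note C = add_subgroupD[OF presentsD(1)]
  show "Group.group M"
    using presents_comm_group by (simp add: comm_group_def)
  show "\<pi> (- a) \<otimes>\<^bsub>M\<^esub> \<pi> a = \<one>\<^bsub>M\<^esub>"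
    using presentsD(6)[OF C(3)[OF assms] assms] by (simp add: presentsD(5))
  show "\<pi> a \<in> carrier M" "\<pi> (- a) \<in> carrier M"
    using assms C(3) by (simp_all add: presentsD(4))
qed

lemma presents_subgroup:
  assumes "add_subgroup S" "S \<subseteq> C"
  shows "subgroup (\<pi> ` S) M"
proof (rule subgroup.intro)
  show "\<pi> ` S \<subseteq> carrier M"
    using assms(2) by (auto simp: presentsD(4))
  show "\<one>\<^bsub>M\<^esub> \<in> \<pi> ` S"
    using add_subgroupD(1)[OF assms(1)] by (simp add: presentsD(5))
  show "x \<otimes>\<^bsub>M\<^esub> y \<in> \<pi> ` S" if xy: "x \<in> \<pi> ` S" "y \<in> \<pi> ` S" for x y
  proof -
    obtain a b where "a \<in> S" "b \<in> S" "x = \<pi> a" "y = \<pi> b"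
      using xy by blast
    then show ?thesis
      using assms(2) add_subgroupD(4)[OF assms(1)] presentsD(6)[of a b] by auto
  qed
  show "inv\<^bsub>M\<^esub> x \<in> \<pi> ` S" if "x \<in> \<pi> ` S" for x
    using that assms(2) add_subgroupD(3)[OF assms(1)] presents_inv by auto
qed

lemma presents_restrict:
  assumes "add_subgroup C'" "C' \<subseteq> C" "K \<subseteq> C'"
  shows "presents (M\<lparr>carrier := \<pi> ` C'\<rparr>) C' K \<pi>"
  using M assms unfolding presents_def by (auto simp: subset_eq)

lemma r_coset_presents:
  assumes "K' \<subseteq> C" "c \<in> C"
  shows "\<pi> ` K' #>\<^bsub>M\<^esub> \<pi> c = (\<lambda>z. \<pi> (z + c)) ` K'"
  using assms presentsD(6) by (auto simp: r_coset_def subset_eq)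

text \<open>The third isomorphism theorem: a quotient of \<open>C / K\<close> is again a quotient of
  \<open>C\<close>.\<close>

lemma presents_Mod:
  assumes K': "add_subgroup K'" "K \<subseteq> K'" "K' \<subseteq> C"
  shows "presents (M Mod (\<pi> ` K')) C K' (\<lambda>c. \<pi> ` K' #>\<^bsub>M\<^esub> \<pi> c)"
proof -
  interpret M: comm_group M
    by (rule presents_comm_group)
  have sub: "subgroup (\<pi> ` K') M"
    by (rule presents_subgroup[OF K'(1,3)])
  interpret N: normal "\<pi> ` K'" M
    by (rule M.subgroup_imp_normal[OF sub])
  note C = add_subgroupD[OF presentsD(1)]
  have \<pi>: "\<pi> a \<in> carrier M" if "a \<in> C" for a
    using that by (simp add: presentsD(4))
  have eq: "\<pi> ` K' #>\<^bsub>M\<^esub> \<pi> a = \<pi> ` K' #>\<^bsub>M\<^esub> \<pi> b \<longleftrightarrow> a - b \<in> K'" if ab: "a \<in> C" "b \<in> C" for a b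
  proof
    assume "\<pi> ` K' #>\<^bsub>M\<^esub> \<pi> a = \<pi> ` K' #>\<^bsub>M\<^esub> \<pi> b"
    then have "\<pi> (0 + a) \<in> (\<lambda>z. \<pi> (z + b)) ` K'"
      unfolding r_coset_presents[OF K'(3) ab(1)] r_coset_presents[OF K'(3) ab(2)]
      using add_subgroupD(1)[OF K'(1)] by blast
    then obtain z where z: "z \<in> K'" "\<pi> a = \<pi> (z + b)"
      by auto
    then have "a - (z + b) \<in> K'"
      using presentsD(7)[OF ab(1), of "z + b"] C(4)[OF _ ab(2)] K'(2,3) by blast
    then have "(a - (z + b)) + z \<in> K'"
      using z(1) by (rule add_subgroupD(4)[OF K'(1)])
    then show "a - b \<in> K'"
      by (simp add: algebra_simps)
  next
    assume d: "a - b \<in> K'"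
    have sub: "(\<lambda>z. \<pi> (z + x)) ` K' \<subseteq> (\<lambda>z. \<pi> (z + y)) ` K'" if "x - y \<in> K'" for x y
    proof
      fix u assume "u \<in> (\<lambda>z. \<pi> (z + x)) ` K'"
      then obtain z where z: "z \<in> K'" "u = \<pi> (z + x)"
        by blast
      have "z + x = (z + (x - y)) + y"
        by simp
      moreover have "z + (x - y) \<in> K'"
        by (rule add_subgroupD(4)[OF K'(1) z(1) that])
      ultimately show "u \<in> (\<lambda>z. \<pi> (z + y)) ` K'"
        unfolding z(2) by (metis imageI)
    qed
    have "b - a \<in> K'"
      using add_subgroupD(3)[OF K'(1) d] by simp
    then show "\<pi> ` K' #>\<^bsub>M\<^esub> \<pi> a = \<pi> ` K' #>\<^bsub>M\<^esub> \<pi> b"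
      unfolding r_coset_presents[OF K'(3) ab(1)] r_coset_presents[OF K'(3) ab(2)]
      using sub[OF d] sub by blast
  qed
  have one: "\<pi> ` K' = \<pi> ` K' #>\<^bsub>M\<^esub> \<pi> 0"
    unfolding r_coset_presents[OF K'(3) C(1)] by simp
  have mult: "(\<pi> ` K' #>\<^bsub>M\<^esub> \<pi> a) <#>\<^bsub>M\<^esub> (\<pi> ` K' #>\<^bsub>M\<^esub> \<pi> b) = \<pi> ` K' #>\<^bsub>M\<^esub> \<pi> (a + b)" if "a \<in> C" "b \<in> C" for a b
    using N.rcos_sum[OF \<pi>[OF that(1)] \<pi>[OF that(2)]] presentsD(6)[OF that] by simp
  have car: "carrier (M Mod (\<pi> ` K')) = (\<lambda>c. \<pi> ` K' #>\<^bsub>M\<^esub> \<pi> c) ` C"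
    by (simp add: carrier_FactGroup presentsD(4) image_image)
  show ?thesis
    unfolding presents_def
    using presentsD(1) K' eq mult car one by (simp add: FactGroup_def)
qed

lemma generate_presents:
  assumes "S \<subseteq> C"
  shows "generate M (\<pi> ` S) = \<pi> ` zspan (K \<union> S)"
proof
  note C = add_subgroupD[OF presentsD(1)]
  have sub: "zspan (K \<union> S) \<subseteq> C"
    using assms presentsD(3) by (intro zspan_least presentsD(1)) simp
  show "generate M (\<pi> ` S) \<subseteq> \<pi> ` zspan (K \<union> S)"
  proof
    fix x assume "x \<in> generate M (\<pi> ` S)"
    then show "x \<in> \<pi> ` zspan (K \<union> S)"
    proof induction
      case one
      then show ?case
        by (simp add: presentsD(5) zspan_zero)
    next
      case (incl h)
      then show ?case
        by (auto intro: zspan_base)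
    next
      case (inv h)
      then obtain s where s: "s \<in> S" "h = \<pi> s"
        by blast
      then have "inv\<^bsub>M\<^esub> h = \<pi> (- s)"
        using presents_inv assms by blast
      moreover have "- s \<in> zspan (K \<union> S)"
        using s(1) by (intro add_subgroupD(3)[OF add_subgroup_zspan] zspan_base) simp
      ultimately show ?case
        by blast
    next
      case (eng h1 h2)
      then obtain a b where ab: "a \<in> zspan (K \<union> S)" "h1 = \<pi> a" "b \<in> zspan (K \<union> S)" "h2 = \<pi> b"
        by blast
      then have "h1 \<otimes>\<^bsub>M\<^esub> h2 = \<pi> (a + b)"
        using presentsD(6) sub by blast
      moreover have "a + b \<in> zspan (K \<union> S)"
        by (rule add_subgroupD(4)[OF add_subgroup_zspan ab(1,3)])
      ultimately show ?case
        by blast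
    qed
  qed
  interpret M: comm_group M
    by (rule presents_comm_group)
  have S_M: "\<pi> ` S \<subseteq> carrier M"
    using assms by (auto simp: presentsD(4))
  show "\<pi> ` zspan (K \<union> S) \<subseteq> generate M (\<pi> ` S)"
  proof
    fix x assume "x \<in> \<pi> ` zspan (K \<union> S)"
    then obtain a where "a \<in> zspan (K \<union> S)" "x = \<pi> a"
      by blast
    then show "x \<in> generate M (\<pi> ` S)"
    proof (induction arbitrary: x rule: zspan.induct)
      case zspan_zero
      then show ?case
        using generate.one[of M] by (simp add: presentsD(5))
    next
      case (zspan_base a)
      then consider "a \<in> K" | "a \<in> S"
        by blast
      then show ?case
      proof cases
        case 1
        then have "\<pi> a = \<pi> 0"
          using presentsD(7)[OF _ C(1), of a] presentsD(3) by auto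
        then show ?thesis
          using generate.one[of M] zspan_base by (simp add: presentsD(5))
      next
        case 2
        then show ?thesis
          using zspan_base by (auto intro: generate.incl)
      qed
    next
      case (zspan_diff a b)
      have ab: "a \<in> C" "b \<in> C"
        using zspan_diff sub by auto
      have "\<pi> (a - b) = \<pi> a \<otimes>\<^bsub>M\<^esub> inv\<^bsub>M\<^esub> (\<pi> b)"
        using presentsD(6)[OF ab(1) C(3)[OF ab(2)]] presents_inv[OF ab(2)] by simp
      moreover have "inv\<^bsub>M\<^esub> (\<pi> b) \<in> generate M (\<pi> ` S)"
        by (rule M.generate_m_inv_closed[OF S_M zspan_diff(4)[OF refl]])
      ultimately show ?case
        using zspan_diff(3)[OF refl] zspan_diff.prems by (auto intro: generate.eng)
    qed
  qed
qed

end

lemma presents_free: "presents (free_Abelian_group X) {c. Poly_Mapping.keys c \<subseteq> X} {0} id"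
proof -
  have "add_subgroup {0 :: 'a \<Rightarrow>\<^sub>0 int}"
    by (simp add: add_subgroup_def)
  then show ?thesis
    using add_subgroup_frag_carrier[of X]
    by (simp add: presents_def) (simp add: free_Abelian_group_def)
qed

lemma presents_free_Mod:
  assumes "add_subgroup K" "K \<subseteq> {c. Poly_Mapping.keys c \<subseteq> X}"
  shows "presents (free_Abelian_group X Mod K) {c. Poly_Mapping.keys c \<subseteq> X} K (\<lambda>c. K #>\<^bsub>free_Abelian_group X\<^esub> c)"
  using presents_Mod[OF presents_free[of X] assms(1) _ assms(2)] add_subgroupD(1)[OF assms(1)] by simp

lemma induced_eq:
  assumes "X \<noteq> {}" "\<And>c. c \<in> X \<Longrightarrow> K #>\<^bsub>H\<^esub> f c = y"
  shows "induced H K f X = y"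
proof -
  have "(\<lambda>c. K #>\<^bsub>H\<^esub> f c) ` X = {y}"
    using assms by auto
  then show ?thesis
    by (simp add: induced_def)
qed

section \<open>Ordinary parts of finite modules\<close>

lemma padic_integers_carrier:
  "f \<in> carrier (padic_integers p) \<longleftrightarrow>
    (\<forall>n. f n \<in> carrier (integer_mod_group (p ^ n)) \<and> f (Suc n) mod int (p ^ n) = f n)"
  by (auto simp: padic_integers_def Let_def PiE_iff)

lemma padic_integers_mult:
  "f \<otimes>\<^bsub>padic_integers p\<^esub> g = (\<lambda>n. (f n + g n) mod int (p ^ n))"
  by (simp add: padic_integers_def Let_def restrict_def)

lemma group_padic_integers:
  assumes "p > 0"
  shows "Group.group (padic_integers p)"
proof -
  let ?G = "product_group UNIV (\<lambda>n. integer_mod_group (p ^ n))"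
  have G: "Group.group ?G"
    by simp
  have *: "padic_integers p = ?G\<lparr>carrier := carrier (padic_integers p)\<rparr>"
    by (simp add: padic_integers_def Let_def)
  have dvd: "int (p ^ n) dvd int (p ^ Suc n)" for n
    by simp
  have "subgroup (carrier (padic_integers p)) ?G"
  proof (rule group.subgroupI[OF G])
    show "carrier (padic_integers p) \<subseteq> carrier ?G"
      by (auto simp: padic_integers_def Let_def)
    have "(\<lambda>_. 0) \<in> carrier (padic_integers p)"
      using assms by (simp add: padic_integers_carrier carrier_integer_mod_group)
    then show "carrier (padic_integers p) \<noteq> {}"
      by blast
    fix f assume f: "f \<in> carrier (padic_integers p)"
    then have fG: "f \<in> carrier ?G"
      by (auto simp: padic_integers_def Let_def)
    have inv: "inv\<^bsub>?G\<^esub> f = (\<lambda>n. (- f n) mod int (p ^ n))"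
      using f fG by (subst inv_product_group) (auto simp: padic_integers_carrier)
    have "(- f (Suc n)) mod int (p ^ Suc n) mod int (p ^ n) = (- f n) mod int (p ^ n)" for n
      using f mod_mod_cancel[OF dvd] mod_minus_eq[of "f (Suc n)" "int (p ^ n)"]
      unfolding padic_integers_carrier by metis
    then show "inv\<^bsub>?G\<^esub> f \<in> carrier (padic_integers p)"
      unfolding inv padic_integers_carrier using assms by (simp add: carrier_integer_mod_group)
    fix g assume g: "g \<in> carrier (padic_integers p)"
    have mult: "f \<otimes>\<^bsub>?G\<^esub> g = (\<lambda>n. (f n + g n) mod int (p ^ n))"
      by (simp add: restrict_def)
    have "(f (Suc n) + g (Suc n)) mod int (p ^ Suc n) mod int (p ^ n) = (f n + g n) mod int (p ^ n)" for n
      using f g mod_mod_cancel[OF dvd] mod_add_eq[of "f (Suc n)" "int (p ^ n)" "g (Suc n)"]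
      unfolding padic_integers_carrier by metis
    then show "f \<otimes>\<^bsub>?G\<^esub> g \<in> carrier (padic_integers p)"
      unfolding mult padic_integers_carrier using assms by (simp add: carrier_integer_mod_group)
  qed
  from group.subgroup_imp_group[OF G this] show ?thesis
    unfolding *[symmetric] .
qed

lemma padic_integers_pow:
  assumes "f \<in> carrier (padic_integers p)" "p > 0"
  shows "f [^]\<^bsub>padic_integers p\<^esub> (m :: nat) = (\<lambda>n. (int m * f n) mod int (p ^ n))"
proof (induction m)
  case 0
  show ?case
    by (simp add: padic_integers_def Let_def)
next
  case (Suc m)
  then show ?case
    by (simp add: padic_integers_mult mod_simps distrib_right add.commute)
qed

text \<open>The equation has exactly one solution modulo each \<open>p ^ n\<close>, and uniqueness
  makes these solutions compatible.\<close>

lemma padic_integers_divide: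
  assumes p: "prime p" and q: "coprime q p" and f: "f \<in> carrier (padic_integers p)"
  shows "\<exists>g\<in>carrier (padic_integers p). g [^]\<^bsub>padic_integers p\<^esub> (q :: nat) = f"
proof -
  have p0: "p > 0"
    using p by (rule prime_gt_0_nat)
  have cop: "coprime (int q) (int (p ^ n))" for n
    using q by simp
  have f_range: "0 \<le> f n" "f n < int (p ^ n)" "f (Suc n) mod int (p ^ n) = f n" for n
    using f p0 by (auto simp: padic_integers_carrier carrier_integer_mod_group)
  have ex: "\<exists>w. 0 \<le> w \<and> w < int (p ^ n) \<and> (int q * w) mod int (p ^ n) = f n" for n
  proof -
    obtain u where "[int q * u = 1] (mod int (p ^ n))"
      using cong_solve_coprime_int[OF cop] by blast
    then have "[int q * u * f n = 1 * f n] (mod int (p ^ n))"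
      by (rule cong_scalar_right)
    then have "(int q * (u * f n)) mod int (p ^ n) = f n"
      using f_range[of n] by (simp add: cong_def mult.assoc)
    then have "(int q * ((u * f n) mod int (p ^ n))) mod int (p ^ n) = f n"
      by (simp add: mod_mult_right_eq)
    then show ?thesis
      using p0 by (intro exI[of _ "(u * f n) mod int (p ^ n)"]) simp
  qed
  have unique: "w = w'" if "0 \<le> w" "w < int (p ^ n)" "0 \<le> w'" "w' < int (p ^ n)"
    "(int q * w) mod int (p ^ n) = (int q * w') mod int (p ^ n)" for w w' n
  proof -
    have "[w = w'] (mod int (p ^ n))"
      using that(5) cong_mult_lcancel[OF cop] by (simp add: cong_def)
    then show ?thesis
      using that(1-4) by (simp add: cong_def)
  qed
  from ex obtain g where g: "\<And>n. 0 \<le> g n" "\<And>n. g n < int (p ^ n)" "\<And>n. (int q * g n) mod int (p ^ n) = f n"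
    by metis
  have "g (Suc n) mod int (p ^ n) = g n" for n
  proof (rule unique)
    have "(int q * (g (Suc n) mod int (p ^ n))) mod int (p ^ n) = (int q * g (Suc n)) mod int (p ^ n)"
      by (rule mod_mult_right_eq)
    also have "\<dots> = ((int q * g (Suc n)) mod int (p ^ Suc n)) mod int (p ^ n)"
      by (rule mod_mod_cancel[symmetric]) simp
    also have "\<dots> = (int q * g n) mod int (p ^ n)"
      unfolding g(3) by (rule f_range(3))
    finally show "(int q * (g (Suc n) mod int (p ^ n))) mod int (p ^ n) = (int q * g n) mod int (p ^ n)" .
  qed (use p0 g in simp_all)
  then have "g \<in> carrier (padic_integers p)"
    using g p0 by (simp add: padic_integers_carrier carrier_integer_mod_group)
  moreover from this have "g [^]\<^bsub>padic_integers p\<^esub> q = f"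
    by (simp add: padic_integers_pow[OF _ p0] g(3) del: of_nat_power)
  ultimately show ?thesis
    by blast
qed

text \<open>The hypothesis puts the image of \<open>t^m\<close> into the \<open>p^m\<close>-th
  powers. Let \<open>p^a q\<close> be the order of \<open>M\<close>, with \<open>q\<close> prime to
  \<open>p\<close>. Every \<open>x \<otimes> v\<close> can be written
  \<open>x \<otimes> q w\<close>, and for \<open>m \<ge> a\<close> the exponent \<open>q p^m\<close>
  annihilates \<open>M\<close>. So \<open>t\<close> is nilpotent on the tensor product and the
  projector is trivial.\<close>

lemma non_ordinaryI:
  assumes M: "comm_group M" "finite (carrier M)" and t: "t \<in> hom M M" and p: "prime p"
    and div: "\<And>x. x \<in> carrier M \<Longrightarrow> \<exists>y\<in>carrier M. t x = y [^]\<^bsub>M\<^esub> p"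
  shows "non_ordinary p M t"
proof -
  interpret M: comm_group M by (rule M(1))
  let ?P = "padic_integers p"
  interpret P: Group.group ?P
    by (rule group_padic_integers[OF prime_gt_0_nat[OF p]])
  interpret t: group_hom M M t
    using t by unfold_locales
  let ?X = "carrier M \<times> carrier ?P"
  define RR where "RR = tensor_relations M ?P (UNIV :: int set) (\<lambda>x n. x [^]\<^bsub>M\<^esub> n) (\<lambda>n y. y [^]\<^bsub>?P\<^esub> n)"
  define gens where "gens =
     ({frag_of (x \<otimes>\<^bsub>M\<^esub> y, v) - frag_of (x, v) - frag_of (y, v) | x y v.
         x \<in> carrier M \<and> y \<in> carrier M \<and> v \<in> carrier ?P} \<union>
      {frag_of (x, v \<otimes>\<^bsub>?P\<^esub> w) - frag_of (x, v) - frag_of (x, w) | x v w.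
         x \<in> carrier M \<and> v \<in> carrier ?P \<and> w \<in> carrier ?P} \<union>
      {frag_of (x [^]\<^bsub>M\<^esub> r, v) - frag_of (x, v [^]\<^bsub>?P\<^esub> r) | x r v.
         x \<in> carrier M \<and> r \<in> (UNIV :: int set) \<and> v \<in> carrier ?P})"
  define C where "C = {c :: ('a \<times> (nat \<Rightarrow> int)) \<Rightarrow>\<^sub>0 int. Poly_Mapping.keys c \<subseteq> ?X}"
  have sub_C: "add_subgroup C"
    unfolding C_def by (rule add_subgroup_frag_carrier)
  have C_of: "x \<in> carrier M \<Longrightarrow> v \<in> carrier ?P \<Longrightarrow> frag_of (x, v) \<in> C" for x v
    by (simp add: C_def)
  have gens_C: "gens \<subseteq> C"
    unfolding gens_def by (auto intro!: add_subgroupD(2)[OF sub_C] C_of)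
  have RR_eq: "RR = zspan gens"
    using generate_free_Abelian_group[of gens ?X] gens_C
    unfolding RR_def tensor_relations_def gens_def[symmetric] C_def by (simp add: free_Abelian_group_def)
  have sub_RR: "add_subgroup RR"
    by (simp add: RR_eq)
  have RR_C: "RR \<subseteq> C"
    unfolding RR_eq by (rule zspan_least[OF gens_C sub_C])
  let ?F = "free_Abelian_group ?X"
  have Z: "Z_tensor M ?P = ?F Mod RR"
    by (simp add: Z_tensor_def tensor_product_def RR_def)
  have one_Z: "\<one>\<^bsub>Z_tensor M ?P\<^esub> = RR"
    by (simp add: Z FactGroup_def)
  have pres: "presents (Z_tensor M ?P) C RR (\<lambda>c. RR #>\<^bsub>?F\<^esub> c)"
    unfolding Z C_def by (rule presents_free_Mod[OF sub_RR RR_C[unfolded C_def]])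
  define \<theta> where "\<theta> = frag_extend (\<lambda>(x, y :: nat \<Rightarrow> int). frag_of (t x, y))"
  have \<theta>_diff: "\<theta> (a - b) = \<theta> a - \<theta> b" for a b
    by (simp add: \<theta>_def frag_extend_diff)
  have \<theta>_of: "\<theta> (frag_of (x, y)) = frag_of (t x, y)" for x y
    by (simp add: \<theta>_def)
  have \<theta>_0: "\<theta> 0 = 0"
    by (simp add: \<theta>_def)
  have \<theta>_add: "\<theta> (a + b) = \<theta> a + \<theta> b" for a b
    by (simp add: \<theta>_def frag_extend_add)
  have \<theta>_C: "\<theta> c \<in> C" if "c \<in> C" for c
  proof -
    have "Poly_Mapping.keys c \<subseteq> ?X"
      using that by (simp add: C_def)
    then show ?thesis
    proof (induction c rule: frag_induction)
      case (one z)
      then show ?case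
        by (cases z) (auto simp: \<theta>_of intro!: C_of)
    next
      case (diff a b)
      then show ?case
        using add_subgroupD(2)[OF sub_C] by (simp add: \<theta>_diff)
    qed (use add_subgroupD(1)[OF sub_C] \<theta>_0 in simp)
  qed
  have \<theta>_RR: "\<theta> c \<in> RR" if "c \<in> RR" for c
  proof -
    have "gens \<subseteq> {c. \<theta> c \<in> RR}"
    proof
      fix c assume "c \<in> gens"
      then have "\<theta> c \<in> gens"
        unfolding gens_def
      proof (elim UnE CollectE exE conjE)
        fix x y v assume "c = frag_of (x \<otimes>\<^bsub>M\<^esub> y, v) - frag_of (x, v) - frag_of (y, v)"
          and x: "x \<in> carrier M" "y \<in> carrier M" "v \<in> carrier ?P"
        then have "\<theta> c = frag_of (t x \<otimes>\<^bsub>M\<^esub> t y, v) - frag_of (t x, v) - frag_of (t y, v)"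
          by (simp add: \<theta>_diff \<theta>_of)
        then show "\<theta> c \<in> {frag_of (x \<otimes>\<^bsub>M\<^esub> y, v) - frag_of (x, v) - frag_of (y, v) | x y v.
            x \<in> carrier M \<and> y \<in> carrier M \<and> v \<in> carrier ?P} \<union>
          {frag_of (x, v \<otimes>\<^bsub>?P\<^esub> w) - frag_of (x, v) - frag_of (x, w) | x v w.
            x \<in> carrier M \<and> v \<in> carrier ?P \<and> w \<in> carrier ?P} \<union>
          {frag_of (x [^]\<^bsub>M\<^esub> r, v) - frag_of (x, v [^]\<^bsub>?P\<^esub> r) | x r v.
            x \<in> carrier M \<and> r \<in> (UNIV :: int set) \<and> v \<in> carrier ?P}"
          using t.hom_closed[OF x(1)] t.hom_closed[OF x(2)] x(3) by blast
      next
        fix x v w assume "c = frag_of (x, v \<otimes>\<^bsub>?P\<^esub> w) - frag_of (x, v) - frag_of (x, w)"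
          and x: "x \<in> carrier M" "v \<in> carrier ?P" "w \<in> carrier ?P"
        then have "\<theta> c = frag_of (t x, v \<otimes>\<^bsub>?P\<^esub> w) - frag_of (t x, v) - frag_of (t x, w)"
          by (simp add: \<theta>_diff \<theta>_of)
        then show "\<theta> c \<in> {frag_of (x \<otimes>\<^bsub>M\<^esub> y, v) - frag_of (x, v) - frag_of (y, v) | x y v.
            x \<in> carrier M \<and> y \<in> carrier M \<and> v \<in> carrier ?P} \<union>
          {frag_of (x, v \<otimes>\<^bsub>?P\<^esub> w) - frag_of (x, v) - frag_of (x, w) | x v w.
            x \<in> carrier M \<and> v \<in> carrier ?P \<and> w \<in> carrier ?P} \<union>
          {frag_of (x [^]\<^bsub>M\<^esub> r, v) - frag_of (x, v [^]\<^bsub>?P\<^esub> r) | x r v.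
            x \<in> carrier M \<and> r \<in> (UNIV :: int set) \<and> v \<in> carrier ?P}"
          using t.hom_closed[OF x(1)] x(2,3) by blast
      next
        fix x v and r :: int assume "c = frag_of (x [^]\<^bsub>M\<^esub> r, v) - frag_of (x, v [^]\<^bsub>?P\<^esub> r)"
          and x: "x \<in> carrier M" "v \<in> carrier ?P"
        then have "\<theta> c = frag_of (t x [^]\<^bsub>M\<^esub> r, v) - frag_of (t x, v [^]\<^bsub>?P\<^esub> r)"
          by (simp add: \<theta>_diff \<theta>_of t.hom_int_pow)
        then show "\<theta> c \<in> {frag_of (x \<otimes>\<^bsub>M\<^esub> y, v) - frag_of (x, v) - frag_of (y, v) | x y v.
            x \<in> carrier M \<and> y \<in> carrier M \<and> v \<in> carrier ?P} \<union>
          {frag_of (x, v \<otimes>\<^bsub>?P\<^esub> w) - frag_of (x, v) - frag_of (x, w) | x v w.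
            x \<in> carrier M \<and> v \<in> carrier ?P \<and> w \<in> carrier ?P} \<union>
          {frag_of (x [^]\<^bsub>M\<^esub> r, v) - frag_of (x, v [^]\<^bsub>?P\<^esub> r) | x r v.
            x \<in> carrier M \<and> r \<in> (UNIV :: int set) \<and> v \<in> carrier ?P}"
          using t.hom_closed[OF x(1)] x(2) by blast
      qed
      then show "c \<in> {c. \<theta> c \<in> RR}"
        by (simp add: RR_eq zspan_base)
    qed
    moreover have "add_subgroup {c. \<theta> c \<in> RR}"
      using add_subgroupD[OF sub_RR] by (simp add: add_subgroup_def \<theta>_diff \<theta>_0)
    ultimately have "RR \<subseteq> {c. \<theta> c \<in> RR}"
      unfolding RR_eq[of ] by (intro zspan_least) (simp_all add: RR_eq)
    then show ?thesis
      using that by blast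
  qed
  have endo: "tensor_endo M ?P t (RR #>\<^bsub>?F\<^esub> c) = RR #>\<^bsub>?F\<^esub> \<theta> c" if c: "c \<in> C" for c
    unfolding tensor_endo_def one_Z \<theta>_def[symmetric]
  proof (rule induced_eq)
    show "RR #>\<^bsub>?F\<^esub> c \<noteq> {}"
      using add_subgroupD(1)[OF sub_RR] by (auto simp: r_coset_def)
    fix d assume "d \<in> RR #>\<^bsub>?F\<^esub> c"
    then obtain r where r: "r \<in> RR" "d = r + c"
      by (auto simp: r_coset_def)
    have "d \<in> C"
      using r c RR_C add_subgroupD(4)[OF sub_C] by blast
    then show "RR #>\<^bsub>?F\<^esub> \<theta> d = RR #>\<^bsub>?F\<^esub> \<theta> c"
      using presentsD(7)[OF pres \<theta>_C \<theta>_C, of d c] c \<theta>_RR[OF r(1)] by (simp add: r(2) \<theta>_add)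
  qed
  have \<theta>_pow_C: "(\<theta> ^^ m) c \<in> C" if "c \<in> C" for c m
    using that by (induction m) (simp_all add: \<theta>_C)
  have endo_pow: "(tensor_endo M ?P t ^^ m) (RR #>\<^bsub>?F\<^esub> c) = RR #>\<^bsub>?F\<^esub> (\<theta> ^^ m) c" if "c \<in> C" for c m
    by (induction m) (simp_all add: endo \<theta>_pow_C that)
  define om where "om = card (carrier M)"
  have om: "om > 0"
    unfolding om_def card_gt_0_iff using M(2) M.one_closed by blast
  obtain a q where aq: "om = p ^ a * q" "coprime q p"
  proof -
    have "\<not> is_unit p" "om \<noteq> 0"
      using p om by (auto dest: not_prime_unit)
    then obtain q where q: "om = p ^ multiplicity p om * q" "\<not> p dvd q"
      using multiplicity_decompose'[of om p] by blast
    then show thesis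
      using that[of "multiplicity p om" q] p by (simp add: coprime_commute prime_imp_coprime)
  qed
  have t_pow: "\<exists>y\<in>carrier M. (t ^^ m) x = y [^]\<^bsub>M\<^esub> (p ^ m)" if "x \<in> carrier M" for x m
    using that
  proof (induction m)
    case 0
    then show ?case
      by (intro bexI[of _ x]) simp_all
  next
    case (Suc m)
    then obtain y where y: "y \<in> carrier M" "(t ^^ m) x = y [^]\<^bsub>M\<^esub> (p ^ m)"
      by blast
    obtain z where z: "z \<in> carrier M" "t y = z [^]\<^bsub>M\<^esub> p"
      using div[OF y(1)] by blast
    have "(t ^^ Suc m) x = t y [^]\<^bsub>M\<^esub> (p ^ m)"
      using y by (simp add: t.hom_nat_pow)
    also have "\<dots> = z [^]\<^bsub>M\<^esub> (p ^ Suc m)"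
      using z by (simp add: M.nat_pow_pow)
    finally show ?case
      using z(1) by blast
  qed
  have \<theta>_pow_diff: "(\<theta> ^^ m) (b - c) = (\<theta> ^^ m) b - (\<theta> ^^ m) c" for m b c
    by (induction m) (simp_all add: \<theta>_diff)
  have \<theta>_pow_of: "(\<theta> ^^ m) (frag_of (x, v)) = frag_of ((t ^^ m) x, v)" for m x v
    by (induction m) (simp_all add: \<theta>_of)
  have one_RR: "frag_of (\<one>\<^bsub>M\<^esub>, v) \<in> RR" if "v \<in> carrier ?P" for v
  proof -
    have "frag_of (\<one>\<^bsub>M\<^esub> \<otimes>\<^bsub>M\<^esub> \<one>\<^bsub>M\<^esub>, v) - frag_of (\<one>\<^bsub>M\<^esub>, v) - frag_of (\<one>\<^bsub>M\<^esub>, v) \<in> gens"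
      unfolding gens_def using that M.one_closed by blast
    then have "- frag_of (\<one>\<^bsub>M\<^esub>, v) \<in> RR"
      unfolding RR_eq by (intro zspan_base) simp
    from add_subgroupD(3)[OF sub_RR this] show ?thesis
      by simp
  qed
  have \<theta>_pow_RR: "(\<theta> ^^ m) c \<in> RR" if "c \<in> C" "a \<le> m" for c m
  proof -
    have "Poly_Mapping.keys c \<subseteq> ?X"
      using that by (simp add: C_def)
    then show ?thesis
    proof (induction c rule: frag_induction)
      case zero
      show ?case
        using add_subgroupD(1)[OF sub_RR] \<theta>_pow_diff[of m 0 0] by simp
    next
      case (one z)
      obtain x v where xv: "z = (x, v)" "x \<in> carrier M" "v \<in> carrier ?P"
        using one by (cases z) auto
      obtain y where y: "y \<in> carrier M" "(t ^^ m) x = y [^]\<^bsub>M\<^esub> (p ^ m)"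
        using t_pow[OF xv(2)] by blast
      obtain w where w: "w \<in> carrier ?P" "w [^]\<^bsub>?P\<^esub> q = v"
        using padic_integers_divide[OF p aq(2) xv(3)] by blast
      let ?y = "y [^]\<^bsub>M\<^esub> (p ^ m)"
      have "p ^ m * q = om * p ^ (m - a)"
        using that(2) by (simp add: aq(1) power_add[symmetric] mult.commute mult.left_commute)
      then have "?y [^]\<^bsub>M\<^esub> q = (y [^]\<^bsub>M\<^esub> om) [^]\<^bsub>M\<^esub> (p ^ (m - a))"
        using y(1) by (simp add: M.nat_pow_pow)
      also have "\<dots> = \<one>\<^bsub>M\<^esub>"
        by (simp only: om_def M.power_order_eq_one[OF M(2) y(1)] M.nat_pow_one)
      finally have y1: "?y [^]\<^bsub>M\<^esub> int q = \<one>\<^bsub>M\<^esub>"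
        by (simp add: int_pow_int)
      have "frag_of (?y [^]\<^bsub>M\<^esub> int q, w) - frag_of (?y, w [^]\<^bsub>?P\<^esub> int q) \<in> gens"
        unfolding gens_def using y(1) w(1) by blast
      then have "frag_of (\<one>\<^bsub>M\<^esub>, w) - frag_of (?y, v) \<in> RR"
        unfolding RR_eq y1 by (intro zspan_base) (simp add: int_pow_int w(2))
      from add_subgroupD(2)[OF sub_RR one_RR[OF w(1)] this] show ?case
        by (simp add: xv(1) \<theta>_pow_of y(2))
    next
      case (diff b c)
      then show ?case
        using add_subgroupD(2)[OF sub_RR] by (simp add: \<theta>_pow_diff)
    qed
  qed
  have proj: "ordinary_projector p M t (RR #>\<^bsub>?F\<^esub> c) = RR" if c: "c \<in> C" for c
  proof -
    have RR0: "RR #>\<^bsub>?F\<^esub> 0 = RR"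
      using presentsD(5)[OF pres] one_Z by simp
    have "(tensor_endo M ?P t ^^ fact m) (RR #>\<^bsub>?F\<^esub> c) = RR" if m: "m \<ge> a" for m
    proof -
      have "a \<le> fact m"
        using m fact_ge_self[of m] by linarith
      then have "(\<theta> ^^ fact m) c - 0 \<in> RR"
        using \<theta>_pow_RR[OF c] by simp
      then show ?thesis
        unfolding endo_pow[OF c]
        using presentsD(7)[OF pres \<theta>_pow_C[OF c] add_subgroupD(1)[OF sub_C]] RR0 by simp
    qed
    then have ev: "\<forall>\<^sub>F m in sequentially. (tensor_endo M ?P t ^^ fact m) (RR #>\<^bsub>?F\<^esub> c) = RR"
      unfolding eventually_sequentially by blast
    show ?thesis
      unfolding ordinary_projector_def
    proof (rule the_equality[where P = "\<lambda>y. \<forall>\<^sub>F m in sequentially. (tensor_endo M ?P t ^^ fact m) (RR #>\<^bsub>?F\<^esub> c) = y", OF ev])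
      fix y assume "\<forall>\<^sub>F m in sequentially. (tensor_endo M ?P t ^^ fact m) (RR #>\<^bsub>?F\<^esub> c) = y"
      with ev have "\<forall>\<^sub>F m in sequentially. y = RR"
        by eventually_elim simp
      then show "y = RR"
        by simp
    qed
  qed
  show ?thesis
    unfolding non_ordinary_def one_Z presentsD(4)[OF pres] image_image
    using proj add_subgroupD(1)[OF sub_C] by auto
qed

section \<open>The quotient by the hyperbolic cycles\<close>

context level
begin

abbreviation proj where "proj c \<equiv> R #>\<^bsub>I_free \<Gamma> n\<^esub> c"

lemma presents_I_tensor: "presents (I_tensor \<Gamma> n) chains R proj"
proof -
  have "I_tensor \<Gamma> n = free_Abelian_group (I \<times> V n) Mod R"
    by (simp add: I_tensor_def tensor_product_def I_relations_def additive_group_def)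
  then show ?thesis
    using presents_free_Mod[of R "I \<times> V n"] R_chains by (simp add: I_free_eq chains_def)
qed

lemma proj_eq: "a \<in> chains \<Longrightarrow> b \<in> chains \<Longrightarrow> proj a = proj b \<longleftrightarrow> a - b \<in> R"
  by (rule presentsD(7)[OF presents_I_tensor])

lemma mem_proj: "d \<in> proj c \<longleftrightarrow> (\<exists>r\<in>R. d = r + c)"
  by (auto simp: r_coset_def I_free_eq)

lemma proj_nonempty: "proj c \<noteq> {}"
  using add_subgroupD(1)[OF add_subgroup_R] mem_proj by blast

lemma boundary_proj: "boundary (proj c) = bd c"
proof -
  have "(\<lambda>c. \<Sum>xv\<in>Poly_Mapping.keys c. of_int (Poly_Mapping.lookup c xv) * ring_act (fst xv) (snd xv)) ` proj c = bd ` proj c"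
    by (simp add: bd_def lext_def)
  also have "\<dots> = (\<lambda>_. bd c) ` proj c"
    by (rule image_cong[OF refl]) (auto simp: mem_proj bd_add bd_R)
  also have "\<dots> = {bd c}"
    using proj_nonempty by (rule image_constant_conv[THEN trans, OF if_not_P])
  finally show ?thesis
    by (simp add: boundary_def)
qed

lemma presents_H1: "presents (H1 \<Gamma> n) cycles R proj"
proof -
  have "kernel (I_tensor \<Gamma> n) (additive_group (V n)) boundary = proj ` cycles"
    unfolding kernel_def presentsD(4)[OF presents_I_tensor]
    by (auto simp: additive_group_def boundary_proj cycles_def)
  then have "H1 \<Gamma> n = (I_tensor \<Gamma> n)\<lparr>carrier := proj ` cycles\<rparr>"
    by (simp add: H1_def)
  moreover have "cycles \<subseteq> chains" "R \<subseteq> cycles"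
    using R_chains bd_R by (auto simp: cycles_def)
  ultimately show ?thesis
    using presents_restrict[OF presents_I_tensor add_subgroup_cycles] by simp
qed

lemma hyperbolic_cycles_eq: "hyperbolic_cycles \<Gamma> k = proj ` KH"
proof -
  have "hyperbolic_cycle \<Gamma> k g = proj (ch g (Q g ^ k))" for g
    by (simp add: hyperbolic_cycle_def pure_tensor_def ch_def)
  then have "hyperbolic_cycle \<Gamma> k ` {g \<in> carrier (bar \<Gamma>). hyperbolic g} = proj ` hyp"
    by (auto simp: hyp_def)
  moreover have "hyp \<subseteq> cycles"
    using KH_cycles by (auto intro: zspan_base)
  ultimately show ?thesis
    using generate_presents[OF presents_H1] by (simp add: hyperbolic_cycles_def)
qed

abbreviation qproj where "qproj c \<equiv> proj ` KH #>\<^bsub>H1 \<Gamma> n\<^esub> proj c"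

lemma presents_cycle_quotient: "presents (cycle_quotient \<Gamma> k) cycles KH qproj"
  unfolding cycle_quotient_def hyperbolic_cycles_eq
  by (rule presents_Mod[OF presents_H1 add_subgroup_zspan R_KH KH_cycles])

lemma mem_qproj: "c \<in> cycles \<Longrightarrow> x \<in> qproj c \<longleftrightarrow> (\<exists>z\<in>KH. x = proj (z + c))"
  using r_coset_presents[OF presents_H1 KH_cycles] by auto

lemma finite_cycle_quotient: "finite (carrier (cycle_quotient \<Gamma> k))"
proof -
  obtain T where T: "finite T" "\<forall>c\<in>cycles. \<exists>t\<in>T. cg KH c t"
    using cycles_finite_quotient by blast
  \<comment> \<open>The elements of \<open>T\<close> need not be cycles; each is replaced by some
    cycle congruent to it, where there is one.\<close>
  define f where "f t = qproj (SOME c. c \<in> cycles \<and> cg KH c t)" for t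
  have "qproj c \<in> f ` T" if c: "c \<in> cycles" for c
  proof -
    obtain t where t: "t \<in> T" "cg KH c t"
      using T(2) c by blast
    define d where "d = (SOME c. c \<in> cycles \<and> cg KH c t)"
    have d: "d \<in> cycles \<and> cg KH d t"
      unfolding d_def by (rule someI[of _ c]) (use c t in blast)
    then have "cg KH c d"
      using cg_trans[OF add_subgroup_zspan t(2) cg_sym[OF add_subgroup_zspan]] by blast
    then have "qproj c = f t"
      unfolding f_def d_def[symmetric]
      using presentsD(7)[OF presents_cycle_quotient c] d by (simp add: cg_def)
    then show ?thesis
      using t(1) by blast
  qed
  then have "carrier (cycle_quotient \<Gamma> k) \<subseteq> f ` T"
    unfolding presentsD(4)[OF presents_cycle_quotient] by blast
  then show ?thesis
    using T(1) finite_surj by blast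
qed

text \<open>The conditions under which a map on chains descends twice: to homology, and to the
  quotient by the hyperbolic cycles.\<close>

definition good_chain_map where
  "good_chain_map t \<longleftrightarrow> (\<forall>a b. t (a - b) = t a - t b) \<and> t ` R \<subseteq> R \<and> t ` cycles \<subseteq> cycles \<and> t ` KH \<subseteq> KH"

context
  fixes t :: "((mat2 set \<Rightarrow>\<^sub>0 int) \<times> poly2 \<Rightarrow>\<^sub>0 int) \<Rightarrow> ((mat2 set \<Rightarrow>\<^sub>0 int) \<times> poly2 \<Rightarrow>\<^sub>0 int)"
  assumes t: "good_chain_map t"
begin

lemma t_diff: "t (a - b) = t a - t b"
  using conjunct1[OF t[unfolded good_chain_map_def]] by (elim allE)

lemma t_add: "t (a + b) = t a + t b"
  using t_diff[of "a + b" b] by simp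

lemma t_R: "a \<in> R \<Longrightarrow> t a \<in> R" and t_cycles: "a \<in> cycles \<Longrightarrow> t a \<in> cycles" and t_KH: "a \<in> KH \<Longrightarrow> t a \<in> KH"
  using t by (simp_all only: good_chain_map_def image_subset_iff)

lemma induced_proj: "c \<in> cycles \<Longrightarrow> induced (I_free \<Gamma> n) R t (proj c) = proj (t c)"
proof (rule induced_eq[OF proj_nonempty])
  fix d assume c: "c \<in> cycles" and "d \<in> proj c"
  then obtain r where r: "r \<in> R" "d = r + c"
    using mem_proj by blast
  have "R \<subseteq> cycles"
    using R_KH KH_cycles by (rule subset_trans)
  then have "d \<in> cycles"
    using r c add_subgroupD(4)[OF add_subgroup_cycles] by blast
  then have "t d \<in> chains" "t c \<in> chains"
    using t_cycles c by (simp_all add: cycles_def)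
  moreover have "t d - t c \<in> R"
    using t_R[OF r(1)] by (simp add: r(2) t_add)
  ultimately show "proj (t d) = proj (t c)"
    by (simp add: proj_eq)
qed

lemma induced_qproj:
  assumes c: "c \<in> cycles" and f: "\<And>d. d \<in> cycles \<Longrightarrow> f (proj d) = proj (t d)"
  shows "induced (H1 \<Gamma> n) (proj ` KH) f (qproj c) = qproj (t c)"
proof (rule induced_eq)
  show "qproj c \<noteq> {}"
    using mem_qproj[OF c] add_subgroupD(1)[OF add_subgroup_zspan] by blast
  fix x assume "x \<in> qproj c"
  then obtain z where z: "z \<in> KH" "x = proj (z + c)"
    using mem_qproj[OF c] by blast
  have zc: "z + c \<in> cycles"
    using z(1) c KH_cycles add_subgroupD(4)[OF add_subgroup_cycles] by blast
  have "qproj (t (z + c)) = qproj (t c)"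
    using presentsD(7)[OF presents_cycle_quotient t_cycles[OF zc] t_cycles[OF c]] t_KH[OF z(1)] by (simp add: t_add)
  then show "proj ` KH #>\<^bsub>H1 \<Gamma> n\<^esub> f x = qproj (t c)"
    by (simp add: z(2) f[OF zc])
qed

end

section \<open>Representatives of the double coset\<close>

lemma mem_double_coset: "\<delta> \<in> double_coset \<Gamma> \<alpha> \<Gamma> \<longleftrightarrow> (\<exists>A\<in>\<Gamma>. \<exists>B\<in>\<Gamma>. \<delta> = cls (A ** (\<alpha> ** B)))"
  by (auto simp: double_coset_def set_mult_def l_coset_def cls_mult)

text \<open>One point is chosen in each orbit of left multiplication. The choice \<open>f\<close>
  depends on the orbit only, which gives uniqueness of the representative.\<close>

lemma coset_reps_exist: "\<exists>B. coset_reps \<Gamma> \<alpha> \<Gamma> B"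
proof -
  let ?D = "double_coset \<Gamma> \<alpha> \<Gamma>"
  define orb where "orb \<delta> = {\<gamma> \<cdot> \<delta> | \<gamma>. \<gamma> \<in> G}" for \<delta>
  have D_cls: "\<exists>A. \<delta> = cls A" if "\<delta> \<in> ?D" for \<delta>
    using that mem_double_coset by blast
  have self: "\<delta> \<in> orb \<delta>" if "\<delta> \<in> ?D" for \<delta>
  proof -
    obtain A where "\<delta> = cls A"
      using D_cls[OF \<open>\<delta> \<in> ?D\<close>] by blast
    then have "\<delta> = e \<cdot> \<delta>"
      by simp
    then show ?thesis
      unfolding orb_def using G_one by blast
  qed
  have orb_D: "orb \<delta> \<subseteq> ?D" if d: "\<delta> \<in> ?D" for \<delta>
  proof
    fix x assume "x \<in> orb \<delta>"
    then obtain C where C: "C \<in> \<Gamma>" "x = cls C \<cdot> \<delta>"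
      unfolding orb_def by blast
    obtain A B where AB: "A \<in> \<Gamma>" "B \<in> \<Gamma>" "\<delta> = cls (A ** (\<alpha> ** B))"
      using d unfolding mem_double_coset by blast
    have "x = cls ((C ** A) ** (\<alpha> ** B))"
      by (simp add: C(2) AB(3) cls_mult matrix_mul_assoc)
    then show "x \<in> ?D"
      unfolding mem_double_coset using mult_in[OF C(1) AB(1)] AB(2) by blast
  qed
  have orb_eq: "orb x = orb \<delta>" if d: "\<delta> \<in> ?D" and x: "x \<in> orb \<delta>" for x \<delta>
  proof -
    obtain A where A: "\<delta> = cls A"
      using D_cls[OF d] by blast
    obtain C where C: "C \<in> \<Gamma>" "x = cls (C ** A)"
      using x unfolding orb_def A by (auto simp: cls_mult)
    have 1: "orb (cls X) = (\<lambda>B. cls (B ** X)) ` \<Gamma>" for X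
      unfolding orb_def cls_mult[symmetric] by blast
    have "\<exists>B'\<in>\<Gamma>. B ** (C ** A) = B' ** A" if "B \<in> \<Gamma>" for B
      using mult_in[OF that C(1)] by (intro bexI[of _ "B ** C"]) (simp_all add: matrix_mul_assoc)
    moreover have "\<exists>B'\<in>\<Gamma>. B ** A = B' ** (C ** A)" if "B \<in> \<Gamma>" for B
      using mult_in[OF that adj_in[OF C(1)]] mult_adj_cancel(2)[OF det_1[OF C(1)], of A]
      by (intro bexI[of _ "B ** adj C"]) (simp_all add: matrix_mul_assoc[symmetric])
    ultimately show ?thesis
      unfolding A C(2) 1 image_def by (intro Collect_cong) metis
  qed
  define f where "f \<delta> = (SOME x. x \<in> orb \<delta>)" for \<delta>
  have f: "f \<delta> \<in> orb \<delta>" if "\<delta> \<in> ?D" for \<delta>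
    unfolding f_def using self[OF that] by (rule someI)
  have f_eq: "f x = f \<delta>" if "orb x = orb \<delta>" for x \<delta>
    unfolding f_def that ..
  have mem: "\<delta> \<in> carrier (bar \<Gamma>) #>\<^bsub>PM2plus\<^esub> \<beta> \<longleftrightarrow> \<delta> \<in> orb \<beta>" for \<delta> \<beta>
    unfolding r_coset_iff orb_def by blast
  have "coset_reps \<Gamma> \<alpha> \<Gamma> (f ` ?D)"
    unfolding coset_reps_def mem
  proof (intro conjI ballI ex_ex1I)
    show "f ` ?D \<subseteq> ?D"
      using f orb_D by blast
    fix \<delta> assume d: "\<delta> \<in> ?D"
    have "orb (f \<delta>) = orb \<delta>"
      by (rule orb_eq[OF d f[OF d]])
    then have "\<delta> \<in> orb (f \<delta>)"
      using self[OF d] by simp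
    then show "\<exists>\<beta>. \<beta> \<in> f ` ?D \<and> \<delta> \<in> orb \<beta>"
      using d by blast
    fix \<beta> \<beta>' assume b: "\<beta> \<in> f ` ?D \<and> \<delta> \<in> orb \<beta>" "\<beta>' \<in> f ` ?D \<and> \<delta> \<in> orb \<beta>'"
    have *: "\<beta> = f \<delta>" if bf: "\<beta> \<in> f ` ?D" and db: "\<delta> \<in> orb \<beta>" for \<beta>
    proof -
      obtain \<delta>' where d': "\<delta>' \<in> ?D" "\<beta> = f \<delta>'"
        using bf by (rule imageE)
      have bD: "\<beta> \<in> ?D"
        using f[OF d'(1)] orb_D[OF d'(1)] d'(2) by blast
      have "orb \<delta> = orb \<beta>"
        by (rule orb_eq[OF bD db])
      also have "\<dots> = orb \<delta>'"
        unfolding d'(2) by (rule orb_eq[OF d'(1) f[OF d'(1)]])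
      finally show ?thesis
        unfolding d'(2) by (rule f_eq[symmetric])
    qed
    show "\<beta> = \<beta>'"
      using *[of \<beta>] *[of \<beta>'] b by simp
  qed
  then show ?thesis ..
qed

end

context level begin

text \<open>The double coset is stable under right multiplication by the group, so the defining
  property of representatives applies to \<open>\<beta> \<cdot> g\<close>.\<close>

lemma coset_reps_is_reps:
  assumes "coset_reps \<Gamma> \<alpha> \<Gamma> B" "finite B" "det \<alpha> > 0"
  shows "is_reps B"
  unfolding is_reps_def
proof (intro conjI ballI)
  have sub: "B \<subseteq> double_coset \<Gamma> \<alpha> \<Gamma>"
    using assms(1) unfolding coset_reps_def by (elim conjE)
  have ex1: "\<exists>!\<beta>. \<beta> \<in> B \<and> (\<exists>\<gamma>\<in>G. \<delta> = \<gamma> \<cdot> \<beta>)" if "\<delta> \<in> double_coset \<Gamma> \<alpha> \<Gamma>" for \<delta>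
    using assms(1) that unfolding coset_reps_def r_coset_iff by (elim conjE) (erule bspec)
  show "finite B"
    by (rule assms(2))
  fix \<beta> assume "\<beta> \<in> B"
  with sub have "\<beta> \<in> double_coset \<Gamma> \<alpha> \<Gamma>"
    by (rule subsetD)
  then obtain A A' where A: "A \<in> \<Gamma>" "A' \<in> \<Gamma>" "\<beta> = cls (A ** (\<alpha> ** A'))"
    unfolding mem_double_coset by (elim bexE)
  have "det (A ** (\<alpha> ** A')) \<noteq> 0"
    using det_1 A assms(3) by (simp add: det_mul)
  then show "\<exists>A. det A \<noteq> 0 \<and> \<beta> = cls A"
    using A(3) by blast
  fix g assume "g \<in> G"
  then obtain C where C: "C \<in> \<Gamma>" "g = cls C"
    by blast
  have "\<beta> \<cdot> g = cls (A ** (\<alpha> ** (A' ** C)))"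
    by (simp add: A(3) C(2) cls_mult matrix_mul_assoc)
  then have "\<beta> \<cdot> g \<in> double_coset \<Gamma> \<alpha> \<Gamma>"
    unfolding mem_double_coset using A(1) mult_in[OF A(2) C(1)] by blast
  then show "\<exists>!\<beta>'. \<beta>' \<in> B \<and> (\<exists>\<gamma>\<in>G. \<beta> \<cdot> g = \<gamma> \<cdot> \<beta>')"
    by (rule ex1)
qed

section \<open>Hecke operators on homology and on the quotient\<close>

abbreviation reps where "reps \<alpha> \<equiv> (SOME B. coset_reps \<Gamma> \<alpha> \<Gamma> B)"

lemma coset_reps_reps: "coset_reps \<Gamma> \<alpha> \<Gamma> (reps \<alpha>)"
  using coset_reps_exist by (rule someI_ex)

text \<open>The system of representatives is in fact finite. Were it infinite, the sum over it would
  have the junk value \<open>0\<close>, for which the claims are trivial.\<close>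

lemma hecke_chain_infinite: "infinite B \<Longrightarrow> hecke_chain \<Gamma> B c = 0"
  by (simp add: hecke_chain_def frag_extend_eq_0 split_beta)

lemma hecke_chain_good:
  assumes "det \<alpha> > 0"
  shows "good_chain_map (hecke_chain \<Gamma> (reps \<alpha>))"
proof (cases "finite (reps \<alpha>)")
  case True
  have B: "is_reps (reps \<alpha>)"
    by (rule coset_reps_is_reps[OF coset_reps_reps True assms])
  show ?thesis
    unfolding good_chain_map_def
    using hc_diff[OF B] hc_R[OF B] hc_KH[OF B] hc_chains[OF B] hc_cycle[OF B] by (auto simp: cycles_def)
next
  case False
  show ?thesis
    unfolding good_chain_map_def
    using add_subgroupD(1)[OF add_subgroup_R] add_subgroupD(1)[OF add_subgroup_cycles] zspan_zero
    by (auto simp: hecke_chain_infinite[OF False])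
qed

lemma hecke_proj: "det \<alpha> > 0 \<Longrightarrow> c \<in> cycles \<Longrightarrow> hecke \<Gamma> \<alpha> \<Gamma> n (proj c) = proj (hecke_chain \<Gamma> (reps \<alpha>) c)"
  unfolding hecke_def by (rule induced_proj[OF hecke_chain_good])

lemma hecke_quotient_qproj:
  "det \<alpha> > 0 \<Longrightarrow> c \<in> cycles \<Longrightarrow> hecke_quotient \<Gamma> \<alpha> k (qproj c) = qproj (hecke_chain \<Gamma> (reps \<alpha>) c)"
  unfolding hecke_quotient_def hyperbolic_cycles_eq by (rule induced_qproj[OF hecke_chain_good _ hecke_proj])

lemma hecke_stable:
  assumes "det \<alpha> > 0"
  shows "hecke \<Gamma> \<alpha> \<Gamma> n ` hyperbolic_cycles \<Gamma> k \<subseteq> hyperbolic_cycles \<Gamma> k"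
  unfolding hyperbolic_cycles_eq
proof safe
  fix c assume c: "c \<in> KH"
  then have "hecke \<Gamma> \<alpha> \<Gamma> n (proj c) = proj (hecke_chain \<Gamma> (reps \<alpha>) c)"
    using KH_cycles by (intro hecke_proj assms) blast
  then show "hecke \<Gamma> \<alpha> \<Gamma> n (proj c) \<in> proj ` KH"
    using t_KH[OF hecke_chain_good[OF assms] c] by blast
qed

lemma hecke_quotient_hom:
  assumes "det \<alpha> > 0"
  shows "hecke_quotient \<Gamma> \<alpha> k \<in> hom (cycle_quotient \<Gamma> k) (cycle_quotient \<Gamma> k)"
proof (rule homI)
  note good = hecke_chain_good[OF assms]
  note pres = presents_cycle_quotient
  fix x assume "x \<in> carrier (cycle_quotient \<Gamma> k)"
  then obtain a where a: "a \<in> cycles" "x = qproj a"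
    by (auto simp: presentsD(4)[OF pres])
  show "hecke_quotient \<Gamma> \<alpha> k x \<in> carrier (cycle_quotient \<Gamma> k)"
    using t_cycles[OF good a(1)] by (simp add: presentsD(4)[OF pres] a hecke_quotient_qproj assms)
  fix y assume "y \<in> carrier (cycle_quotient \<Gamma> k)"
  then obtain b where b: "b \<in> cycles" "y = qproj b"
    by (auto simp: presentsD(4)[OF pres])
  have ab: "a + b \<in> cycles"
    by (rule add_subgroupD(4)[OF add_subgroup_cycles a(1) b(1)])
  show "hecke_quotient \<Gamma> \<alpha> k (x \<otimes>\<^bsub>cycle_quotient \<Gamma> k\<^esub> y)
    = hecke_quotient \<Gamma> \<alpha> k x \<otimes>\<^bsub>cycle_quotient \<Gamma> k\<^esub> hecke_quotient \<Gamma> \<alpha> k y"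
    unfolding a(2) b(2) presentsD(6)[OF pres a(1) b(1)] hecke_quotient_qproj[OF assms ab]
      hecke_quotient_qproj[OF assms a(1)] hecke_quotient_qproj[OF assms b(1)]
      presentsD(6)[OF pres t_cycles[OF good a(1)] t_cycles[OF good b(1)]] t_add[OF good] ..
qed

lemma qproj_pow:
  assumes "c \<in> cycles"
  shows "qproj c [^]\<^bsub>cycle_quotient \<Gamma> k\<^esub> m = qproj (frag_cmul (int m) c)"
proof (induction m)
  case 0
  show ?case
    by (simp add: presentsD(5)[OF presents_cycle_quotient])
next
  case (Suc m)
  have "frag_cmul (int m) c \<in> cycles"
    by (rule add_subgroup_frag_cmul[OF add_subgroup_cycles assms])
  from presentsD(6)[OF presents_cycle_quotient this assms] show ?case
    by (simp add: Suc frag_cmul_distrib add.commute)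
qed

text \<open>Every representative is the class of some \<open>A ** (\<alpha> ** A')\<close>, with
  \<open>\<alpha> = diag2 1 (int p)\<close>. Multiplying by \<open>adj A\<close> leaves
  \<open>\<alpha> ** A'\<close>, whose second row is divisible by \<open>p\<close>; this holds for
  all \<open>p\<close>, those dividing \<open>N\<close> included.\<close>

lemma hecke_quotient_non_ordinary:
  assumes p: "prime p"
  shows "non_ordinary p (cycle_quotient \<Gamma> k) (hecke_quotient \<Gamma> (diag2 1 (int p)) k)"
proof -
  let ?\<alpha> = "diag2 1 (int p)" and ?M = "cycle_quotient \<Gamma> k"
  have \<alpha>: "?\<alpha> = mk 1 0 0 (int p)"
    by (simp add: diag2_def mk_def)
  have det: "det ?\<alpha> > 0" "det ?\<alpha> = int p"
    using prime_gt_0_nat[OF p] by (simp_all add: \<alpha>)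
  note pres = presents_cycle_quotient
  show ?thesis
  proof (rule non_ordinaryI[OF presents_comm_group[OF pres] finite_cycle_quotient hecke_quotient_hom[OF det(1)] p])
    fix x assume "x \<in> carrier ?M"
    then obtain c where c: "c \<in> cycles" "x = qproj c"
      by (auto simp: presentsD(4)[OF pres])
    have "\<exists>c'\<in>cycles. cg KH (hecke_chain \<Gamma> (reps ?\<alpha>) c) (frag_cmul (int p) c')"
    proof (cases "finite (reps ?\<alpha>)")
      case True
      have B: "is_reps (reps ?\<alpha>)"
        by (rule coset_reps_is_reps[OF coset_reps_reps True det(1)])
      show ?thesis
      proof (rule hc_divisible[OF p B _ c(1)])
        fix \<beta> assume "\<beta> \<in> reps ?\<alpha>"
        then have "\<beta> \<in> double_coset \<Gamma> ?\<alpha> \<Gamma>"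
          using coset_reps_reps[of ?\<alpha>] unfolding coset_reps_def by blast
        then obtain A A' where A: "A \<in> \<Gamma>" "A' \<in> \<Gamma>" "\<beta> = cls (A ** (?\<alpha> ** A'))"
          unfolding mem_double_coset by blast
        have "cls (adj A) \<cdot> \<beta> = cls (?\<alpha> ** A')"
          using mult_adj_cancel(2)[OF det_1[OF A(1)]] by (simp add: A(3) cls_mult)
        moreover have "det (?\<alpha> ** A') = int p"
          using det(2) det_1[OF A(2)] by (simp add: det_mul)
        moreover have "int p dvd (?\<alpha> ** A')$2$1" "int p dvd (?\<alpha> ** A')$2$2"
          by (simp_all add: \<alpha> mult_nth)
        ultimately show "\<exists>\<eta>\<in>G. \<exists>M. det M = int p \<and> int p dvd M$2$1 \<and> int p dvd M$2$2 \<and> \<eta> \<cdot> \<beta> = cls M"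
          using adj_in[OF A(1)] by blast
      qed
    next
      case False
      show ?thesis
        unfolding hecke_chain_infinite[OF False]
        using add_subgroupD(1)[OF add_subgroup_cycles] by (intro bexI[of _ 0]) (simp_all add: cg_def zspan_zero)
    qed
    then obtain c' where c': "c' \<in> cycles" "cg KH (hecke_chain \<Gamma> (reps ?\<alpha>) c) (frag_cmul (int p) c')"
      by blast
    have "frag_cmul (int p) c' \<in> cycles"
      by (rule add_subgroup_frag_cmul[OF add_subgroup_cycles c'(1)])
    then have "hecke_quotient \<Gamma> ?\<alpha> k x = qproj (frag_cmul (int p) c')"
      unfolding c(2) hecke_quotient_qproj[OF det(1) c(1)]
      using presentsD(7)[OF pres t_cycles[OF hecke_chain_good[OF det(1)] c(1)]] c'(2) by (simp add: cg_def)
    also have "\<dots> = qproj c' [^]\<^bsub>?M\<^esub> p"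
      by (rule qproj_pow[OF c'(1), symmetric])
    finally show "\<exists>y\<in>carrier ?M. hecke_quotient \<Gamma> ?\<alpha> k x = y [^]\<^bsub>?M\<^esub> p"
      using c'(1) by (auto simp: presentsD(4)[OF pres])
  qed
qed

end

lemma level_of_subgroup:
  assumes "N > 0" "subgroup \<Gamma> SL2Z" "Gamma1 N \<subseteq> \<Gamma>"
  shows "level \<Gamma> N"
proof
  note sub = subgroup.mem_carrier[OF assms(2)]
  show det: "det A = 1" if "A \<in> \<Gamma>" for A
    using sub[OF that] by (simp add: SL2Z_def)
  show "mat 1 \<in> \<Gamma>"
    using subgroup.one_closed[OF assms(2)] by (simp add: SL2Z_def M2plus_def)
  show "A ** B \<in> \<Gamma>" if "A \<in> \<Gamma>" "B \<in> \<Gamma>" for A B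
    using subgroup.m_closed[OF assms(2) that] by (simp add: SL2Z_def M2plus_def)
  show "adj A \<in> \<Gamma>" if A: "A \<in> \<Gamma>" for A
  proof -
    have "inv\<^bsub>SL2Z\<^esub> A = adj A"
    proof (rule monoid.inv_char)
      show "monoid SL2Z"
        by (rule monoidI) (auto simp: SL2Z_def M2plus_def det_mul matrix_mul_assoc)
    qed (use det[OF A] in \<open>simp_all add: SL2Z_def M2plus_def adj_inverse\<close>)
    then show ?thesis
      using subgroup.m_inv_closed[OF assms(2) A] by simp
  qed
qed (use assms in auto)

theorem theorem1p4:
  fixes N k :: nat and \<Gamma> :: "mat2 set"
  assumes "N > 0"
    and "congruence_subgroup \<Gamma>"
    and "Gamma1 N \<subseteq> \<Gamma>" and "\<Gamma> \<subseteq> Gamma0 N"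
  shows "(\<forall>\<alpha>\<in>carrier M2plus.
             hecke \<Gamma> \<alpha> \<Gamma> (2 * k) ` hyperbolic_cycles \<Gamma> k \<subseteq> hyperbolic_cycles \<Gamma> k \<and>
             hecke_quotient \<Gamma> \<alpha> k \<in> hom (cycle_quotient \<Gamma> k) (cycle_quotient \<Gamma> k)) \<and>
         finite (carrier (cycle_quotient \<Gamma> k)) \<and>
         (\<forall>p. prime p \<longrightarrow>
             non_ordinary p (cycle_quotient \<Gamma> k) (hecke_quotient \<Gamma> (diag2 1 (int p)) k))"
proof -
  interpret level \<Gamma> N k
    using assms by (intro level_of_subgroup) (simp_all add: congruence_subgroup_def)
  show ?thesis
    using hecke_stable hecke_quotient_hom finite_cycle_quotient hecke_quotient_non_ordinary
    by (simp add: M2plus_def)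
qed

end
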